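(* Let $A=\Bbbk Q/I$ and let $R$ be a reduction system satisfying $(\diamond)$ for $I$. Set $P_n=A\otimes\Bbbk S_n\otimes A$ for $n\ge0$ and $P_{-1}=A$. Define $\partial_0(a\otimes b)=ab$ and $\rho_{-1}(a)=a\otimes1$, and recursively for $n\ge1$ $$\partial_n(a\otimes w\otimes b)=a\big((\mathrm{id}-\rho_{n-2}\partial_{n-1})\delta_n\big)(1\otimes w\otimes1)\,b\qquad(a,b\in A,\ w\in S_n),$$ $$\rho_{n-1}=\gamma_{n-1}+\sum_{i\ge1}\gamma_{n-1}(\delta_n\gamma_{n-1}-\partial_n\gamma_{n-1})^i .$$ Then $\partial_\bullet$ and $\rho_\bullet$ can be taken as differential and homotopy in the Chouhy--Solotar resolution, i.e. $(P_\bullet,\partial_\bullet)$ is a projective $A$-bimodule resolution of $A$ with augmentation $\partial_0$, and the $\rho_{n-1}:P_{n-1}\to P_n$ are homomorphisms of left $A$-modules satisfying, for all $n\ge0$, $\partial_n\rho_{n-1}+\rho_{n-2}\partial_{n-1}=\mathrm{id}_{P_{n-1}}$ and $\rho_n(a\otimes w\otimes1)=0$ for $w\in S_n$, $a\in A$ (where $\partial_{-1}=0$, $\rho_{-2}=0$).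
   Context: $\Bbbk$ is a field of characteristic $0$, $Q$ a finite quiver, $Q_n$ the set of paths of length $n$; in $\Bbbk Q$ the product $pq$ is concatenation if the target of $p$ is the source of $q$, else $0$. $\otimes=\otimes_{\Bbbk Q_0}$; $I\subset\Bbbk Q$ is a two-sided ideal, $\pi:\Bbbk Q\to A$ the projection. Reduction systems: $R=\{(s,\varphi_s)\mid s\in S\}$ with $S\subset Q_{\ge2}$, $s$ not a subpath of $s'$ for $s\ne s'\in S$, $\varphi_s$ a linear combination of irreducible paths parallel to $s$ (same source and target); a path is irreducible if it has no subpath in $S$; $\mathrm{Irr}_S$ is the set of irreducible paths. A basic reduction is a linear map of $\Bbbk Q$ sending one path $qsr$ ($s\in S$) to $q\varphi_sr$ and fixing all other paths; a reduction is a finite composition of these. A path $p$ is reduction-finite if for any infinite sequence of reductions $\mathfrak r_n\cdots\mathfrak r_1(p)$ is eventually constant, and reduction-unique if moreover all irreducible $\mathfrak r(p)$, $\mathfrak r$ a reduction, coincide. $R$ satisfies $(\diamond)$ for $I$ if $I=\langle s-\varphi_s\rangle_{s\in S}$ and every path is reduction-unique. Then $\{\pi(u)\}_{u\in\mathrm{Irr}_S}$ is a $\Bbbk$-basis of $A$. $S_0=Q_0$, $S_1=Q_1$, $S_2=S$, and for $n\ge1$, $S_{n+2}$ is the set of $n$-ambiguities, i.e. paths $u_0u_1\cdots u_{n+1}$ with $u_0\in Q_1$, $u_1,\dots,u_{n+1}$ irreducible, each $u_iu_{i+1}$ reducible and $u_id$ irreducible for every proper left subpath $d$ of $u_{i+1}$.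 For a path $p$ and $n\ge1$: $\mathrm{split}_n(p)=\sum\pi(q)\otimes w\otimes\pi(r)$ over all factorizations $p=qwr$ with $w\in S_n$; $\mathrm{split}^{\mathrm R}_n(p)$ (resp. $\mathrm{split}^{\mathrm L}_n(p)$) is the single summand with $w$ the rightmost (resp. leftmost) subpath of $p$ in $S_n$, and all are zero if $p$ has no subpath in $S_n$. $\delta_n:P_n\to P_{n-1}$ is the $A$-bimodule map with $\delta_n(1\otimes w\otimes1)=\pi(w)\otimes1-1\otimes\pi(w)$ for $n=1$, $=\mathrm{split}^{\mathrm R}_{n-1}(w)-\mathrm{split}^{\mathrm L}_{n-1}(w)$ for odd $n>2$, and $=\mathrm{split}_{n-1}(w)$ for even $n\ge2$. $\gamma_{n-1}:P_{n-1}\to P_n$ ($n\ge1$) is the left $A$-module map with $\gamma_{n-1}(1\otimes w\otimes\pi(u))=(-1)^n\mathrm{split}_n(wu)$ for $w\in S_{n-1}$, $u\in\mathrm{Irr}_S$. *)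

theory Defs
  imports
    "HOL-Algebra.Algebra"
    "HOL-Library.Poly_Mapping"
    "Graph_Theory.Graph_Theory"
begin

section \<open>Bimodules over a noncommutative ring\<close>

text \<open>
  As for the library's \<^typ>\<open>('a, 'm) module\<close>, the underlying additive group is a \<^typ>\<open>'m ring\<close>
  record whose multiplicative fields play no role.
\<close>

record ('a, 'm) bimod = "('a, 'm) module" +
  rsmult :: "['m, 'a] \<Rightarrow> 'm"  (infixl \<open>\<odot>\<^sub>r\<index>\<close> 70)

text \<open>
  \<^term>\<open>K\<close> is the set of (images in \<^term>\<open>R\<close> of) the scalars of the ground field. Bimodules over an
  algebra are required to be symmetric over the ground field, i.e. they are modules over
  the enveloping algebra.
\<close>

locale bimodule = R?: ring R + M?: abelian_group M
  for K :: "'a set" and R :: "'a ring" (structure) and M :: "('a, 'm) bimod" (structure) +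
  assumes lact_closed: "\<lbrakk>a \<in> carrier R; x \<in> carrier M\<rbrakk> \<Longrightarrow> a \<odot>\<^bsub>M\<^esub> x \<in> carrier M"
    and lact_add_left: "\<lbrakk>a \<in> carrier R; b \<in> carrier R; x \<in> carrier M\<rbrakk> \<Longrightarrow>
          (a \<oplus>\<^bsub>R\<^esub> b) \<odot>\<^bsub>M\<^esub> x = a \<odot>\<^bsub>M\<^esub> x \<oplus>\<^bsub>M\<^esub> b \<odot>\<^bsub>M\<^esub> x"
    and lact_add_right: "\<lbrakk>a \<in> carrier R; x \<in> carrier M; y \<in> carrier M\<rbrakk> \<Longrightarrow>
          a \<odot>\<^bsub>M\<^esub> (x \<oplus>\<^bsub>M\<^esub> y) = a \<odot>\<^bsub>M\<^esub> x \<oplus>\<^bsub>M\<^esub> a \<odot>\<^bsub>M\<^esub> y"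
    and lact_mult: "\<lbrakk>a \<in> carrier R; b \<in> carrier R; x \<in> carrier M\<rbrakk> \<Longrightarrow>
          (a \<otimes>\<^bsub>R\<^esub> b) \<odot>\<^bsub>M\<^esub> x = a \<odot>\<^bsub>M\<^esub> (b \<odot>\<^bsub>M\<^esub> x)"
    and lact_one: "x \<in> carrier M \<Longrightarrow> \<one>\<^bsub>R\<^esub> \<odot>\<^bsub>M\<^esub> x = x"
    and ract_closed: "\<lbrakk>a \<in> carrier R; x \<in> carrier M\<rbrakk> \<Longrightarrow> x \<odot>\<^sub>r\<^bsub>M\<^esub> a \<in> carrier M"
    and ract_add_right: "\<lbrakk>a \<in> carrier R; b \<in> carrier R; x \<in> carrier M\<rbrakk> \<Longrightarrow>
          x \<odot>\<^sub>r\<^bsub>M\<^esub> (a \<oplus>\<^bsub>R\<^esub> b) = x \<odot>\<^sub>r\<^bsub>M\<^esub> a \<oplus>\<^bsub>M\<^esub> x \<odot>\<^sub>r\<^bsub>M\<^esub> b"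
    and ract_add_left: "\<lbrakk>a \<in> carrier R; x \<in> carrier M; y \<in> carrier M\<rbrakk> \<Longrightarrow>
          (x \<oplus>\<^bsub>M\<^esub> y) \<odot>\<^sub>r\<^bsub>M\<^esub> a = x \<odot>\<^sub>r\<^bsub>M\<^esub> a \<oplus>\<^bsub>M\<^esub> y \<odot>\<^sub>r\<^bsub>M\<^esub> a"
    and ract_mult: "\<lbrakk>a \<in> carrier R; b \<in> carrier R; x \<in> carrier M\<rbrakk> \<Longrightarrow>
          x \<odot>\<^sub>r\<^bsub>M\<^esub> (a \<otimes>\<^bsub>R\<^esub> b) = (x \<odot>\<^sub>r\<^bsub>M\<^esub> a) \<odot>\<^sub>r\<^bsub>M\<^esub> b"
    and ract_one: "x \<in> carrier M \<Longrightarrow> x \<odot>\<^sub>r\<^bsub>M\<^esub> \<one>\<^bsub>R\<^esub> = x"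
    and act_assoc: "\<lbrakk>a \<in> carrier R; b \<in> carrier R; x \<in> carrier M\<rbrakk> \<Longrightarrow>
          (a \<odot>\<^bsub>M\<^esub> x) \<odot>\<^sub>r\<^bsub>M\<^esub> b = a \<odot>\<^bsub>M\<^esub> (x \<odot>\<^sub>r\<^bsub>M\<^esub> b)"
    and act_scalars: "\<lbrakk>c \<in> K; x \<in> carrier M\<rbrakk> \<Longrightarrow> c \<odot>\<^bsub>M\<^esub> x = x \<odot>\<^sub>r\<^bsub>M\<^esub> c"

definition regular_bimod :: "'a ring \<Rightarrow> ('a, 'a) bimod" where
  "regular_bimod R = \<lparr>carrier = carrier R, monoid.mult = monoid.mult R, monoid.one = monoid.one R,
     ring.zero = ring.zero R, ring.add = ring.add R, smult = monoid.mult R, rsmult = monoid.mult R\<rparr>"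

definition left_hom :: "'a ring \<Rightarrow> ('a, 'm) bimod \<Rightarrow> ('a, 'n) bimod \<Rightarrow> ('m \<Rightarrow> 'n) set" where
  "left_hom R M N = {f \<in> hom (add_monoid M) (add_monoid N).
     \<forall>a\<in>carrier R. \<forall>x\<in>carrier M. f (a \<odot>\<^bsub>M\<^esub> x) = a \<odot>\<^bsub>N\<^esub> f x}"

definition bimod_hom :: "'a ring \<Rightarrow> ('a, 'm) bimod \<Rightarrow> ('a, 'n) bimod \<Rightarrow> ('m \<Rightarrow> 'n) set" where
  "bimod_hom R M N = {f \<in> left_hom R M N.
     \<forall>a\<in>carrier R. \<forall>x\<in>carrier M. f (x \<odot>\<^sub>r\<^bsub>M\<^esub> a) = f x \<odot>\<^sub>r\<^bsub>N\<^esub> a}"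

text \<open>
  The lifting property has to be tested against bimodules over some types \<^typ>\<open>'m\<close> and \<^typ>\<open>'n\<close>, which
  a definition cannot quantify over. They are made explicit as arguments; a theorem in which
  they are type variables asserts the lifting property against all bimodules.
\<close>

definition projective_bimodule ::
  "'m itself \<Rightarrow> 'n itself \<Rightarrow> 'a set \<Rightarrow> 'a ring \<Rightarrow> ('a, 'p) bimod \<Rightarrow> bool" where
  "projective_bimodule _ _ K R P \<longleftrightarrow> bimodule K R P \<and>
     (\<forall>(M :: ('a, 'm) bimod) (N :: ('a, 'n) bimod). \<forall>g \<in> bimod_hom R M N. \<forall>f \<in> bimod_hom R P N.
        bimodule K R M \<longrightarrow> bimodule K R N \<longrightarrow> g ` carrier M = carrier N \<longrightarrow>
        (\<exists>h \<in> bimod_hom R P M. \<forall>x\<in>carrier P. g (h x) = f x))"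

text \<open>
  The differential \<^term>\<open>d (Suc n)\<close> goes from \<^term>\<open>P (Suc n)\<close> to \<^term>\<open>P n\<close>, and \<^term>\<open>e\<close> is the
  augmentation from \<^term>\<open>P 0\<close> to \<^term>\<open>M\<close>. The value \<^term>\<open>d 0\<close> is not used.
\<close>

definition projective_bimodule_resolution ::
  "'m itself \<Rightarrow> 'n itself \<Rightarrow> 'a set \<Rightarrow> 'a ring \<Rightarrow>
   (nat \<Rightarrow> ('a, 'p) bimod) \<Rightarrow> (nat \<Rightarrow> 'p \<Rightarrow> 'p) \<Rightarrow> ('p \<Rightarrow> 'b) \<Rightarrow> ('a, 'b) bimod \<Rightarrow> bool" where
  "projective_bimodule_resolution TM TN K R P d e M \<longleftrightarrow>
     bimodule K R M \<and>
     (\<forall>n. projective_bimodule TM TN K R (P n)) \<and>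
     e \<in> bimod_hom R (P 0) M \<and>
     (\<forall>n. d (Suc n) \<in> bimod_hom R (P (Suc n)) (P n)) \<and>
     e ` carrier (P 0) = carrier M \<and>
     d 1 ` carrier (P 1) = {x \<in> carrier (P 0). e x = \<zero>\<^bsub>M\<^esub>} \<and>
     (\<forall>n. d (Suc (Suc n)) ` carrier (P (Suc (Suc n))) =
            {x \<in> carrier (P (Suc n)). d (Suc n) x = \<zero>\<^bsub>P n\<^esub>})"

section \<open>Path algebras\<close>

text \<open>A path is its source together with its list of arrows; \<^term>\<open>(v, [])\<close> is the trivial path at \<^term>\<open>v\<close>.\<close>

type_synonym ('v, 'e) path = "'v \<times> 'e list"

definition paths :: "('v, 'e) pre_digraph \<Rightarrow> ('v, 'e) path set" where
  "paths Q = {(u, p). \<exists>v. pre_digraph.awalk Q u p v}"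

definition src :: "('v, 'e) path \<Rightarrow> 'v" where
  "src p = fst p"

definition tgt :: "('v, 'e) pre_digraph \<Rightarrow> ('v, 'e) path \<Rightarrow> 'v" where
  "tgt Q p = pre_digraph.awlast Q (fst p) (snd p)"

definition plen :: "('v, 'e) path \<Rightarrow> nat" where
  "plen p = length (snd p)"

text \<open>Concatenation, meaningful if the target of the first path is the source of the second.\<close>

definition pcat :: "('v, 'e) path \<Rightarrow> ('v, 'e) path \<Rightarrow> ('v, 'e) path" where
  "pcat p q = (fst p, snd p @ snd q)"

definition path_algebra :: "('v, 'e) pre_digraph \<Rightarrow> (('v, 'e) path \<Rightarrow>\<^sub>0 'k :: field) ring" where
  "path_algebra Q = \<lparr>carrier = {x. Poly_Mapping.keys x \<subseteq> paths Q},
     monoid.mult = (\<lambda>x y. \<Sum>p\<in>Poly_Mapping.keys x. \<Sum>q\<in>Poly_Mapping.keys y.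
        if tgt Q p = src q
        then Poly_Mapping.single (pcat p q) (Poly_Mapping.lookup x p * Poly_Mapping.lookup y q)
        else 0),
     monoid.one = (\<Sum>v\<in>verts Q. Poly_Mapping.single (v, []) 1),
     ring.zero = 0,
     ring.add = (+)\<rparr>"

definition scale :: "'k :: field \<Rightarrow> ('p \<Rightarrow>\<^sub>0 'k) \<Rightarrow> ('p \<Rightarrow>\<^sub>0 'k)" where
  "scale c x = Poly_Mapping.map ((*) c) x"

definition linear_ext :: "('p \<Rightarrow> ('q \<Rightarrow>\<^sub>0 'k :: field)) \<Rightarrow> ('p \<Rightarrow>\<^sub>0 'k) \<Rightarrow> ('q \<Rightarrow>\<^sub>0 'k)" where
  "linear_ext f x = (\<Sum>p\<in>Poly_Mapping.keys x. scale (Poly_Mapping.lookup x p) (f p))"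

definition linear_span :: "'p set \<Rightarrow> ('p \<Rightarrow>\<^sub>0 'k :: field) set" where
  "linear_span W = {x. Poly_Mapping.keys x \<subseteq> W}"

abbreviation pe :: "'p \<Rightarrow> ('p \<Rightarrow>\<^sub>0 'k :: field)" where
  "pe p \<equiv> Poly_Mapping.single p 1"

definition factorizations ::
  "('v, 'e) pre_digraph \<Rightarrow> ('v, 'e) path set \<Rightarrow> ('v, 'e) path \<Rightarrow>
   (('v, 'e) path \<times> ('v, 'e) path \<times> ('v, 'e) path) set" where
  "factorizations Q W p = {(q, w, r). q \<in> paths Q \<and> w \<in> W \<and> r \<in> paths Q \<and>
     tgt Q q = src w \<and> tgt Q w = src r \<and> p = pcat q (pcat w r)}"

section \<open>Reduction systems\<close>

definition irreducible_paths :: "('v, 'e) pre_digraph \<Rightarrow> ('v, 'e) path set \<Rightarrow> ('v, 'e) path set" where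
  "irreducible_paths Q S = {p \<in> paths Q. factorizations Q S p = {}}"

definition reduction_system ::
  "('v, 'e) pre_digraph \<Rightarrow> ('v, 'e) path set \<Rightarrow>
   (('v, 'e) path \<Rightarrow> (('v, 'e) path \<Rightarrow>\<^sub>0 'k :: field)) \<Rightarrow> bool" where
  "reduction_system Q S \<phi> \<longleftrightarrow>
     S \<subseteq> {p \<in> paths Q. plen p \<ge> 2} \<and>
     (\<forall>s\<in>S. \<forall>s'\<in>S. s \<noteq> s' \<longrightarrow> factorizations Q {s} s' = {}) \<and>
     (\<forall>s\<in>S. \<phi> s \<in> linear_span {p \<in> irreducible_paths Q S. src p = src s \<and> tgt Q p = tgt Q s})"

definition basic_reduction ::
  "('v, 'e) pre_digraph \<Rightarrow> (('v, 'e) path \<Rightarrow> (('v, 'e) path \<Rightarrow>\<^sub>0 'k :: field)) \<Rightarrow>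
   ('v, 'e) path \<Rightarrow> ('v, 'e) path \<Rightarrow> ('v, 'e) path \<Rightarrow>
   (('v, 'e) path \<Rightarrow>\<^sub>0 'k) \<Rightarrow> (('v, 'e) path \<Rightarrow>\<^sub>0 'k)" where
  "basic_reduction Q \<phi> q s r = linear_ext (\<lambda>p.
     if p = pcat q (pcat s r)
     then pe q \<otimes>\<^bsub>path_algebra Q\<^esub> \<phi> s \<otimes>\<^bsub>path_algebra Q\<^esub> pe r
     else pe p)"

inductive_set reductions ::
  "('v, 'e) pre_digraph \<Rightarrow> ('v, 'e) path set \<Rightarrow>
   (('v, 'e) path \<Rightarrow> (('v, 'e) path \<Rightarrow>\<^sub>0 'k :: field)) \<Rightarrow>
   ((('v, 'e) path \<Rightarrow>\<^sub>0 'k) \<Rightarrow> (('v, 'e) path \<Rightarrow>\<^sub>0 'k)) set"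
  for Q S \<phi> where
  red_id: "id \<in> reductions Q S \<phi>"
| red_step: "\<lbrakk>f \<in> reductions Q S \<phi>; (q, s, r) \<in> factorizations Q S p\<rbrakk> \<Longrightarrow>
     basic_reduction Q \<phi> q s r \<circ> f \<in> reductions Q S \<phi>"

definition reduction_finite ::
  "('v, 'e) pre_digraph \<Rightarrow> ('v, 'e) path set \<Rightarrow>
   (('v, 'e) path \<Rightarrow> (('v, 'e) path \<Rightarrow>\<^sub>0 'k :: field)) \<Rightarrow> ('v, 'e) path \<Rightarrow> bool" where
  "reduction_finite Q S \<phi> p \<longleftrightarrow> (\<forall>f. (\<forall>i :: nat. f i \<in> reductions Q S \<phi>) \<longrightarrow>
     (\<exists>N. \<forall>n\<ge>N. fold f [0..<n] (pe p) = fold f [0..<N] (pe p)))"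

definition reduction_unique ::
  "('v, 'e) pre_digraph \<Rightarrow> ('v, 'e) path set \<Rightarrow>
   (('v, 'e) path \<Rightarrow> (('v, 'e) path \<Rightarrow>\<^sub>0 'k :: field)) \<Rightarrow> ('v, 'e) path \<Rightarrow> bool" where
  "reduction_unique Q S \<phi> p \<longleftrightarrow> reduction_finite Q S \<phi> p \<and>
     (\<forall>f\<in>reductions Q S \<phi>. \<forall>g\<in>reductions Q S \<phi>.
        f (pe p) \<in> linear_span (irreducible_paths Q S) \<longrightarrow>
        g (pe p) \<in> linear_span (irreducible_paths Q S) \<longrightarrow> f (pe p) = g (pe p))"

definition satisfies_diamond ::
  "('v, 'e) pre_digraph \<Rightarrow> ('v, 'e) path set \<Rightarrow>
   (('v, 'e) path \<Rightarrow> (('v, 'e) path \<Rightarrow>\<^sub>0 'k :: field)) \<Rightarrow> (('v, 'e) path \<Rightarrow>\<^sub>0 'k) set \<Rightarrow> bool" where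
  "satisfies_diamond Q S \<phi> I \<longleftrightarrow>
     I = Idl\<^bsub>path_algebra Q\<^esub> {pe s - \<phi> s | s. s \<in> S} \<and>
     (\<forall>p\<in>paths Q. reduction_unique Q S \<phi> p)"

text \<open>
  \<^term>\<open>ambiguities Q S n\<close> consists of the paths \<open>u\<^sub>0 u\<^sub>1 \<dots> u\<^sub>n\<^sub>+\<^sub>1\<close>; the list \<^term>\<open>us\<close> below is
  \<open>[u\<^sub>0, \<dots>, u\<^sub>n\<^sub>+\<^sub>1]\<close>.
\<close>

definition ambiguities ::
  "('v, 'e) pre_digraph \<Rightarrow> ('v, 'e) path set \<Rightarrow> nat \<Rightarrow> ('v, 'e) path set" where
  "ambiguities Q S n = {p. \<exists>us. length us = n + 2 \<and> set us \<subseteq> paths Q \<and>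
     (\<forall>i\<le>n. tgt Q (us ! i) = src (us ! Suc i)) \<and>
     p = (src (us ! 0), concat (map snd us)) \<and>
     plen (us ! 0) = 1 \<and>
     (\<forall>i\<le>n. us ! Suc i \<in> irreducible_paths Q S) \<and>
     (\<forall>i\<le>n. pcat (us ! i) (us ! Suc i) \<notin> irreducible_paths Q S) \<and>
     (\<forall>i\<le>n. \<forall>d\<in>paths Q. \<forall>r\<in>paths Q.
        tgt Q d = src r \<and> pcat d r = us ! Suc i \<and> d \<noteq> us ! Suc i \<longrightarrow>
        pcat (us ! i) d \<in> irreducible_paths Q S)}"

fun overlap_paths :: "('v, 'e) pre_digraph \<Rightarrow> ('v, 'e) path set \<Rightarrow> nat \<Rightarrow> ('v, 'e) path set" where
  "overlap_paths Q S 0 = {p \<in> paths Q. plen p = 0}"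
| "overlap_paths Q S (Suc 0) = {p \<in> paths Q. plen p = 1}"
| "overlap_paths Q S (Suc (Suc 0)) = S"
| "overlap_paths Q S (Suc (Suc (Suc n))) = ambiguities Q S (Suc n)"

section \<open>The bimodules $P_n$ and the maps between them\<close>

type_synonym ('v, 'e, 'k) path_elem = "('v, 'e) path \<Rightarrow>\<^sub>0 'k"
type_synonym ('v, 'e, 'k) quot_elem = "('v, 'e, 'k) path_elem set"
type_synonym ('v, 'e, 'k) triple =
  "('v, 'e, 'k) quot_elem \<times> ('v, 'e, 'k) path_elem \<times> ('v, 'e, 'k) quot_elem"
type_synonym ('v, 'e, 'k) tens = "(('v, 'e, 'k) triple \<Rightarrow>\<^sub>0 int) set"

text \<open>
  The locale makes no assumptions; it only fixes the data on which the constructions depend.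
\<close>

locale quiver_quotient =
  fixes Q :: "('v, 'e) pre_digraph"
    and S :: "('v, 'e) path set"
    and I :: "(('v, 'e) path \<Rightarrow>\<^sub>0 'k :: field) set"
begin

abbreviation kQ :: "('v, 'e, 'k) path_elem ring" where
  "kQ \<equiv> path_algebra Q"

definition A :: "('v, 'e, 'k) quot_elem ring" where
  "A = kQ Quot I"

definition \<pi> :: "('v, 'e, 'k) path_elem \<Rightarrow> ('v, 'e, 'k) quot_elem" where
  "\<pi> x = I +>\<^bsub>kQ\<^esub> x"

definition scalars :: "('v, 'e, 'k) quot_elem set" where
  "scalars = range (\<lambda>c. \<pi> (scale c \<one>\<^bsub>kQ\<^esub>))"

text \<open>
  $P_n = A \otimes k S_n \otimes A$, the tensor products being over the subalgebra of
  \<^term>\<open>kQ\<close> spanned by the trivial paths: the free abelian group on triples modulo additivity in each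
  argument and the two balancing relations. Scalars are multiples of the unit of that
  subalgebra, so compatibility with them is part of the balancing relations.
\<close>

definition triples :: "nat \<Rightarrow> ('v, 'e, 'k) triple set" where
  "triples n = carrier A \<times> linear_span (overlap_paths Q S n) \<times> carrier A"

definition tensor_relations :: "nat \<Rightarrow> ('v, 'e, 'k) tens" where
  "tensor_relations n =
     {frag_of (a \<oplus>\<^bsub>A\<^esub> a', x, b) - frag_of (a, x, b) - frag_of (a', x, b) | a a' x b.
        a \<in> carrier A \<and> a' \<in> carrier A \<and> x \<in> linear_span (overlap_paths Q S n) \<and> b \<in> carrier A} \<union>
     {frag_of (a, x + x', b) - frag_of (a, x, b) - frag_of (a, x', b) | a x x' b.
        a \<in> carrier A \<and> x \<in> linear_span (overlap_paths Q S n) \<and> x' \<in> linear_span (overlap_paths Q S n) \<and>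
        b \<in> carrier A} \<union>
     {frag_of (a, x, b \<oplus>\<^bsub>A\<^esub> b') - frag_of (a, x, b) - frag_of (a, x, b') | a x b b'.
        a \<in> carrier A \<and> x \<in> linear_span (overlap_paths Q S n) \<and> b \<in> carrier A \<and> b' \<in> carrier A} \<union>
     {frag_of (a \<otimes>\<^bsub>A\<^esub> \<pi> e, x, b) - frag_of (a, e \<otimes>\<^bsub>kQ\<^esub> x, b) | a e x b.
        a \<in> carrier A \<and> e \<in> linear_span (overlap_paths Q S 0) \<and> x \<in> linear_span (overlap_paths Q S n) \<and>
        b \<in> carrier A} \<union>
     {frag_of (a, x \<otimes>\<^bsub>kQ\<^esub> e, b) - frag_of (a, x, \<pi> e \<otimes>\<^bsub>A\<^esub> b) | a x e b.
        a \<in> carrier A \<and> x \<in> linear_span (overlap_paths Q S n) \<and> e \<in> linear_span (overlap_paths Q S 0) \<and>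
        b \<in> carrier A}"

definition tensor_null :: "nat \<Rightarrow> ('v, 'e, 'k) tens" where
  "tensor_null n = generate (free_Abelian_group (triples n)) (tensor_relations n)"

definition tensor_class :: "nat \<Rightarrow> (('v, 'e, 'k) triple \<Rightarrow>\<^sub>0 int) \<Rightarrow> ('v, 'e, 'k) tens" where
  "tensor_class n f = tensor_null n #>\<^bsub>free_Abelian_group (triples n)\<^esub> f"

definition P :: "nat \<Rightarrow> (('v, 'e, 'k) quot_elem, ('v, 'e, 'k) tens) bimod" where
  "P n = (let G = free_Abelian_group (triples n) Mod tensor_null n in
     \<lparr>carrier = carrier G, monoid.mult = undefined, monoid.one = undefined, ring.zero = monoid.one G, ring.add = monoid.mult G,
      smult = (\<lambda>a T. \<Union>f\<in>T. tensor_class n (frag_extend (\<lambda>(a', x, b'). frag_of (a \<otimes>\<^bsub>A\<^esub> a', x, b')) f)),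
      rsmult = (\<lambda>T b. \<Union>f\<in>T. tensor_class n (frag_extend (\<lambda>(a', x, b'). frag_of (a', x, b' \<otimes>\<^bsub>A\<^esub> b)) f))\<rparr>)"

definition tensor :: "nat \<Rightarrow> ('v, 'e, 'k) quot_elem \<Rightarrow> ('v, 'e, 'k) path_elem \<Rightarrow> ('v, 'e, 'k) quot_elem \<Rightarrow> ('v, 'e, 'k) tens" where
  "tensor n a x b = tensor_class n (frag_of (a, x, b))"

definition split :: "nat \<Rightarrow> ('v, 'e) path \<Rightarrow> ('v, 'e, 'k) tens" where
  "split n p = (\<Oplus>\<^bsub>P n\<^esub>t\<in>factorizations Q (overlap_paths Q S n) p.
     case t of (q, w, r) \<Rightarrow> tensor n (\<pi> (pe q)) (pe w) (\<pi> (pe r)))"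

text \<open>
  The index sets of the next two sums have at most one element, as \<^term>\<open>p\<close> and the lengths of \<^term>\<open>q\<close>
  and \<^term>\<open>r\<close> determine the factorization.
\<close>

definition split_right :: "nat \<Rightarrow> ('v, 'e) path \<Rightarrow> ('v, 'e, 'k) tens" where
  "split_right n p = (\<Oplus>\<^bsub>P n\<^esub>t\<in>{(q, w, r) \<in> factorizations Q (overlap_paths Q S n) p.
       \<forall>(q', w', r') \<in> factorizations Q (overlap_paths Q S n) p. plen q' \<le> plen q \<and> plen r \<le> plen r'}.
     case t of (q, w, r) \<Rightarrow> tensor n (\<pi> (pe q)) (pe w) (\<pi> (pe r)))"

definition split_left :: "nat \<Rightarrow> ('v, 'e) path \<Rightarrow> ('v, 'e, 'k) tens" where
  "split_left n p = (\<Oplus>\<^bsub>P n\<^esub>t\<in>{(q, w, r) \<in> factorizations Q (overlap_paths Q S n) p.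
       \<forall>(q', w', r') \<in> factorizations Q (overlap_paths Q S n) p. plen q \<le> plen q' \<and> plen r' \<le> plen r}.
     case t of (q, w, r) \<Rightarrow> tensor n (\<pi> (pe q)) (pe w) (\<pi> (pe r)))"

text \<open>
  \<^term>\<open>\<delta> n\<close> maps \<^term>\<open>P n\<close> to \<^term>\<open>P (n - 1)\<close> and is meaningful for \<^term>\<open>n \<ge> 1\<close>. An element
  $a \otimes b$ of $P_0 = A \otimes A$ is \<^term>\<open>tensor 0 a \<one>\<^bsub>kQ\<^esub> b\<close>. Maps given by prescribed values are
  made unique by being extensional.
\<close>

definition \<delta> :: "nat \<Rightarrow> ('v, 'e, 'k) tens \<Rightarrow> ('v, 'e, 'k) tens" where
  "\<delta> n = (THE f. f \<in> bimod_hom A (P n) (P (n - 1)) \<and> f \<in> extensional (carrier (P n)) \<and>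
     (\<forall>w\<in>overlap_paths Q S n. f (tensor n \<one>\<^bsub>A\<^esub> (pe w) \<one>\<^bsub>A\<^esub>) =
        (if n = 1 then tensor 0 (\<pi> (pe w)) \<one>\<^bsub>kQ\<^esub> \<one>\<^bsub>A\<^esub> \<ominus>\<^bsub>P 0\<^esub> tensor 0 \<one>\<^bsub>A\<^esub> \<one>\<^bsub>kQ\<^esub> (\<pi> (pe w))
         else if odd n then split_right (n - 1) w \<ominus>\<^bsub>P (n - 1)\<^esub> split_left (n - 1) w
         else split (n - 1) w)))"

definition \<gamma> :: "nat \<Rightarrow> ('v, 'e, 'k) tens \<Rightarrow> ('v, 'e, 'k) tens" where
  "\<gamma> n = (THE f. f \<in> left_hom A (P n) (P (Suc n)) \<and> f \<in> extensional (carrier (P n)) \<and>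
     (\<forall>w\<in>overlap_paths Q S n. \<forall>u\<in>irreducible_paths Q S. f (tensor n \<one>\<^bsub>A\<^esub> (pe w) (\<pi> (pe u))) =
        (if tgt Q w = src u then add_pow (P (Suc n)) ((- 1 :: int) ^ Suc n) (split (Suc n) (pcat w u))
         else \<zero>\<^bsub>P (Suc n)\<^esub>)))"

definition augmentation :: "('v, 'e, 'k) tens \<Rightarrow> ('v, 'e, 'k) quot_elem" where
  "augmentation = (THE f. f \<in> hom (add_monoid (P 0)) (add_monoid A) \<and>
     f \<in> extensional (carrier (P 0)) \<and>
     (\<forall>a\<in>carrier A. \<forall>b\<in>carrier A. f (tensor 0 a \<one>\<^bsub>kQ\<^esub> b) = a \<otimes>\<^bsub>A\<^esub> b))"

definition coaugmentation :: "('v, 'e, 'k) quot_elem \<Rightarrow> ('v, 'e, 'k) tens" where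
  "coaugmentation a = tensor 0 a \<one>\<^bsub>kQ\<^esub> \<one>\<^bsub>A\<^esub>"

text \<open>
  For \<^term>\<open>n \<ge> 1\<close> the differential $\partial_n$ in terms of $h = \rho_{n-2}\partial_{n-1}$, which is an
  endomorphism of \<^term>\<open>P (n - 1)\<close> also for \<^term>\<open>n = 1\<close>.
\<close>

definition differential_step :: "nat \<Rightarrow> (('v, 'e, 'k) tens \<Rightarrow> ('v, 'e, 'k) tens) \<Rightarrow> ('v, 'e, 'k) tens \<Rightarrow> ('v, 'e, 'k) tens" where
  "differential_step n h = (THE f. f \<in> hom (add_monoid (P n)) (add_monoid (P (n - 1))) \<and>
     f \<in> extensional (carrier (P n)) \<and>
     (\<forall>a\<in>carrier A. \<forall>b\<in>carrier A. \<forall>w\<in>overlap_paths Q S n. f (tensor n a (pe w) b) =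
        (let y = \<delta> n (tensor n \<one>\<^bsub>A\<^esub> (pe w) \<one>\<^bsub>A\<^esub>)
         in (a \<odot>\<^bsub>P (n - 1)\<^esub> (y \<ominus>\<^bsub>P (n - 1)\<^esub> h y)) \<odot>\<^sub>r\<^bsub>P (n - 1)\<^esub> b)))"

text \<open>
  The summands of $\rho_n$ and $\rho_n$ itself, in terms of $d = \partial_{n+1}$. The sum
  over all \<^term>\<open>i \<ge> 1\<close> is pointwise; it is taken over the \<^term>\<open>i\<close> with nonzero summand and makes sense at
  \<^term>\<open>x\<close> if these are finitely many.
\<close>

definition homotopy_summand :: "nat \<Rightarrow> (('v, 'e, 'k) tens \<Rightarrow> ('v, 'e, 'k) tens) \<Rightarrow> nat \<Rightarrow> ('v, 'e, 'k) tens \<Rightarrow> ('v, 'e, 'k) tens" where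
  "homotopy_summand n d i x =
     \<gamma> n (((\<lambda>y. \<delta> (Suc n) (\<gamma> n y) \<ominus>\<^bsub>P n\<^esub> d (\<gamma> n y)) ^^ i) x)"

definition homotopy_step :: "nat \<Rightarrow> (('v, 'e, 'k) tens \<Rightarrow> ('v, 'e, 'k) tens) \<Rightarrow> ('v, 'e, 'k) tens \<Rightarrow> ('v, 'e, 'k) tens" where
  "homotopy_step n d x = \<gamma> n x \<oplus>\<^bsub>P (Suc n)\<^esub>
     (\<Oplus>\<^bsub>P (Suc n)\<^esub>i\<in>{i. i \<ge> 1 \<and> homotopy_summand n d i x \<noteq> \<zero>\<^bsub>P (Suc n)\<^esub>}. homotopy_summand n d i x)"

text \<open>
  $\partial_n$ for \<^term>\<open>n \<ge> 1\<close> and $\rho_n$ for \<^term>\<open>n \<ge> 0\<close>. The maps $\partial_0$ and $\rho_{-1}$ are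
  \<^term>\<open>augmentation\<close> and \<^term>\<open>coaugmentation\<close>; \<^term>\<open>differential 0\<close> is left unspecified.
\<close>

fun differential :: "nat \<Rightarrow> ('v, 'e, 'k) tens \<Rightarrow> ('v, 'e, 'k) tens" where
  "differential (Suc 0) = differential_step 1 (coaugmentation \<circ> augmentation)"
| "differential (Suc (Suc n)) = differential_step (Suc (Suc n))
     (homotopy_step n (differential (Suc n)) \<circ> differential (Suc n))"

definition homotopy :: "nat \<Rightarrow> ('v, 'e, 'k) tens \<Rightarrow> ('v, 'e, 'k) tens" where
  "homotopy n = homotopy_step n (differential (Suc n))"

end

end

theory Submission
  imports Defs
begin

text \<open>
  The proof is a perturbation argument: the resolution of a monomial algebra is understood by pure
  combinatorics of overlaps, and for general $A$ the error terms are smaller in a well-founded order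
  on paths.

  Fix a path $p$ and record a subpath by the positions where it starts and ends. Since no path in $S$
  is a subpath of another one, the relations inside $p$ are intervals which are ordered in the same
  way by their starts and by their ends. The subpaths of $p$ in $S_n$ are the greedy chains of such
  intervals: after the first arrow, every point of the chain is the end of the first relation that
  starts at the point two steps before or later (\<open>occurrences_eq_occ\<close>). Greediness makes
  a chain depend monotonically on its start, and comparing chains that start at different places gives
  the parity phenomena behind the definition of $\delta_n$; for example, a path in $S_n$ with $n$ odd
  contains exactly two paths in $S_{n-1}$ (\<open>odd_occurrences\<close>).

  As a left module, $P_n$ is generated by the $1 \otimes w \otimes u$ with $w \in S_n$ and $u$
  irreducible. Call such a generator terminal if $wu$ does not begin with a path in $S_{n+1}$, and let
  $T_n$ be the left submodule spanned by terminal generators. Then $\gamma_n$ kills $T_n$ and has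
  image $T_{n+1}$ (\<open>\<gamma>_Terminal\<close>, \<open>Terminal_in_\<gamma>_image\<close>), and
  $x - \delta_{n+1}\gamma_n x \in T_n$ for every $x \in P_n$
  (\<open>id_minus_\<delta>\<gamma>\<close>). The last fact holds exactly and not just up to smaller
  terms, although $\delta$ is not a differential: $\delta_{n+1}\gamma_n$ only redistributes the
  letters of $wu$, and all right factors that occur are irreducible, being end pieces of $u$.

  To compare sizes, say that a path lies above the paths that a basic reduction replaces it by.
  Because every path is reduction-finite, this relation is well-founded (\<open>wf_rewrites\<close>).
  The element $\pi(q) \otimes w \otimes \pi(r)$ has size $qwr$; bringing its right factor to normal
  form only produces elements of smaller or equal size, so $\gamma$ and $\delta$ do not increase
  sizes.

  Now to the recursion. Let $H = \rho_{n-1}\partial_n$, an endomorphism of the left module $P_n$. The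
  induction hypothesis (locale \<open>resolution_stage\<close>) is that $H$ is a projection onto $T_n$
  which does not increase sizes, that $\partial_n H = \partial_n$, and that $\partial_n x = 0$ implies
  $Hx = 0$. Since $\partial_{n+1}$ is $(1 - H)\delta_{n+1}$ on the generators of the bimodule,
  $\partial_n\partial_{n+1} = 0$, hence $H\partial_{n+1} = 0$. Let $E = \delta_{n+1}\gamma_n -
  \partial_{n+1}\gamma_n$. On a generator, $E$ is a signed sum of terms $q\,H(\delta_{n+1}(1 \otimes v
  \otimes 1))\,r$ with $qvr = wu$ and $v \in S_{n+1}$. The summands of $H(\ldots)$ are terminal of
  size at most $v$. One of size exactly $v$ is not of the form $1 \otimes w' \otimes r'$, as $w'r' =
  v$ begins with an element of $S_{n+1}$; so its middle factor starts, and hence also ends, further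
  right than $w$ does. Thus $E$ lowers the pair of size and length of the right factor
  lexicographically (\<open>E_rank\<close>) and is locally nilpotent, and $\rho_n = \gamma_n(1 -
  E)^{-1}$ is well defined. Finally
  $$(1 - H)(1 - E) = (1 - H)(1 - \delta_{n+1}\gamma_n) + (1 - H)\partial_{n+1}\gamma_n = \partial_{n+1}\gamma_n$$
  because $1 - H$ kills $T_n$ and $H\partial_{n+1} = 0$. This says $\partial_{n+1}\rho_n = 1 - H$
  (\<open>D_homotopy\<close>), which is the homotopy identity; exactness at $P_n$ is immediate from
  it, and $\rho_n\partial_{n+1}$ inherits the hypothesis.

  $P_n$ is handled through its generators and its universal property. The latter gives projectivity
  and the existence of all maps; for $\gamma_n$, which is prescribed on irreducible right factors, it
  is combined with the uniqueness of normal forms.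
\<close>

section \<open>Chains of overlapping intervals\<close>

text \<open>
  The points from 0 to \<open>N\<close> stand for the vertices along a path of length \<open>N\<close>, and \<open>Rel\<close> for its subpaths in
  $S$. The last assumption expresses that none of these is contained in another.
\<close>

locale interval_system =
  fixes Rel :: "(nat \<times> nat) set" and N :: nat
  assumes Rel_length: "(a, b) \<in> Rel \<Longrightarrow> a + 2 \<le> b"
    and Rel_bound: "(a, b) \<in> Rel \<Longrightarrow> b \<le> N"
    and Rel_start_less_iff: "(a, b) \<in> Rel \<Longrightarrow> (a', b') \<in> Rel \<Longrightarrow> a < a' \<longleftrightarrow> b < b'"
begin

lemma Rel_start_le_iff: "(a, b) \<in> Rel \<Longrightarrow> (a', b') \<in> Rel \<Longrightarrow> a \<le> a' \<longleftrightarrow> b \<le> b'"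
  using Rel_start_less_iff by (metis linorder_not_less)

definition step :: "nat \<Rightarrow> nat \<Rightarrow> nat \<Rightarrow> bool" where
  "step x y z \<longleftrightarrow> (\<exists>a. x \<le> a \<and> a < y \<and> (a, z) \<in> Rel) \<and> (\<forall>a b. (a, b) \<in> Rel \<longrightarrow> x \<le> a \<longrightarrow> z \<le> b)"

text \<open>
  For a path $u_0 u_1 \ldots u_{n-1}$ in $S_n$, point \<open>k\<close> of its chain is where $u_k$ starts, and point \<open>n\<close> is its
  end. Chains of length 0, 1 and 2 are vertices, arrows and relations.
\<close>

definition chain :: "nat \<Rightarrow> (nat \<Rightarrow> nat) \<Rightarrow> bool" where
  "chain n e \<longleftrightarrow> e n \<le> N \<and> (1 \<le> n \<longrightarrow> e 1 = Suc (e 0)) \<and>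
     (\<forall>k. k + 2 \<le> n \<longrightarrow> step (e k) (e (Suc k)) (e (Suc (Suc k))))"

definition occ :: "nat \<Rightarrow> (nat \<times> nat) set" where
  "occ n = {(e 0, e n) | e. chain n e}"

definition rel_free :: "nat \<Rightarrow> bool" where
  "rel_free x \<longleftrightarrow> (\<forall>a b. (a, b) \<in> Rel \<longrightarrow> \<not> x \<le> a)"

lemma chain_one: "chain n e \<Longrightarrow> 1 \<le> n \<Longrightarrow> e (Suc 0) = Suc (e 0)"
  by (simp add: chain_def)

lemma chain_step: "chain n e \<Longrightarrow> k + 2 \<le> n \<Longrightarrow> step (e k) (e (Suc k)) (e (Suc (Suc k)))"
  by (simp add: chain_def)

lemma chain_rel:
  assumes "chain n e" "k + 2 \<le> n"
  obtains a where "e k \<le> a" "a < e (Suc k)" "(a, e (Suc (Suc k))) \<in> Rel"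
  using chain_step[OF assms] by (auto simp: step_def)

lemma chain_least:
  "chain n e \<Longrightarrow> k + 2 \<le> n \<Longrightarrow> (a, b) \<in> Rel \<Longrightarrow> e k \<le> a \<Longrightarrow> e (Suc (Suc k)) \<le> b"
  using chain_step by (auto simp: step_def)

lemma chain_less_Suc:
  assumes c: "chain n e" and "k < n"
  shows "e k < e (Suc k)"
  using \<open>k < n\<close>
proof (induction k)
  case 0
  then show ?case using chain_one[OF c] by simp
next
  case (Suc k)
  obtain a where a: "e k \<le> a" "a < e (Suc k)" "(a, e (Suc (Suc k))) \<in> Rel"
    using chain_rel[OF c, of k] Suc.prems by auto
  show ?case
  proof (cases k)
    case 0
    then have "a = e 0" using a chain_one[OF c] Suc.prems by simp
    then show ?thesis using Rel_length[OF a(3)] chain_one[OF c] Suc.prems 0 by simp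
  next
    case (Suc j)
    obtain a' where "e j \<le> a'" "a' < e (Suc j)" "(a', e (Suc (Suc j))) \<in> Rel"
      using chain_rel[OF c, of j] Suc Suc.prems by auto
    then show ?thesis using Suc a Rel_start_less_iff[of a' "e (Suc k)" a "e (Suc (Suc k))"] by simp
  qed
qed

lemma chain_mono:
  assumes "chain n e" and "j \<le> k" "k \<le> n"
  shows "e j \<le> e k"
  using assms(2,3)
proof (induction rule: dec_induct)
  case (step m)
  then show ?case using chain_less_Suc[OF assms(1), of m] by simp
qed simp

lemma chain_prefix: "chain n e \<Longrightarrow> k \<le> n \<Longrightarrow> chain k e"
  using chain_mono[of n e k n] by (simp add: chain_def)

lemma chain_bound: "chain n e \<Longrightarrow> k \<le> n \<Longrightarrow> e k \<le> N"
  using chain_prefix[of n e k] by (simp add: chain_def)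

lemma chain_determined:
  assumes "chain n e" "chain n e'" "e 0 = e' 0" "k \<le> n"
  shows "e k = e' k"
  using assms(4)
proof (induction k rule: less_induct)
  case (less k)
  show ?case
  proof (cases "k \<le> 1")
    case True
    then consider "k = 0" | "k = 1" by linarith
    then show ?thesis
      using assms(3) chain_one[OF assms(1)] chain_one[OF assms(2)] less.prems by cases auto
  next
    case False
    then obtain j where k: "k = Suc (Suc j)" by (metis One_nat_def not_less_eq_eq le0 not0_implies_Suc)
    have "e j = e' j" "e (Suc j) = e' (Suc j)" using less k by simp_all
    then show ?thesis
      using chain_step[OF assms(1), of j] chain_step[OF assms(2), of j] less.prems
      by (simp add: k step_def) (meson le_antisym)
  qed
qed

text \<open>
  The relation that ends at point \<open>k\<close> of the later chain does not start before its point \<open>k - 2\<close>, hence by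
  induction not before point \<open>k - 1\<close> of the earlier chain; so the greedy choice of point \<open>k + 1\<close> there
  stops no later. The induction starts with $i + 1 \le i'$ at \<open>k = 0\<close>, and therefore reaches only even \<open>k\<close>.
  All parity phenomena come from here.
\<close>

lemma chain_overtake:
  assumes c: "chain n e" "chain n' e'" and less: "e 0 < e' 0"
    and k: "even k" "k \<le> n'" "Suc k \<le> n"
  shows "e (Suc k) \<le> e' k"
  using k
proof (induction k rule: less_induct)
  case (less k)
  show ?case
  proof (cases "k = 0")
    case True
    then show ?thesis using chain_one[OF c(1)] less.prems \<open>e 0 < e' 0\<close> by simp
  next
    case False
    then obtain j where j: "k = Suc (Suc j)"
      using less.prems(1) by (metis even_Suc not0_implies_Suc odd_Suc_minus_one even_zero)
    have "e (Suc j) \<le> e' j" using less j by simp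
    moreover obtain a where "e' j \<le> a" "(a, e' (Suc (Suc j))) \<in> Rel"
      using chain_rel[OF c(2), of j] less.prems j by auto
    ultimately show ?thesis
      using chain_least[OF c(1), of "Suc j" a "e' k"] less.prems j by simp
  qed
qed

lemma chain_strict_mono_start:
  assumes c: "chain n e" "chain n' e'" and less: "e 0 < e' 0" and k: "k \<le> n" "k \<le> n'"
  shows "e k < e' k"
proof (cases "even k")
  case False
  then obtain j where j: "k = Suc j" "even j" by (metis even_Suc old.nat.exhaust even_zero)
  then have "e k \<le> e' j" using chain_overtake[OF c less, of j] k by simp
  also have "e' j < e' k" using chain_less_Suc[OF c(2), of j] j k by simp
  finally show ?thesis .
next
  case True
  show ?thesis
  proof (cases "k = 0")
    case False
    then obtain j where j: "k = Suc (Suc j)" "even j"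
      using True by (metis even_Suc not0_implies_Suc even_zero odd_one One_nat_def)
    obtain a where a: "a < e (Suc j)" "(a, e k) \<in> Rel"
      using chain_rel[OF c(1), of j] k j by auto
    obtain a' where a': "e' j \<le> a'" "(a', e' k) \<in> Rel"
      using chain_rel[OF c(2), of j] k j by auto
    have "e (Suc j) \<le> e' j" using chain_overtake[OF c less, of j] j k by simp
    then show ?thesis using a a' Rel_start_less_iff by fastforce
  qed (use less in simp)
qed

lemma chain_mono_start:
  assumes "chain n e" "chain n' e'" and "e 0 \<le> e' 0" and "k \<le> n" "k \<le> n'"
  shows "e k \<le> e' k"
proof (cases "e 0 = e' 0")
  case True
  then show ?thesis
    using chain_determined[OF chain_prefix chain_prefix, of n e k n' e' k] assms by simp
next
  case False
  then show ?thesis using chain_strict_mono_start[OF assms(1,2)] assms by fastforce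
qed

lemma chain_extend:
  assumes c: "chain n e" and free: "rel_free (e n)"
    and ab: "(a, b) \<in> Rel" "e (n - 1) \<le> a" and n: "1 \<le> n"
  obtains z where "chain (Suc n) (e(Suc n := z))" "z \<le> b"
proof -
  define z where "z = (LEAST z. \<exists>a. (a, z) \<in> Rel \<and> e (n - 1) \<le> a)"
  have "\<exists>a. (a, z) \<in> Rel \<and> e (n - 1) \<le> a"
    unfolding z_def by (rule LeastI[of _ b]) (use ab in blast)
  then obtain a' where a': "(a', z) \<in> Rel" "e (n - 1) \<le> a'" by blast
  have least: "z \<le> b'" if "(a'', b') \<in> Rel" "e (n - 1) \<le> a''" for a'' b'
    unfolding z_def by (rule Least_le) (use that in blast)
  have "a' < e n" using free a' unfolding rel_free_def by (meson linorder_not_less)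
  then have "step (e (n - 1)) (e n) z" using a' least by (auto simp: step_def)
  then have "chain (Suc n) (e(Suc n := z))"
    using c n Rel_bound[OF a'(1)]
    by (auto simp: chain_def le_Suc_eq)
  then show ?thesis using that least[OF ab] by blast
qed

lemma occI: "chain n e \<Longrightarrow> (e 0, e n) \<in> occ n"
  by (auto simp: occ_def)

lemma occE:
  assumes "(i, j) \<in> occ n"
  obtains e where "chain n e" "e 0 = i" "e n = j"
  using assms by (auto simp: occ_def)

lemma occ_bounds: "(i, j) \<in> occ n \<Longrightarrow> i \<le> j \<and> j \<le> N"
  by (auto elim!: occE intro: chain_mono chain_bound)

lemma finite_occ: "finite (occ n)"
  by (rule finite_subset[of _ "{..N} \<times> {..N}"]) (use occ_bounds in fastforce, simp)

lemma occ_unique_end: "(i, j) \<in> occ n \<Longrightarrow> (i, j') \<in> occ n \<Longrightarrow> j = j'"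
  by (metis occE chain_determined le_refl)

lemma occ_less_end: "(i, j) \<in> occ n \<Longrightarrow> (i', j') \<in> occ n \<Longrightarrow> i < i' \<Longrightarrow> j < j'"
  by (metis occE chain_strict_mono_start le_refl)

lemma occ_le_end: "(i, j) \<in> occ n \<Longrightarrow> (i', j') \<in> occ n \<Longrightarrow> i \<le> i' \<Longrightarrow> j \<le> j'"
  using occ_less_end occ_unique_end by (metis le_less)

lemma occ_prefix:
  assumes "(i, j) \<in> occ (Suc n)"
  obtains j' where "(i, j') \<in> occ n" "j' < j"
  using assms by (metis chain_less_Suc chain_prefix lessI less_imp_le_nat occE occI)

text \<open>
  For positive \<open>m\<close>, the last relation of a chain of length \<open>m + 1\<close> that starts further right starts late
  enough to extend the given chain, after whose end no relation starts.
\<close>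

lemma occ_Suc_none:
  assumes ij0: "(i\<^sub>0, j\<^sub>0) \<in> occ m" and free: "rel_free j\<^sub>0"
    and none: "\<And>z. (i\<^sub>0, z) \<notin> occ (Suc m)"
    and ij: "(i, j) \<in> occ (Suc m)" and le: "i\<^sub>0 \<le> i"
  shows False
proof -
  obtain e where e: "chain m e" "e 0 = i\<^sub>0" "e m = j\<^sub>0" using ij0 by (rule occE)
  obtain e' where e': "chain (Suc m) e'" "e' 0 = i" using ij by (rule occE)
  show False
  proof (cases m)
    case 0
    have "e' 1 \<le> N" using chain_bound[OF e'(1), of 1] 0 by simp
    then have "Suc i\<^sub>0 \<le> N" using chain_one[OF e'(1)] e' le by simp
    then have "chain 1 (e(1 := Suc i\<^sub>0))" using e by (simp add: chain_def)
    then show False using none occI[of 1 "e(1 := Suc i\<^sub>0)"] e 0 by simp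
  next
    case (Suc k)
    obtain a where a: "e' k \<le> a" "(a, e' (Suc m)) \<in> Rel"
      using chain_rel[OF e'(1), of k] Suc by auto
    have "e k \<le> e' k" using chain_mono_start[OF e(1) e'(1), of k] Suc e e' le by simp
    then obtain z where "chain (Suc m) (e(Suc m := z))"
      using chain_extend[OF e(1) _ a(2)] free e a(1) Suc by (metis One_nat_def diff_Suc_1 le_trans Suc_le_mono le0)
    then show False using none occI[of "Suc m" "e(Suc m := z)"] e by simp
  qed
qed

text \<open>
  The last relation of a chain of length \<open>m + 2\<close> starts at its point \<open>m\<close> or later, that is, not before
  $j_0$.
\<close>

lemma occ_Suc_Suc_none:
  assumes "(i\<^sub>0, j\<^sub>0) \<in> occ m" "rel_free j\<^sub>0" "(i, j) \<in> occ (Suc (Suc m))" "i\<^sub>0 \<le> i"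
  shows False
proof -
  obtain e where e: "chain m e" "e 0 = i\<^sub>0" "e m = j\<^sub>0" using assms(1) by (rule occE)
  obtain e' where e': "chain (Suc (Suc m)) e'" "e' 0 = i" using assms(3) by (rule occE)
  obtain a where a: "e' m \<le> a" "(a, e' (Suc (Suc m))) \<in> Rel"
    using chain_rel[OF e'(1), of m] by auto
  have "e m \<le> e' m" using chain_mono_start[OF e(1) e'(1), of m] e e' assms(4) by simp
  then show False using assms(2) a e le_trans unfolding rel_free_def by blast
qed

text \<open>
  For odd \<open>m\<close> already point \<open>m - 1\<close> of a chain that starts further right is not before $j_0$, by
  \<open>chain_overtake\<close>.
\<close>

lemma occ_odd_none:
  assumes "odd m" "(i\<^sub>0, j\<^sub>0) \<in> occ m" "rel_free j\<^sub>0" "i\<^sub>0 < i" "(i, j) \<in> occ (Suc m)"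
  shows False
proof -
  obtain e where e: "chain m e" "e 0 = i\<^sub>0" "e m = j\<^sub>0" using assms(2) by (rule occE)
  obtain e' where e': "chain (Suc m) e'" "e' 0 = i" using assms(5) by (rule occE)
  obtain k where k: "m = Suc k" "even k" using assms(1) by (metis even_Suc old.nat.exhaust even_zero)
  obtain a where a: "e' k \<le> a" "(a, e' (Suc m)) \<in> Rel"
    using chain_rel[OF e'(1), of k] k by auto
  have "e m \<le> e' k" using chain_overtake[OF e(1) e'(1), of k] e e' assms(4) k by simp
  then show False using assms(3) a e le_trans unfolding rel_free_def by blast
qed

lemma occ_even_inner:
  assumes "even m" "(i, j) \<in> occ (Suc m)" "(i', j') \<in> occ m" "i < i'" "j' \<le> j"
  shows "j' = j"
proof -
  obtain e where e: "chain (Suc m) e" "e 0 = i" "e (Suc m) = j" using assms(2) by (rule occE)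
  obtain e' where e': "chain m e'" "e' 0 = i'" "e' m = j'" using assms(3) by (rule occE)
  have "e (Suc m) \<le> e' m" using chain_overtake[OF e(1) e'(1), of m] assms e e' by simp
  then show ?thesis using e e' assms by simp
qed

text \<open>
  The last relation of the chain from $i'$ starts late enough, by \<open>chain_overtake\<close>, to extend the chain
  from $i$.
\<close>

lemma occ_even_next:
  assumes "even m" "(i\<^sub>0, j\<^sub>0) \<in> occ m" "rel_free j\<^sub>0" "i\<^sub>0 \<le> i" "i < i'"
    and ij: "(i, j) \<in> occ m" "(i', j') \<in> occ m"
  obtains z where "(i, z) \<in> occ (Suc m)" "z \<le> j'"
proof -
  obtain e where e: "chain m e" "e 0 = i" "e m = j" using ij(1) by (rule occE)
  obtain e' where e': "chain m e'" "e' 0 = i'" "e' m = j'" using ij(2) by (rule occE)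
  show thesis
  proof (cases "m = 0")
    case True
    have "chain 1 (e(1 := Suc i))" using e e' True assms(5) by (auto simp: chain_def)
    then show thesis using that[of "Suc i"] occI[of 1 "e(1 := Suc i)"] e e' True assms(5) by simp
  next
    case False
    then obtain k where k: "m = Suc (Suc k)" "even k"
      using assms(1) by (metis even_Suc not0_implies_Suc even_zero odd_one One_nat_def)
    obtain a where a: "e' k \<le> a" "(a, e' m) \<in> Rel" using chain_rel[OF e'(1), of k] k by auto
    have "e (Suc k) \<le> e' k" using chain_overtake[OF e(1) e'(1), of k] e e' assms(5) k by simp
    moreover have "rel_free (e m)"
      using assms(3) occ_le_end[OF assms(2) ij(1) assms(4)] e unfolding rel_free_def using le_trans by blast
    ultimately obtain z where "chain (Suc m) (e(Suc m := z))" "z \<le> e' m"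
      using chain_extend[OF e(1) _ a(2)] a(1) k by (metis One_nat_def diff_Suc_1 le_trans Suc_le_mono le0)
    then show thesis using that[of z] occI[of "Suc m" "e(Suc m := z)"] e e' by simp
  qed
qed

lemma occ_prefix_rel_free:
  assumes ij: "(i, j) \<in> occ (Suc n)" and free: "rel_free j"
    and none: "\<And>z. (i, z) \<notin> occ (Suc (Suc n))" and pre: "(i, j') \<in> occ n"
  shows "rel_free j'"
proof -
  obtain e where e: "chain (Suc n) e" "e 0 = i" "e (Suc n) = j" using ij by (rule occE)
  have j': "j' = e n" using pre occI[OF chain_prefix[OF e(1)], of n] e occ_unique_end by simp
  show ?thesis
    unfolding rel_free_def
  proof (intro allI impI notI)
    fix a b assume "(a, b) \<in> Rel" "j' \<le> a"
    then obtain z where "chain (Suc (Suc n)) (e(Suc (Suc n) := z))"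
      using chain_extend[OF e(1)] free e j' by (metis diff_Suc_1 le_numeral_extra(4) One_nat_def Suc_le_mono le0)
    then show False using none occI[of "Suc (Suc n)" "e(Suc (Suc n) := z)"] e by simp
  qed
qed

text \<open>
  Overlaps are symmetric: the chain can also be built greedily from the right, always taking the last
  relation that ends in time. Its points \<open>b\<close> interleave with those of the given chain. Restarting the
  greedy chain from the left at \<open>b 2\<close> stays between consecutive points of \<open>b\<close>, and therefore ends at
  the same place one step sooner.
\<close>

lemma occ_last_inner:
  assumes "(i, j) \<in> occ (Suc m)"
  obtains i' where "(i', j) \<in> occ m" "i < i'"
proof -
  obtain e where e: "chain (Suc m) e" "e 0 = i" "e (Suc m) = j" using assms by (rule occE)
  have e_less: "e k < e (Suc k)" if "k \<le> m" for k using chain_less_Suc[OF e(1)] that by simp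
  \<comment> \<open>The points of the greedy chain read from the right end. They are indexed from \<open>m + 2\<close> downwards so that
     \<open>b k\<close> lies in the interval from \<open>e (k - 1)\<close> to \<open>e k\<close>.\<close>
  define f where "f = rec_nat (j, j - 1) (\<lambda>_ (x, y). (y, Max {a. \<exists>z. (a, z) \<in> Rel \<and> z \<le> x}))"
  define b where "b k = fst (f (m + 2 - k))" for k
  have f_Suc: "f (Suc t) = (snd (f t), Max {a. \<exists>z. (a, z) \<in> Rel \<and> z \<le> fst (f t)})" for t
    by (simp add: f_def split: prod.splits)
  have fin: "finite {a. \<exists>z. (a, z) \<in> Rel \<and> z \<le> x}" for x
    by (rule finite_subset[of _ "{..N}"]) (use Rel_length Rel_bound in fastforce, simp)
  have b0: "b (m + 2) = j" by (simp add: b_def f_def)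
  have b1: "b (m + 1) = j - 1" by (simp add: b_def f_def)
  have b_rec: "b k = Max {a. \<exists>z. (a, z) \<in> Rel \<and> z \<le> b (k + 2)}" if "k \<le> m" for k
  proof -
    have "m + 2 - k = Suc (Suc (m - k))" using that by simp
    moreover have "m + 2 - (k + 2) = m - k" by simp
    ultimately show ?thesis by (simp add: b_def f_Suc)
  qed
  have max: "(\<exists>y. (b k, y) \<in> Rel \<and> y \<le> b (k + 2)) \<and> (\<forall>a y. (a, y) \<in> Rel \<longrightarrow> y \<le> b (k + 2) \<longrightarrow> a \<le> b k)"
    if "k \<le> m" "(a, y) \<in> Rel" "y \<le> b (k + 2)" for k a y
    using Max_in[OF fin, of "b (k + 2)"] Max_ge[OF fin, of _ "b (k + 2)"] that
    unfolding b_rec[OF that(1)] by blast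
  have "1 \<le> k \<Longrightarrow> k \<le> m + 1 \<Longrightarrow> e (k - 1) \<le> b k \<and> b k < e k \<and> (k \<le> m \<longrightarrow>
      (\<exists>y. (b k, y) \<in> Rel \<and> y \<le> b (k + 2)) \<and> (\<forall>a y. (a, y) \<in> Rel \<longrightarrow> y \<le> b (k + 2) \<longrightarrow> a \<le> b k))" for k
  proof (induction "m + 1 - k" arbitrary: k rule: less_induct)
    case less
    show ?case
    proof (cases "k = m + 1")
      case True
      then show ?thesis using b1 e_less[of m] e(3) by simp
    next
      case False
      then have km: "k \<le> m" using less.prems by simp
      obtain l where l: "k = Suc l" using less.prems by (cases k) auto
      obtain a where a: "e l \<le> a" "a < e k" "(a, e (Suc k)) \<in> Rel"
        using chain_rel[OF e(1), of l] km l by auto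
      have lower: "e (Suc k) \<le> b (k + 2)"
      proof (cases "k = m")
        case True
        then show ?thesis using b0 e(3) by simp
      next
        case False
        then show ?thesis using less.hyps[of "k + 2"] km by (cases "k + 2 = m + 2") (auto)
      qed
      have M: "(\<exists>y. (b k, y) \<in> Rel \<and> y \<le> b (k + 2)) \<and> (\<forall>a y. (a, y) \<in> Rel \<longrightarrow> y \<le> b (k + 2) \<longrightarrow> a \<le> b k)"
        using max[OF km a(3) lower] .
      then have "a \<le> b k" using a lower by blast
      moreover have "b k < e k"
      proof (cases "k = m")
        case True
        obtain y where "(b k, y) \<in> Rel" "y \<le> e (Suc k)" using M b0 True e(3) by auto
        then have "b k \<le> a" using Rel_start_le_iff a by blast
        then show ?thesis using a by simp
      next
        case False
        then have up: "b (k + 2) < e (k + 2)"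
          using less.hyps[of "k + 2"] km b0 by (cases "k + 2 = m + 2") auto
        show ?thesis
        proof (rule ccontr)
          assume "\<not> b k < e k"
          then have "\<And>y. (b k, y) \<in> Rel \<Longrightarrow> e (Suc (Suc k)) \<le> y"
            using chain_least[OF e(1), of k] False km by simp
          then show False using M up by fastforce
        qed
      qed
      ultimately show ?thesis using M a l by simp
    qed
  qed
    note B = this
  note b = b0 b1
  have b_rel: "\<exists>y. (b k, y) \<in> Rel \<and> y \<le> b (k + 2)" if "1 \<le> k" "k \<le> m" for k
    using B[of k] that by simp
  have b_max: "a \<le> b k" if "1 \<le> k" "k \<le> m" "(a, y) \<in> Rel" "y \<le> b (k + 2)" for k a y
    using B[of k] that by auto
  have b_e: "e (k - 1) \<le> b k \<and> b k < e k" if "1 \<le> k" "k \<le> m + 1" for k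
    using B[of k] that by simp
  have b_less: "b k < b (Suc k)" if "1 \<le> k" "k \<le> m + 1" for k
  proof (cases "k = m + 1")
    case True
    then show ?thesis using b e_less[of m] e(3) by simp
  next
    case False
    then show ?thesis using b_e[of k] b_e[of "Suc k"] that by simp
  qed
  \<comment> \<open>The greedy chain from the left that starts at \<open>b 2\<close>.\<close>
  define g where "g = rec_nat (b 2, Suc (b 2)) (\<lambda>_ (x, y). (y, LEAST z. \<exists>a. (a, z) \<in> Rel \<and> x \<le> a))"
  define e' where "e' k = fst (g k)" for k
  have g_Suc: "g (Suc t) = (snd (g t), LEAST z. \<exists>a. (a, z) \<in> Rel \<and> fst (g t) \<le> a)" for t
    by (simp add: g_def split: prod.splits)
  have e'0: "e' 0 = b 2" "e' (Suc 0) = Suc (b 2)" by (simp_all add: e'_def g_def)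
  have e'_rec: "e' (Suc (Suc k)) = (LEAST z. \<exists>a. (a, z) \<in> Rel \<and> e' k \<le> a)" for k
    by (simp add: e'_def g_Suc)
  have main: "k \<le> m \<Longrightarrow> b (k + 1) < e' k \<and> e' k \<le> b (k + 2) \<and>
     (2 \<le> k \<longrightarrow> step (e' (k - 2)) (e' (k - 1)) (e' k))" for k
  proof (induction k rule: less_induct)
    case (less k)
    consider "k = 0" | "k = 1" | l where "k = Suc (Suc l)" by (metis One_nat_def not0_implies_Suc)
    then show ?case
    proof cases
      case 1
      then show ?thesis using e'0 b_less[of 1] by (simp add: numeral_2_eq_2)
    next
      case 2
      then show ?thesis using e'0 b_less[of 2] less.prems by (simp add: numeral_2_eq_2 numeral_3_eq_3)
    next
      case (3 l)
      have IH: "b (l + 1) < e' l" "e' l \<le> b (l + 2)" "b (l + 2) < e' (Suc l)"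
        using less.IH[of l] less.IH[of "Suc l"] less.prems 3 by simp_all
      obtain y where y: "(b (l + 2), y) \<in> Rel" "y \<le> b (k + 2)"
        using b_rel[of k] less.prems 3 by auto
      have "\<exists>a. (a, e' k) \<in> Rel \<and> e' l \<le> a"
        unfolding 3 e'_rec by (rule LeastI[of _ y]) (use y IH in blast)
      then obtain a where a: "(a, e' k) \<in> Rel" "e' l \<le> a" by blast
      have least: "e' k \<le> y'" if "(a', y') \<in> Rel" "e' l \<le> a'" for a' y'
        unfolding 3 e'_rec by (rule Least_le) (use that in blast)
      have "e' k \<le> y" using least y IH by blast
      then have "a \<le> b (l + 2)" using Rel_start_le_iff[OF a(1) y(1)] by simp
      then have "step (e' l) (e' (Suc l)) (e' k)" using a least IH by (auto simp: step_def)
      moreover have "b (k + 1) < e' k"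
        using b_max[of "l + 1" a "e' k"] a IH less.prems 3 by fastforce
      ultimately show ?thesis using \<open>e' k \<le> y\<close> y 3 by simp
    qed
  qed
  have "e' m = j" using main[of m] b e_less[of m] e(3) by simp linarith
  moreover have "chain m e'"
    unfolding chain_def
  proof (intro conjI allI impI)
    show "e' m \<le> N" using \<open>e' m = j\<close> occ_bounds[OF assms] by simp
  next
    fix k assume "k + 2 \<le> m"
    then show "step (e' k) (e' (Suc k)) (e' (Suc (Suc k)))" using main[of "k + 2"] by simp
  qed (use e'0 in simp)
  ultimately have "(b 2, j) \<in> occ m" using occI[of m e'] e'0 by simp
  moreover have "i < b 2"
  proof (cases "m = 0")
    case True
    then show ?thesis using b e e_less[of 0] by (simp add: numeral_2_eq_2)
  next
    case False
    then have "e 1 \<le> b 2" using b_e[of 2] by simp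
    then show ?thesis using e_less[of 0] e by simp
  qed
  ultimately show thesis using that by blast
qed

end

section \<open>Subpaths as intervals\<close>

locale quiver_relations = wf_digraph Q
  for Q :: "('v, 'e) pre_digraph" +
  fixes S :: "('v, 'e) path set"
  assumes S_paths: "S \<subseteq> {p \<in> paths Q. plen p \<ge> 2}"
    and S_antichain: "s \<in> S \<Longrightarrow> s' \<in> S \<Longrightarrow> s \<noteq> s' \<Longrightarrow> factorizations Q {s} s' = {}"
begin

definition vtx :: "('v, 'e) path \<Rightarrow> nat \<Rightarrow> 'v" where
  "vtx p i = tgt Q (fst p, take i (snd p))"

definition slice :: "('v, 'e) path \<Rightarrow> nat \<Rightarrow> nat \<Rightarrow> ('v, 'e) path" where
  "slice p i j = (vtx p i, take (j - i) (drop i (snd p)))"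

lemma paths_iff: "p \<in> paths Q \<longleftrightarrow> awalk (fst p) (snd p) (tgt Q p)"
proof -
  have "awalk u es v \<Longrightarrow> awalk u es (awlast u es)" for u es v
    by (metis awalkE)
  then show ?thesis unfolding paths_def tgt_def by (cases p) auto
qed

lemma tgt_append: "tgt Q (v, xs @ ys) = tgt Q (tgt Q (v, xs), ys)"
  by (simp add: tgt_def awlast_append)

lemma paths_append: "(v, xs @ ys) \<in> paths Q \<longleftrightarrow> (v, xs) \<in> paths Q \<and> (tgt Q (v, xs), ys) \<in> paths Q"
  by (simp add: paths_iff tgt_append) (simp add: tgt_def)

lemma trivial_path: "(v, []) \<in> paths Q \<longleftrightarrow> v \<in> verts Q"
  by (simp add: paths_iff tgt_def awalk_Nil_iff)

lemma src_in_verts: "p \<in> paths Q \<Longrightarrow> src p \<in> verts Q"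
  by (auto simp: paths_iff src_def)

lemma tgt_in_verts: "p \<in> paths Q \<Longrightarrow> tgt Q p \<in> verts Q"
  unfolding paths_iff by blast

lemma tgt_trivial [simp]: "tgt Q (v, []) = v"
  by (simp add: tgt_def)

lemma src_pcat [simp]: "src (pcat p q) = src p"
  by (simp add: src_def pcat_def)

lemma plen_pcat [simp]: "plen (pcat p q) = plen p + plen q"
  by (simp add: plen_def pcat_def)

lemma tgt_pcat: "tgt Q p = src q \<Longrightarrow> tgt Q (pcat p q) = tgt Q q"
  by (simp add: pcat_def tgt_append src_def)

lemma pcat_in_paths: "p \<in> paths Q \<Longrightarrow> q \<in> paths Q \<Longrightarrow> tgt Q p = src q \<Longrightarrow> pcat p q \<in> paths Q"
  by (cases p, cases q) (simp add: pcat_def paths_append src_def)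

lemma pcat_assoc: "pcat (pcat p q) r = pcat p (pcat q r)"
  by (simp add: pcat_def)

lemma pcat_trivial_right [simp]: "pcat p (v, []) = p"
  by (simp add: pcat_def)

lemma pcat_trivial_left: "v = src p \<Longrightarrow> pcat (v, []) p = p"
  by (simp add: pcat_def src_def)

lemma plen_zero: "plen p = 0 \<Longrightarrow> p = (src p, [])"
  by (cases p) (simp add: plen_def src_def)

lemma vtx_0 [simp]: "vtx p 0 = src p"
  by (simp add: vtx_def src_def)

lemma vtx_plen [simp]: "vtx p (plen p) = tgt Q p"
  by (simp add: vtx_def plen_def)

lemma src_slice [simp]: "src (slice p i j) = vtx p i"
  by (simp add: slice_def src_def)

lemma tgt_slice: "i \<le> j \<Longrightarrow> tgt Q (slice p i j) = vtx p j"
  by (simp add: slice_def vtx_def tgt_append[symmetric] take_add[symmetric])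

lemma plen_slice: "j \<le> plen p \<Longrightarrow> plen (slice p i j) = j - i"
  by (simp add: slice_def plen_def)

lemma slice_in_paths:
  assumes "p \<in> paths Q" "i \<le> j"
  shows "slice p i j \<in> paths Q"
proof -
  have "snd p = take i (snd p) @ take (j - i) (drop i (snd p)) @ drop j (snd p)"
    using assms(2) by (metis append.assoc append_take_drop_id le_add_diff_inverse take_add)
  then have "(fst p, take i (snd p) @ take (j - i) (drop i (snd p)) @ drop j (snd p)) \<in> paths Q"
    using assms(1) by (metis prod.collapse)
  then show ?thesis by (simp add: slice_def vtx_def paths_append)
qed

lemma slice_full [simp]: "slice p 0 (plen p) = p"
  by (simp add: slice_def src_def plen_def)

lemma slice_empty: "slice p i i = (vtx p i, [])"
  by (simp add: slice_def)

lemma pcat_slice: "i \<le> j \<Longrightarrow> j \<le> k \<Longrightarrow> pcat (slice p i j) (slice p j k) = slice p i k"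
proof -
  assume "i \<le> j" "j \<le> k"
  then have "take (j - i) (drop i (snd p)) @ take (k - j) (drop j (snd p)) = take (k - i) (drop i (snd p))"
    using take_add[of "j - i" "k - j" "drop i (snd p)"] by simp
  then show ?thesis by (simp add: slice_def pcat_def)
qed

lemma slice_slice:
  assumes "i + b \<le> j" "a \<le> b"
  shows "slice (slice p i j) a b = slice p (i + a) (i + b)"
proof -
  have "tgt Q (vtx p i, take a (take (j - i) (drop i (snd p)))) = vtx p (i + a)"
    using assms by (simp add: vtx_def tgt_append[symmetric] take_add min_def)
  moreover have "take (b - a) (drop a (take (j - i) (drop i (snd p)))) = take (b - a) (drop (i + a) (snd p))"
    using assms by (simp add: drop_take min_def add.commute)
  ultimately show ?thesis by (simp add: slice_def vtx_def[of "(_, _)"])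
qed

lemma slice_pcat_left: "i \<le> j \<Longrightarrow> j \<le> plen p \<Longrightarrow> slice (pcat p q) i j = slice p i j"
  by (simp add: slice_def pcat_def vtx_def plen_def)

lemma slice_pcat_right:
  "tgt Q p = src q \<Longrightarrow> slice (pcat p q) (plen p + i) (plen p + j) = slice q i j"
  by (simp add: slice_def pcat_def vtx_def plen_def tgt_append src_def)

lemma slice_pcat_snd: "tgt Q p = src q \<Longrightarrow> slice (pcat p q) (plen p) (plen p + plen q) = q"
  using slice_pcat_right[of p q 0 "plen q"] by simp

lemma prefix_eq_slice:
  assumes "pcat d r = slice p i j" "i \<le> j" "j \<le> plen p"
  shows "plen d \<le> j - i" "d = slice p i (i + plen d)"
proof -
  have "plen d + plen r = j - i"
    using assms plen_slice[of j p i] plen_pcat[of d r] by simp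
  then show len: "plen d \<le> j - i" by simp
  have "d = slice (pcat d r) 0 (plen d)" by (simp add: slice_pcat_left)
  also have "\<dots> = slice p i (i + plen d)"
    using slice_slice[of i "plen d" j 0 p] len assms by simp
  finally show "d = slice p i (i + plen d)" .
qed

text \<open>
  A factorization is given by the positions where its middle factor starts and ends; all that follows is
  in terms of positions.
\<close>

lemma factorizations_slice:
  assumes "p \<in> paths Q"
  shows "factorizations Q W p = (\<lambda>(i, j). (slice p 0 i, slice p i j, slice p j (plen p))) `
     {(i, j). i \<le> j \<and> j \<le> plen p \<and> slice p i j \<in> W}" (is "?L = ?R")
proof (rule equalityI; rule subsetI)
  fix t assume "t \<in> ?L"
  then obtain q w r where t: "t = (q, w, r)" and qwr: "w \<in> W" "tgt Q q = src w" "tgt Q w = src r"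
    and p: "p = pcat q (pcat w r)"
    by (auto simp: factorizations_def)
  define i j where "i = plen q" and "j = plen q + plen w"
  have "slice p 0 i = q" by (simp add: p i_def slice_pcat_left)
  moreover have "slice p i j = w"
    using slice_pcat_right[of q "pcat w r" 0 "plen w"] qwr
    by (simp add: p i_def j_def slice_pcat_left)
  moreover have "slice p j (plen p) = r"
    using slice_pcat_right[of q "pcat w r" "plen w" "plen w + plen r"] qwr slice_pcat_snd[of w r]
    by (simp add: p j_def add.assoc)
  moreover have "i \<le> j" "j \<le> plen p" by (simp_all add: i_def j_def p)
  ultimately show "t \<in> ?R" using qwr t by force
next
  fix t assume "t \<in> ?R"
  then obtain i j where ij: "i \<le> j" "j \<le> plen p" "slice p i j \<in> W"
    and t: "t = (slice p 0 i, slice p i j, slice p j (plen p))" by auto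
  then show "t \<in> ?L"
    using assms by (simp add: factorizations_def slice_in_paths tgt_slice pcat_slice)
qed

lemma factorizations_slice_inj:
  "inj_on (\<lambda>(i, j). (slice p 0 i, slice p i j, slice p j (plen p))) {(i, j). i \<le> j \<and> j \<le> plen p \<and> slice p i j \<in> W}"
proof (rule inj_onI, clarify)
  fix i j i' j'
  assume eq: "slice p 0 i = slice p 0 i'" "slice p i j = slice p i' j'"
    and le: "i \<le> j" "j \<le> plen p" "i' \<le> j'" "j' \<le> plen p"
  have "i = i'" using arg_cong[OF eq(1), of plen] le plen_slice[of i p 0] plen_slice[of i' p 0] by linarith
  moreover have "j - i = j' - i'"
    using arg_cong[OF eq(2), of plen] le plen_slice[of j p i] plen_slice[of j' p i'] by linarith
  ultimately show "i = i' \<and> j = j'" using le by linarith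
qed

definition rel :: "('v, 'e) path \<Rightarrow> (nat \<times> nat) set" where
  "rel p = {(i, j). i \<le> j \<and> j \<le> plen p \<and> slice p i j \<in> S}"

abbreviation Irr :: "('v, 'e) path set" where
  "Irr \<equiv> irreducible_paths Q S"

lemma irreducible_iff: "p \<in> Irr \<longleftrightarrow> p \<in> paths Q \<and> rel p = {}"
  by (auto simp: irreducible_paths_def rel_def factorizations_slice)

lemma irreducible_in_paths: "p \<in> Irr \<Longrightarrow> p \<in> paths Q"
  by (simp add: irreducible_iff)

lemma slice_irreducible_iff:
  assumes "p \<in> paths Q" "i \<le> j" "j \<le> plen p"
  shows "slice p i j \<in> Irr \<longleftrightarrow> (\<forall>a b. (a, b) \<in> rel p \<longrightarrow> i \<le> a \<longrightarrow> \<not> b \<le> j)"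
proof -
  have "rel (slice p i j) = {} \<longleftrightarrow> (\<forall>a b. (a, b) \<in> rel p \<longrightarrow> i \<le> a \<longrightarrow> \<not> b \<le> j)"
  proof
    assume L: "rel (slice p i j) = {}"
    show "\<forall>a b. (a, b) \<in> rel p \<longrightarrow> i \<le> a \<longrightarrow> \<not> b \<le> j"
    proof (intro allI impI notI)
      fix a b assume "(a, b) \<in> rel p" "i \<le> a" "b \<le> j"
      then have "(a - i, b - i) \<in> rel (slice p i j)"
        using assms by (auto simp: rel_def plen_slice slice_slice)
      then show False using L by simp
    qed
  next
    assume R: "\<forall>a b. (a, b) \<in> rel p \<longrightarrow> i \<le> a \<longrightarrow> \<not> b \<le> j"
    have False if "(a, b) \<in> rel (slice p i j)" for a b
    proof -
      have "(i + a, i + b) \<in> rel p" "i + b \<le> j"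
        using that assms by (auto simp: rel_def plen_slice slice_slice)
      then show False using R by simp
    qed
    then show "rel (slice p i j) = {}" by auto
  qed
  then show ?thesis using assms by (simp add: irreducible_iff slice_in_paths)
qed

lemma S_subpath_eq:
  assumes "p \<in> paths Q" "(a, b) \<in> rel p" "(a', b') \<in> rel p" "a \<le> a'" "b' \<le> b"
  shows "a = a' \<and> b = b'"
proof (rule ccontr)
  assume neq: "\<not> (a = a' \<and> b = b')"
  have le: "a \<le> b" "b \<le> plen p" "a' \<le> b'" "b' \<le> plen p"
    and S: "slice p a b \<in> S" "slice p a' b' \<in> S"
    using assms by (auto simp: rel_def)
  have "plen (slice p a b) \<noteq> plen (slice p a' b')"
    using neq le assms by (auto simp: plen_slice)
  then have "factorizations Q {slice p a' b'} (slice p a b) = {}"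
    using S_antichain[OF S(2,1)] by metis
  moreover have "slice (slice p a b) (a' - a) (b' - a) = slice p a' b'"
    using slice_slice[of a "b' - a" b "a' - a" p] assms le by simp
  ultimately show False
    using assms le by (auto simp: factorizations_slice slice_in_paths plen_slice)
qed

lemma rel_length: "p \<in> paths Q \<Longrightarrow> (a, b) \<in> rel p \<Longrightarrow> a + 2 \<le> b"
  using S_paths plen_slice[of b p a] by (fastforce simp: rel_def)

lemma interval_system_rel:
  assumes p: "p \<in> paths Q"
  shows "interval_system (rel p) (plen p)"
proof
  show "a + 2 \<le> b" if "(a, b) \<in> rel p" for a b using rel_length[OF p that] .
  show "b \<le> plen p" if "(a, b) \<in> rel p" for a b using that by (simp add: rel_def)
  fix a b a' b' assume "(a, b) \<in> rel p" "(a', b') \<in> rel p"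
  then show "a < a' \<longleftrightarrow> b < b'"
    using S_subpath_eq[OF p, of a b a' b'] S_subpath_eq[OF p, of a' b' a b] by linarith
qed

lemma rel_free_iff:
  assumes "p \<in> paths Q" "j \<le> plen p"
  shows "interval_system.rel_free (rel p) j \<longleftrightarrow> slice p j (plen p) \<in> Irr"
  using assms interval_system.rel_free_def[OF interval_system_rel[OF assms(1)]]
  by (auto simp: slice_irreducible_iff rel_def)

abbreviation SS :: "nat \<Rightarrow> ('v, 'e) path set" where
  "SS n \<equiv> overlap_paths Q S n"

definition occurrences :: "('v, 'e) path \<Rightarrow> nat \<Rightarrow> (nat \<times> nat) set" where
  "occurrences p n = {(i, j). i \<le> j \<and> j \<le> plen p \<and> slice p i j \<in> SS n}"

lemma slice_concat:
  assumes "\<And>k. k < n \<Longrightarrow> e k \<le> e (Suc k)"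
  shows "concat (map snd (map (\<lambda>k. slice p (e k) (e (Suc k))) [0..<n])) = take (e n - e 0) (drop (e 0) (snd p))"
  using assms
proof (induction n)
  case (Suc n)
  have "k \<le> n \<Longrightarrow> e 0 \<le> e k" for k
    using Suc.prems by (induction k) (auto intro: order_trans)
  then have "e 0 \<le> e n" by simp
  moreover have "e n \<le> e (Suc n)" using Suc.prems by simp
  ultimately have "take (e n - e 0) (drop (e 0) (snd p)) @ take (e (Suc n) - e n) (drop (e n) (snd p))
      = take (e (Suc n) - e 0) (drop (e 0) (snd p))"
    using take_add[of "e n - e 0" "e (Suc n) - e n" "drop (e 0) (snd p)"] by simp
  then show ?case using Suc by (simp add: slice_def)
qed simp

text \<open>
  The pieces $u_k$ are the slices between consecutive points. That $u_k u_{k+1}$ is reducible, but becomes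
  irreducible when $u_{k+1}$ is shortened, says that the first relation that starts at the beginning of
  $u_k$ or later ends where $u_{k+1}$ ends; that $u_{k+1}$ is irreducible says that this relation starts
  inside $u_k$. This is the greedy condition on the chain, and the next lemma reads it backwards.
\<close>

lemma occurrences_of_chain:
  assumes p: "p \<in> paths Q" and c: "interval_system.chain (rel p) (plen p) (Suc (Suc (Suc m))) e"
  shows "slice p (e 0) (e (Suc (Suc (Suc m)))) \<in> ambiguities Q S (Suc m)"
proof -
  interpret interval_system "rel p" "plen p" by (rule interval_system_rel[OF p])
  let ?n = "Suc (Suc (Suc m))"
  define us where "us = map (\<lambda>k. slice p (e k) (e (Suc k))) [0..<?n]"
  have us: "us ! k = slice p (e k) (e (Suc k))" if "k < ?n" for k
    using that by (simp add: us_def del: upt_Suc)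
  have mono: "e k \<le> e (Suc k)" if "k < ?n" for k using chain_less_Suc[OF c that] by simp
  have bound: "e k \<le> plen p" if "k \<le> ?n" for k using chain_bound[OF c that] .
  have cat: "pcat (us ! k) (us ! Suc k) = slice p (e k) (e (Suc (Suc k)))" if "k \<le> Suc m" for k
    using that by (simp add: us mono pcat_slice)
  show ?thesis
    unfolding ambiguities_def mem_Collect_eq
  proof (intro exI[of _ us] conjI)
    show "length us = Suc m + 2" by (simp add: us_def del: upt_Suc)
    show "set us \<subseteq> paths Q" using p mono by (auto simp: us_def slice_in_paths simp del: upt_Suc)
    show "\<forall>i\<le>Suc m. tgt Q (us ! i) = src (us ! Suc i)" by (simp add: us tgt_slice mono)
    show "slice p (e 0) (e ?n) = (src (us ! 0), concat (map snd us))"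
      using slice_concat[of ?n e p] mono us[of 0] unfolding us_def slice_def src_def by simp
    show "plen (us ! 0) = 1" using chain_one[OF c] bound[of 1] by (simp add: us plen_slice)
    show "\<forall>i\<le>Suc m. us ! Suc i \<in> Irr"
    proof (intro allI impI)
      fix k assume k: "k \<le> Suc m"
      obtain a where a: "a < e (Suc k)" "(a, e (Suc (Suc k))) \<in> rel p"
        using chain_rel[OF c, of k] k by auto
      then show "us ! Suc k \<in> Irr"
        using Rel_start_le_iff[of _ _ a] k p mono bound by (fastforce simp: us slice_irreducible_iff)
    qed
    show "\<forall>i\<le>Suc m. pcat (us ! i) (us ! Suc i) \<notin> Irr"
    proof (intro allI impI)
      fix k assume k: "k \<le> Suc m"
      obtain a where a: "e k \<le> a" "(a, e (Suc (Suc k))) \<in> rel p"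
        using chain_rel[OF c, of k] k by auto
      have "e k \<le> e (Suc (Suc k))" using mono[of k] mono[of "Suc k"] k by simp
      then show "pcat (us ! k) (us ! Suc k) \<notin> Irr"
        using a k p mono bound unfolding cat[OF k] by (auto simp: slice_irreducible_iff)
    qed
    show "\<forall>i\<le>Suc m. \<forall>d\<in>paths Q. \<forall>r\<in>paths Q. tgt Q d = src r \<and> pcat d r = us ! Suc i \<and>
        d \<noteq> us ! Suc i \<longrightarrow> pcat (us ! i) d \<in> Irr"
    proof (intro allI impI ballI, elim conjE)
      fix k d r assume k: "k \<le> Suc m" and d: "pcat d r = us ! Suc k" "d \<noteq> us ! Suc k"
      have le: "e k \<le> e (Suc k)" "e (Suc k) \<le> e (Suc (Suc k))" "e (Suc (Suc k)) \<le> plen p"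
        using mono[of k] mono[of "Suc k"] bound k by simp_all
      define c' where "c' = e (Suc k) + plen d"
      have *: "plen d \<le> e (Suc (Suc k)) - e (Suc k)" "d = slice p (e (Suc k)) c'"
        using prefix_eq_slice[of d r p "e (Suc k)" "e (Suc (Suc k))"] d le k by (simp_all add: us c'_def)
      then have "c' \<noteq> e (Suc (Suc k))" using d k us by auto
      then have c': "c' < e (Suc (Suc k))" "e (Suc k) \<le> c'" using *(1) le by (simp_all add: c'_def)
      have "pcat (us ! k) d = slice p (e k) c'" using * c' le k by (simp add: us pcat_slice)
      moreover have "\<not> b \<le> c'" if "(a, b) \<in> rel p" "e k \<le> a" for a b
        using chain_least[OF c _ that] k c' by simp
      ultimately show "pcat (us ! k) d \<in> Irr" using p c' le by (simp add: slice_irreducible_iff)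
    qed
  qed
qed

lemma chain_of_ambiguity:
  assumes p: "p \<in> paths Q" and ij: "i \<le> j" "j \<le> plen p" and amb: "slice p i j \<in> ambiguities Q S (Suc m)"
  obtains e where "interval_system.chain (rel p) (plen p) (Suc (Suc (Suc m))) e" "e 0 = i" "e (Suc (Suc (Suc m))) = j"
proof -
  interpret interval_system "rel p" "plen p" by (rule interval_system_rel[OF p])
  let ?n = "Suc (Suc (Suc m))"
  obtain us where len: "length us = Suc m + 2" and us_paths: "set us \<subseteq> paths Q"
    and comp: "\<And>k. k \<le> Suc m \<Longrightarrow> tgt Q (us ! k) = src (us ! Suc k)"
    and cat: "slice p i j = (src (us ! 0), concat (map snd us))"
    and one: "plen (us ! 0) = 1"
    and irr: "\<And>k. k \<le> Suc m \<Longrightarrow> us ! Suc k \<in> Irr"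
    and red: "\<And>k. k \<le> Suc m \<Longrightarrow> pcat (us ! k) (us ! Suc k) \<notin> Irr"
    and least: "\<And>k d r. k \<le> Suc m \<Longrightarrow> d \<in> paths Q \<Longrightarrow> r \<in> paths Q \<Longrightarrow> tgt Q d = src r \<Longrightarrow>
       pcat d r = us ! Suc k \<Longrightarrow> d \<noteq> us ! Suc k \<Longrightarrow> pcat (us ! k) d \<in> Irr"
    using amb unfolding ambiguities_def mem_Collect_eq by (elim exE conjE) (rule that; blast)
  define e where "e k = i + length (concat (map snd (take k us)))" for k
  have e0: "e 0 = i" by (simp add: e_def)
  have en: "e ?n = j"
  proof -
    have "length (concat (map snd us)) = j - i"
      using cat plen_slice[OF ij(2), of i] by (simp add: plen_def)
    then show ?thesis using len ij by (simp add: e_def)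
  qed
  have e_Suc: "e (Suc k) = e k + plen (us ! k)" if "k < ?n" for k
    using that len by (simp add: e_def take_Suc_conv_app_nth plen_def)
  have mono: "e k \<le> e (Suc k)" if "k < ?n" for k using e_Suc[OF that] by simp
  have bound: "k \<le> ?n \<Longrightarrow> e k \<le> plen p" for k
  proof -
    assume k: "k \<le> ?n"
    have "us = take k us @ drop k us" by simp
    from arg_cong[OF this, of "\<lambda>xs. concat (map snd xs)"]
    have "concat (map snd us) = concat (map snd (take k us)) @ concat (map snd (drop k us))" by (simp only: map_append concat_append)
    then have "length (concat (map snd (take k us))) \<le> length (concat (map snd us))" by simp
    then have "e k \<le> e ?n" using len by (simp add: e_def)
    then show "e k \<le> plen p" using en ij by simp
  qed
  have drop_i: "take (j - i) (drop i (snd p)) = concat (map snd us)" and v0: "vtx p i = src (us ! 0)"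
    using cat by (simp_all add: slice_def)
  have us_snd: "snd (us ! k) = take (e (Suc k) - e k) (drop (e k) (snd p))" if "k < ?n" for k
  proof -
    have "us = take k us @ us ! k # drop (Suc k) us" using id_take_nth_drop[of k us] that len by simp
    from arg_cong[OF this, of "\<lambda>xs. concat (map snd xs)"]
    have "concat (map snd us) = concat (map snd (take k us)) @ snd (us ! k) @ concat (map snd (drop (Suc k) us))"
      by simp
    then have "drop i (snd p) = concat (map snd (take k us)) @ snd (us ! k) @
        (concat (map snd (drop (Suc k) us)) @ drop (j - i) (drop i (snd p)))"
      using drop_i append_take_drop_id[of "j - i" "drop i (snd p)"] by simp
    from arg_cong[OF this, of "drop (length (concat (map snd (take k us))))"]
    have "drop (e k) (snd p) = snd (us ! k) @
        (concat (map snd (drop (Suc k) us)) @ drop (j - i) (drop i (snd p)))"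
      by (simp add: e_def add.commute)
    then show ?thesis using e_Suc[OF that] by (simp add: plen_def)
  qed
  have "src (us ! k) = vtx p (e k)" if "k < ?n" for k
    using that
  proof (induction k)
    case 0
    then show ?case using v0 e0 by simp
  next
    case (Suc k)
    then have "us ! k = slice p (e k) (e (Suc k))"
      using us_snd[of k] by (cases "us ! k") (simp add: slice_def src_def)
    then show ?case using comp[of k] mono[of k] Suc.prems by (simp add: tgt_slice)
  qed
  then have us: "us ! k = slice p (e k) (e (Suc k))" if "k < ?n" for k
    using us_snd[OF that] that by (cases "us ! k") (force simp: slice_def src_def)
  have "step (e k) (e (Suc k)) (e (Suc (Suc k)))" if k: "k \<le> Suc m" for k
  proof -
    have le: "e k \<le> e (Suc k)" "e (Suc k) \<le> e (Suc (Suc k))" "e (Suc (Suc k)) \<le> plen p"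
      using mono[of k] mono[of "Suc k"] bound k by simp_all
    have cat: "pcat (us ! k) (us ! Suc k) = slice p (e k) (e (Suc (Suc k)))"
      using k le by (simp add: us pcat_slice)
    obtain a b where ab: "(a, b) \<in> rel p" "e k \<le> a" "b \<le> e (Suc (Suc k))"
      using red[OF k] p le unfolding cat by (auto simp: slice_irreducible_iff)
    have first: "\<not> b' \<le> e (Suc k)" if "(a', b') \<in> rel p" "e k \<le> a'" for a' b'
    proof (cases k)
      case 0
      then show ?thesis using one e_Suc[of 0] Rel_length[OF that(1)] that by simp
    next
      case (Suc l)
      then have "us ! k \<in> Irr" using irr[of l] k by simp
      then show ?thesis using that p le k by (simp add: us slice_irreducible_iff)
    qed
    have less: "e (Suc k) < e (Suc (Suc k))" using first[OF ab(1,2)] ab(3) by simp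
    have all: "e (Suc (Suc k)) \<le> b'" if "(a', b') \<in> rel p" "e k \<le> a'" for a' b'
    proof (rule ccontr)
      assume "\<not> e (Suc (Suc k)) \<le> b'"
      define c where "c = e (Suc (Suc k)) - 1"
      have c: "e (Suc k) \<le> c" "c < e (Suc (Suc k))" "b' \<le> c"
        using less \<open>\<not> e (Suc (Suc k)) \<le> b'\<close> by (simp_all add: c_def)
      have "pcat (us ! k) (slice p (e (Suc k)) c) \<in> Irr"
      proof (rule least[OF k, of _ "slice p c (e (Suc (Suc k)))"])
        show "slice p (e (Suc k)) c \<noteq> us ! Suc k"
          using c le k plen_slice[of c p "e (Suc k)"] plen_slice[of "e (Suc (Suc k))" p "e (Suc k)"]
          by (auto simp: us)
      qed (use c p k le in \<open>simp_all add: slice_in_paths tgt_slice pcat_slice us\<close>)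
      moreover have "pcat (us ! k) (slice p (e (Suc k)) c) = slice p (e k) c"
        using c le k by (simp add: us pcat_slice)
      ultimately have "slice p (e k) c \<in> Irr" by simp
      then show False using that c le p by (simp add: slice_irreducible_iff)
    qed
    have "b = e (Suc (Suc k))" using all[OF ab(1,2)] ab(3) by simp
    moreover have "a < e (Suc k)"
    proof (rule ccontr)
      assume "\<not> a < e (Suc k)"
      then show False using irr[OF k] ab p le k by (auto simp: us slice_irreducible_iff)
    qed
    ultimately show ?thesis using ab all by (auto simp: step_def)
  qed
  then have "chain ?n e"
    using bound[of ?n] one e_Suc[of 0] by (simp add: chain_def)
  then show thesis using that e0 en by blast
qed

lemma occurrences_eq_occ:
  assumes p: "p \<in> paths Q"
  shows "occurrences p n = interval_system.occ (rel p) (plen p) n"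
proof -
  interpret interval_system "rel p" "plen p" by (rule interval_system_rel[OF p])
  consider "n = 0" | "n = 1" | "n = 2" | m where "n = Suc (Suc (Suc m))"
    by (metis One_nat_def Suc_1 not0_implies_Suc)
  then show ?thesis
  proof cases
    case 1
    have "(i, j) \<in> occurrences p 0 \<longleftrightarrow> (i, j) \<in> occ 0" for i j
    proof
      assume "(i, j) \<in> occ 0"
      then show "(i, j) \<in> occurrences p 0"
        using p by (auto simp: occurrences_def occ_def chain_def slice_in_paths plen_slice)
    next
      assume "(i, j) \<in> occurrences p 0"
      then show "(i, j) \<in> occ 0"
        by (auto simp: occurrences_def occ_def chain_def plen_slice intro!: exI[of _ "\<lambda>_. i"])
    qed
    then show ?thesis using 1 by auto
  next
    case 2
    have "(i, j) \<in> occurrences p 1 \<longleftrightarrow> (i, j) \<in> occ 1" for i j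
    proof
      assume "(i, j) \<in> occ 1"
      then show "(i, j) \<in> occurrences p 1"
        using p by (auto simp: occurrences_def occ_def chain_def slice_in_paths plen_slice)
    next
      assume "(i, j) \<in> occurrences p 1"
      then show "(i, j) \<in> occ 1"
        by (auto simp: occurrences_def occ_def chain_def plen_slice intro!: exI[of _ "\<lambda>k. i + k"])
    qed
    then show ?thesis using 2 by auto
  next
    case 3
    have "(i, j) \<in> occurrences p 2 \<longleftrightarrow> (i, j) \<in> occ 2" for i j
    proof
      assume "(i, j) \<in> occ 2"
      then obtain e where e: "chain 2 e" "e 0 = i" "e 2 = j" by (rule occE)
      have "(i, j) \<in> rel p"
        using chain_rel[OF e(1), of 0] chain_one[OF e(1)] e by (auto simp: numeral_2_eq_2 less_Suc_eq_le)
      then show "(i, j) \<in> occurrences p 2"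
        by (simp add: occurrences_def rel_def numeral_2_eq_2)
    next
      assume "(i, j) \<in> occurrences p 2"
      then have ij: "(i, j) \<in> rel p" by (simp add: occurrences_def rel_def numeral_2_eq_2)
      define e where "e k = (if k = 0 then i else if k = 1 then Suc i else j)" for k :: nat
      have "chain 2 e"
        using ij Rel_bound[OF ij] Rel_start_le_iff[OF ij] by (auto simp: chain_def e_def step_def)
      then show "(i, j) \<in> occ 2" using occI[of 2 e] by (simp add: e_def)
    qed
    then show ?thesis using 3 by auto
  next
    case (4 m)
    have "(i, j) \<in> occurrences p n \<longleftrightarrow> (i, j) \<in> occ n" for i j
    proof
      assume "(i, j) \<in> occ n"
      then show "(i, j) \<in> occurrences p n"
        using occ_bounds[of i j n] occurrences_of_chain[OF p, of m] 4
        by (auto simp: occurrences_def elim!: occE)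
    next
      assume "(i, j) \<in> occurrences p n"
      then show "(i, j) \<in> occ n"
        using chain_of_ambiguity[OF p, of i j m] occI 4 by (auto simp: occurrences_def)
    qed
    then show ?thesis by auto
  qed
qed

lemma overlap_in_paths: "SS n \<subseteq> paths Q"
proof -
  consider "n = 0" | "n = 1" | "n = 2" | m where "n = Suc (Suc (Suc m))"
    by (metis One_nat_def Suc_1 not0_implies_Suc)
  then show ?thesis
  proof cases
    case (4 m)
    have "(src (us ! 0), concat (map snd us)) \<in> paths Q \<and>
        tgt Q (src (us ! 0), concat (map snd us)) = tgt Q (last us)"
      if "us \<noteq> []" "set us \<subseteq> paths Q" "\<forall>i. Suc i < length us \<longrightarrow> tgt Q (us ! i) = src (us ! Suc i)"
      for us :: "('v, 'e) path list"
      using that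
    proof (induction us rule: rev_nonempty_induct)
      case (single x)
      then show ?case by (simp add: src_def)
    next
      case (snoc x xs)
      have IH: "(src (xs ! 0), concat (map snd xs)) \<in> paths Q \<and>
        tgt Q (src (xs ! 0), concat (map snd xs)) = tgt Q (last xs)"
        using snoc.prems by (intro snoc.IH) (auto simp: nth_append dest: Suc_lessD)
      have "tgt Q (last xs) = src x"
        using snoc.prems(2)[rule_format, of "length xs - 1"] snoc.hyps
        by (simp add: nth_append last_conv_nth)
      then show ?case using IH snoc by (simp add: nth_append paths_append tgt_append src_def)
    qed
    note cat = this
    have "(src (us ! 0), concat (map snd us)) \<in> paths Q"
      if "length us = Suc m + 2" "set us \<subseteq> paths Q" "\<forall>i\<le>Suc m. tgt Q (us ! i) = src (us ! Suc i)" for us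
      using cat[of us] that by (cases us) (simp_all add: less_Suc_eq_le)
    then show ?thesis unfolding 4 overlap_paths.simps ambiguities_def by blast
  qed (use S_paths in \<open>auto simp: numeral_2_eq_2\<close>)
qed

end

section \<open>Linear combinations of paths\<close>

abbreviation single :: "'p \<Rightarrow> 'k \<Rightarrow> ('p \<Rightarrow>\<^sub>0 'k :: field)" where
  "single \<equiv> Poly_Mapping.single"

abbreviation coeff :: "('p \<Rightarrow>\<^sub>0 'k :: field) \<Rightarrow> 'p \<Rightarrow> 'k" where
  "coeff \<equiv> Poly_Mapping.lookup"

abbreviation supp :: "('p \<Rightarrow>\<^sub>0 'k :: field) \<Rightarrow> 'p set" where
  "supp \<equiv> Poly_Mapping.keys"

lemma coeff_scale [simp]: "coeff (scale c x) p = c * coeff x p"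
  by (simp add: scale_def Poly_Mapping.map.rep_eq when_def)

lemma scale_add_right: "scale c (x + y) = scale c x + scale c y"
  by (rule poly_mapping_eqI) (simp add: lookup_add distrib_left)

lemma scale_add_left: "scale (c + d) x = scale c x + scale d x"
  by (rule poly_mapping_eqI) (simp add: lookup_add distrib_right)

lemma scale_scale [simp]: "scale c (scale d x) = scale (c * d) x"
  by (rule poly_mapping_eqI) (simp add: mult.assoc)

lemma scale_one [simp]: "scale 1 x = x"
  by (rule poly_mapping_eqI) simp

lemma scale_zero_left [simp]: "scale 0 x = 0"
  by (rule poly_mapping_eqI) simp

lemma scale_zero_right [simp]: "scale c 0 = 0"
  by (rule poly_mapping_eqI) simp

lemma scale_single [simp]: "scale c (single p d) = single p (c * d)"
  by (rule poly_mapping_eqI) (simp add: lookup_single when_def)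

lemma scale_sum: "scale c (sum f J) = (\<Sum>x\<in>J. scale c (f x))"
  by (induction J rule: infinite_finite_induct) (simp_all add: scale_add_right)

lemma supp_scale: "supp (scale c x) \<subseteq> supp x"
  by (auto simp: in_keys_iff)

lemma linear_ext_superset:
  assumes "finite F" "supp x \<subseteq> F"
  shows "linear_ext f x = (\<Sum>p\<in>F. scale (coeff x p) (f p))"
  unfolding linear_ext_def
  by (rule sum.mono_neutral_left) (use assms in \<open>auto simp: in_keys_iff\<close>)

lemma linear_ext_add: "linear_ext f (x + y) = linear_ext f x + linear_ext f y"
proof -
  let ?F = "supp x \<union> supp y"
  have "supp (x + y) \<subseteq> ?F" by (rule keys_add)
  then show ?thesis
    by (simp add: linear_ext_superset[of ?F] lookup_add scale_add_left sum.distrib)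
qed

lemma linear_ext_zero [simp]: "linear_ext f 0 = 0"
  by (simp add: linear_ext_def)

lemma linear_ext_single [simp]: "linear_ext f (single p c) = scale c (f p)"
  by (subst linear_ext_superset[of "{p}"]) auto

lemma linear_ext_scale: "linear_ext f (scale c x) = scale c (linear_ext f x)"
  by (subst linear_ext_superset[of "supp x"])
    (simp_all add: supp_scale linear_ext_def scale_sum)

lemma sum_singles: "x = (\<Sum>p\<in>supp x. single p (coeff x p))"
proof (rule poly_mapping_eqI)
  fix q
  have "coeff (\<Sum>p\<in>supp x. single p (coeff x p)) q = (\<Sum>p\<in>supp x. coeff x p when p = q)"
    by (simp add: lookup_sum lookup_single)
  also have "\<dots> = coeff x q"
    by (simp add: when_def in_keys_iff)
  finally show "coeff x q = coeff (\<Sum>p\<in>supp x. single p (coeff x p)) q" ..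
qed

lemma linear_span_zero [simp]: "0 \<in> linear_span W"
  by (simp add: linear_span_def)

lemma linear_span_add: "x \<in> linear_span W \<Longrightarrow> y \<in> linear_span W \<Longrightarrow> x + y \<in> linear_span W"
  unfolding linear_span_def using keys_add[of x y] by blast

lemma linear_span_scale: "x \<in> linear_span W \<Longrightarrow> scale c x \<in> linear_span W"
  unfolding linear_span_def using supp_scale[of c x] by blast

lemma linear_span_single: "p \<in> W \<Longrightarrow> single p c \<in> linear_span W"
  by (simp add: linear_span_def)

lemma linear_span_sum: "(\<And>i. i \<in> J \<Longrightarrow> f i \<in> linear_span W) \<Longrightarrow> sum f J \<in> linear_span W"
  by (induction J rule: infinite_finite_induct) (simp_all add: linear_span_add)

lemma linear_span_induct [consumes 1, case_names zero single add]:
  assumes x: "x \<in> linear_span W"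
    and zero: "H 0" and single: "\<And>p c. p \<in> W \<Longrightarrow> H (single p c)"
    and add: "\<And>x y. x \<in> linear_span W \<Longrightarrow> y \<in> linear_span W \<Longrightarrow> H x \<Longrightarrow> H y \<Longrightarrow> H (x + y)"
  shows "H x"
proof -
  have "H (\<Sum>p\<in>F. single p (coeff x p)) \<and> (\<Sum>p\<in>F. single p (coeff x p)) \<in> linear_span W"
    if "finite F" "F \<subseteq> supp x" for F
    using that
  proof (induction F rule: finite_induct)
    case (insert p F)
    then have "p \<in> W" using x by (auto simp: linear_span_def)
    then show ?case using insert by (auto intro: add single linear_span_add linear_span_single)
  qed (simp add: zero)
  then show ?thesis using sum_singles[of x] by (metis finite_keys order_refl)
qed

lemma linear_ext_in_span:
  assumes "x \<in> linear_span W" "\<And>p. p \<in> W \<Longrightarrow> f p \<in> linear_span V"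
  shows "linear_ext f x \<in> linear_span V"
  unfolding linear_ext_def
  by (rule linear_span_sum, rule linear_span_scale, rule assms(2)) (use assms(1) in \<open>auto simp: linear_span_def\<close>)

lemma linear_ext_cong:
  assumes "x \<in> linear_span W" "\<And>p. p \<in> W \<Longrightarrow> f p = g p"
  shows "linear_ext f x = linear_ext g x"
  unfolding linear_ext_def by (rule sum.cong) (use assms in \<open>auto simp: linear_span_def\<close>)

section \<open>Path algebras\<close>

context
  fixes Q :: "('v, 'e) pre_digraph"
begin

abbreviation pmult :: "(('v, 'e) path \<Rightarrow>\<^sub>0 'k :: field) \<Rightarrow> (('v, 'e) path \<Rightarrow>\<^sub>0 'k) \<Rightarrow> (('v, 'e) path \<Rightarrow>\<^sub>0 'k)" (infixl \<open>\<star>\<close> 70) where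
  "x \<star> y \<equiv> x \<otimes>\<^bsub>path_algebra Q\<^esub> y"

lemma pmult_superset:
  assumes "finite F" "supp x \<subseteq> F" "finite G" "supp y \<subseteq> G"
  shows "x \<star> y = (\<Sum>p\<in>F. \<Sum>q\<in>G. if tgt Q p = src q then single (pcat p q) (coeff x p * coeff y q) else 0)"
proof -
  have "x \<star> y = (\<Sum>p\<in>supp x. \<Sum>q\<in>supp y. if tgt Q p = src q then single (pcat p q) (coeff x p * coeff y q) else 0)"
    by (simp add: path_algebra_def)
  also have "\<dots> = (\<Sum>p\<in>supp x. \<Sum>q\<in>G. if tgt Q p = src q then single (pcat p q) (coeff x p * coeff y q) else 0)"
    by (rule sum.cong[OF refl], rule sum.mono_neutral_left) (use assms in \<open>auto simp: in_keys_iff\<close>)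
  also have "\<dots> = (\<Sum>p\<in>F. \<Sum>q\<in>G. if tgt Q p = src q then single (pcat p q) (coeff x p * coeff y q) else 0)"
    by (rule sum.mono_neutral_left) (use assms in \<open>auto simp: in_keys_iff intro!: sum.neutral\<close>)
  finally show ?thesis .
qed

lemma pmult_add_left: "(x + y) \<star> z = x \<star> z + y \<star> z"
proof -
  let ?F = "supp x \<union> supp y"
  have "supp (x + y) \<subseteq> ?F" by (rule keys_add)
  then show ?thesis
    by (simp add: pmult_superset[of ?F _ "supp z"] sum.distrib[symmetric] lookup_add distrib_right
        single_add if_distrib cong: if_cong sum.cong)
qed

lemma pmult_add_right: "z \<star> (x + y) = z \<star> x + z \<star> y"
proof -
  let ?F = "supp x \<union> supp y"
  have "supp (x + y) \<subseteq> ?F" by (rule keys_add)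
  then show ?thesis
    by (simp add: pmult_superset[of "supp z" _ ?F] sum.distrib[symmetric] lookup_add distrib_left
        single_add if_distrib cong: if_cong sum.cong)
qed

lemma pmult_scale_left: "scale c x \<star> y = scale c (x \<star> y)"
  by (simp add: pmult_superset[of "supp x" _ "supp y"] supp_scale scale_sum if_distrib mult.assoc
      cong: if_cong sum.cong)

lemma pmult_scale_right: "x \<star> scale c y = scale c (x \<star> y)"
  by (simp add: pmult_superset[of "supp x" _ "supp y"] supp_scale scale_sum if_distrib mult.left_commute
      cong: if_cong sum.cong)

lemma pmult_zero [simp]: "0 \<star> y = 0" "x \<star> 0 = 0"
  by (simp_all add: pmult_superset[of "{}" _ "supp y"] pmult_superset[of "supp x" _ "{}"])

lemma pmult_single:
  "single p a \<star> single q b = (if tgt Q p = src q then single (pcat p q) (a * b) else 0)"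
  by (subst pmult_superset[of "{p}" _ "{q}"]) simp_all

lemma path_algebra_simps [simp]:
  "carrier (path_algebra Q) = linear_span (paths Q)"
  "\<zero>\<^bsub>path_algebra Q\<^esub> = (0 :: ('v, 'e) path \<Rightarrow>\<^sub>0 'k :: field)"
  "x \<oplus>\<^bsub>path_algebra Q\<^esub> y = x + (y :: ('v, 'e) path \<Rightarrow>\<^sub>0 'k)"
  by (simp_all add: path_algebra_def linear_span_def)

end

section \<open>The rewriting order\<close>

locale rewriting = quiver_relations Q S
  for Q :: "('v, 'e) pre_digraph" and S :: "('v, 'e) path set" +
  fixes \<phi> :: "('v, 'e) path \<Rightarrow> (('v, 'e) path \<Rightarrow>\<^sub>0 'k :: field)"
  assumes \<phi>: "s \<in> S \<Longrightarrow> \<phi> s \<in> linear_span {p \<in> irreducible_paths Q S. src p = src s \<and> tgt Q p = tgt Q s}"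
    and finite_unique: "p \<in> paths Q \<Longrightarrow> reduction_unique Q S \<phi> p"
begin

abbreviation kQmult :: "(('v, 'e) path \<Rightarrow>\<^sub>0 'k) \<Rightarrow> (('v, 'e) path \<Rightarrow>\<^sub>0 'k) \<Rightarrow> (('v, 'e) path \<Rightarrow>\<^sub>0 'k)" (infixl \<open>\<star>\<close> 70) where
  "x \<star> y \<equiv> x \<otimes>\<^bsub>path_algebra Q\<^esub> y"

abbreviation red :: "('v, 'e) path \<Rightarrow> ('v, 'e) path \<Rightarrow> ('v, 'e) path \<Rightarrow> (('v, 'e) path \<Rightarrow>\<^sub>0 'k)" where
  "red q s r \<equiv> pe q \<star> \<phi> s \<star> pe r"

lemma red_expand:
  assumes "(q, s, r) \<in> factorizations Q S p"
  shows "red q s r = linear_ext (\<lambda>u. pe (pcat q (pcat u r))) (\<phi> s)"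
proof -
  have *: "s \<in> S" "tgt Q q = src s" "tgt Q s = src r" using assms by (auto simp: factorizations_def)
  have "pe q \<star> x \<star> pe r = linear_ext (\<lambda>u. pe (pcat q (pcat u r))) x"
    if "x \<in> linear_span {p \<in> irreducible_paths Q S. src p = src s \<and> tgt Q p = tgt Q s}"
    for x :: "('v, 'e) path \<Rightarrow>\<^sub>0 'k"
    using that
  proof (induction x rule: linear_span_induct)
    case (single p c)
    then show ?case using * by (simp add: pmult_single tgt_pcat pcat_assoc)
  qed (simp_all add: pmult_add_left pmult_add_right linear_ext_add)
  then show ?thesis using \<phi>[OF *(1)] .
qed

definition rewr :: "(('v, 'e) path \<times> ('v, 'e) path) set" where
  "rewr = {(p, p'). \<exists>q s r. (q, s, r) \<in> factorizations Q S p \<and> p' \<in> supp (red q s r)}"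

lemma supp_red:
  assumes f: "(q, s, r) \<in> factorizations Q S p" and p': "p' \<in> supp (red q s r)"
  obtains u where "u \<in> Irr" "src u = src s" "tgt Q u = tgt Q s" "p' = pcat q (pcat u r)"
proof -
  have *: "s \<in> S" using f by (auto simp: factorizations_def)
  have "red q s r \<in> linear_span ((\<lambda>u. pcat q (pcat u r)) ` {p \<in> irreducible_paths Q S. src p = src s \<and> tgt Q p = tgt Q s})"
    unfolding red_expand[OF f] by (rule linear_ext_in_span[OF \<phi>[OF *]]) (auto intro: linear_span_single)
  then show thesis using p' that by (auto simp: linear_span_def)
qed

text \<open>
  Paths parallel to $s$ stay distinct after multiplication by $q$ and $r$, so nothing cancels. Therefore the
  rewriting relation on paths is compatible with concatenation.
\<close>

lemma coeff_red:
  assumes f: "(q, s, r) \<in> factorizations Q S p" and u: "src u = src s"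
  shows "coeff (red q s r) (pcat q (pcat u r)) = coeff (\<phi> s) u"
proof -
  have *: "s \<in> S" using f by (auto simp: factorizations_def)
  have "coeff (linear_ext (\<lambda>u. pe (pcat q (pcat u r))) x) (pcat q (pcat u r)) = coeff x u"
    if "x \<in> linear_span {p \<in> irreducible_paths Q S. src p = src s \<and> tgt Q p = tgt Q s}"
    for x :: "('v, 'e) path \<Rightarrow>\<^sub>0 'k"
    using that
  proof (induction x rule: linear_span_induct)
    case (single p c)
    have "pcat q (pcat p r) = pcat q (pcat u r) \<longleftrightarrow> p = u"
      using single u by (cases p, cases u) (auto simp: pcat_def src_def)
    then show ?case by (simp add: lookup_single when_def)
  qed (simp_all add: linear_ext_add lookup_add)
  then show ?thesis unfolding red_expand[OF f] using \<phi>[OF *] by blast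
qed

lemma red_not_self:
  assumes f: "(q, s, r) \<in> factorizations Q S p"
  shows "coeff (red q s r) p = 0"
proof -
  have *: "s \<in> S" "s \<in> paths Q" "p = pcat q (pcat s r)" using f S_paths by (auto simp: factorizations_def)
  then have "(0, plen s) \<in> rel s" by (simp add: rel_def)
  then have "s \<notin> Irr" by (auto simp: irreducible_iff)
  then have "coeff (\<phi> s) s = 0" using \<phi>[OF *(1)] by (auto simp: linear_span_def in_keys_iff)
  then show ?thesis using coeff_red[OF f, of s] * by simp
qed

lemma rewr_parallel:
  assumes "(p, p') \<in> rewr"
  shows "p \<in> paths Q \<and> p' \<in> paths Q \<and> src p' = src p \<and> tgt Q p' = tgt Q p"
proof -
  obtain q s r where f: "(q, s, r) \<in> factorizations Q S p" and p': "p' \<in> supp (red q s r)"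
    using assms by (auto simp: rewr_def)
  obtain u where u: "u \<in> Irr" "src u = src s" "tgt Q u = tgt Q s" "p' = pcat q (pcat u r)"
    using supp_red[OF f p'] .
  have *: "s \<in> paths Q" using f S_paths by (auto simp: factorizations_def)
  show ?thesis using f u * irreducible_in_paths[of u]
    by (auto simp: factorizations_def tgt_pcat pcat_in_paths)
qed

lemma rewr_pcat:
  assumes "(p, p') \<in> rewr" "q \<in> paths Q" "r \<in> paths Q" "tgt Q q = src p" "tgt Q p = src r"
  shows "(pcat q (pcat p r), pcat q (pcat p' r)) \<in> rewr"
proof -
  obtain a s b where f: "(a, s, b) \<in> factorizations Q S p" and p': "p' \<in> supp (red a s b)"
    using assms by (auto simp: rewr_def)
  obtain u where u: "src u = src s" "p' = pcat a (pcat u b)"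
    using supp_red[OF f p'] by metis
  have s: "s \<in> paths Q" using f S_paths by (auto simp: factorizations_def)
  have f': "(pcat q a, s, pcat b r) \<in> factorizations Q S (pcat q (pcat p r))"
    using f assms s by (auto simp: factorizations_def pcat_assoc pcat_in_paths tgt_pcat)
  have "coeff (red a s b) p' \<noteq> 0" using p' by (simp add: in_keys_iff)
  then have "coeff (red (pcat q a) s (pcat b r)) (pcat (pcat q a) (pcat u (pcat b r))) \<noteq> 0"
    using coeff_red[OF f u(1)] coeff_red[OF f' u(1)] u(2) by simp
  then have "pcat q (pcat p' r) \<in> supp (red (pcat q a) s (pcat b r))"
    using u(2) by (simp add: in_keys_iff pcat_assoc)
  then show ?thesis using f' unfolding rewr_def by blast
qed

subsection \<open>Reductions\<close>

lemma basic_reduction_eq: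
  assumes "(q, s, r) \<in> factorizations Q S p"
  shows "basic_reduction Q \<phi> q s r x = x - single p (coeff x p) + scale (coeff x p) (red q s r)"
proof -
  have p: "p = pcat q (pcat s r)" using assms by (auto simp: factorizations_def)
  have "x \<in> linear_span UNIV" by (simp add: linear_span_def)
  then show ?thesis
  proof (induction x rule: linear_span_induct)
    case (single p' c)
    then show ?case by (simp add: basic_reduction_def p lookup_single when_def)
  qed (simp_all add: basic_reduction_def linear_ext_add lookup_add scale_add_left single_add)
qed

lemma coeff_basic_reduction:
  assumes "(q, s, r) \<in> factorizations Q S p"
  shows "coeff (basic_reduction Q \<phi> q s r x) p' =
    (if p' = p then 0 else coeff x p' + coeff x p * coeff (red q s r) p')"
  using red_not_self[OF assms] by (simp add: basic_reduction_eq[OF assms] lookup_add lookup_minus lookup_single)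

abbreviation Red :: "((('v, 'e) path \<Rightarrow>\<^sub>0 'k) \<Rightarrow> (('v, 'e) path \<Rightarrow>\<^sub>0 'k)) set" where
  "Red \<equiv> reductions Q S \<phi>"

lemma basic_reduction_in_Red: "(q, s, r) \<in> factorizations Q S p \<Longrightarrow> basic_reduction Q \<phi> q s r \<in> Red"
  using reductions.red_step[OF reductions.red_id] by fastforce

lemma Red_comp: "g \<in> Red \<Longrightarrow> f \<in> Red \<Longrightarrow> g \<circ> f \<in> Red"
  by (induction g rule: reductions.induct) (auto simp: comp_assoc intro: reductions.intros)

lemma Red_add: "f \<in> Red \<Longrightarrow> f (x + y) = f x + f y"
  by (induction f rule: reductions.induct) (simp_all add: basic_reduction_def linear_ext_add)

lemma Red_scale: "f \<in> Red \<Longrightarrow> f (scale c x) = scale c (f x)"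
  by (induction f rule: reductions.induct) (simp_all add: basic_reduction_def linear_ext_scale)

lemma Red_linear_ext:
  assumes "f \<in> Red"
  shows "f x = linear_ext (\<lambda>p. f (pe p)) x"
proof -
  have "f 0 = 0" using Red_scale[OF assms, of 0 0] by simp
  have "x \<in> linear_span UNIV" by (simp add: linear_span_def)
  then show ?thesis
  proof (induction x rule: linear_span_induct)
    case (single p c)
    then show ?case using Red_scale[OF assms, of c "pe p"] by simp
  qed (simp_all add: \<open>f 0 = 0\<close> Red_add[OF assms] linear_ext_add)
qed

lemma Red_irreducible:
  assumes "f \<in> Red" "x \<in> linear_span Irr"
  shows "f x = x"
  using assms
proof (induction f rule: reductions.induct)
  case (red_step f q s r p)
  have "p \<notin> Irr" using red_step.hyps(2) by (auto simp: irreducible_paths_def)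
  then have "coeff x p = 0" using red_step.prems by (auto simp: linear_span_def in_keys_iff)
  then show ?case using red_step basic_reduction_eq[of q s r p x] by simp
qed simp

lemma Red_in_paths:
  assumes "f \<in> Red" "x \<in> linear_span (paths Q)"
  shows "f x \<in> linear_span (paths Q)"
  using assms
proof (induction f rule: reductions.induct)
  case (red_step f q s r p)
  have "red q s r \<in> linear_span (paths Q)"
    using rewr_parallel red_step.hyps(2) unfolding linear_span_def rewr_def by blast
  moreover have "single p c \<in> linear_span (paths Q)" for c :: 'k
    using red_step.hyps(2) S_paths
    by (intro linear_span_single) (auto simp: factorizations_def pcat_in_paths tgt_pcat)
  then have "- single p c \<in> linear_span (paths Q)" for c :: 'k
    by (metis single_uminus)
  ultimately show ?case
    unfolding comp_apply basic_reduction_eq[OF red_step.hyps(2)] diff_conv_add_uminus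
    using red_step by (intro linear_span_add linear_span_scale) simp_all
qed simp

text \<open>
  Reduction-finiteness of \<open>p\<close>, used contrapositively: iterating the choice of an effective reduction gives
  an infinite sequence of reductions which never becomes constant.
\<close>

lemma no_infinite_reduction:
  assumes p: "p \<in> paths Q" and start: "g\<^sub>0 \<in> Red" "Inv (g\<^sub>0 (pe p))"
    and step: "\<And>x. Inv x \<Longrightarrow> \<exists>g\<in>Red. g x \<noteq> x \<and> Inv (g x)"
  shows False
proof -
  obtain F where F: "\<And>x. Inv x \<Longrightarrow> F x \<in> Red \<and> F x x \<noteq> x \<and> Inv (F x x)"
    using step by metis
  define J where "J n = ((\<lambda>x. F x x) ^^ n) (g\<^sub>0 (pe p))" for n
  have J: "Inv (J n)" "J (Suc n) = F (J n) (J n)" "J (Suc n) \<noteq> J n" for n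
  proof -
    show inv: "Inv (J n)" by (induction n) (simp_all add: J_def start F)
    show "J (Suc n) = F (J n) (J n)" by (simp add: J_def)
    then show "J (Suc n) \<noteq> J n" using F[OF inv] by simp
  qed
  define f where "f i = (case i of 0 \<Rightarrow> g\<^sub>0 | Suc j \<Rightarrow> F (J j))" for i
  have fold: "fold f [0..<Suc n] (pe p) = J n" for n
    by (induction n) (simp_all add: f_def J J_def)
  have "\<forall>i. f i \<in> Red" using F J(1) start by (simp add: f_def split: nat.split)
  then obtain N where "\<And>n. n \<ge> N \<Longrightarrow> fold f [0..<n] (pe p) = fold f [0..<N] (pe p)"
    using finite_unique[OF p] unfolding reduction_unique_def reduction_finite_def by blast
  from this[of "Suc N"] this[of "Suc (Suc N)"]
  have "fold f [0..<Suc N] (pe p) = fold f [0..<Suc (Suc N)] (pe p)" by (simp del: upt_Suc)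
  then show False using J(3)[of N] unfolding fold by simp
qed

text \<open>
  Start with one path of a shortest cycle, and keep reducing the path of the cycle that occurs in the
  current element. The cycle being shortest, it has no chords, so each reduction brings in the next path
  of the cycle and no other one; in particular the next path cannot cancel, and this continues for ever.
\<close>

lemma rewr_acyclic: "(p, p) \<notin> rewr\<^sup>+"
proof
  assume "(p, p) \<in> rewr\<^sup>+"
  then have "\<exists>n>0. \<exists>p. (p, p) \<in> rewr ^^ n" unfolding trancl_power by blast
  define n where "n = (LEAST n. n > 0 \<and> (\<exists>p. (p, p) \<in> rewr ^^ n))"
  have n: "n > 0 \<and> (\<exists>p. (p, p) \<in> rewr ^^ n)"
    unfolding n_def by (rule LeastI_ex) fact
  have least: "(p, p) \<notin> rewr ^^ k" if "0 < k" "k < n" for k p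
    using not_less_Least[of k "\<lambda>n. n > 0 \<and> (\<exists>p. (p, p) \<in> rewr ^^ n)"] that unfolding n_def by blast
  obtain p where p: "(p, p) \<in> rewr ^^ n" using n by blast
  then obtain c where c: "c 0 = p" "c n = p" and c_step: "\<And>i. i < n \<Longrightarrow> (c i, c (Suc i)) \<in> rewr"
    by (auto simp: relpow_fun_conv)
  have reach: "(c i, c j) \<in> rewr ^^ (j - i)" if "i \<le> j" "j \<le> n" for i j
    using that c_step by (auto simp: relpow_fun_conv intro!: exI[of _ "\<lambda>k. c (i + k)"])
  have inj: "c i \<noteq> c j" if "i < j" "j < n" for i j
  proof
    assume "c i = c j"
    then have "(c j, c j) \<in> rewr ^^ (j - i)" using reach[of i j] that by simp
    then show False using least[of "j - i" "c j"] that by simp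
  qed
  have chord: "j = Suc i mod n" if "(c i, c j) \<in> rewr" "i < n" "j < n" for i j
  proof (rule ccontr)
    assume neq: "j \<noteq> Suc i mod n"
    show False
    proof (cases "j \<le> i")
      case True
      have "(c j, c j) \<in> rewr ^^ Suc (i - j)"
        using relpow_Suc_I[OF reach[of j i] that(1)] True that by simp
      moreover have "Suc (i - j) < n"
      proof (rule ccontr)
        assume "\<not> Suc (i - j) < n"
        then have "j = 0" "Suc i = n" using that True by auto
        then show False using neq by simp
      qed
      ultimately show False using least[of "Suc (i - j)"] by blast
    next
      case False
      then have less: "Suc i < j" using neq that by (cases "Suc i = j") auto
      have "(c 0, c j) \<in> rewr ^^ Suc i"
        using relpow_Suc_I[OF reach[of 0 i] that(1)] that by simp
      moreover have "(c j, c n) \<in> rewr ^^ (n - j)" using reach[of j n] that by simp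
      ultimately have "(c 0, c n) \<in> rewr ^^ (Suc i + (n - j))"
        unfolding relpow_add by (rule relcompI)
      moreover have "0 < Suc i + (n - j)" "Suc i + (n - j) < n" using that less by simp_all
      ultimately show False using least[of "Suc i + (n - j)" "c 0"] c by metis
    qed
  qed
  \<comment> \<open>Exactly one path of the cycle occurs in \<open>x\<close>.\<close>
  define Inv where "Inv x \<longleftrightarrow> (\<exists>i<n. coeff x (c i) \<noteq> 0 \<and> (\<forall>j<n. j \<noteq> i \<longrightarrow> coeff x (c j) = 0))"
    for x :: "('v, 'e) path \<Rightarrow>\<^sub>0 'k"
  show False
  proof (rule no_infinite_reduction[of "c 0" id Inv])
    show "c 0 \<in> paths Q" using rewr_parallel[OF c_step[of 0]] n by simp
    show "id \<in> Red" by (rule reductions.red_id)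
    show "Inv (id (pe (c 0)))"
      unfolding Inv_def using n inj[of 0] by (intro exI[of _ 0]) (auto simp: lookup_single when_def)
    fix x assume "Inv x"
    then obtain i where i: "i < n" "coeff x (c i) \<noteq> 0" and zero: "\<And>j. j < n \<Longrightarrow> j \<noteq> i \<Longrightarrow> coeff x (c j) = 0"
      by (auto simp: Inv_def)
    obtain q s r where f: "(q, s, r) \<in> factorizations Q S (c i)" and m: "c (Suc i) \<in> supp (red q s r)"
      using c_step[OF i(1)] by (auto simp: rewr_def)
    define g where "g = basic_reduction Q \<phi> q s r"
    have g: "coeff (g x) p' = (if p' = c i then 0 else coeff x p' + coeff x (c i) * coeff (red q s r) p')" for p'
      unfolding g_def by (rule coeff_basic_reduction[OF f])
    define i' where "i' = Suc i mod n"
    have ci': "c (Suc i) = c i'"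
      using i c by (cases "Suc i = n") (auto simp: i'_def)
    have "c i' \<noteq> c i" using m red_not_self[OF f] ci' by (auto simp: in_keys_iff)
    have i': "i' < n" "i' \<noteq> i" using n \<open>c i' \<noteq> c i\<close> by (auto simp: i'_def)
    have "coeff (g x) (c i') \<noteq> 0"
      using g[of "c i'"] zero[OF i'] \<open>c i' \<noteq> c i\<close> m i ci' by (simp add: in_keys_iff)
    moreover have "coeff (g x) (c j) = 0" if "j < n" "j \<noteq> i'" for j
    proof (cases "j = i")
      case False
      then have "coeff (red q s r) (c j) = 0"
        using chord[of i j] that i(1) f unfolding rewr_def i'_def in_keys_iff by blast
      then show ?thesis using g zero[OF that(1) False] by simp
    qed (simp add: g)
    ultimately have "Inv (g x)" unfolding Inv_def using i' by blast
    moreover have "g x \<noteq> x" using g[of "c i"] i by auto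
    ultimately show "\<exists>g\<in>Red. g x \<noteq> x \<and> Inv (g x)"
      using basic_reduction_in_Red[OF f] g_def by blast
  qed
qed

text \<open>
  A path from which an infinite descent starts can be reduced for ever, as long as the next path of the
  descent does not cancel. To be safe, reduce, among the paths of this kind that occur, one from which no
  other can be reached. Such a path exists because there are no cycles, and the path that replaces it is
  new.
\<close>

lemma wf_rewrites: "wf (rewr\<inverse>)"
proof (rule ccontr)
  assume "\<not> wf (rewr\<inverse>)"
  then obtain p where p: "p \<notin> Wellfounded.acc (rewr\<inverse>)" by (auto simp: wf_iff_acc)
  define bad where "bad p \<longleftrightarrow> p \<notin> Wellfounded.acc (rewr\<inverse>)" for p
  have bad_step: "\<exists>p'. (p, p') \<in> rewr \<and> bad p'" if "bad p" for p
    using that unfolding bad_def by (meson converse_iff acc.accI)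
  define Inv where "Inv x \<longleftrightarrow> (\<exists>b\<in>supp x. bad b)" for x :: "('v, 'e) path \<Rightarrow>\<^sub>0 'k"
  show False
  proof (rule no_infinite_reduction[of p id Inv])
    show "p \<in> paths Q" using bad_step[of p] p rewr_parallel unfolding bad_def by blast
    show "id \<in> Red" by (rule reductions.red_id)
    show "Inv (id (pe p))" using p by (simp add: Inv_def bad_def)
    fix x assume "Inv x"
    define B where "B = {b \<in> supp x. bad b}"
    have B: "finite B" "B \<noteq> {}" using \<open>Inv x\<close> by (auto simp: B_def Inv_def)
    define r where "r = (rewr\<^sup>+)\<inverse> \<inter> B \<times> B"
    have "acyclic r"
    proof (rule acyclicI, rule allI, rule notI)
      fix a assume "(a, a) \<in> r\<^sup>+"
      then have "(a, a) \<in> ((rewr\<^sup>+)\<inverse>)\<^sup>+" by (rule trancl_mono) (simp add: r_def)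
      then have "(a, a) \<in> rewr\<^sup>+" by (simp add: trancl_converse)
      then show False using rewr_acyclic by blast
    qed
    moreover have "finite r" using B(1) by (simp add: r_def)
    ultimately have "wf r" by (simp add: finite_acyclic_wf)
    then obtain b where b: "b \<in> B" "\<And>y. (y, b) \<in> r \<Longrightarrow> y \<notin> B"
      using B(2) by (meson ex_in_conv wfE_min)
    have "bad b" using b(1) by (simp add: B_def)
    then obtain b' where b': "(b, b') \<in> rewr" "bad b'" using bad_step by blast
    have "b' \<notin> supp x"
      using b(1) b(2)[of b'] b' r_into_trancl[OF b'(1)] unfolding r_def B_def by blast
    obtain q s t where f: "(q, s, t) \<in> factorizations Q S b" and m: "b' \<in> supp (red q s t)"
      using b'(1) by (auto simp: rewr_def)
    define g where "g = basic_reduction Q \<phi> q s t"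
    have g: "coeff (g x) p' = (if p' = b then 0 else coeff x p' + coeff x b * coeff (red q s t) p')" for p'
      unfolding g_def by (rule coeff_basic_reduction[OF f])
    have "b' \<noteq> b" using m red_not_self[OF f] by (auto simp: in_keys_iff)
    then have "b' \<in> supp (g x)"
      using g[of b'] \<open>b' \<notin> supp x\<close> m b(1) by (simp add: in_keys_iff B_def)
    then have "Inv (g x)" using b'(2) by (auto simp: Inv_def)
    moreover have "g x \<noteq> x" using g[of b] b(1) by (auto simp: B_def in_keys_iff)
    ultimately show "\<exists>g\<in>Red. g x \<noteq> x \<and> Inv (g x)"
      using basic_reduction_in_Red[OF f] g_def by blast
  qed
qed

definition below :: "(('v, 'e) path \<times> ('v, 'e) path) set" where
  "below = (rewr\<inverse>)\<^sup>+"

lemma wf_below: "wf below"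
  unfolding below_def by (rule wf_trancl[OF wf_rewrites])

lemma below_trans: "(p, q) \<in> below \<Longrightarrow> (q, r) \<in> below \<Longrightarrow> (p, r) \<in> below"
  unfolding below_def by (rule trancl_trans)

lemma below_eq_trans: "(p, q) \<in> below\<^sup>= \<Longrightarrow> (q, r) \<in> below\<^sup>= \<Longrightarrow> (p, r) \<in> below\<^sup>="
  using below_trans by blast

lemma below_parallel:
  assumes "(p', p) \<in> below"
  shows "p \<in> paths Q \<and> p' \<in> paths Q \<and> src p' = src p \<and> tgt Q p' = tgt Q p"
  using assms unfolding below_def
  by (induction rule: trancl_induct) (auto dest: rewr_parallel)

lemma below_pcat:
  assumes "(p', p) \<in> below" "q \<in> paths Q" "r \<in> paths Q" "tgt Q q = src p" "tgt Q p = src r"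
  shows "(pcat q (pcat p' r), pcat q (pcat p r)) \<in> below"
  using assms unfolding below_def
proof (induction rule: trancl_induct)
  case (base y)
  then show ?case using rewr_pcat[of y p' q r] by auto
next
  case (step y z)
  have "src y = src z" "tgt Q y = tgt Q z" using rewr_parallel step.hyps(2) by fastforce+
  then have "(pcat q (pcat y r), pcat q (pcat z r)) \<in> rewr\<inverse>"
    using step rewr_pcat[of z y q r] by auto
  then show ?case
    using step.IH step.prems \<open>src y = src z\<close> \<open>tgt Q y = tgt Q z\<close> by (simp add: trancl.trancl_into_trancl)
qed

lemma red_below: "(q, s, r) \<in> factorizations Q S p \<Longrightarrow> p' \<in> supp (red q s r) \<Longrightarrow> (p', p) \<in> below"
  unfolding below_def rewr_def by blast

subsection \<open>Normal forms\<close>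

text \<open>
  Each path is reduced in turn; the results that are irreducible already are not affected by later
  reductions.
\<close>

lemma simultaneous_reduction:
  assumes "finite F" "F \<subseteq> paths Q"
  shows "\<exists>g\<in>Red. \<forall>p\<in>F. g (pe p) \<in> linear_span Irr"
  using assms
proof (induction F rule: finite_induct)
  case empty
  then show ?case using reductions.red_id by blast
next
  case (insert p F)
  then obtain g where g: "g \<in> Red" "\<And>q. q \<in> F \<Longrightarrow> g (pe q) \<in> linear_span Irr" by auto
  have p: "p \<in> paths Q" using insert by simp
  have "\<exists>h\<in>Red. h (g (pe p)) \<in> linear_span Irr"
  proof (rule ccontr)
    assume no: "\<not> (\<exists>h\<in>Red. h (g (pe p)) \<in> linear_span Irr)"
    show False
    proof (rule no_infinite_reduction[OF p g(1), of "\<lambda>x. \<exists>h\<in>Red. x = h (g (pe p))"])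
      show "\<exists>h\<in>Red. g (pe p) = h (g (pe p))" by (rule bexI[of _ id]) (simp_all add: reductions.red_id)
      fix x assume "\<exists>h\<in>Red. x = h (g (pe p))"
      then obtain h where h: "h \<in> Red" "x = h (g (pe p))" by blast
      then have "x \<notin> linear_span Irr" "x \<in> linear_span (paths Q)"
        using no Red_in_paths g(1) p linear_span_single[of p "paths Q"] by blast+
      then obtain b where b: "b \<in> supp x" "b \<in> paths Q" "b \<notin> Irr" by (auto simp: linear_span_def)
      then obtain q s r where f: "(q, s, r) \<in> factorizations Q S b"
        by (auto simp: irreducible_paths_def)
      have "basic_reduction Q \<phi> q s r x \<noteq> x"
        using coeff_basic_reduction[OF f, of x b] b(1) by (auto simp: in_keys_iff)
      then show "\<exists>g'\<in>Red. g' x \<noteq> x \<and> (\<exists>h\<in>Red. g' x = h (g (pe p)))"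
        using basic_reduction_in_Red[OF f] Red_comp[OF basic_reduction_in_Red[OF f] h(1)] h(2)
        by (metis comp_apply)
    qed
  qed
  then obtain h where "h \<in> Red" "h (g (pe p)) \<in> linear_span Irr" by blast
  then show ?case
    using g Red_irreducible[of h] by (intro bexI[of _ "h \<circ> g"] Red_comp) auto
qed

definition nfp :: "('v, 'e) path \<Rightarrow> (('v, 'e) path \<Rightarrow>\<^sub>0 'k)" where
  "nfp p = (THE y. y \<in> linear_span Irr \<and> (\<exists>g\<in>Red. y = g (pe p)))"

lemma nfp_eq:
  assumes "p \<in> paths Q" "g \<in> Red" "g (pe p) \<in> linear_span Irr"
  shows "nfp p = g (pe p)"
  unfolding nfp_def
proof (rule the_equality)
  show "g (pe p) \<in> linear_span Irr \<and> (\<exists>h\<in>Red. g (pe p) = h (pe p))" using assms by blast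
  fix y assume "y \<in> linear_span Irr \<and> (\<exists>h\<in>Red. y = h (pe p))"
  then obtain h where h: "h \<in> Red" "y = h (pe p)" "h (pe p) \<in> linear_span Irr" by auto
  have "\<forall>f\<in>Red. \<forall>g\<in>Red. f (pe p) \<in> linear_span Irr \<longrightarrow> g (pe p) \<in> linear_span Irr \<longrightarrow> f (pe p) = g (pe p)"
    using finite_unique[OF assms(1)] unfolding reduction_unique_def by simp
  then show "y = g (pe p)" using h assms(2,3) by simp
qed

lemma nfp_in_span: "p \<in> paths Q \<Longrightarrow> nfp p \<in> linear_span Irr"
  using simultaneous_reduction[of "{p}"] nfp_eq by fastforce

lemma nfp_irreducible: "u \<in> Irr \<Longrightarrow> nfp u = pe u"
  using nfp_eq[OF irreducible_in_paths reductions.red_id] by (simp add: linear_span_single)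

definition nf :: "(('v, 'e) path \<Rightarrow>\<^sub>0 'k) \<Rightarrow> (('v, 'e) path \<Rightarrow>\<^sub>0 'k)" where
  "nf = linear_ext nfp"

lemma nf_add: "nf (x + y) = nf x + nf y"
  by (simp add: nf_def linear_ext_add)

lemma nf_scale: "nf (scale c x) = scale c (nf x)"
  by (simp add: nf_def linear_ext_scale)

lemma nf_in_span: "x \<in> linear_span (paths Q) \<Longrightarrow> nf x \<in> linear_span Irr"
  unfolding nf_def by (rule linear_ext_in_span) (auto intro: nfp_in_span)

lemma nf_single [simp]: "u \<in> Irr \<Longrightarrow> nf (single u c) = single u c"
  by (simp add: nf_def nfp_irreducible)

text \<open>
  Bringing the outcome of a basic reduction of $p$ to normal form is a way to reduce $p$, and all ways lead
  to the same result.
\<close>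

lemma nf_red:
  assumes f: "(q, s, r) \<in> factorizations Q S p"
  shows "nf (red q s r) = nfp p"
proof -
  define x where "x = red q s r"
  have p: "p \<in> paths Q" using f S_paths by (auto simp: factorizations_def pcat_in_paths tgt_pcat)
  have x: "x \<in> linear_span (paths Q)"
    using red_below[OF f] below_parallel unfolding x_def linear_span_def by blast
  then obtain g where g: "g \<in> Red" "\<And>q. q \<in> supp x \<Longrightarrow> g (pe q) \<in> linear_span Irr"
    using simultaneous_reduction[of "supp x"] by (auto simp: linear_span_def)
  have "nf x = linear_ext (\<lambda>p. g (pe p)) x"
    unfolding nf_def
    by (rule linear_ext_cong[of _ "supp x"]) (use x g nfp_eq in \<open>auto simp: linear_span_def\<close>)
  also have "\<dots> = g x" by (rule Red_linear_ext[OF g(1), symmetric])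
  also have "\<dots> = (g \<circ> basic_reduction Q \<phi> q s r) (pe p)"
    by (simp add: basic_reduction_eq[OF f] x_def)
  finally have "nf x = (g \<circ> basic_reduction Q \<phi> q s r) (pe p)" .
  moreover have "g \<circ> basic_reduction Q \<phi> q s r \<in> Red" by (rule Red_comp[OF g(1) basic_reduction_in_Red[OF f]])
  moreover have "nf x \<in> linear_span Irr" by (rule nf_in_span[OF x])
  ultimately have "nfp p = nf x" using nfp_eq[OF p] by metis
  then show ?thesis by (simp add: x_def)
qed

end

section \<open>Abelian groups and additive maps\<close>

lemma add_homI:
  assumes "\<And>x. x \<in> carrier M \<Longrightarrow> f x \<in> carrier N"
    and "\<And>x y. x \<in> carrier M \<Longrightarrow> y \<in> carrier M \<Longrightarrow> f (x \<oplus>\<^bsub>M\<^esub> y) = f x \<oplus>\<^bsub>N\<^esub> f y"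
  shows "f \<in> hom (add_monoid M) (add_monoid N)"
  using assms by (auto simp: hom_def)

lemma add_hom_closed: "f \<in> hom (add_monoid M) (add_monoid N) \<Longrightarrow> x \<in> carrier M \<Longrightarrow> f x \<in> carrier N"
  by (auto simp: hom_def)

lemma add_hom_add: "f \<in> hom (add_monoid M) (add_monoid N) \<Longrightarrow> x \<in> carrier M \<Longrightarrow> y \<in> carrier M \<Longrightarrow>
    f (x \<oplus>\<^bsub>M\<^esub> y) = f x \<oplus>\<^bsub>N\<^esub> f y"
  by (auto simp: hom_def)

lemma add_hom_comp:
  "f \<in> hom (add_monoid M) (add_monoid N) \<Longrightarrow> g \<in> hom (add_monoid N) (add_monoid L) \<Longrightarrow>
    (\<lambda>x. g (f x)) \<in> hom (add_monoid M) (add_monoid L)"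
  by (auto simp: hom_def Pi_def)

context
  fixes M :: "('a, 'm) ring_scheme" and N :: "('b, 'n) ring_scheme" and f
  assumes M: "abelian_group M" and N: "abelian_group N"
    and f: "f \<in> hom (add_monoid M) (add_monoid N)"
begin

interpretation M: abelian_group M by (rule M)
interpretation N: abelian_group N by (rule N)

lemma add_hom_zero: "f \<zero>\<^bsub>M\<^esub> = \<zero>\<^bsub>N\<^esub>"
  using hom_one[OF f M.add.is_group N.add.is_group] by simp

lemma add_hom_uminus:
  assumes "x \<in> carrier M"
  shows "f (\<ominus>\<^bsub>M\<^esub> x) = \<ominus>\<^bsub>N\<^esub> f x"
proof -
  have "f (\<ominus>\<^bsub>M\<^esub> x) \<oplus>\<^bsub>N\<^esub> f x = \<zero>\<^bsub>N\<^esub>"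
    using assms add_hom_add[OF f, of "\<ominus>\<^bsub>M\<^esub> x" x] by (simp add: M.l_neg add_hom_zero)
  then show ?thesis using assms add_hom_closed[OF f] by (intro N.minus_equality[symmetric]) auto
qed

lemma add_hom_minus:
  "x \<in> carrier M \<Longrightarrow> y \<in> carrier M \<Longrightarrow> f (x \<ominus>\<^bsub>M\<^esub> y) = f x \<ominus>\<^bsub>N\<^esub> f y"
  using add_hom_add[OF f, of x "\<ominus>\<^bsub>M\<^esub> y"] by (simp add: a_minus_def add_hom_uminus)

lemma add_hom_finsum:
  assumes "g \<in> J \<rightarrow> carrier M"
  shows "f (\<Oplus>\<^bsub>M\<^esub>i\<in>J. g i) = (\<Oplus>\<^bsub>N\<^esub>i\<in>J. f (g i))"
  using assms
proof (induction J rule: infinite_finite_induct)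
  case (insert x F)
  then have "(\<lambda>i. f (g i)) \<in> F \<rightarrow> carrier N" using add_hom_closed[OF f] by auto
  then show ?case using insert add_hom_closed[OF f] add_hom_add[OF f]
    by (simp add: M.finsum_insert N.finsum_insert Pi_def)
qed (simp_all add: M.finsum_infinite N.finsum_infinite add_hom_zero)

end

lemma (in abelian_group) finsum_mono_neutral:
  assumes "finite B" "C \<subseteq> B" "f \<in> C \<rightarrow> carrier G" "\<And>i. i \<in> B - C \<Longrightarrow> f i = \<zero>"
  shows "finsum G f C = finsum G f B"
proof -
  have "f \<in> B \<rightarrow> carrier G"
  proof (rule Pi_I)
    fix x assume "x \<in> B"
    then show "f x \<in> carrier G" using assms(3) assms(4)[of x] by (cases "x \<in> C") auto
  qed
  then show ?thesis using assms by (intro add.finprod_mono_neutral_cong_left) auto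
qed

lemma (in abelian_group) finsum_uminus:
  assumes "f \<in> B \<rightarrow> carrier G"
  shows "finsum G (\<lambda>i. \<ominus> f i) B = \<ominus> finsum G f B"
proof -
  have "(\<lambda>x. \<ominus> x) \<in> hom (add_monoid G) (add_monoid G)"
    by (rule add_homI) (simp_all add: minus_add)
  from add_hom_finsum[OF abelian_group_axioms abelian_group_axioms this assms] show ?thesis by simp
qed

lemma (in abelian_group) finsum_minus:
  assumes "f \<in> B \<rightarrow> carrier G" "g \<in> B \<rightarrow> carrier G"
  shows "finsum G (\<lambda>i. f i \<ominus> g i) B = finsum G f B \<ominus> finsum G g B"
  using assms by (simp add: a_minus_def finsum_addf finsum_uminus Pi_def)

lemma (in abelian_group) minus_add_cancel:
  assumes "x \<in> carrier G" "y \<in> carrier G"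
  shows "(x \<ominus> y) \<oplus> y = x"
proof -
  have "(x \<ominus> y) \<oplus> y = x \<oplus> (\<ominus> y \<oplus> y)" using assms by (simp add: a_minus_def a_assoc)
  then show ?thesis using assms by (simp add: l_neg)
qed

lemma (in abelian_group) minus_eq_zero_iff:
  assumes "x \<in> carrier G" "y \<in> carrier G"
  shows "x \<ominus> y = \<zero> \<longleftrightarrow> x = y"
proof
  assume "x \<ominus> y = \<zero>"
  then show "x = y" using minus_add_cancel[OF assms] assms by simp
qed (use assms in \<open>simp add: a_minus_def r_neg\<close>)

lemma (in abelian_group) add_minus_cancel_left:
  assumes "x \<in> carrier G" "y \<in> carrier G"
  shows "(x \<oplus> y) \<ominus> x = y"
proof -
  have "(x \<oplus> y) \<ominus> x = y \<oplus> (x \<oplus> \<ominus> x)" using assms by (simp add: a_minus_def a_ac)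
  then show ?thesis using assms by (simp add: r_neg)
qed

lemma (in abelian_group) minus_zero_right: "x \<in> carrier G \<Longrightarrow> x \<ominus> \<zero> = x"
  using add_minus_cancel_left[of \<zero> x] by simp

lemma (in abelian_group) minus_swap:
  assumes "x \<in> carrier G" "y \<in> carrier G" "z \<in> carrier G" "x \<ominus> y = z"
  shows "y = x \<ominus> z" "x = z \<oplus>\<^bsub>G\<^esub> y"
proof -
  show "x = z \<oplus>\<^bsub>G\<^esub> y" using minus_add_cancel[of x y] assms by simp
  then show "y = x \<ominus> z" using add_minus_cancel_left[of z y] assms by simp
qed

lemma (in abelian_group) add_minus_add:
  "a \<in> carrier G \<Longrightarrow> b \<in> carrier G \<Longrightarrow> c \<in> carrier G \<Longrightarrow> d \<in> carrier G \<Longrightarrow>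
    (a \<oplus>\<^bsub>G\<^esub> b) \<ominus> (c \<oplus>\<^bsub>G\<^esub> d) = (a \<ominus> c) \<oplus>\<^bsub>G\<^esub> (b \<ominus> d)"
  by (simp add: a_minus_def minus_add a_ac)

lemma (in abelian_group) finsum_minus_term:
  assumes J: "finite J" "a \<in> J" and f: "f \<in> J \<rightarrow> carrier G" and y: "y \<in> carrier G"
    and H: "\<zero>\<^bsub>G\<^esub> \<in> H" "\<And>x y. x \<in> H \<Longrightarrow> y \<in> H \<Longrightarrow> x \<oplus>\<^bsub>G\<^esub> y \<in> H" "H \<subseteq> carrier G"
    and fa: "f a \<ominus>\<^bsub>G\<^esub> y \<in> H" and others: "\<And>b. b \<in> J \<Longrightarrow> b \<noteq> a \<Longrightarrow> f b \<in> H"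
  shows "finsum G f J \<ominus>\<^bsub>G\<^esub> y \<in> H"
proof -
  have J_eq: "J = insert a (J - {a})" using J by blast
  have sum_in: "finsum G f K \<in> H" if "finite K" "K \<subseteq> J - {a}" for K
    using that
  proof (induction K rule: finite_induct)
    case (insert b K)
    then have "f b \<in> H" "f \<in> K \<rightarrow> carrier G" "f b \<in> carrier G" using others f by auto
    then show ?case using insert H by (simp add: finsum_insert)
  qed (use H in simp)
  have c: "f a \<in> carrier G" "finsum G f (J - {a}) \<in> carrier G" "f \<in> J - {a} \<rightarrow> carrier G"
    using f J H(3) sum_in[of "J - {a}"] by auto
  have "finsum G f J = f a \<oplus>\<^bsub>G\<^esub> finsum G f (J - {a})"
    by (subst J_eq, rule finsum_insert) (use J c in auto)
  then have "finsum G f J \<ominus>\<^bsub>G\<^esub> y = (f a \<ominus>\<^bsub>G\<^esub> y) \<oplus>\<^bsub>G\<^esub> finsum G f (J - {a})"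
    using c y by (simp add: a_minus_def a_ac)
  then show ?thesis using H(2) fa sum_in[of "J - {a}"] J by simp
qed

section \<open>The quotient algebra\<close>

locale diamond_system = quiver_quotient Q S I
  for Q :: "('v, 'e) pre_digraph" and S :: "('v, 'e) path set"
    and I :: "(('v, 'e) path \<Rightarrow>\<^sub>0 'k :: field) set" +
  fixes \<phi> :: "('v, 'e) path \<Rightarrow> (('v, 'e) path \<Rightarrow>\<^sub>0 'k)"
  assumes fin_digraph_Q: "fin_digraph Q"
    and ideal_I: "ideal I (path_algebra Q)"
    and reduction_system: "reduction_system Q S \<phi>"
    and diamond: "satisfies_diamond Q S \<phi> I"

sublocale diamond_system \<subseteq> rewriting Q S \<phi>
proof -
  interpret fin_digraph Q by (rule fin_digraph_Q)
  show "rewriting Q S \<phi>"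
    using reduction_system diamond
    unfolding reduction_system_def satisfies_diamond_def
    by unfold_locales blast+
qed

context diamond_system
begin

interpretation I: ideal I kQ by (rule ideal_I)

abbreviation trivial :: "'v \<Rightarrow> ('v, 'e) path" where
  "trivial v \<equiv> (v, [])"

abbreviation lin :: "(('v, 'e) path \<Rightarrow>\<^sub>0 'k) set" where
  "lin \<equiv> linear_span (paths Q)"

lemma kQ_one: "\<one>\<^bsub>kQ\<^esub> = (\<Sum>v\<in>verts Q. pe (trivial v))"
  by (simp add: path_algebra_def)

lemma pmult_closed: "x \<in> lin \<Longrightarrow> y \<in> lin \<Longrightarrow> x \<star> y \<in> lin"
  using I.m_closed[of x y] by simp

lemma pmult_assoc: "x \<in> lin \<Longrightarrow> y \<in> lin \<Longrightarrow> z \<in> lin \<Longrightarrow> x \<star> y \<star> z = x \<star> (y \<star> z)"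
  using I.m_assoc[of x y z] by simp

lemma one_in_lin: "\<one>\<^bsub>kQ\<^esub> \<in> lin"
  using I.one_closed by simp

lemma pmult_one [simp]: "x \<in> lin \<Longrightarrow> \<one>\<^bsub>kQ\<^esub> \<star> x = x" "x \<in> lin \<Longrightarrow> x \<star> \<one>\<^bsub>kQ\<^esub> = x"
  using I.l_one[of x] I.r_one[of x] by simp_all

lemma linear_span_uminus: "x \<in> linear_span W \<Longrightarrow> - x \<in> linear_span W" for x :: "'p \<Rightarrow>\<^sub>0 'k"
  by (simp add: linear_span_def)

lemma linear_span_diff: "x \<in> linear_span W \<Longrightarrow> y \<in> linear_span W \<Longrightarrow> x - y \<in> linear_span W" for x :: "'p \<Rightarrow>\<^sub>0 'k"
  using linear_span_add[of x W "- y"] linear_span_uminus by force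

lemma kQ_uminus: "x \<in> lin \<Longrightarrow> \<ominus>\<^bsub>kQ\<^esub> x = - x"
  using I.minus_equality[of "- x" x] linear_span_uminus[of x "paths Q"] by simp

lemma pmult_diff_right: "x \<star> (y - z) = x \<star> y - x \<star> z"
  using pmult_add_right[of Q x "y - z" z] by simp

lemma pmult_diff_left: "(y - z) \<star> x = y \<star> x - z \<star> x"
  using pmult_add_left[of Q "y - z" z x] by simp

lemma A_ring: "ring A"
  unfolding A_def by (rule I.quotient_is_ring)

interpretation A: ring A by (rule A_ring)

lemma \<pi>_ring_hom: "\<pi> \<in> ring_hom kQ A"
  using I.rcos_ring_hom unfolding A_def by (simp add: \<pi>_def[abs_def])

lemma \<pi>_closed [simp]: "x \<in> lin \<Longrightarrow> \<pi> x \<in> carrier A"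
  using ring_hom_closed[OF \<pi>_ring_hom, of x] by simp

lemma \<pi>_add: "x \<in> lin \<Longrightarrow> y \<in> lin \<Longrightarrow> \<pi> (x + y) = \<pi> x \<oplus>\<^bsub>A\<^esub> \<pi> y"
  using ring_hom_add[OF \<pi>_ring_hom, of x y] by simp

lemma \<pi>_mult: "x \<in> lin \<Longrightarrow> y \<in> lin \<Longrightarrow> \<pi> (x \<star> y) = \<pi> x \<otimes>\<^bsub>A\<^esub> \<pi> y"
  using ring_hom_mult[OF \<pi>_ring_hom, of x y] by simp

lemma \<pi>_one: "\<pi> \<one>\<^bsub>kQ\<^esub> = \<one>\<^bsub>A\<^esub>"
  using ring_hom_one[OF \<pi>_ring_hom] .

lemma \<pi>_zero [simp]: "\<pi> 0 = \<zero>\<^bsub>A\<^esub>"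
  using A.l_neg[of "\<pi> 0"] \<pi>_add[of 0 0] by (metis A.add.r_cancel_one' \<pi>_closed add.right_neutral linear_span_zero)

lemma \<pi>_eq_iff:
  assumes "x \<in> lin" "y \<in> lin"
  shows "\<pi> x = \<pi> y \<longleftrightarrow> x - y \<in> I"
proof -
  have "x - y = x \<ominus>\<^bsub>kQ\<^esub> y" using assms by (simp add: a_minus_def kQ_uminus)
  then show ?thesis
    unfolding \<pi>_def using I.quotient_eq_iff_same_a_r_cos[OF ideal_I, of x y] assms by simp
qed

lemma \<pi>_surj: "a \<in> carrier A \<Longrightarrow> \<exists>x\<in>lin. a = \<pi> x"
  by (auto simp: A_def FactRing_def A_RCOSETS_def' \<pi>_def)

lemma I_in_lin: "I \<subseteq> lin"
  using I.a_subset by simp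

definition \<kappa> :: "'k \<Rightarrow> ('v, 'e, 'k) quot_elem" where
  "\<kappa> c = \<pi> (scale c \<one>\<^bsub>kQ\<^esub>)"

lemma scalars_eq: "scalars = range \<kappa>"
  by (auto simp: scalars_def \<kappa>_def)

lemma \<kappa>_closed [simp]: "\<kappa> c \<in> carrier A"
  by (simp add: \<kappa>_def linear_span_scale one_in_lin)

lemma scale_in_lin [simp]: "x \<in> lin \<Longrightarrow> scale c x \<in> lin"
  by (rule linear_span_scale)

lemma \<kappa>_left: "x \<in> lin \<Longrightarrow> \<kappa> c \<otimes>\<^bsub>A\<^esub> \<pi> x = \<pi> (scale c x)"
  unfolding \<kappa>_def by (subst \<pi>_mult[symmetric]) (simp_all add: one_in_lin pmult_scale_left)

lemma \<kappa>_right: "x \<in> lin \<Longrightarrow> \<pi> x \<otimes>\<^bsub>A\<^esub> \<kappa> c = \<pi> (scale c x)"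
  unfolding \<kappa>_def by (subst \<pi>_mult[symmetric]) (simp_all add: one_in_lin pmult_scale_right)

lemma \<kappa>_comm: "a \<in> carrier A \<Longrightarrow> \<kappa> c \<otimes>\<^bsub>A\<^esub> a = a \<otimes>\<^bsub>A\<^esub> \<kappa> c"
  using \<pi>_surj \<kappa>_left \<kappa>_right by metis

lemma \<kappa>_add: "\<kappa> (c + d) = \<kappa> c \<oplus>\<^bsub>A\<^esub> \<kappa> d"
  by (simp add: \<kappa>_def scale_add_left \<pi>_add one_in_lin)

lemma \<kappa>_mult: "\<kappa> (c * d) = \<kappa> c \<otimes>\<^bsub>A\<^esub> \<kappa> d"
  by (subst (2) \<kappa>_def) (simp add: \<kappa>_left one_in_lin, simp add: \<kappa>_def)

lemma \<kappa>_zero [simp]: "\<kappa> 0 = \<zero>\<^bsub>A\<^esub>"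
  by (simp add: \<kappa>_def)

lemma \<kappa>_one [simp]: "\<kappa> 1 = \<one>\<^bsub>A\<^esub>"
  by (simp add: \<kappa>_def \<pi>_one)

lemma single_in_lin [simp]: "p \<in> paths Q \<Longrightarrow> single p c \<in> lin"
  by (rule linear_span_single)

lemma \<pi>_single: "p \<in> paths Q \<Longrightarrow> \<pi> (single p c) = \<kappa> c \<otimes>\<^bsub>A\<^esub> \<pi> (pe p)"
  by (simp add: \<kappa>_left)

lemma pe_mult_pe: "pe p \<star> pe q = (if tgt Q p = src q then pe (pcat p q) else (0 :: ('v, 'e) path \<Rightarrow>\<^sub>0 'k))"
  by (simp add: pmult_single)

subsection \<open>Normal forms in the quotient\<close>

lemma nf_zero [simp]: "nf 0 = 0"
  by (simp add: nf_def)

lemma nf_minus: "nf (x - y) = nf x - nf y"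
  using nf_add[of "x - y" y] by simp

lemma pmult_zero_source:
  "x \<in> linear_span {p. src p = v} \<Longrightarrow> tgt Q p \<noteq> v \<Longrightarrow> single p c \<star> x = 0"
  by (induction x rule: linear_span_induct) (auto simp: pmult_single pmult_add_right)

lemma pmult_zero_target:
  "x \<in> linear_span {p. tgt Q p = v} \<Longrightarrow> src p \<noteq> v \<Longrightarrow> x \<star> single p c = 0"
  by (induction x rule: linear_span_induct) (auto simp: pmult_single pmult_add_left)

lemma relator_parallel:
  assumes "s \<in> S"
  shows "pe s - \<phi> s \<in> linear_span {p \<in> paths Q. src p = src s \<and> tgt Q p = tgt Q s}"
proof (rule linear_span_diff)
  show "pe s \<in> linear_span {p \<in> paths Q. src p = src s \<and> tgt Q p = tgt Q s}"
    using assms S_paths by (intro linear_span_single) auto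
  show "\<phi> s \<in> linear_span {p \<in> paths Q. src p = src s \<and> tgt Q p = tgt Q s}"
    using \<phi>[OF assms] irreducible_in_paths unfolding linear_span_def by blast
qed

lemma nf_sandwich:
  assumes s: "s \<in> S" and y: "y \<in> lin" and z: "z \<in> lin"
  shows "nf (y \<star> (pe s - \<phi> s) \<star> z) = 0"
  using y
proof (induction y rule: linear_span_induct)
  case (single p a)
  show ?case
    using z
  proof (induction z rule: linear_span_induct)
    case (single r b)
    have src: "pe s - \<phi> s \<in> linear_span {p. src p = src s}" "pe s - \<phi> s \<in> linear_span {p. tgt Q p = tgt Q s}"
      using relator_parallel[OF s] unfolding linear_span_def by blast+
    have "single p a \<star> (pe s - \<phi> s) \<star> single r b = scale (a * b) (pe p \<star> (pe s - \<phi> s) \<star> pe r)"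
      using pmult_scale_left[of Q a "pe p"] pmult_scale_right[of Q _ b "pe r"]
      by (simp add: pmult_scale_left mult.commute)
    moreover have "nf (pe p \<star> (pe s - \<phi> s) \<star> pe r) = 0"
    proof (cases "tgt Q p = src s \<and> tgt Q s = src r")
      case True
      then have f: "(p, s, r) \<in> factorizations Q S (pcat p (pcat s r))"
        using s \<open>p \<in> paths Q\<close> single by (auto simp: factorizations_def)
      have "pe p \<star> pe s \<star> pe r = (pe (pcat p (pcat s r)) :: ('v, 'e) path \<Rightarrow>\<^sub>0 'k)"
        using True by (simp add: pe_mult_pe tgt_pcat pcat_assoc)
      then show ?thesis
        using nf_red[OF f] by (simp add: pmult_diff_right pmult_diff_left nf_minus) (simp add: nf_def)
    next
      case False
      then consider "tgt Q p \<noteq> src s" | "src r \<noteq> tgt Q s" by auto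
      then show ?thesis
      proof cases
        case 1
        then show ?thesis using pmult_zero_source[OF src(1)] by simp
      next
        case 2
        have rp: "r \<in> paths Q" using single by simp
        have "pe s - \<phi> s \<in> lin" using relator_parallel[OF s] unfolding linear_span_def by blast
        then have "pe p \<star> (pe s - \<phi> s) \<star> pe r = pe p \<star> ((pe s - \<phi> s) \<star> pe r)"
          using \<open>p \<in> paths Q\<close> rp by (simp add: pmult_assoc)
        then show ?thesis using pmult_zero_target[OF src(2) 2] by simp
      qed
    qed
    ultimately show ?case by (simp add: nf_scale)
  qed (simp_all add: pmult_add_right nf_add)
qed (simp_all add: pmult_add_left nf_add)

lemma relators_in_lin: "{pe s - \<phi> s |s. s \<in> S} \<subseteq> carrier kQ"
  using relator_parallel unfolding path_algebra_simps linear_span_def by blast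

lemma I_eq: "I = Idl\<^bsub>kQ\<^esub> {pe s - \<phi> s |s. s \<in> S}"
  using diamond by (simp add: satisfies_diamond_def)

lemma relator_in_I: "s \<in> S \<Longrightarrow> pe s - \<phi> s \<in> I"
  using I.genideal_self[OF relators_in_lin] I_eq by blast

text \<open>
  The elements $x$ such that all $yxz$ have normal form 0 are an ideal, and it contains the relators.
\<close>

lemma nf_I:
  assumes "x \<in> I"
  shows "nf x = 0"
proof -
  define J where "J = {x \<in> lin. \<forall>y\<in>lin. \<forall>z\<in>lin. nf (y \<star> x \<star> z) = 0}"
  have "subgroup J (add_monoid kQ)"
  proof (rule I.add.subgroupI)
    show "J \<subseteq> carrier kQ" by (auto simp: J_def)
    show "J \<noteq> {}" by (auto simp: J_def intro!: exI[of _ 0])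
    show "\<ominus>\<^bsub>kQ\<^esub> a \<in> J" if "a \<in> J" for a
      using that nf_minus[of 0] pmult_diff_right[of _ 0 a] pmult_diff_left[of 0]
      by (auto simp: J_def kQ_uminus linear_span_uminus)
    show "a \<oplus>\<^bsub>kQ\<^esub> b \<in> J" if "a \<in> J" "b \<in> J" for a b
      using that by (auto simp: J_def linear_span_add pmult_add_left pmult_add_right nf_add)
  qed
  then have "ideal J kQ"
  proof (rule idealI[OF I.ring_axioms])
    fix a x assume a: "a \<in> J" and x: "x \<in> carrier kQ"
    have "nf (y \<star> (x \<star> a) \<star> z) = 0" "nf (y \<star> (a \<star> x) \<star> z) = 0" if "y \<in> lin" "z \<in> lin" for y z
    proof -
      have "y \<star> (x \<star> a) \<star> z = (y \<star> x) \<star> a \<star> z" "y \<star> (a \<star> x) \<star> z = y \<star> a \<star> (x \<star> z)"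
        using that a x by (simp_all add: J_def pmult_assoc pmult_closed)
      then show "nf (y \<star> (x \<star> a) \<star> z) = 0" "nf (y \<star> (a \<star> x) \<star> z) = 0"
        using a that x by (simp_all add: J_def pmult_closed)
    qed
    then show "x \<star> a \<in> J" "a \<star> x \<in> J" using a x by (simp_all add: J_def pmult_closed)
  qed
  moreover have "{pe s - \<phi> s |s. s \<in> S} \<subseteq> J"
    using relators_in_lin nf_sandwich by (auto simp: J_def)
  ultimately have "x \<in> J" using I.genideal_minimal assms I_eq by blast
  then have "nf (\<one>\<^bsub>kQ\<^esub> \<star> x \<star> \<one>\<^bsub>kQ\<^esub>) = 0" using one_in_lin unfolding J_def by blast
  then show ?thesis using assms I_in_lin by (auto simp: subset_iff)
qed

text \<open>
  By \<open>nf_I\<close> the choice of the representative is immaterial.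
\<close>

definition normal_form :: "('v, 'e, 'k) quot_elem \<Rightarrow> (('v, 'e) path \<Rightarrow>\<^sub>0 'k)" where
  "normal_form a = nf (SOME x. x \<in> lin \<and> \<pi> x = a)"

lemma normal_form_\<pi>:
  assumes "x \<in> lin"
  shows "normal_form (\<pi> x) = nf x"
proof -
  define y where "y = (SOME y. y \<in> lin \<and> \<pi> y = \<pi> x)"
  have "y \<in> lin \<and> \<pi> y = \<pi> x" unfolding y_def by (rule someI[of _ x]) (use assms in simp)
  then have "nf (y - x) = 0" using nf_I \<pi>_eq_iff assms by blast
  then show ?thesis by (simp add: normal_form_def y_def[symmetric] nf_minus)
qed

text \<open>
  The class of a path is a combination of classes of irreducible paths which are not above it in the
  rewriting order, by well-founded induction on that order.
\<close>

lemma \<pi>_path_induct: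
  assumes p: "p \<in> paths Q"
    and zero: "H \<zero>\<^bsub>A\<^esub>"
    and plus: "\<And>a b. a \<in> carrier A \<Longrightarrow> b \<in> carrier A \<Longrightarrow> H a \<Longrightarrow> H b \<Longrightarrow> H (a \<oplus>\<^bsub>A\<^esub> b)"
    and irr: "\<And>u c. u \<in> Irr \<Longrightarrow> (u, p) \<in> below\<^sup>= \<Longrightarrow> H (\<pi> (single u c))"
  shows "H (\<pi> (single p c))"
proof -
  have "(p', p) \<in> below\<^sup>= \<longrightarrow> (\<forall>c. H (\<pi> (single p' c)))" for p'
  proof (induction p' rule: wf_induct_rule[OF wf_below])
    case (1 p')
    show ?case
    proof (intro impI allI)
      fix c assume le: "(p', p) \<in> below\<^sup>="
      then have p': "p' \<in> paths Q" using p below_parallel by blast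
      show "H (\<pi> (single p' c))"
      proof (cases "p' \<in> Irr")
        case False
        then obtain q s r where f: "(q, s, r) \<in> factorizations Q S p'"
          using p' by (auto simp: irreducible_paths_def)
        then have s: "s \<in> S" "q \<in> paths Q" "r \<in> paths Q" and eq: "p' = pcat q (pcat s r)"
          and comp: "tgt Q q = src s" "tgt Q s = src r"
          by (auto simp: factorizations_def)
        have sp: "s \<in> paths Q" using s S_paths by auto
        have \<phi>s: "\<phi> s \<in> lin" using \<phi>[OF s(1)] irreducible_in_paths unfolding linear_span_def by blast
        have "pe q \<star> (pe s - \<phi> s) \<star> pe r \<in> I"
          using relator_in_I[OF s(1)] I.I_l_closed I.I_r_closed s by simp
        then have "pe p' - red q s r \<in> I"
          using comp by (simp add: pmult_diff_right pmult_diff_left pe_mult_pe tgt_pcat pcat_assoc eq)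
        moreover have redlin: "red q s r \<in> lin" using s \<phi>s by (simp add: pmult_closed)
        ultimately have "\<pi> (pe p') = \<pi> (red q s r)" using p' \<pi>_eq_iff by simp
        then have "\<pi> (single p' c) = \<pi> (scale c (red q s r))"
          using p' redlin by (metis \<pi>_single \<kappa>_left)
        moreover have "scale c (red q s r) \<in> linear_span {p''. (p'', p') \<in> below}"
          by (rule linear_span_scale) (use red_below[OF f] in \<open>auto simp: linear_span_def\<close>)
        moreover have "x \<in> lin \<and> H (\<pi> x)" if "x \<in> linear_span {p''. (p'', p') \<in> below}" for x
          using that
        proof (induction x rule: linear_span_induct)
          case zero
          then show ?case using \<open>H \<zero>\<^bsub>A\<^esub>\<close> by simp
        next
          case (single p'' d)
          then have "p'' \<in> paths Q" "(p'', p) \<in> below\<^sup>=" using below_parallel below_trans le by blast+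
          then have "H (\<pi> (single p'' d))" using 1 single by blast
          then show ?case using \<open>p'' \<in> paths Q\<close> by simp
        next
          case (add x y)
          then show ?case using plus by (simp add: linear_span_add \<pi>_add)
        qed
        ultimately show ?thesis by simp
      qed (use irr le in blast)
    qed
  qed
  then show ?thesis by blast
qed

lemma A_induct:
  assumes "a \<in> carrier A" and zero: "H \<zero>\<^bsub>A\<^esub>"
    and add: "\<And>a b. a \<in> carrier A \<Longrightarrow> b \<in> carrier A \<Longrightarrow> H a \<Longrightarrow> H b \<Longrightarrow> H (a \<oplus>\<^bsub>A\<^esub> b)"
    and single: "\<And>p c. p \<in> paths Q \<Longrightarrow> H (\<pi> (single p c))"
  shows "H a"
proof -
  obtain x where x: "x \<in> lin" "a = \<pi> x" using \<pi>_surj assms(1) by blast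
  show ?thesis
    unfolding x(2) using x(1)
    by (induction x rule: linear_span_induct) (simp_all add: zero single \<pi>_add add)
qed

lemma A_induct_irreducible:
  assumes "a \<in> carrier A" and zero: "H \<zero>\<^bsub>A\<^esub>"
    and add: "\<And>a b. a \<in> carrier A \<Longrightarrow> b \<in> carrier A \<Longrightarrow> H a \<Longrightarrow> H b \<Longrightarrow> H (a \<oplus>\<^bsub>A\<^esub> b)"
    and irr: "\<And>u c. u \<in> Irr \<Longrightarrow> H (\<pi> (single u c))"
  shows "H a"
  by (rule A_induct[OF assms(1)], rule zero, erule (3) add, rule \<pi>_path_induct)
    (auto intro: zero add irr)

end

section \<open>The bimodules $P_n$\<close>

declare overlap_paths.simps [simp del]

context quiver_quotient
begin

abbreviation FG :: "nat \<Rightarrow> (('v, 'e, 'k) triple \<Rightarrow>\<^sub>0 int) monoid" where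
  "FG n \<equiv> free_Abelian_group (triples n)"

end

context diamond_system
begin

interpretation I: ideal I kQ by (rule ideal_I)
interpretation A: ring A by (rule A_ring)

abbreviation Span :: "nat \<Rightarrow> (('v, 'e) path \<Rightarrow>\<^sub>0 'k) set" where
  "Span n \<equiv> linear_span (SS n)"

lemma Span_in_lin: "x \<in> Span n \<Longrightarrow> x \<in> lin"
  using overlap_in_paths[of n] by (auto simp: linear_span_def)

lemma trivial_in_SS: "v \<in> verts Q \<Longrightarrow> trivial v \<in> SS 0"
  by (simp add: overlap_paths.simps trivial_path plen_def)

lemma SS_0: "SS 0 = trivial ` verts Q"
proof -
  have "p \<in> paths Q \<Longrightarrow> plen p = 0 \<Longrightarrow> p = trivial (src p) \<and> src p \<in> verts Q" for p
    using plen_zero src_in_verts by blast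
  then show ?thesis by (auto simp: overlap_paths.simps trivial_path plen_def)
qed

lemma single_in_Span: "w \<in> SS n \<Longrightarrow> single w c \<in> Span n"
  by (rule linear_span_single)

lemma one_in_Span: "\<one>\<^bsub>kQ\<^esub> \<in> Span 0"
  unfolding kQ_one by (rule linear_span_sum, rule single_in_Span) (rule trivial_in_SS)

lemma Span0_left:
  assumes "e \<in> Span 0"
  shows "e \<star> single w c = single w (coeff e (trivial (src w)) * c)"
  using assms
proof (induction e rule: linear_span_induct)
  case (single p d)
  then have "p = trivial (src p)" by (auto simp: overlap_paths.simps plen_zero)
  then obtain v where "p = trivial v" by blast
  then show ?case
    by (cases "v = src w") (auto simp: pmult_single pcat_trivial_left lookup_single when_def)
qed (simp_all add: pmult_add_left lookup_add distrib_right single_add)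

lemma Span0_right:
  assumes "e \<in> Span 0"
  shows "single w c \<star> e = single w (c * coeff e (trivial (tgt Q w)))"
  using assms
proof (induction e rule: linear_span_induct)
  case (single p d)
  then have "p = trivial (src p)" by (auto simp: overlap_paths.simps plen_zero)
  then obtain v where "p = trivial v" by blast
  then show ?case
    by (cases "v = tgt Q w") (auto simp: pmult_single lookup_single when_def src_def)
qed (simp_all add: pmult_add_right lookup_add distrib_left single_add)

lemma Span0_left_Span: "e \<in> Span 0 \<Longrightarrow> x \<in> Span n \<Longrightarrow> e \<star> x \<in> Span n"
  by (rotate_tac, induction x rule: linear_span_induct)
    (auto simp: pmult_add_right Span0_left intro: linear_span_add linear_span_single)

lemma Span0_right_Span: "e \<in> Span 0 \<Longrightarrow> x \<in> Span n \<Longrightarrow> x \<star> e \<in> Span n"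
  by (rotate_tac, induction x rule: linear_span_induct)
    (auto simp: pmult_add_left Span0_right intro: linear_span_add linear_span_single)

lemma coeff_Span0_left:
  assumes "e \<in> Span 0" "x \<in> Span n"
  shows "coeff (e \<star> x) w = coeff e (trivial (src w)) * coeff x w"
  using assms(2)
  by (induction x rule: linear_span_induct)
    (auto simp: pmult_add_right Span0_left[OF assms(1)] lookup_add distrib_left lookup_single when_def)

lemma coeff_Span0_right:
  assumes "e \<in> Span 0" "x \<in> Span n"
  shows "coeff (x \<star> e) w = coeff x w * coeff e (trivial (tgt Q w))"
  using assms(2)
  by (induction x rule: linear_span_induct)
    (auto simp: pmult_add_left Span0_right[OF assms(1)] lookup_add distrib_right lookup_single when_def)

subsection \<open>The underlying groups\<close>

lemma FG_group: "comm_group (FG n)"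
  by (rule abelian_free_Abelian_group)

lemma FG_diff: "f \<in> carrier (FG n) \<Longrightarrow> g \<in> carrier (FG n) \<Longrightarrow> f - g \<in> carrier (FG n)"
  using keys_diff[of f g] by auto

lemma frag_of_in_FG: "a \<in> carrier A \<Longrightarrow> x \<in> Span n \<Longrightarrow> b \<in> carrier A \<Longrightarrow> frag_of (a, x, b) \<in> carrier (FG n)"
  by (simp add: triples_def)

lemma tensor_relations_in: "tensor_relations n \<subseteq> carrier (FG n)"
  unfolding tensor_relations_def
  by (auto simp del: carrier_free_Abelian_group_iff simp: linear_span_add Span0_left_Span Span0_right_Span
      Span_in_lin[of _ 0] intro!: FG_diff frag_of_in_FG)

lemma tensor_null_subgroup: "subgroup (tensor_null n) (FG n)"
  unfolding tensor_null_def by (rule group.generate_is_subgroup) (simp_all add: tensor_relations_in)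

lemma tensor_null_normal: "tensor_null n \<lhd> FG n"
  using comm_group.subgroup_imp_normal[OF FG_group tensor_null_subgroup] .

lemma P_simps:
  "carrier (P n) = carrier (FG n Mod tensor_null n)"
  "\<zero>\<^bsub>P n\<^esub> = \<one>\<^bsub>FG n Mod tensor_null n\<^esub>"
  "x \<oplus>\<^bsub>P n\<^esub> y = x \<otimes>\<^bsub>FG n Mod tensor_null n\<^esub> y"
  by (simp_all add: P_def Let_def)

lemma P_hom_dom: "hom (add_monoid (P n)) M = hom (FG n Mod tensor_null n) M"
  by (simp add: hom_def P_simps)

lemma P_hom_cod: "hom M (add_monoid (P n)) = hom M (FG n Mod tensor_null n)"
  by (simp add: hom_def P_simps)

lemma P_abelian_group: "abelian_group (P n)"
proof -
  interpret G: comm_group "FG n Mod tensor_null n"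
    by (rule comm_group.abelian_FactGroup[OF FG_group tensor_null_subgroup])
  show ?thesis
    by (rule abelian_groupI; unfold P_simps)
      (rule G.m_closed G.one_closed G.m_assoc G.m_comm G.l_one G.l_inv_ex; assumption)+
qed

interpretation P: abelian_group "P n" for n by (rule P_abelian_group)

lemmas P_hom_zero = add_hom_zero[OF P_abelian_group P_abelian_group]
lemmas P_hom_uminus = add_hom_uminus[OF P_abelian_group P_abelian_group]
lemmas P_hom_minus = add_hom_minus[OF P_abelian_group P_abelian_group]
lemmas P_hom_finsum = add_hom_finsum[OF P_abelian_group P_abelian_group]

lemma tensor_class_hom: "tensor_class n \<in> hom (FG n) (add_monoid (P n))"
  unfolding P_hom_cod tensor_class_def[abs_def]
  using normal.r_coset_hom_Mod[OF tensor_null_normal] .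

lemma tensor_class_closed: "f \<in> carrier (FG n) \<Longrightarrow> tensor_class n f \<in> carrier (P n)"
  using tensor_class_hom by (fastforce simp: hom_def)

lemma tensor_class_add:
  "f \<in> carrier (FG n) \<Longrightarrow> g \<in> carrier (FG n) \<Longrightarrow> tensor_class n (f + g) = tensor_class n f \<oplus>\<^bsub>P n\<^esub> tensor_class n g"
  using tensor_class_hom by (fastforce simp: hom_def)

lemma tensor_class_zero: "tensor_class n 0 = \<zero>\<^bsub>P n\<^esub>"
  using hom_one[OF tensor_class_hom] P.add.is_group by simp

lemma tensor_class_diff:
  assumes "f \<in> carrier (FG n)" "g \<in> carrier (FG n)"
  shows "tensor_class n (f - g) = tensor_class n f \<ominus>\<^bsub>P n\<^esub> tensor_class n g"
proof -
  have fg: "f - g \<in> carrier (FG n)" using assms keys_diff[of f g] by auto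
  have "tensor_class n (f - g) \<oplus>\<^bsub>P n\<^esub> tensor_class n g = tensor_class n f"
    using tensor_class_add[OF fg assms(2)] by simp
  then show ?thesis
    using tensor_class_closed fg assms P.add.inv_solve_right[of _ n] by (simp add: a_minus_def)
qed

lemma tensor_class_surj: "T \<in> carrier (P n) \<Longrightarrow> \<exists>f\<in>carrier (FG n). T = tensor_class n f"
  by (auto simp: P_simps FactGroup_def RCOSETS_def tensor_class_def)

lemma tensor_class_self: "f \<in> carrier (FG n) \<Longrightarrow> f \<in> tensor_class n f"
  unfolding tensor_class_def using group.rcos_self[OF _ _ tensor_null_subgroup] by simp

lemma tensor_class_mem:
  assumes "f \<in> carrier (FG n)" "g \<in> tensor_class n f"
  shows "g \<in> carrier (FG n) \<and> tensor_class n g = tensor_class n f"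
proof -
  have *: "g \<in> tensor_null n #>\<^bsub>FG n\<^esub> f" using assms(2) by (simp add: tensor_class_def)
  have "tensor_null n #>\<^bsub>FG n\<^esub> f \<subseteq> carrier (FG n)"
    by (rule monoid.r_coset_subset_G[OF _ subgroup.subset[OF tensor_null_subgroup] assms(1)])
      (simp add: group.is_monoid)
  then have "g \<in> carrier (FG n)" using * by (rule subsetD)
  moreover have "tensor_null n #>\<^bsub>FG n\<^esub> f = tensor_null n #>\<^bsub>FG n\<^esub> g"
    by (rule group.repr_independence[OF _ * assms(1) tensor_null_subgroup]) simp
  ultimately show ?thesis by (simp add: tensor_class_def)
qed

lemma tensor_null_zero:
  assumes "f \<in> tensor_relations n"
  shows "tensor_class n f = \<zero>\<^bsub>P n\<^esub>"
proof -
  have "f \<in> tensor_null n" using assms by (simp add: tensor_null_def generate.incl)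
  then have "tensor_null n #>\<^bsub>FG n\<^esub> f = tensor_null n"
    using subgroup.rcos_const[OF tensor_null_subgroup] by simp
  then show ?thesis by (simp add: tensor_class_def P_simps FactGroup_def)
qed

lemma tensor_closed [simp]: "a \<in> carrier A \<Longrightarrow> x \<in> Span n \<Longrightarrow> b \<in> carrier A \<Longrightarrow> tensor n a x b \<in> carrier (P n)"
  unfolding tensor_def by (intro tensor_class_closed frag_of_in_FG)

lemma tensor_eq_sumI:
  assumes "frag_of (a, x, b) - frag_of (a', x', b') - frag_of (a'', x'', b'') \<in> tensor_relations n"
    and "(a, x, b) \<in> triples n" "(a', x', b') \<in> triples n" "(a'', x'', b'') \<in> triples n"
  shows "tensor n a x b = tensor n a' x' b' \<oplus>\<^bsub>P n\<^esub> tensor n a'' x'' b''"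
proof -
  have c: "tensor n a x b \<in> carrier (P n)" "tensor n a' x' b' \<in> carrier (P n)" "tensor n a'' x'' b'' \<in> carrier (P n)"
    using assms(2-4) by (auto simp: triples_def)
  have f: "frag_of (a, x, b) \<in> carrier (FG n)" "frag_of (a', x', b') \<in> carrier (FG n)" "frag_of (a'', x'', b'') \<in> carrier (FG n)"
    using assms(2-4) by simp_all
  have "frag_of (a, x, b) - frag_of (a', x', b') \<in> carrier (FG n)" using f keys_diff by fastforce
  then have "tensor n a x b \<ominus>\<^bsub>P n\<^esub> tensor n a' x' b' \<ominus>\<^bsub>P n\<^esub> tensor n a'' x'' b'' = \<zero>\<^bsub>P n\<^esub>"
    using tensor_null_zero[OF assms(1)] f by (simp add: tensor_class_diff tensor_def)
  then have "tensor n a x b \<ominus>\<^bsub>P n\<^esub> tensor n a' x' b' = tensor n a'' x'' b''"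
    using c P.minus_eq_zero_iff by simp
  then show ?thesis using P.minus_add_cancel[OF c(1,2)] c by (simp add: P.a_comm)
qed

lemma tensor_eqI:
  assumes "frag_of (a, x, b) - frag_of (a', x', b') \<in> tensor_relations n"
    and "(a, x, b) \<in> triples n" "(a', x', b') \<in> triples n"
  shows "tensor n a x b = tensor n a' x' b'"
proof -
  have c: "tensor n a x b \<in> carrier (P n)" "tensor n a' x' b' \<in> carrier (P n)"
    using assms(2-3) by (auto simp: triples_def)
  have f: "frag_of (a, x, b) \<in> carrier (FG n)" "frag_of (a', x', b') \<in> carrier (FG n)"
    using assms(2-3) by simp_all
  have "tensor n a x b \<ominus>\<^bsub>P n\<^esub> tensor n a' x' b' = \<zero>\<^bsub>P n\<^esub>"
    using tensor_null_zero[OF assms(1)] f by (simp add: tensor_class_diff tensor_def)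
  then show ?thesis using c P.minus_eq_zero_iff by simp
qed

lemma tensor_add_left:
  "a \<in> carrier A \<Longrightarrow> a' \<in> carrier A \<Longrightarrow> x \<in> Span n \<Longrightarrow> b \<in> carrier A \<Longrightarrow>
    tensor n (a \<oplus>\<^bsub>A\<^esub> a') x b = tensor n a x b \<oplus>\<^bsub>P n\<^esub> tensor n a' x b"
  by (rule tensor_eq_sumI) (auto simp: tensor_relations_def triples_def)

lemma tensor_add_mid:
  "a \<in> carrier A \<Longrightarrow> x \<in> Span n \<Longrightarrow> x' \<in> Span n \<Longrightarrow> b \<in> carrier A \<Longrightarrow>
    tensor n a (x + x') b = tensor n a x b \<oplus>\<^bsub>P n\<^esub> tensor n a x' b"
  by (rule tensor_eq_sumI) (auto simp: tensor_relations_def triples_def linear_span_add)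

lemma tensor_add_right:
  "a \<in> carrier A \<Longrightarrow> x \<in> Span n \<Longrightarrow> b \<in> carrier A \<Longrightarrow> b' \<in> carrier A \<Longrightarrow>
    tensor n a x (b \<oplus>\<^bsub>A\<^esub> b') = tensor n a x b \<oplus>\<^bsub>P n\<^esub> tensor n a x b'"
  by (rule tensor_eq_sumI) (auto simp: tensor_relations_def triples_def)

lemma tensor_balance_left:
  assumes "a \<in> carrier A" "e \<in> Span 0" "x \<in> Span n" "b \<in> carrier A"
  shows "tensor n (a \<otimes>\<^bsub>A\<^esub> \<pi> e) x b = tensor n a (e \<star> x) b"
  by (rule tensor_eqI) (use assms in \<open>auto simp: tensor_relations_def triples_def Span0_left_Span Span_in_lin[of _ 0]\<close>)

lemma tensor_balance_right:
  assumes "a \<in> carrier A" "x \<in> Span n" "e \<in> Span 0" "b \<in> carrier A"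
  shows "tensor n a (x \<star> e) b = tensor n a x (\<pi> e \<otimes>\<^bsub>A\<^esub> b)"
  by (rule tensor_eqI) (use assms in \<open>auto simp: tensor_relations_def triples_def Span0_right_Span Span_in_lin[of _ 0]\<close>)

lemma P_induct_minus:
  assumes T: "T \<in> carrier (P n)" and zero: "H \<zero>\<^bsub>P n\<^esub>"
    and tensor: "\<And>a x b. a \<in> carrier A \<Longrightarrow> x \<in> Span n \<Longrightarrow> b \<in> carrier A \<Longrightarrow> H (tensor n a x b)"
    and minus: "\<And>x y. x \<in> carrier (P n) \<Longrightarrow> y \<in> carrier (P n) \<Longrightarrow> H x \<Longrightarrow> H y \<Longrightarrow> H (x \<ominus>\<^bsub>P n\<^esub> y)"
  shows "H T"
proof -
  obtain f where f: "f \<in> carrier (FG n)" "T = tensor_class n f" using tensor_class_surj[OF T] by blast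
  have "f \<in> carrier (FG n) \<and> H (tensor_class n f)"
    using f(1)[unfolded carrier_free_Abelian_group_iff]
  proof (rule frag_induction)
    show "0 \<in> carrier (FG n) \<and> H (tensor_class n 0)" by (simp add: zero tensor_class_zero)
    show "frag_of t \<in> carrier (FG n) \<and> H (tensor_class n (frag_of t))" if "t \<in> triples n" for t
      using that tensor by (cases t) (auto simp: triples_def tensor_def)
    show "g - h \<in> carrier (FG n) \<and> H (tensor_class n (g - h))"
      if "g \<in> carrier (FG n) \<and> H (tensor_class n g)" "h \<in> carrier (FG n) \<and> H (tensor_class n h)" for g h
      using that by (simp add: FG_diff tensor_class_diff minus tensor_class_closed del: carrier_free_Abelian_group_iff)
  qed
  then show ?thesis using f by simp
qed

text \<open>
  The balanced and additive map \<open>F\<close> extends to the free abelian group on the triples and kills the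
  relations.
\<close>

lemma P_universal:
  assumes M: "abelian_group M"
    and closed: "\<And>a x b. a \<in> carrier A \<Longrightarrow> x \<in> Span n \<Longrightarrow> b \<in> carrier A \<Longrightarrow> F a x b \<in> carrier M"
    and add_left: "\<And>a a' x b. a \<in> carrier A \<Longrightarrow> a' \<in> carrier A \<Longrightarrow> x \<in> Span n \<Longrightarrow> b \<in> carrier A \<Longrightarrow>
      F (a \<oplus>\<^bsub>A\<^esub> a') x b = F a x b \<oplus>\<^bsub>M\<^esub> F a' x b"
    and add_mid: "\<And>a x x' b. a \<in> carrier A \<Longrightarrow> x \<in> Span n \<Longrightarrow> x' \<in> Span n \<Longrightarrow> b \<in> carrier A \<Longrightarrow>
      F a (x + x') b = F a x b \<oplus>\<^bsub>M\<^esub> F a x' b"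
    and add_right: "\<And>a x b b'. a \<in> carrier A \<Longrightarrow> x \<in> Span n \<Longrightarrow> b \<in> carrier A \<Longrightarrow> b' \<in> carrier A \<Longrightarrow>
      F a x (b \<oplus>\<^bsub>A\<^esub> b') = F a x b \<oplus>\<^bsub>M\<^esub> F a x b'"
    and bal_left: "\<And>a e x b. a \<in> carrier A \<Longrightarrow> e \<in> Span 0 \<Longrightarrow> x \<in> Span n \<Longrightarrow> b \<in> carrier A \<Longrightarrow>
      F (a \<otimes>\<^bsub>A\<^esub> \<pi> e) x b = F a (e \<star> x) b"
    and bal_right: "\<And>a e x b. a \<in> carrier A \<Longrightarrow> e \<in> Span 0 \<Longrightarrow> x \<in> Span n \<Longrightarrow> b \<in> carrier A \<Longrightarrow>
      F a (x \<star> e) b = F a x (\<pi> e \<otimes>\<^bsub>A\<^esub> b)"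
  obtains f where "f \<in> hom (add_monoid (P n)) (add_monoid M)"
    "\<And>a x b. a \<in> carrier A \<Longrightarrow> x \<in> Span n \<Longrightarrow> b \<in> carrier A \<Longrightarrow> f (tensor n a x b) = F a x b"
proof -
  interpret M: abelian_group M by (rule M)
  have "(\<lambda>(a, x, b). F a x b) ` triples n \<subseteq> carrier M" using closed by (auto simp: triples_def)
  then obtain h where h: "h \<in> hom (FG n) (add_monoid M)"
    and h_of: "\<And>t. t \<in> triples n \<Longrightarrow> h (frag_of t) = (case t of (a, x, b) \<Rightarrow> F a x b)"
    using comm_group.free_Abelian_group_universal[OF M.a_comm_group, of _ "triples n"]
    by (metis partial_object.simps(1) monoid.surjective)
  have h_diff: "h (f - g) = h f \<ominus>\<^bsub>M\<^esub> h g" if "f \<in> carrier (FG n)" "g \<in> carrier (FG n)" for f g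
  proof -
    have fg: "f - g \<in> carrier (FG n)" using that keys_diff[of f g] by auto
    have c: "h f \<in> carrier M" "h g \<in> carrier M" "h (f - g) \<in> carrier M"
      using h that fg by (auto simp: hom_def)
    have "h (x + y) = h x \<oplus>\<^bsub>M\<^esub> h y" if "x \<in> carrier (FG n)" "y \<in> carrier (FG n)" for x y
      using h that by (simp add: hom_def del: carrier_free_Abelian_group_iff)
    from this[OF fg that(2)] have "h f = h (f - g) \<oplus>\<^bsub>M\<^esub> h g" by simp
    then show ?thesis using c M.add.inv_solve_right by (simp add: a_minus_def)
  qed
  interpret h: group_hom "FG n" "add_monoid M" h
    by (simp add: group_hom_def group_hom_axioms_def h M.a_group)
  have ker: "tensor_relations n \<subseteq> kernel (FG n) (add_monoid M) h"
  proof
    fix t assume t: "t \<in> tensor_relations n"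
    have cancel: "u \<ominus>\<^bsub>M\<^esub> x \<ominus>\<^bsub>M\<^esub> y = \<zero>\<^bsub>M\<^esub>" if "u = x \<oplus>\<^bsub>M\<^esub> y" "x \<in> carrier M" "y \<in> carrier M" for u x y
      using that M.add_minus_cancel_left[of x y] M.minus_eq_zero_iff[of y y] by simp
    have three: "h (frag_of (a, x, b) - frag_of (a', x', b') - frag_of (a'', x'', b'')) = \<zero>\<^bsub>M\<^esub>"
      if "F a x b = F a' x' b' \<oplus>\<^bsub>M\<^esub> F a'' x'' b''" "(a, x, b) \<in> triples n" "(a', x', b') \<in> triples n" "(a'', x'', b'') \<in> triples n"
      for a x b a' x' b' a'' x'' b''
    proof -
      have "frag_of (a, x, b) - frag_of (a', x', b') \<in> carrier (FG n)" using that keys_diff by fastforce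
      then have "h (frag_of (a, x, b) - frag_of (a', x', b') - frag_of (a'', x'', b'')) = F a x b \<ominus>\<^bsub>M\<^esub> F a' x' b' \<ominus>\<^bsub>M\<^esub> F a'' x'' b''"
        using that by (simp add: h_diff h_of)
      then show ?thesis using cancel[OF that(1)] closed that by (simp add: triples_def)
    qed
    have two: "h (frag_of (a, x, b) - frag_of (a', x', b')) = \<zero>\<^bsub>M\<^esub>"
      if "F a x b = F a' x' b'" "(a, x, b) \<in> triples n" "(a', x', b') \<in> triples n" for a x b a' x' b'
      using that closed by (simp add: h_diff h_of a_minus_def M.r_neg triples_def)
    have "h t = \<zero>\<^bsub>M\<^esub>"
      using t unfolding tensor_relations_def
      by (elim UnE CollectE exE conjE)
        (auto intro!: three two simp: triples_def add_left add_mid add_right bal_left bal_right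
          linear_span_add Span0_left_Span Span0_right_Span Span_in_lin[of _ 0])
    moreover have "t \<in> carrier (FG n)" using t tensor_relations_in by blast
    ultimately show "t \<in> kernel (FG n) (add_monoid M) h" unfolding kernel_def by simp
  qed
  have "tensor_null n \<subseteq> kernel (FG n) (add_monoid M) h"
    unfolding tensor_null_def
    by (rule h.generate_subgroup_incl[OF ker h.subgroup_kernel])
  then obtain f where f: "f \<in> hom (FG n Mod tensor_null n) (add_monoid M)"
    "\<And>x. x \<in> carrier (FG n) \<Longrightarrow> f (tensor_null n #>\<^bsub>FG n\<^esub> x) = h x"
    using h.FactGroup_universal_kernel[OF tensor_null_normal] by metis
  show thesis
  proof (rule that)
    show "f \<in> hom (add_monoid (P n)) (add_monoid M)" using f(1) by (simp add: P_hom_dom)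
    show "f (tensor n a x b) = F a x b" if "a \<in> carrier A" "x \<in> Span n" "b \<in> carrier A" for a x b
      using f(2)[of "frag_of (a, x, b)"] that h_of[of "(a, x, b)"] frag_of_in_FG[OF that]
      by (simp add: tensor_def tensor_class_def triples_def)
  qed
qed

subsection \<open>The bimodule structure\<close>

lemma tensor_hom_left: "x \<in> Span n \<Longrightarrow> b \<in> carrier A \<Longrightarrow> (\<lambda>a. tensor n a x b) \<in> hom (add_monoid A) (add_monoid (P n))"
  by (rule add_homI) (simp_all add: tensor_add_left)

lemma tensor_hom_right: "x \<in> Span n \<Longrightarrow> a \<in> carrier A \<Longrightarrow> (\<lambda>b. tensor n a x b) \<in> hom (add_monoid A) (add_monoid (P n))"
  by (rule add_homI) (simp_all add: tensor_add_right)

lemma tensor_zero_left: "x \<in> Span n \<Longrightarrow> b \<in> carrier A \<Longrightarrow> tensor n \<zero>\<^bsub>A\<^esub> x b = \<zero>\<^bsub>P n\<^esub>"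
  by (rule add_hom_zero[OF A.abelian_group_axioms P_abelian_group tensor_hom_left])

lemma tensor_uminus_left:
  "a \<in> carrier A \<Longrightarrow> x \<in> Span n \<Longrightarrow> b \<in> carrier A \<Longrightarrow> tensor n (\<ominus>\<^bsub>A\<^esub> a) x b = \<ominus>\<^bsub>P n\<^esub> tensor n a x b"
  by (rule add_hom_uminus[OF A.abelian_group_axioms P_abelian_group tensor_hom_left])

lemma tensor_zero_mid: "a \<in> carrier A \<Longrightarrow> b \<in> carrier A \<Longrightarrow> tensor n a 0 b = \<zero>\<^bsub>P n\<^esub>"
  using tensor_add_mid[of a 0 n 0 b] P.add.r_cancel_one'[of "tensor n a 0 b" n] by simp

lemma tensor_zero_right: "a \<in> carrier A \<Longrightarrow> x \<in> Span n \<Longrightarrow> tensor n a x \<zero>\<^bsub>A\<^esub> = \<zero>\<^bsub>P n\<^esub>"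
  by (rule add_hom_zero[OF A.abelian_group_axioms P_abelian_group tensor_hom_right])

lemma P_induct [consumes 1, case_names zero tensor plus]:
  assumes T: "T \<in> carrier (P n)" and zero: "H \<zero>\<^bsub>P n\<^esub>"
    and tensor: "\<And>a x b. a \<in> carrier A \<Longrightarrow> x \<in> Span n \<Longrightarrow> b \<in> carrier A \<Longrightarrow> H (tensor n a x b)"
    and plus: "\<And>x y. x \<in> carrier (P n) \<Longrightarrow> y \<in> carrier (P n) \<Longrightarrow> H x \<Longrightarrow> H y \<Longrightarrow> H (x \<oplus>\<^bsub>P n\<^esub> y)"
  shows "H T"
proof -
  have "H T \<and> H (\<ominus>\<^bsub>P n\<^esub> T)"
    using T
  proof (rule P_induct_minus)
    fix x y assume "x \<in> carrier (P n)" "y \<in> carrier (P n)" "H x \<and> H (\<ominus>\<^bsub>P n\<^esub> x)" "H y \<and> H (\<ominus>\<^bsub>P n\<^esub> y)"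
    then show "H (x \<ominus>\<^bsub>P n\<^esub> y) \<and> H (\<ominus>\<^bsub>P n\<^esub> (x \<ominus>\<^bsub>P n\<^esub> y))"
      by (simp add: a_minus_def plus P.minus_add)
  next
    have neg_zero: "\<ominus>\<^bsub>P n\<^esub> \<zero>\<^bsub>P n\<^esub> = \<zero>\<^bsub>P n\<^esub>" by (rule P.minus_equality) simp_all
    show "H \<zero>\<^bsub>P n\<^esub> \<and> H (\<ominus>\<^bsub>P n\<^esub> \<zero>\<^bsub>P n\<^esub>)" unfolding neg_zero using zero by blast
  qed (simp_all add: tensor tensor_uminus_left[symmetric])
  then show ?thesis by blast
qed

text \<open>
  The action is defined by a union over the representatives of a class. That they all give the same
  class is known once some additive map \<open>g\<close> has the right values on tensors.
\<close>

lemma smult_eq: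
  assumes a: "a \<in> carrier A" and g: "g \<in> hom (add_monoid (P n)) (add_monoid (P n))"
    and g_tensor: "\<And>a' x b. a' \<in> carrier A \<Longrightarrow> x \<in> Span n \<Longrightarrow> b \<in> carrier A \<Longrightarrow>
      g (tensor n a' x b) = tensor n (a \<otimes>\<^bsub>A\<^esub> a') x b"
    and T: "T \<in> carrier (P n)"
  shows "a \<odot>\<^bsub>P n\<^esub> T = g T"
proof -
  let ?L = "frag_extend (\<lambda>(a', x, b'). frag_of (a \<otimes>\<^bsub>A\<^esub> a', x, b'))"
  have L: "f \<in> carrier (FG n) \<and> ?L f \<in> carrier (FG n) \<and> tensor_class n (?L f) = g (tensor_class n f)"
    if "f \<in> carrier (FG n)" for f
    using that[unfolded carrier_free_Abelian_group_iff]
  proof (rule frag_induction)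
    fix t assume "t \<in> triples n"
    then obtain a' x b where t: "t = (a', x, b)" "a' \<in> carrier A" "x \<in> Span n" "b \<in> carrier A"
      by (auto simp: triples_def)
    then show "frag_of t \<in> carrier (FG n) \<and> ?L (frag_of t) \<in> carrier (FG n) \<and>
        tensor_class n (?L (frag_of t)) = g (tensor_class n (frag_of t))"
      using g_tensor[of a' x b] a unfolding tensor_def by (simp add: triples_def)
  qed (simp_all add: tensor_class_zero P_hom_zero[OF g] frag_extend_diff FG_diff
      tensor_class_diff P_hom_minus[OF g] tensor_class_closed
      del: carrier_free_Abelian_group_iff, simp)
  obtain f where f: "f \<in> carrier (FG n)" "T = tensor_class n f" using tensor_class_surj[OF T] by blast
  have "a \<odot>\<^bsub>P n\<^esub> T = (\<Union>f\<in>T. tensor_class n (?L f))" by (simp add: P_def Let_def)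
  also have "\<dots> = (\<Union>f'\<in>T. g T)"
  proof (rule SUP_cong[OF refl])
    fix f' assume "f' \<in> T"
    then show "tensor_class n (?L f') = g T" using tensor_class_mem[OF f(1), of f'] f L by metis
  qed
  also have "\<dots> = g T" using tensor_class_self[OF f(1)] f(2) by blast
  finally show ?thesis .
qed

lemma rsmult_eq:
  assumes a: "a \<in> carrier A" and g: "g \<in> hom (add_monoid (P n)) (add_monoid (P n))"
    and g_tensor: "\<And>a' x b. a' \<in> carrier A \<Longrightarrow> x \<in> Span n \<Longrightarrow> b \<in> carrier A \<Longrightarrow>
      g (tensor n a' x b) = tensor n a' x (b \<otimes>\<^bsub>A\<^esub> a)"
    and T: "T \<in> carrier (P n)"
  shows "T \<odot>\<^sub>r\<^bsub>P n\<^esub> a = g T"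
proof -
  let ?L = "frag_extend (\<lambda>(a', x, b'). frag_of (a', x, b' \<otimes>\<^bsub>A\<^esub> a))"
  have L: "f \<in> carrier (FG n) \<and> ?L f \<in> carrier (FG n) \<and> tensor_class n (?L f) = g (tensor_class n f)"
    if "f \<in> carrier (FG n)" for f
    using that[unfolded carrier_free_Abelian_group_iff]
  proof (rule frag_induction)
    fix t assume "t \<in> triples n"
    then obtain a' x b where t: "t = (a', x, b)" "a' \<in> carrier A" "x \<in> Span n" "b \<in> carrier A"
      by (auto simp: triples_def)
    then show "frag_of t \<in> carrier (FG n) \<and> ?L (frag_of t) \<in> carrier (FG n) \<and>
        tensor_class n (?L (frag_of t)) = g (tensor_class n (frag_of t))"
      using g_tensor[of a' x b] a unfolding tensor_def by (simp add: triples_def)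
  qed (simp_all add: tensor_class_zero P_hom_zero[OF g] frag_extend_diff FG_diff
      tensor_class_diff P_hom_minus[OF g] tensor_class_closed
      del: carrier_free_Abelian_group_iff, simp)
  obtain f where f: "f \<in> carrier (FG n)" "T = tensor_class n f" using tensor_class_surj[OF T] by blast
  have "T \<odot>\<^sub>r\<^bsub>P n\<^esub> a = (\<Union>f\<in>T. tensor_class n (?L f))" by (simp add: P_def Let_def)
  also have "\<dots> = (\<Union>f'\<in>T. g T)"
  proof (rule SUP_cong[OF refl])
    fix f' assume "f' \<in> T"
    then show "tensor_class n (?L f') = g T" using tensor_class_mem[OF f(1), of f'] f L by metis
  qed
  also have "\<dots> = g T" using tensor_class_self[OF f(1)] f(2) by blast
  finally show ?thesis .
qed

lemma smult_hom_tensor: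
  assumes a: "a \<in> carrier A"
  shows "(\<lambda>T. a \<odot>\<^bsub>P n\<^esub> T) \<in> hom (add_monoid (P n)) (add_monoid (P n)) \<and>
    (\<forall>a'\<in>carrier A. \<forall>x\<in>Span n. \<forall>b\<in>carrier A. a \<odot>\<^bsub>P n\<^esub> tensor n a' x b = tensor n (a \<otimes>\<^bsub>A\<^esub> a') x b)"
proof -
  obtain g where g: "g \<in> hom (add_monoid (P n)) (add_monoid (P n))"
    "\<And>a' x b. a' \<in> carrier A \<Longrightarrow> x \<in> Span n \<Longrightarrow> b \<in> carrier A \<Longrightarrow> g (tensor n a' x b) = tensor n (a \<otimes>\<^bsub>A\<^esub> a') x b"
    by (rule P_universal[OF P_abelian_group[of n], of n "\<lambda>a' x b. tensor n (a \<otimes>\<^bsub>A\<^esub> a') x b"])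
      (simp_all add: a A.r_distr tensor_add_left tensor_add_mid tensor_add_right tensor_balance_left[symmetric]
        tensor_balance_right A.m_assoc Span_in_lin[of _ 0])
  have eq: "a \<odot>\<^bsub>P n\<^esub> T = g T" if "T \<in> carrier (P n)" for T by (rule smult_eq[OF a g that])
  have "(\<lambda>T. a \<odot>\<^bsub>P n\<^esub> T) \<in> hom (add_monoid (P n)) (add_monoid (P n))"
    by (rule add_homI) (simp_all add: eq add_hom_closed[OF g(1)] add_hom_add[OF g(1)])
  then show ?thesis by (simp add: eq g(2))
qed

lemma rsmult_hom_tensor:
  assumes a: "a \<in> carrier A"
  shows "(\<lambda>T. T \<odot>\<^sub>r\<^bsub>P n\<^esub> a) \<in> hom (add_monoid (P n)) (add_monoid (P n)) \<and>
    (\<forall>a'\<in>carrier A. \<forall>x\<in>Span n. \<forall>b\<in>carrier A. tensor n a' x b \<odot>\<^sub>r\<^bsub>P n\<^esub> a = tensor n a' x (b \<otimes>\<^bsub>A\<^esub> a))"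
proof -
  obtain g where g: "g \<in> hom (add_monoid (P n)) (add_monoid (P n))"
    "\<And>a' x b. a' \<in> carrier A \<Longrightarrow> x \<in> Span n \<Longrightarrow> b \<in> carrier A \<Longrightarrow> g (tensor n a' x b) = tensor n a' x (b \<otimes>\<^bsub>A\<^esub> a)"
    by (rule P_universal[OF P_abelian_group[of n], of n "\<lambda>a' x b. tensor n a' x (b \<otimes>\<^bsub>A\<^esub> a)"])
      (simp_all add: a A.l_distr tensor_add_left tensor_add_mid tensor_add_right tensor_balance_left
        tensor_balance_right A.m_assoc Span_in_lin[of _ 0])
  have eq: "T \<odot>\<^sub>r\<^bsub>P n\<^esub> a = g T" if "T \<in> carrier (P n)" for T by (rule rsmult_eq[OF a g that])
  have "(\<lambda>T. T \<odot>\<^sub>r\<^bsub>P n\<^esub> a) \<in> hom (add_monoid (P n)) (add_monoid (P n))"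
    by (rule add_homI) (simp_all add: eq add_hom_closed[OF g(1)] add_hom_add[OF g(1)])
  then show ?thesis by (simp add: eq g(2))
qed

lemma smult_hom: "a \<in> carrier A \<Longrightarrow> (\<lambda>T. a \<odot>\<^bsub>P n\<^esub> T) \<in> hom (add_monoid (P n)) (add_monoid (P n))"
  using smult_hom_tensor by blast

lemma rsmult_hom: "a \<in> carrier A \<Longrightarrow> (\<lambda>T. T \<odot>\<^sub>r\<^bsub>P n\<^esub> a) \<in> hom (add_monoid (P n)) (add_monoid (P n))"
  using rsmult_hom_tensor by blast

lemma smult_tensor [simp]: "a \<in> carrier A \<Longrightarrow> a' \<in> carrier A \<Longrightarrow> x \<in> Span n \<Longrightarrow> b \<in> carrier A \<Longrightarrow>
    a \<odot>\<^bsub>P n\<^esub> tensor n a' x b = tensor n (a \<otimes>\<^bsub>A\<^esub> a') x b"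
  using smult_hom_tensor by blast

lemma rsmult_tensor [simp]: "a \<in> carrier A \<Longrightarrow> a' \<in> carrier A \<Longrightarrow> x \<in> Span n \<Longrightarrow> b \<in> carrier A \<Longrightarrow>
    tensor n a' x b \<odot>\<^sub>r\<^bsub>P n\<^esub> a = tensor n a' x (b \<otimes>\<^bsub>A\<^esub> a)"
  using rsmult_hom_tensor by blast

lemma smult_scalar_tensor:
  assumes "a \<in> carrier A" "x \<in> Span n" "b \<in> carrier A"
  shows "tensor n (a \<otimes>\<^bsub>A\<^esub> \<kappa> c) x b = tensor n a (scale c x) b"
    and "tensor n a x (\<kappa> c \<otimes>\<^bsub>A\<^esub> b) = tensor n a (scale c x) b"
proof -
  have c: "scale c \<one>\<^bsub>kQ\<^esub> \<in> Span 0" by (intro linear_span_scale one_in_Span)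
  have x: "x \<in> lin" using assms Span_in_lin by blast
  show "tensor n (a \<otimes>\<^bsub>A\<^esub> \<kappa> c) x b = tensor n a (scale c x) b"
    using tensor_balance_left[OF assms(1) c assms(2,3)] x by (simp add: \<kappa>_def pmult_scale_left)
  show "tensor n a x (\<kappa> c \<otimes>\<^bsub>A\<^esub> b) = tensor n a (scale c x) b"
    using tensor_balance_right[OF assms(1,2) c assms(3)] x by (simp add: \<kappa>_def pmult_scale_right)
qed

lemma P_bimodule: "bimodule scalars A (P n)"
proof -
  note homs = add_hom_closed[OF smult_hom] add_hom_closed[OF rsmult_hom]
    add_hom_add[OF smult_hom] add_hom_add[OF rsmult_hom]
    P_hom_zero[OF smult_hom]
    P_hom_zero[OF rsmult_hom]
  show ?thesis
  proof (intro bimodule.intro bimodule_axioms.intro A_ring P_abelian_group)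
    fix a b x y assume a: "a \<in> carrier A" and b: "b \<in> carrier A" and x: "x \<in> carrier (P n)" and y: "y \<in> carrier (P n)"
    show "(a \<oplus>\<^bsub>A\<^esub> b) \<odot>\<^bsub>P n\<^esub> x = a \<odot>\<^bsub>P n\<^esub> x \<oplus>\<^bsub>P n\<^esub> b \<odot>\<^bsub>P n\<^esub> x"
      using x by (induction x rule: P_induct) (simp_all add: homs a b A.l_distr tensor_add_left P.a_ac)
    show "(a \<otimes>\<^bsub>A\<^esub> b) \<odot>\<^bsub>P n\<^esub> x = a \<odot>\<^bsub>P n\<^esub> (b \<odot>\<^bsub>P n\<^esub> x)"
      using x by (induction x rule: P_induct) (simp_all add: homs a b A.m_assoc)
    show "x \<odot>\<^sub>r\<^bsub>P n\<^esub> (a \<oplus>\<^bsub>A\<^esub> b) = x \<odot>\<^sub>r\<^bsub>P n\<^esub> a \<oplus>\<^bsub>P n\<^esub> x \<odot>\<^sub>r\<^bsub>P n\<^esub> b"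
      using x by (induction x rule: P_induct) (simp_all add: homs a b A.r_distr tensor_add_right P.a_ac)
    show "x \<odot>\<^sub>r\<^bsub>P n\<^esub> (a \<otimes>\<^bsub>A\<^esub> b) = (x \<odot>\<^sub>r\<^bsub>P n\<^esub> a) \<odot>\<^sub>r\<^bsub>P n\<^esub> b"
      using x by (induction x rule: P_induct) (simp_all add: homs a b A.m_assoc)
    show "(a \<odot>\<^bsub>P n\<^esub> x) \<odot>\<^sub>r\<^bsub>P n\<^esub> b = a \<odot>\<^bsub>P n\<^esub> (x \<odot>\<^sub>r\<^bsub>P n\<^esub> b)"
      using x by (induction x rule: P_induct) (simp_all add: homs a b)
  next
    fix x assume x: "x \<in> carrier (P n)"
    show "\<one>\<^bsub>A\<^esub> \<odot>\<^bsub>P n\<^esub> x = x"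
      using x by (induction x rule: P_induct) (simp_all add: homs)
    show "x \<odot>\<^sub>r\<^bsub>P n\<^esub> \<one>\<^bsub>A\<^esub> = x"
      using x by (induction x rule: P_induct) (simp_all add: homs)
    fix c assume "c \<in> scalars"
    then obtain k where c: "c = \<kappa> k" by (auto simp: scalars_eq)
    show "c \<odot>\<^bsub>P n\<^esub> x = x \<odot>\<^sub>r\<^bsub>P n\<^esub> c"
      unfolding c using x
      by (induction x rule: P_induct)
        (simp_all add: homs \<kappa>_comm smult_scalar_tensor, simp_all add: \<kappa>_comm[symmetric] smult_scalar_tensor)
  qed (simp_all add: homs)
qed

end

section \<open>Maps out of $P_n$\<close>

lemma bimod_hom_left: "f \<in> bimod_hom R M N \<Longrightarrow> f \<in> left_hom R M N"
  by (simp add: bimod_hom_def)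

lemma left_hom_add: "f \<in> left_hom R M N \<Longrightarrow> f \<in> hom (add_monoid M) (add_monoid N)"
  by (simp add: left_hom_def)

lemma bimod_hom_add: "f \<in> bimod_hom R M N \<Longrightarrow> f \<in> hom (add_monoid M) (add_monoid N)"
  by (simp add: left_hom_def bimod_hom_def)

lemma left_hom_smult: "f \<in> left_hom R M N \<Longrightarrow> a \<in> carrier R \<Longrightarrow> x \<in> carrier M \<Longrightarrow> f (a \<odot>\<^bsub>M\<^esub> x) = a \<odot>\<^bsub>N\<^esub> f x"
  by (simp add: left_hom_def)

lemma bimod_hom_rsmult: "f \<in> bimod_hom R M N \<Longrightarrow> a \<in> carrier R \<Longrightarrow> x \<in> carrier M \<Longrightarrow> f (x \<odot>\<^sub>r\<^bsub>M\<^esub> a) = f x \<odot>\<^sub>r\<^bsub>N\<^esub> a"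
  by (simp add: bimod_hom_def)

lemma bimod_homI:
  assumes "f \<in> hom (add_monoid M) (add_monoid N)"
    and "\<And>a x. a \<in> carrier R \<Longrightarrow> x \<in> carrier M \<Longrightarrow> f (a \<odot>\<^bsub>M\<^esub> x) = a \<odot>\<^bsub>N\<^esub> f x"
    and "\<And>a x. a \<in> carrier R \<Longrightarrow> x \<in> carrier M \<Longrightarrow> f (x \<odot>\<^sub>r\<^bsub>M\<^esub> a) = f x \<odot>\<^sub>r\<^bsub>N\<^esub> a"
  shows "f \<in> bimod_hom R M N"
  using assms by (simp add: bimod_hom_def left_hom_def)

context bimodule
begin

lemma lact_hom: "a \<in> carrier R \<Longrightarrow> (\<lambda>x. a \<odot>\<^bsub>M\<^esub> x) \<in> hom (add_monoid M) (add_monoid M)"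
  by (rule add_homI) (simp_all add: lact_closed lact_add_right)

lemma ract_hom: "a \<in> carrier R \<Longrightarrow> (\<lambda>x. x \<odot>\<^sub>r\<^bsub>M\<^esub> a) \<in> hom (add_monoid M) (add_monoid M)"
  by (rule add_homI) (simp_all add: ract_closed ract_add_left)

lemma lact_hom_left: "x \<in> carrier M \<Longrightarrow> (\<lambda>a. a \<odot>\<^bsub>M\<^esub> x) \<in> hom (add_monoid R) (add_monoid M)"
  by (rule add_homI) (simp_all add: lact_closed lact_add_left)

lemmas lact_zero = add_hom_zero[OF M.abelian_group_axioms M.abelian_group_axioms lact_hom]
lemmas ract_zero = add_hom_zero[OF M.abelian_group_axioms M.abelian_group_axioms ract_hom]
lemmas zero_lact = add_hom_zero[OF R.abelian_group_axioms M.abelian_group_axioms lact_hom_left]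
lemmas lact_minus = add_hom_minus[OF M.abelian_group_axioms M.abelian_group_axioms lact_hom]
lemmas ract_minus = add_hom_minus[OF M.abelian_group_axioms M.abelian_group_axioms ract_hom]
lemmas lact_finsum = add_hom_finsum[OF M.abelian_group_axioms M.abelian_group_axioms lact_hom]
lemmas ract_finsum = add_hom_finsum[OF M.abelian_group_axioms M.abelian_group_axioms ract_hom]

end

context diamond_system
begin

interpretation A: ring A by (rule A_ring)

lemmas A_abelian_group = A.abelian_group_axioms
lemmas A_l_distr = A.l_distr and A_r_distr = A.r_distr and A_m_assoc = A.m_assoc

end

sublocale diamond_system \<subseteq> P: bimodule scalars A "P n" for n
  by (rule P_bimodule)

context diamond_system
begin

interpretation I: ideal I kQ by (rule ideal_I)
interpretation A: ring A by (rule A_ring)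

abbreviation idem :: "'v \<Rightarrow> ('v, 'e, 'k) quot_elem" where
  "idem v \<equiv> \<pi> (pe (trivial v))"

lemma SS_path: "w \<in> SS n \<Longrightarrow> w \<in> paths Q"
  using overlap_in_paths by blast

lemma trivial_src: "p \<in> paths Q \<Longrightarrow> trivial (src p) \<in> paths Q"
  by (simp add: trivial_path src_in_verts)

lemma trivial_tgt: "p \<in> paths Q \<Longrightarrow> trivial (tgt Q p) \<in> paths Q"
  by (simp add: trivial_path tgt_in_verts)

lemma idem_src_closed: "p \<in> paths Q \<Longrightarrow> idem (src p) \<in> carrier A"
  by (simp add: trivial_src)

lemma idem_tgt_closed: "p \<in> paths Q \<Longrightarrow> idem (tgt Q p) \<in> carrier A"
  by (simp add: trivial_tgt)

lemma idem_mult_single: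
  assumes "p \<in> paths Q" "v \<in> verts Q"
  shows "idem v \<otimes>\<^bsub>A\<^esub> \<pi> (single p c) = (if v = src p then \<pi> (single p c) else \<zero>\<^bsub>A\<^esub>)"
  using assms by (subst \<pi>_mult[symmetric]) (auto simp: trivial_path pmult_single pcat_trivial_left)

lemma single_mult_idem:
  assumes "p \<in> paths Q" "v \<in> verts Q"
  shows "\<pi> (single p c) \<otimes>\<^bsub>A\<^esub> idem v = (if tgt Q p = v then \<pi> (single p c) else \<zero>\<^bsub>A\<^esub>)"
  using assms by (subst \<pi>_mult[symmetric]) (auto simp: trivial_path pmult_single src_def)

lemma single_mult_single:
  assumes "p \<in> paths Q" "q \<in> paths Q" "tgt Q p = src q"
  shows "\<pi> (single p c) \<otimes>\<^bsub>A\<^esub> \<pi> (single q d) = \<pi> (single (pcat p q) (c * d))"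
  using assms by (subst \<pi>_mult[symmetric]) (auto simp: pmult_single)

lemma pe_in_Span [simp]: "w \<in> SS n \<Longrightarrow> pe w \<in> Span n"
  by (rule single_in_Span)

lemma tensor_single:
  assumes "a \<in> carrier A" "w \<in> SS n" "b \<in> carrier A"
  shows "tensor n a (single w c) b = tensor n (a \<otimes>\<^bsub>A\<^esub> \<kappa> c) (pe w) b"
  using smult_scalar_tensor(1)[OF assms(1) pe_in_Span[OF assms(2)] assms(3), of c] by simp

lemma tensor_scalar_swap:
  assumes "a \<in> carrier A" "x \<in> Span n" "b \<in> carrier A"
  shows "tensor n a x (\<kappa> c \<otimes>\<^bsub>A\<^esub> b) = tensor n (a \<otimes>\<^bsub>A\<^esub> \<kappa> c) x b"
  using smult_scalar_tensor[OF assms] by simp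

lemma P_induct_pe [consumes 1, case_names zero tensor plus]:
  assumes T: "T \<in> carrier (P n)" and zero: "H \<zero>\<^bsub>P n\<^esub>"
    and tensor: "\<And>a w b. a \<in> carrier A \<Longrightarrow> w \<in> SS n \<Longrightarrow> b \<in> carrier A \<Longrightarrow> H (tensor n a (pe w) b)"
    and plus: "\<And>x y. x \<in> carrier (P n) \<Longrightarrow> y \<in> carrier (P n) \<Longrightarrow> H x \<Longrightarrow> H y \<Longrightarrow> H (x \<oplus>\<^bsub>P n\<^esub> y)"
  shows "H T"
  using T
proof (induction T rule: P_induct)
  case (tensor a x b)
  show ?case
    using tensor(2)
  proof (induction x rule: linear_span_induct)
    case (single w c)
    show ?case
      unfolding tensor_single[OF tensor(1) single tensor(3)]
      by (rule assms(3)) (use tensor single in simp_all)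
  qed (use tensor in \<open>simp_all add: tensor_zero_mid zero tensor_add_mid plus\<close>)
qed (simp_all add: zero plus)

lemma P_hom_eq_pe:
  assumes f: "f \<in> hom (add_monoid (P n)) (add_monoid M)" and g: "g \<in> hom (add_monoid (P n)) (add_monoid M)"
    and M: "abelian_group M"
    and eq: "\<And>a w b. a \<in> carrier A \<Longrightarrow> w \<in> SS n \<Longrightarrow> b \<in> carrier A \<Longrightarrow> f (tensor n a (pe w) b) = g (tensor n a (pe w) b)"
    and x: "x \<in> carrier (P n)"
  shows "f x = g x"
  using x
  by (induction x rule: P_induct_pe)
    (simp_all add: add_hom_zero[OF P_abelian_group M f] add_hom_zero[OF P_abelian_group M g] eq
      add_hom_add[OF f] add_hom_add[OF g])

lemma tensor_idem_left:
  "a \<in> carrier A \<Longrightarrow> w \<in> SS n \<Longrightarrow> b \<in> carrier A \<Longrightarrow> tensor n (a \<otimes>\<^bsub>A\<^esub> idem (src w)) (pe w) b = tensor n a (pe w) b"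
  using tensor_balance_left[of a "pe (trivial (src w))" "pe w" n b] SS_path[of w n]
  by (simp add: trivial_in_SS src_in_verts pmult_single pcat_trivial_left)

lemma tensor_idem_right:
  "a \<in> carrier A \<Longrightarrow> w \<in> SS n \<Longrightarrow> b \<in> carrier A \<Longrightarrow> tensor n a (pe w) (idem (tgt Q w) \<otimes>\<^bsub>A\<^esub> b) = tensor n a (pe w) b"
  using tensor_balance_right[of a "pe w" n "pe (trivial (tgt Q w))" b] SS_path[of w n]
  by (simp add: trivial_in_SS tgt_in_verts pmult_single) (simp add: src_def)

definition composable :: "nat \<Rightarrow> (('v, 'e) path \<times> ('v, 'e) path \<times> ('v, 'e) path) set" where
  "composable n = {(q, w, r). q \<in> paths Q \<and> w \<in> SS n \<and> r \<in> paths Q \<and> tgt Q q = src w \<and> tgt Q w = src r}"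

definition tm :: "nat \<Rightarrow> 'k \<Rightarrow> ('v, 'e) path \<times> ('v, 'e) path \<times> ('v, 'e) path \<Rightarrow> ('v, 'e, 'k) tens" where
  "tm n c t = (case t of (q, w, r) \<Rightarrow> tensor n (\<pi> (single q c)) (pe w) (\<pi> (pe r)))"

lemma tm_closed [simp]: "t \<in> composable n \<Longrightarrow> tm n c t \<in> carrier (P n)"
  by (auto simp: tm_def composable_def)

lemma P_induct_tm [consumes 1, case_names zero tm plus]:
  assumes T: "T \<in> carrier (P n)" and zero: "H \<zero>\<^bsub>P n\<^esub>"
    and tm: "\<And>q w u c. (q, w, u) \<in> composable n \<Longrightarrow> u \<in> Irr \<Longrightarrow> H (tm n c (q, w, u))"
    and plus: "\<And>x y. x \<in> carrier (P n) \<Longrightarrow> y \<in> carrier (P n) \<Longrightarrow> H x \<Longrightarrow> H y \<Longrightarrow> H (x \<oplus>\<^bsub>P n\<^esub> y)"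
  shows "H T"
  using T
proof (induction T rule: P_induct_pe)
  case (tensor a w b)
  note w = tensor(2) and b = tensor(3)
  have wp: "w \<in> paths Q" using SS_path w by blast
  have base: "H (tensor n (\<pi> (single q c)) (pe w) (\<pi> (single u d)))" if qu: "q \<in> paths Q" "u \<in> Irr" for q c u d
  proof -
    have up: "u \<in> paths Q" using that irreducible_in_paths by blast
    have eq: "tensor n (\<pi> (single q c)) (pe w) (\<pi> (single u d)) = tensor n (\<pi> (single q (c * d))) (pe w) (\<pi> (pe u))"
      using that up w tensor_scalar_swap[of "\<pi> (single q c)" "pe w" n "\<pi> (pe u)" d]
      by (simp add: \<kappa>_left \<kappa>_right mult.commute)
    consider "tgt Q q \<noteq> src w" | "tgt Q w \<noteq> src u" | "(q, w, u) \<in> composable n"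
      using qu up w by (auto simp: composable_def)
    then show ?thesis
    proof cases
      case 1
      then have "\<pi> (single q (c * d)) \<otimes>\<^bsub>A\<^esub> idem (src w) = \<zero>\<^bsub>A\<^esub>"
        using single_mult_idem[of q "src w"] that src_in_verts[OF wp] by simp
      then show ?thesis
        using tensor_idem_left[of "\<pi> (single q (c * d))" w n "\<pi> (pe u)"] that up w zero eq
        by (simp add: tensor_zero_left)
    next
      case 2
      then have "idem (tgt Q w) \<otimes>\<^bsub>A\<^esub> \<pi> (pe u) = \<zero>\<^bsub>A\<^esub>"
        using idem_mult_single[of u "tgt Q w" 1] up tgt_in_verts[OF wp] by simp
      then show ?thesis
        using tensor_idem_right[of "\<pi> (single q (c * d))" w n "\<pi> (pe u)"] that up w zero eq
        by (simp add: tensor_zero_right)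
    next
      case 3
      then show ?thesis using tm[OF 3 that(2)] eq by (simp add: tm_def)
    qed
  qed
  have "H (tensor n (\<pi> (single q c)) (pe w) b)" if "q \<in> paths Q" for q c
    using b
    by (rule A_induct_irreducible) (use that w in \<open>simp_all add: tensor_zero_right zero tensor_add_right plus base\<close>)
  then show ?case
    using tensor(1)
    by (intro A_induct[where a = a and H = "\<lambda>a. H (tensor n a (pe w) b)"])
      (use w b in \<open>simp_all add: tensor_zero_left zero tensor_add_left plus\<close>)
qed (simp_all add: zero plus)

text \<open>
  The middle factor has the basis $S_n$, so a map can be prescribed at basis elements. Of the balancing
  conditions there remain those for scalars and for the idempotents at the two ends of \<open>w\<close>.
\<close>

lemma P_lift:
  assumes M: "abelian_group M"
    and closed: "\<And>w a b. w \<in> SS n \<Longrightarrow> a \<in> carrier A \<Longrightarrow> b \<in> carrier A \<Longrightarrow> F w a b \<in> carrier M"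
    and add_left: "\<And>w a a' b. w \<in> SS n \<Longrightarrow> a \<in> carrier A \<Longrightarrow> a' \<in> carrier A \<Longrightarrow> b \<in> carrier A \<Longrightarrow>
      F w (a \<oplus>\<^bsub>A\<^esub> a') b = F w a b \<oplus>\<^bsub>M\<^esub> F w a' b"
    and add_right: "\<And>w a b b'. w \<in> SS n \<Longrightarrow> a \<in> carrier A \<Longrightarrow> b \<in> carrier A \<Longrightarrow> b' \<in> carrier A \<Longrightarrow>
      F w a (b \<oplus>\<^bsub>A\<^esub> b') = F w a b \<oplus>\<^bsub>M\<^esub> F w a b'"
    and scalar: "\<And>w a b c. w \<in> SS n \<Longrightarrow> a \<in> carrier A \<Longrightarrow> b \<in> carrier A \<Longrightarrow>
      F w (a \<otimes>\<^bsub>A\<^esub> \<kappa> c) b = F w a (\<kappa> c \<otimes>\<^bsub>A\<^esub> b)"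
    and src: "\<And>w a b. w \<in> SS n \<Longrightarrow> a \<in> carrier A \<Longrightarrow> b \<in> carrier A \<Longrightarrow>
      F w (a \<otimes>\<^bsub>A\<^esub> idem (src w)) b = F w a b"
    and tgt: "\<And>w a b. w \<in> SS n \<Longrightarrow> a \<in> carrier A \<Longrightarrow> b \<in> carrier A \<Longrightarrow>
      F w a (idem (tgt Q w) \<otimes>\<^bsub>A\<^esub> b) = F w a b"
  shows "\<exists>f. f \<in> hom (add_monoid (P n)) (add_monoid M) \<and> f \<in> extensional (carrier (P n)) \<and>
    (\<forall>w\<in>SS n. \<forall>a\<in>carrier A. \<forall>b\<in>carrier A. f (tensor n a (pe w) b) = F w a b)"
proof -
  interpret M: abelian_group M by (rule M)
  \<comment> \<open>The middle factor is expanded in the basis, and its coefficients are moved to the left.\<close>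
  define G where "G a x b = (\<Oplus>\<^bsub>M\<^esub>w\<in>supp x. F w (a \<otimes>\<^bsub>A\<^esub> \<kappa> (coeff x w)) b)" for a x b
  have zero: "F w \<zero>\<^bsub>A\<^esub> b = \<zero>\<^bsub>M\<^esub>" if "w \<in> SS n" "b \<in> carrier A" for w b
    by (rule add_hom_zero[OF A_abelian_group M, of "\<lambda>a. F w a b"]) (rule add_homI; simp add: that closed add_left)
  have supp_SS: "w \<in> SS n" if "x \<in> Span n" "w \<in> supp x" for x w
    using that by (auto simp: linear_span_def)
  have G_superset: "G a x b = (\<Oplus>\<^bsub>M\<^esub>w\<in>B. F w (a \<otimes>\<^bsub>A\<^esub> \<kappa> (coeff x w)) b)"
    if "finite B" "supp x \<subseteq> B" "B \<subseteq> SS n" "a \<in> carrier A" "b \<in> carrier A" for a x b B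
    unfolding G_def
    by (rule M.finsum_mono_neutral)
      (use that zero in \<open>auto simp: in_keys_iff Pi_def subset_iff intro!: closed\<close>)
  have x_in: "supp x \<subseteq> SS n" if "x \<in> Span n" for x using that by (simp add: linear_span_def)
  have cl: "(\<lambda>w. F w (a \<otimes>\<^bsub>A\<^esub> \<kappa> (c w)) b) \<in> supp x \<rightarrow> carrier M"
    if "x \<in> Span n" "a \<in> carrier A" "b \<in> carrier A" for x a b c
    using that supp_SS by (auto intro!: closed)
  obtain f where f: "f \<in> hom (add_monoid (P n)) (add_monoid M)"
    "\<And>a x b. a \<in> carrier A \<Longrightarrow> x \<in> Span n \<Longrightarrow> b \<in> carrier A \<Longrightarrow> f (tensor n a x b) = G a x b"
  proof (rule P_universal[OF M, of n G])
    fix a x b assume a: "a \<in> carrier A" and x: "x \<in> Span n" and b: "b \<in> carrier A"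
    show "G a x b \<in> carrier M" unfolding G_def by (rule M.finsum_closed, rule cl[OF x a b])
    show "G (a \<oplus>\<^bsub>A\<^esub> a') x b = G a x b \<oplus>\<^bsub>M\<^esub> G a' x b" if a': "a' \<in> carrier A" for a'
      unfolding G_def M.finsum_addf[OF cl[OF x a b] cl[OF x a' b], symmetric]
      by (rule M.finsum_cong')
        (use x a a' b supp_SS[OF x] in \<open>auto simp: A_l_distr add_left intro!: closed\<close>)
    show "G a x (b \<oplus>\<^bsub>A\<^esub> b') = G a x b \<oplus>\<^bsub>M\<^esub> G a x b'" if b': "b' \<in> carrier A" for b'
      unfolding G_def M.finsum_addf[OF cl[OF x a b] cl[OF x a b'], symmetric]
      by (rule M.finsum_cong')
        (use x a b' b supp_SS[OF x] in \<open>auto simp: add_right intro!: closed\<close>)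
    show "G a (x + x') b = G a x b \<oplus>\<^bsub>M\<^esub> G a x' b" if x': "x' \<in> Span n" for x'
    proof -
      let ?B = "supp x \<union> supp x'"
      have B: "finite ?B" "?B \<subseteq> SS n" using x_in[OF x] x_in[OF x'] by auto
      have "G a (x + x') b = (\<Oplus>\<^bsub>M\<^esub>w\<in>?B. F w (a \<otimes>\<^bsub>A\<^esub> \<kappa> (coeff (x + x') w)) b)"
        by (rule G_superset) (use B keys_add[of x x'] a b in auto)
      also have "\<dots> = (\<Oplus>\<^bsub>M\<^esub>w\<in>?B. F w (a \<otimes>\<^bsub>A\<^esub> \<kappa> (coeff x w)) b \<oplus>\<^bsub>M\<^esub> F w (a \<otimes>\<^bsub>A\<^esub> \<kappa> (coeff x' w)) b)"
        by (rule M.finsum_cong')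
          (use B(2) a b in \<open>auto simp: lookup_add \<kappa>_add A_r_distr add_left subset_iff intro!: closed\<close>)
      also have "\<dots> = (\<Oplus>\<^bsub>M\<^esub>w\<in>?B. F w (a \<otimes>\<^bsub>A\<^esub> \<kappa> (coeff x w)) b) \<oplus>\<^bsub>M\<^esub> (\<Oplus>\<^bsub>M\<^esub>w\<in>?B. F w (a \<otimes>\<^bsub>A\<^esub> \<kappa> (coeff x' w)) b)"
        by (rule M.finsum_addf) (use B(2) a b in \<open>auto intro!: closed\<close>)
      also have "\<dots> = G a x b \<oplus>\<^bsub>M\<^esub> G a x' b"
        using G_superset[OF B(1) _ B(2) a b, of x] G_superset[OF B(1) _ B(2) a b, of x'] by simp
      finally show ?thesis .
    qed
    fix e assume e: "e \<in> Span 0"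
    have el: "e \<in> lin" using e Span_in_lin by blast
    have "G a (e \<star> x) b = (\<Oplus>\<^bsub>M\<^esub>w\<in>supp x. F w (a \<otimes>\<^bsub>A\<^esub> \<kappa> (coeff (e \<star> x) w)) b)"
      by (rule G_superset) (use x_in[OF x] a b in \<open>auto simp: in_keys_iff coeff_Span0_left[OF e x]\<close>)
    also have "\<dots> = (\<Oplus>\<^bsub>M\<^esub>w\<in>supp x. F w (a \<otimes>\<^bsub>A\<^esub> \<pi> e \<otimes>\<^bsub>A\<^esub> \<kappa> (coeff x w)) b)"
    proof (rule M.finsum_cong'[OF refl])
      show "(\<lambda>w. F w (a \<otimes>\<^bsub>A\<^esub> \<pi> e \<otimes>\<^bsub>A\<^esub> \<kappa> (coeff x w)) b) \<in> supp x \<rightarrow> carrier M"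
        using a b el supp_SS[OF x] by (auto intro!: closed)
      fix w assume "w \<in> supp x"
      then have w: "w \<in> SS n" using supp_SS x by blast
      note wp = SS_path[OF w]
      have cl: "idem (src w) \<in> carrier A" by (rule idem_src_closed[OF wp])
      have "\<pi> e \<otimes>\<^bsub>A\<^esub> \<kappa> (coeff x w) \<otimes>\<^bsub>A\<^esub> idem (src w) = \<pi> e \<otimes>\<^bsub>A\<^esub> \<pi> (single (trivial (src w)) (coeff x w))"
        using el trivial_src[OF wp] by (simp add: A_m_assoc \<kappa>_left)
      also have "\<dots> = \<pi> (single (trivial (src w)) (coeff (e \<star> x) w))"
        using el trivial_src[OF wp]
        by (subst \<pi>_mult[symmetric]) (simp_all add: Span0_left[OF e] coeff_Span0_left[OF e x] src_def)
      also have "\<dots> = \<kappa> (coeff (e \<star> x) w) \<otimes>\<^bsub>A\<^esub> idem (src w)"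
        using trivial_src[OF wp] by (simp add: \<kappa>_left)
      finally have "a \<otimes>\<^bsub>A\<^esub> \<pi> e \<otimes>\<^bsub>A\<^esub> \<kappa> (coeff x w) \<otimes>\<^bsub>A\<^esub> idem (src w) = a \<otimes>\<^bsub>A\<^esub> \<kappa> (coeff (e \<star> x) w) \<otimes>\<^bsub>A\<^esub> idem (src w)"
        using a el cl by (simp add: A_m_assoc)
      then show "F w (a \<otimes>\<^bsub>A\<^esub> \<kappa> (coeff (e \<star> x) w)) b = F w (a \<otimes>\<^bsub>A\<^esub> \<pi> e \<otimes>\<^bsub>A\<^esub> \<kappa> (coeff x w)) b"
        using src[OF w, of "a \<otimes>\<^bsub>A\<^esub> \<pi> e \<otimes>\<^bsub>A\<^esub> \<kappa> (coeff x w)" b] src[OF w, of "a \<otimes>\<^bsub>A\<^esub> \<kappa> (coeff (e \<star> x) w)" b] a b el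
        by simp
    qed
    finally show "G (a \<otimes>\<^bsub>A\<^esub> \<pi> e) x b = G a (e \<star> x) b" by (simp add: G_def)
    have "G a (x \<star> e) b = (\<Oplus>\<^bsub>M\<^esub>w\<in>supp x. F w (a \<otimes>\<^bsub>A\<^esub> \<kappa> (coeff (x \<star> e) w)) b)"
      by (rule G_superset) (use x_in[OF x] a b in \<open>auto simp: in_keys_iff coeff_Span0_right[OF e x]\<close>)
    also have "\<dots> = (\<Oplus>\<^bsub>M\<^esub>w\<in>supp x. F w (a \<otimes>\<^bsub>A\<^esub> \<kappa> (coeff x w)) (\<pi> e \<otimes>\<^bsub>A\<^esub> b))"
    proof (rule M.finsum_cong'[OF refl])
      show "(\<lambda>w. F w (a \<otimes>\<^bsub>A\<^esub> \<kappa> (coeff x w)) (\<pi> e \<otimes>\<^bsub>A\<^esub> b)) \<in> supp x \<rightarrow> carrier M"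
        using a b el supp_SS[OF x] by (auto intro!: closed)
      fix w assume "w \<in> supp x"
      then have w: "w \<in> SS n" using supp_SS x by blast
      note wp = SS_path[OF w]
      let ?t = "trivial (tgt Q w)" and ?c = "coeff e (trivial (tgt Q w))"
      have cl: "idem (tgt Q w) \<in> carrier A" by (rule idem_tgt_closed[OF wp])
      have "idem (tgt Q w) \<otimes>\<^bsub>A\<^esub> \<pi> e = \<pi> (single ?t ?c)"
        using el trivial_tgt[OF wp] by (subst \<pi>_mult[symmetric]) (simp_all add: Span0_right[OF e])
      also have "\<dots> = idem (tgt Q w) \<otimes>\<^bsub>A\<^esub> \<kappa> ?c"
        using trivial_tgt[OF wp] by (simp add: \<kappa>_right)
      finally have "idem (tgt Q w) \<otimes>\<^bsub>A\<^esub> (\<pi> e \<otimes>\<^bsub>A\<^esub> b) = idem (tgt Q w) \<otimes>\<^bsub>A\<^esub> (\<kappa> ?c \<otimes>\<^bsub>A\<^esub> b)"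
        using b el cl by (simp add: A_m_assoc[symmetric])
      then have "F w (a \<otimes>\<^bsub>A\<^esub> \<kappa> (coeff x w)) (\<pi> e \<otimes>\<^bsub>A\<^esub> b) = F w (a \<otimes>\<^bsub>A\<^esub> \<kappa> (coeff x w)) (\<kappa> ?c \<otimes>\<^bsub>A\<^esub> b)"
        using tgt[OF w, of "a \<otimes>\<^bsub>A\<^esub> \<kappa> (coeff x w)" "\<pi> e \<otimes>\<^bsub>A\<^esub> b"] tgt[OF w, of "a \<otimes>\<^bsub>A\<^esub> \<kappa> (coeff x w)" "\<kappa> ?c \<otimes>\<^bsub>A\<^esub> b"] a b el
        by simp
      also have "\<dots> = F w (a \<otimes>\<^bsub>A\<^esub> \<kappa> (coeff (x \<star> e) w)) b"
        using scalar[OF w, of "a \<otimes>\<^bsub>A\<^esub> \<kappa> (coeff x w)" b ?c] a b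
        by (simp add: coeff_Span0_right[OF e x] \<kappa>_mult A_m_assoc)
      finally show "F w (a \<otimes>\<^bsub>A\<^esub> \<kappa> (coeff (x \<star> e) w)) b = F w (a \<otimes>\<^bsub>A\<^esub> \<kappa> (coeff x w)) (\<pi> e \<otimes>\<^bsub>A\<^esub> b)" by simp
    qed
    finally show "G a (x \<star> e) b = G a x (\<pi> e \<otimes>\<^bsub>A\<^esub> b)" by (simp add: G_def)
  qed (rule that, assumption, simp)
  have f_pe: "f (tensor n a (pe w) b) = F w a b" if "w \<in> SS n" "a \<in> carrier A" "b \<in> carrier A" for w a b
    using that f(2)[of a "pe w" b] G_superset[of "{w}" "pe w" a b] closed[OF that]
    by (simp add: M.finsum_insert)
  show ?thesis
  proof (intro exI[of _ "restrict f (carrier (P n))"] conjI ballI)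
    show "restrict f (carrier (P n)) \<in> hom (add_monoid (P n)) (add_monoid M)"
      using f(1) by (auto simp: hom_def)
    show "restrict f (carrier (P n)) (tensor n a (pe w) b) = F w a b"
      if "w \<in> SS n" "a \<in> carrier A" "b \<in> carrier A" for w a b
      using f_pe that by simp
  qed simp
qed

lemma bimod_hom_eqI:
  assumes M: "bimodule K A M" and f: "f \<in> bimod_hom A (P n) M" and g: "g \<in> bimod_hom A (P n) M"
    and eq: "\<And>w. w \<in> SS n \<Longrightarrow> f (tensor n \<one>\<^bsub>A\<^esub> (pe w) \<one>\<^bsub>A\<^esub>) = g (tensor n \<one>\<^bsub>A\<^esub> (pe w) \<one>\<^bsub>A\<^esub>)"
    and x: "x \<in> carrier (P n)"
  shows "f x = g x"
proof (rule P_hom_eq_pe[OF bimod_hom_add[OF f] bimod_hom_add[OF g] _ _ x])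
  interpret M: bimodule K A M by (rule M)
  show "abelian_group M" by (rule M.M.abelian_group_axioms)
  fix a w b assume a: "a \<in> carrier A" and w: "w \<in> SS n" and b: "b \<in> carrier A"
  have t: "tensor n a (pe w) b = (a \<odot>\<^bsub>P n\<^esub> tensor n \<one>\<^bsub>A\<^esub> (pe w) \<one>\<^bsub>A\<^esub>) \<odot>\<^sub>r\<^bsub>P n\<^esub> b"
    using a w b by simp
  have c: "tensor n \<one>\<^bsub>A\<^esub> (pe w) \<one>\<^bsub>A\<^esub> \<in> carrier (P n)" "a \<odot>\<^bsub>P n\<^esub> tensor n \<one>\<^bsub>A\<^esub> (pe w) \<one>\<^bsub>A\<^esub> \<in> carrier (P n)"
    using a w by simp_all
  show "f (tensor n a (pe w) b) = g (tensor n a (pe w) b)"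
    unfolding t bimod_hom_rsmult[OF f b c(2)] bimod_hom_rsmult[OF g b c(2)]
      left_hom_smult[OF bimod_hom_left[OF f] a c(1)] left_hom_smult[OF bimod_hom_left[OF g] a c(1)] eq[OF w] ..
qed

text \<open>
  $P_n$ is the direct sum of the bimodules $A e \otimes_{\Bbbk} e' A$, where $e$ and $e'$ are the idempotents at the
  source and the target of $w \in S_n$. A bimodule map is thus the choice of an element of $e M e'$ for each $w$.
\<close>

lemma P_bimod_lift:
  assumes M: "bimodule scalars A M"
    and y: "\<And>w. w \<in> SS n \<Longrightarrow> y w \<in> carrier M"
    and src: "\<And>w. w \<in> SS n \<Longrightarrow> idem (src w) \<odot>\<^bsub>M\<^esub> y w = y w"
    and tgt: "\<And>w. w \<in> SS n \<Longrightarrow> y w \<odot>\<^sub>r\<^bsub>M\<^esub> idem (tgt Q w) = y w"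
  obtains f where "f \<in> bimod_hom A (P n) M" "f \<in> extensional (carrier (P n))"
    "\<And>w a b. w \<in> SS n \<Longrightarrow> a \<in> carrier A \<Longrightarrow> b \<in> carrier A \<Longrightarrow>
      f (tensor n a (pe w) b) = (a \<odot>\<^bsub>M\<^esub> y w) \<odot>\<^sub>r\<^bsub>M\<^esub> b"
proof -
  interpret M: bimodule scalars A M by (rule M)
  note simps = M.lact_closed M.ract_closed M.lact_add_left M.lact_add_right M.ract_add_left M.ract_add_right
    M.act_assoc M.lact_mult M.ract_mult y idem_src_closed[OF SS_path] idem_tgt_closed[OF SS_path]
  have "\<exists>f. f \<in> hom (add_monoid (P n)) (add_monoid M) \<and> f \<in> extensional (carrier (P n)) \<and>
    (\<forall>w\<in>SS n. \<forall>a\<in>carrier A. \<forall>b\<in>carrier A. f (tensor n a (pe w) b) = (a \<odot>\<^bsub>M\<^esub> y w) \<odot>\<^sub>r\<^bsub>M\<^esub> b)"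
  proof (rule P_lift[OF M.M.abelian_group_axioms, of n "\<lambda>w a b. (a \<odot>\<^bsub>M\<^esub> y w) \<odot>\<^sub>r\<^bsub>M\<^esub> b"])
    fix w a b assume w: "w \<in> SS n" and a: "a \<in> carrier A" and b: "b \<in> carrier A"
    show "((a \<otimes>\<^bsub>A\<^esub> \<kappa> c) \<odot>\<^bsub>M\<^esub> y w) \<odot>\<^sub>r\<^bsub>M\<^esub> b = (a \<odot>\<^bsub>M\<^esub> y w) \<odot>\<^sub>r\<^bsub>M\<^esub> (\<kappa> c \<otimes>\<^bsub>A\<^esub> b)" for c
      using w a b M.act_scalars[of "\<kappa> c" "y w"] by (simp add: simps scalars_eq)
    show "(a \<odot>\<^bsub>M\<^esub> y w) \<odot>\<^sub>r\<^bsub>M\<^esub> (idem (tgt Q w) \<otimes>\<^bsub>A\<^esub> b) = (a \<odot>\<^bsub>M\<^esub> y w) \<odot>\<^sub>r\<^bsub>M\<^esub> b"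
      using w a b tgt[OF w] by (simp add: simps M.ract_mult[symmetric])
  qed (simp_all add: simps src)
  then obtain f where f: "f \<in> hom (add_monoid (P n)) (add_monoid M)" "f \<in> extensional (carrier (P n))"
    and f_pe: "\<And>w a b. w \<in> SS n \<Longrightarrow> a \<in> carrier A \<Longrightarrow> b \<in> carrier A \<Longrightarrow> f (tensor n a (pe w) b) = (a \<odot>\<^bsub>M\<^esub> y w) \<odot>\<^sub>r\<^bsub>M\<^esub> b"
    by blast
  have "f \<in> bimod_hom A (P n) M"
  proof (rule bimod_homI[OF f(1)])
    fix a x assume a: "a \<in> carrier A" and x: "x \<in> carrier (P n)"
    note z = add_hom_zero[OF P_abelian_group M.M.abelian_group_axioms f(1)] add_hom_add[OF f(1)] add_hom_closed[OF f(1)]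
    show "f (a \<odot>\<^bsub>P n\<^esub> x) = a \<odot>\<^bsub>M\<^esub> f x"
      using x
      by (induction x rule: P_induct_pe)
        (simp_all add: a z P.lact_zero M.lact_zero P.lact_add_right M.lact_add_right P.lact_closed f_pe simps)
    show "f (x \<odot>\<^sub>r\<^bsub>P n\<^esub> a) = f x \<odot>\<^sub>r\<^bsub>M\<^esub> a"
      using x
      by (induction x rule: P_induct_pe)
        (simp_all add: a z P.ract_zero M.ract_zero P.ract_add_left M.ract_add_left P.ract_closed f_pe simps)
  qed
  then show thesis using that f(2) f_pe by blast
qed

text \<open>
  Lift the images of the generators and cut the lifts down by the idempotents at the ends of \<open>w\<close>.
\<close>

lemma P_projective: "projective_bimodule TYPE('m) TYPE('n) scalars A (P n)"
  unfolding projective_bimodule_def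
proof (intro conjI P_bimodule allI ballI impI)
  fix M :: "(('v, 'e, 'k) quot_elem, 'm) bimod" and N :: "(('v, 'e, 'k) quot_elem, 'n) bimod" and g f
  assume g: "g \<in> bimod_hom A M N" and f: "f \<in> bimod_hom A (P n) N"
    and M: "bimodule scalars A M" and N: "bimodule scalars A N" and surj: "g ` carrier M = carrier N"
  interpret M: bimodule scalars A M by (rule M)
  interpret N: bimodule scalars A N by (rule N)
  define gen where "gen w = tensor n \<one>\<^bsub>A\<^esub> (pe w) \<one>\<^bsub>A\<^esub>" for w
  have gen: "gen w \<in> carrier (P n)" "idem (src w) \<odot>\<^bsub>P n\<^esub> gen w = gen w" "gen w \<odot>\<^sub>r\<^bsub>P n\<^esub> idem (tgt Q w) = gen w"
    if "w \<in> SS n" for w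
  proof -
    note cl = idem_src_closed[OF SS_path[OF that]] idem_tgt_closed[OF SS_path[OF that]]
    show "gen w \<in> carrier (P n)" using that by (simp add: gen_def)
    show "idem (src w) \<odot>\<^bsub>P n\<^esub> gen w = gen w" "gen w \<odot>\<^sub>r\<^bsub>P n\<^esub> idem (tgt Q w) = gen w"
      using that cl tensor_idem_left[OF _ that, of "\<one>\<^bsub>A\<^esub>" "\<one>\<^bsub>A\<^esub>"] tensor_idem_right[OF _ that, of "\<one>\<^bsub>A\<^esub>" "\<one>\<^bsub>A\<^esub>"]
      by (simp_all add: gen_def)
  qed
  have "\<exists>m. \<forall>w\<in>SS n. m w \<in> carrier M \<and> g (m w) = f (gen w)"
  proof (rule bchoice, rule ballI)
    fix w assume "w \<in> SS n"
    then have "f (gen w) \<in> carrier N" using add_hom_closed[OF bimod_hom_add[OF f] gen(1)] by blast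
    then show "\<exists>m. m \<in> carrier M \<and> g m = f (gen w)" using surj by (metis imageE)
  qed
  then obtain m where m: "\<And>w. w \<in> SS n \<Longrightarrow> m w \<in> carrier M" "\<And>w. w \<in> SS n \<Longrightarrow> g (m w) = f (gen w)" by blast
  define y where "y w = (idem (src w) \<odot>\<^bsub>M\<^esub> m w) \<odot>\<^sub>r\<^bsub>M\<^esub> idem (tgt Q w)" for w
  have idem_idem: "idem v \<otimes>\<^bsub>A\<^esub> idem v = idem v" if "v \<in> verts Q" for v
    using idem_mult_single[of "trivial v" v 1] that by (simp add: trivial_path src_def)
  have y: "y w \<in> carrier M" "idem (src w) \<odot>\<^bsub>M\<^esub> y w = y w" "y w \<odot>\<^sub>r\<^bsub>M\<^esub> idem (tgt Q w) = y w" if w: "w \<in> SS n" for w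
  proof -
    note cl = idem_src_closed[OF SS_path[OF w]] idem_tgt_closed[OF SS_path[OF w]]
    note ii = idem_idem[OF src_in_verts[OF SS_path[OF w]]] idem_idem[OF tgt_in_verts[OF SS_path[OF w]]]
    show "y w \<in> carrier M" using m(1)[OF w] cl by (simp add: y_def M.lact_closed M.ract_closed)
    show "idem (src w) \<odot>\<^bsub>M\<^esub> y w = y w" "y w \<odot>\<^sub>r\<^bsub>M\<^esub> idem (tgt Q w) = y w"
      using m(1)[OF w] cl
      by (simp_all add: y_def M.lact_closed M.ract_closed M.act_assoc[symmetric] M.lact_mult[symmetric]
          M.ract_mult[symmetric] ii)
  qed
  obtain h where h: "h \<in> bimod_hom A (P n) M" and h_pe: "\<And>w a b. w \<in> SS n \<Longrightarrow> a \<in> carrier A \<Longrightarrow> b \<in> carrier A \<Longrightarrow>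
      h (tensor n a (pe w) b) = (a \<odot>\<^bsub>M\<^esub> y w) \<odot>\<^sub>r\<^bsub>M\<^esub> b"
    using P_bimod_lift[OF M y] by metis
  have gh: "(\<lambda>x. g (h x)) \<in> bimod_hom A (P n) N"
  proof (rule bimod_homI)
    show "(\<lambda>x. g (h x)) \<in> hom (add_monoid (P n)) (add_monoid N)"
      by (rule add_hom_comp[OF bimod_hom_add[OF h] bimod_hom_add[OF g]])
  qed (simp_all add: left_hom_smult[OF bimod_hom_left[OF h]] left_hom_smult[OF bimod_hom_left[OF g]]
      bimod_hom_rsmult[OF h] bimod_hom_rsmult[OF g] add_hom_closed[OF bimod_hom_add[OF h]])
  have "g (h x) = f x" if "x \<in> carrier (P n)" for x
  proof (rule bimod_hom_eqI[OF N gh f _ that])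
    fix w assume w: "w \<in> SS n"
    note cl = idem_src_closed[OF SS_path[OF w]] idem_tgt_closed[OF SS_path[OF w]]
    have "h (gen w) = y w" using h_pe[OF w, of "\<one>\<^bsub>A\<^esub>" "\<one>\<^bsub>A\<^esub>"] y(1)[OF w] by (simp add: gen_def M.lact_one M.ract_one)
    then have "g (h (gen w)) = (idem (src w) \<odot>\<^bsub>N\<^esub> f (gen w)) \<odot>\<^sub>r\<^bsub>N\<^esub> idem (tgt Q w)"
      using m[OF w] cl
      by (simp add: y_def bimod_hom_rsmult[OF g] left_hom_smult[OF bimod_hom_left[OF g]] M.lact_closed)
    also have "\<dots> = f ((idem (src w) \<odot>\<^bsub>P n\<^esub> gen w) \<odot>\<^sub>r\<^bsub>P n\<^esub> idem (tgt Q w))"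
      using cl gen(1)[OF w]
      by (simp add: bimod_hom_rsmult[OF f] left_hom_smult[OF bimod_hom_left[OF f]] P.lact_closed del: smult_tensor)
    finally show "g (h (tensor n \<one>\<^bsub>A\<^esub> (pe w) \<one>\<^bsub>A\<^esub>)) = f (tensor n \<one>\<^bsub>A\<^esub> (pe w) \<one>\<^bsub>A\<^esub>)"
      using gen[OF w] by (simp add: gen_def)
  qed
  then show "\<exists>h\<in>bimod_hom A (P n) M. \<forall>x\<in>carrier (P n). g (h x) = f x" using h by blast
qed

lemma normal_form_add:
  "a \<in> carrier A \<Longrightarrow> b \<in> carrier A \<Longrightarrow> normal_form (a \<oplus>\<^bsub>A\<^esub> b) = normal_form a + normal_form b"
  using \<pi>_surj[of a] \<pi>_surj[of b]
  by (auto simp: \<pi>_add[symmetric] normal_form_\<pi> nf_add linear_span_add)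

lemma normal_form_scale: "a \<in> carrier A \<Longrightarrow> normal_form (\<kappa> c \<otimes>\<^bsub>A\<^esub> a) = scale c (normal_form a)"
  using \<pi>_surj[of a] by (auto simp: \<kappa>_left normal_form_\<pi> nf_scale)

lemma normal_form_irreducible: "u \<in> Irr \<Longrightarrow> normal_form (\<pi> (single u c)) = single u c"
  by (simp add: normal_form_\<pi> irreducible_in_paths)

lemma normal_form_span: "a \<in> carrier A \<Longrightarrow> supp (normal_form a) \<subseteq> Irr"
proof -
  assume "a \<in> carrier A"
  then obtain x where "x \<in> lin" "a = \<pi> x" using \<pi>_surj by blast
  then show ?thesis using nf_in_span[of x] by (simp add: normal_form_\<pi> linear_span_def)
qed

lemma left_hom_eqI:
  assumes M: "bimodule K A M" and f: "f \<in> left_hom A (P n) M" and g: "g \<in> left_hom A (P n) M"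
    and eq: "\<And>w u. w \<in> SS n \<Longrightarrow> u \<in> Irr \<Longrightarrow> f (tensor n \<one>\<^bsub>A\<^esub> (pe w) (\<pi> (pe u))) = g (tensor n \<one>\<^bsub>A\<^esub> (pe w) (\<pi> (pe u)))"
    and x: "x \<in> carrier (P n)"
  shows "f x = g x"
  using x
proof (induction x rule: P_induct_tm)
  interpret M: bimodule K A M by (rule M)
  note z = add_hom_zero[OF P_abelian_group M.M.abelian_group_axioms left_hom_add[OF f]]
    add_hom_zero[OF P_abelian_group M.M.abelian_group_axioms left_hom_add[OF g]]
  {
    case zero
    then show ?case by (simp add: z)
  next
    case (tm q w u c)
    then have *: "q \<in> paths Q" "w \<in> SS n" "u \<in> paths Q" by (auto simp: composable_def)
    have "tm n c (q, w, u) = \<pi> (single q c) \<odot>\<^bsub>P n\<^esub> tensor n \<one>\<^bsub>A\<^esub> (pe w) (\<pi> (pe u))"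
      using * by (simp add: tm_def)
    then show ?case using * eq[OF *(2) tm(2)] by (simp add: left_hom_smult[OF f] left_hom_smult[OF g] del: smult_tensor)
  next
    case (plus x y)
    then show ?case by (simp add: add_hom_add[OF left_hom_add[OF f]] add_hom_add[OF left_hom_add[OF g]])
  }
qed

text \<open>
  $P_n$ is also the direct sum of the left modules $Ae$, where $e$ is the idempotent at the source of $w$, one
  for each composable pair of $w \in S_n$ and irreducible $u$. Normal forms provide the coefficient of $u$ in a right factor.
\<close>

lemma P_left_lift:
  assumes M: "bimodule scalars A M"
    and y: "\<And>w u. w \<in> SS n \<Longrightarrow> u \<in> Irr \<Longrightarrow> y w u \<in> carrier M"
    and src: "\<And>w u. w \<in> SS n \<Longrightarrow> u \<in> Irr \<Longrightarrow> idem (src w) \<odot>\<^bsub>M\<^esub> y w u = y w u"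
    and tgt: "\<And>w u. w \<in> SS n \<Longrightarrow> u \<in> Irr \<Longrightarrow> tgt Q w \<noteq> src u \<Longrightarrow> y w u = \<zero>\<^bsub>M\<^esub>"
  obtains f where "f \<in> left_hom A (P n) M" "f \<in> extensional (carrier (P n))"
    "\<And>w u. w \<in> SS n \<Longrightarrow> u \<in> Irr \<Longrightarrow> f (tensor n \<one>\<^bsub>A\<^esub> (pe w) (\<pi> (pe u))) = y w u"
proof -
  interpret M: bimodule scalars A M by (rule M)
  \<comment> \<open>The right factor is expanded in irreducible paths, and its coefficients are moved to the left.\<close>
  define F where "F w a b = (\<Oplus>\<^bsub>M\<^esub>u\<in>supp (normal_form b). (a \<otimes>\<^bsub>A\<^esub> \<kappa> (coeff (normal_form b) u)) \<odot>\<^bsub>M\<^esub> y w u)" for w a b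
  have cl: "(\<lambda>u. (a \<otimes>\<^bsub>A\<^esub> \<kappa> (c u)) \<odot>\<^bsub>M\<^esub> y w u) \<in> B \<rightarrow> carrier M"
    if "w \<in> SS n" "a \<in> carrier A" "B \<subseteq> Irr" for w a c B
    using that by (auto intro!: M.lact_closed y)
  have F_superset: "F w a b = (\<Oplus>\<^bsub>M\<^esub>u\<in>B. (a \<otimes>\<^bsub>A\<^esub> \<kappa> (coeff (normal_form b) u)) \<odot>\<^bsub>M\<^esub> y w u)"
    if "finite B" "supp (normal_form b) \<subseteq> B" "B \<subseteq> Irr" "w \<in> SS n" "a \<in> carrier A" for w a b B
    unfolding F_def
  proof (rule M.finsum_mono_neutral[OF that(1,2)])
    show "(\<lambda>u. (a \<otimes>\<^bsub>A\<^esub> \<kappa> (coeff (normal_form b) u)) \<odot>\<^bsub>M\<^esub> y w u) \<in> supp (normal_form b) \<rightarrow> carrier M"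
      by (rule cl) (use that in auto)
    fix u assume "u \<in> B - supp (normal_form b)"
    then show "(a \<otimes>\<^bsub>A\<^esub> \<kappa> (coeff (normal_form b) u)) \<odot>\<^bsub>M\<^esub> y w u = \<zero>\<^bsub>M\<^esub>"
      using that y[of w u] by (auto simp: in_keys_iff M.zero_lact)
  qed
  have F_closed: "F w a b \<in> carrier M" if "w \<in> SS n" "a \<in> carrier A" "b \<in> carrier A" for w a b
    unfolding F_def by (rule M.finsum_closed, rule cl) (use that normal_form_span in auto)
  have F_add_right: "F w a (b \<oplus>\<^bsub>A\<^esub> b') = F w a b \<oplus>\<^bsub>M\<^esub> F w a b'"
    if w: "w \<in> SS n" and a: "a \<in> carrier A" and b: "b \<in> carrier A" and b': "b' \<in> carrier A" for w a b b'
  proof -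
    let ?B = "supp (normal_form b) \<union> supp (normal_form b')"
    have B: "finite ?B" "?B \<subseteq> Irr" using normal_form_span b b' by auto
    have "F w a (b \<oplus>\<^bsub>A\<^esub> b') = (\<Oplus>\<^bsub>M\<^esub>u\<in>?B. (a \<otimes>\<^bsub>A\<^esub> \<kappa> (coeff (normal_form (b \<oplus>\<^bsub>A\<^esub> b')) u)) \<odot>\<^bsub>M\<^esub> y w u)"
      by (rule F_superset[OF B(1) _ B(2) w a]) (simp only: normal_form_add[OF b b'] keys_add)
    also have "\<dots> = (\<Oplus>\<^bsub>M\<^esub>u\<in>?B. (a \<otimes>\<^bsub>A\<^esub> \<kappa> (coeff (normal_form b) u)) \<odot>\<^bsub>M\<^esub> y w u \<oplus>\<^bsub>M\<^esub> (a \<otimes>\<^bsub>A\<^esub> \<kappa> (coeff (normal_form b') u)) \<odot>\<^bsub>M\<^esub> y w u)"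
    proof (rule M.finsum_cong'[OF refl])
      show "(\<lambda>u. (a \<otimes>\<^bsub>A\<^esub> \<kappa> (coeff (normal_form b) u)) \<odot>\<^bsub>M\<^esub> y w u \<oplus>\<^bsub>M\<^esub> (a \<otimes>\<^bsub>A\<^esub> \<kappa> (coeff (normal_form b') u)) \<odot>\<^bsub>M\<^esub> y w u) \<in> ?B \<rightarrow> carrier M"
        using cl[OF w a B(2)] by (auto intro!: M.M.add.m_closed M.lact_closed y simp: a w subsetD[OF B(2)])
      fix u assume "u \<in> ?B"
      then have "y w u \<in> carrier M" using y w B(2) by blast
      then show "(a \<otimes>\<^bsub>A\<^esub> \<kappa> (coeff (normal_form (b \<oplus>\<^bsub>A\<^esub> b')) u)) \<odot>\<^bsub>M\<^esub> y w u =
          (a \<otimes>\<^bsub>A\<^esub> \<kappa> (coeff (normal_form b) u)) \<odot>\<^bsub>M\<^esub> y w u \<oplus>\<^bsub>M\<^esub> (a \<otimes>\<^bsub>A\<^esub> \<kappa> (coeff (normal_form b') u)) \<odot>\<^bsub>M\<^esub> y w u"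
        using a by (simp add: normal_form_add[OF b b'] lookup_add \<kappa>_add A_r_distr M.lact_add_left)
    qed
    also have "\<dots> = (\<Oplus>\<^bsub>M\<^esub>u\<in>?B. (a \<otimes>\<^bsub>A\<^esub> \<kappa> (coeff (normal_form b) u)) \<odot>\<^bsub>M\<^esub> y w u) \<oplus>\<^bsub>M\<^esub>
        (\<Oplus>\<^bsub>M\<^esub>u\<in>?B. (a \<otimes>\<^bsub>A\<^esub> \<kappa> (coeff (normal_form b') u)) \<odot>\<^bsub>M\<^esub> y w u)"
      by (rule M.finsum_addf[OF cl[OF w a B(2)] cl[OF w a B(2)]])
    also have "\<dots> = F w a b \<oplus>\<^bsub>M\<^esub> F w a b'"
      using F_superset[OF B(1) _ B(2) w a, of b] F_superset[OF B(1) _ B(2) w a, of b'] by simp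
    finally show ?thesis .
  qed
  have F_single: "F w a (\<pi> (single u c)) = (a \<otimes>\<^bsub>A\<^esub> \<kappa> c) \<odot>\<^bsub>M\<^esub> y w u"
    if "w \<in> SS n" "a \<in> carrier A" "u \<in> Irr" for w a u c
    using F_superset[of "{u}" "\<pi> (single u c)" w a] that y[OF that(1,3)]
    by (simp add: normal_form_irreducible M.finsum_insert M.lact_closed)
  have F_zero_right: "F w a \<zero>\<^bsub>A\<^esub> = \<zero>\<^bsub>M\<^esub>" if "w \<in> SS n" "a \<in> carrier A" for w a
    by (rule add_hom_zero[OF A_abelian_group M.M.abelian_group_axioms, of "F w a"], rule add_homI)
      (use that F_closed F_add_right in auto)
  have "\<exists>f. f \<in> hom (add_monoid (P n)) (add_monoid M) \<and> f \<in> extensional (carrier (P n)) \<and>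
    (\<forall>w\<in>SS n. \<forall>a\<in>carrier A. \<forall>b\<in>carrier A. f (tensor n a (pe w) b) = F w a b)"
  proof (rule P_lift[OF M.M.abelian_group_axioms, of n F])
    fix w a b assume w: "w \<in> SS n" and a: "a \<in> carrier A" and b: "b \<in> carrier A"
    note sp = normal_form_span[OF b]
    show "F w a b \<in> carrier M" by (rule F_closed[OF w a b])
    show "F w a (b \<oplus>\<^bsub>A\<^esub> b') = F w a b \<oplus>\<^bsub>M\<^esub> F w a b'" if "b' \<in> carrier A" for b'
      by (rule F_add_right[OF w a b that])
    have yc: "y w u \<in> carrier M" if "u \<in> supp (normal_form b)" for u using that sp y w by blast
    show "F w (a \<oplus>\<^bsub>A\<^esub> a') b = F w a b \<oplus>\<^bsub>M\<^esub> F w a' b" if a': "a' \<in> carrier A" for a'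
      unfolding F_def M.finsum_addf[OF cl[OF w a sp] cl[OF w a' sp], symmetric]
      by (rule M.finsum_cong') (use a a' w yc in \<open>auto simp: A_l_distr M.lact_add_left intro!: M.M.add.m_closed M.lact_closed\<close>)
    show "F w (a \<otimes>\<^bsub>A\<^esub> idem (src w)) b = F w a b"
      unfolding F_def
    proof (rule M.finsum_cong'[OF refl cl[OF w a sp]])
      fix u assume u: "u \<in> supp (normal_form b)"
      let ?c = "coeff (normal_form b) u"
      have i: "idem (src w) \<in> carrier A" by (rule idem_src_closed[OF SS_path[OF w]])
      have "a \<otimes>\<^bsub>A\<^esub> idem (src w) \<otimes>\<^bsub>A\<^esub> \<kappa> ?c = (a \<otimes>\<^bsub>A\<^esub> \<kappa> ?c) \<otimes>\<^bsub>A\<^esub> idem (src w)"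
        using a i \<kappa>_comm[OF i, of ?c] by (simp add: A_m_assoc)
      then show "(a \<otimes>\<^bsub>A\<^esub> idem (src w) \<otimes>\<^bsub>A\<^esub> \<kappa> ?c) \<odot>\<^bsub>M\<^esub> y w u = (a \<otimes>\<^bsub>A\<^esub> \<kappa> ?c) \<odot>\<^bsub>M\<^esub> y w u"
        using a i yc[OF u] src[OF w, of u] u sp by (auto simp: M.lact_mult)
    qed
    show "F w (a \<otimes>\<^bsub>A\<^esub> \<kappa> c) b = F w a (\<kappa> c \<otimes>\<^bsub>A\<^esub> b)" for c
    proof -
      have "F w a (\<kappa> c \<otimes>\<^bsub>A\<^esub> b) = (\<Oplus>\<^bsub>M\<^esub>u\<in>supp (normal_form b). (a \<otimes>\<^bsub>A\<^esub> \<kappa> (coeff (normal_form (\<kappa> c \<otimes>\<^bsub>A\<^esub> b)) u)) \<odot>\<^bsub>M\<^esub> y w u)"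
        by (rule F_superset[OF _ _ sp w a]) (simp_all add: normal_form_scale[OF b] supp_scale)
      also have "\<dots> = F w (a \<otimes>\<^bsub>A\<^esub> \<kappa> c) b"
        unfolding F_def
        by (rule M.finsum_cong'[OF refl]; (rule cl)?)
          (use w a sp in \<open>auto simp: normal_form_scale[OF b] \<kappa>_mult A_m_assoc\<close>)
      finally show ?thesis by simp
    qed
    show "F w a (idem (tgt Q w) \<otimes>\<^bsub>A\<^esub> b) = F w a b"
      using b
    proof (rule A_induct_irreducible)
      have i: "idem (tgt Q w) \<in> carrier A" by (rule idem_tgt_closed[OF SS_path[OF w]])
      show "F w a (idem (tgt Q w) \<otimes>\<^bsub>A\<^esub> \<zero>\<^bsub>A\<^esub>) = F w a \<zero>\<^bsub>A\<^esub>" using i by simp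
      show "F w a (idem (tgt Q w) \<otimes>\<^bsub>A\<^esub> (b \<oplus>\<^bsub>A\<^esub> b')) = F w a (b \<oplus>\<^bsub>A\<^esub> b')"
        if "b \<in> carrier A" "b' \<in> carrier A" "F w a (idem (tgt Q w) \<otimes>\<^bsub>A\<^esub> b) = F w a b"
          "F w a (idem (tgt Q w) \<otimes>\<^bsub>A\<^esub> b') = F w a b'" for b b'
        using that i w a by (simp add: A_r_distr F_add_right)
      show "F w a (idem (tgt Q w) \<otimes>\<^bsub>A\<^esub> \<pi> (single u c)) = F w a (\<pi> (single u c))" if u: "u \<in> Irr" for u c
        using F_single[OF w a u, of c] tgt[OF w u] F_zero_right[OF w a] a
          idem_mult_single[OF irreducible_in_paths[OF u] tgt_in_verts[OF SS_path[OF w]], of c]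
        by (auto simp: M.lact_zero)
    qed
  qed
  then obtain f where f: "f \<in> hom (add_monoid (P n)) (add_monoid M)" "f \<in> extensional (carrier (P n))"
    and f_pe: "\<And>w a b. w \<in> SS n \<Longrightarrow> a \<in> carrier A \<Longrightarrow> b \<in> carrier A \<Longrightarrow> f (tensor n a (pe w) b) = F w a b"
    by blast
  note z = add_hom_zero[OF P_abelian_group M.M.abelian_group_axioms f(1)] add_hom_add[OF f(1)] add_hom_closed[OF f(1)]
  have F_left: "F w (a' \<otimes>\<^bsub>A\<^esub> a) b = a' \<odot>\<^bsub>M\<^esub> F w a b"
    if w: "w \<in> SS n" and a: "a \<in> carrier A" and b: "b \<in> carrier A" and a': "a' \<in> carrier A" for w a b a'
  proof -
    have yc: "y w u \<in> carrier M" if "u \<in> supp (normal_form b)" for u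
      using that normal_form_span[OF b] y w by blast
    show ?thesis
      unfolding F_def M.lact_finsum[OF a' cl[OF w a normal_form_span[OF b]]]
      by (rule M.finsum_cong'[OF refl])
        (use a a' yc in \<open>auto simp: A_m_assoc M.lact_mult intro!: M.lact_closed\<close>)
  qed
  have "f \<in> left_hom A (P n) M"
    unfolding left_hom_def mem_Collect_eq
  proof (intro conjI ballI f(1))
    fix a x assume a: "a \<in> carrier A" and x: "x \<in> carrier (P n)"
    show "f (a \<odot>\<^bsub>P n\<^esub> x) = a \<odot>\<^bsub>M\<^esub> f x"
      using x
      by (induction x rule: P_induct_pe)
        (simp_all add: a z P.lact_zero M.lact_zero P.lact_add_right M.lact_add_right P.lact_closed f_pe F_left)
  qed
  moreover have "f (tensor n \<one>\<^bsub>A\<^esub> (pe w) (\<pi> (pe u))) = y w u" if "w \<in> SS n" "u \<in> Irr" for w u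
    using f_pe[OF that(1), of "\<one>\<^bsub>A\<^esub>" "\<pi> (pe u)"] F_single[OF that(1) _ that(2), of "\<one>\<^bsub>A\<^esub>" 1] y[OF that] that
    by (simp add: irreducible_in_paths M.lact_one)
  ultimately show thesis using that f(2) by blast
qed

end

context diamond_system
begin

section \<open>Additive spans of elementary tensors\<close>

text \<open>
  The elementary tensors carry a scalar, so the additive closure is also the linear span.
\<close>

inductive_set Sp :: "nat \<Rightarrow> (('v, 'e) path \<times> ('v, 'e) path \<times> ('v, 'e) path) set \<Rightarrow> ('v, 'e, 'k) tens set"
  for n :: nat and B :: "(('v, 'e) path \<times> ('v, 'e) path \<times> ('v, 'e) path) set" where
  Sp_zero: "\<zero>\<^bsub>P n\<^esub> \<in> Sp n B"
| Sp_tm: "t \<in> composable n \<Longrightarrow> t \<in> B \<Longrightarrow> tm n c t \<in> Sp n B"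
| Sp_add: "x \<in> Sp n B \<Longrightarrow> y \<in> Sp n B \<Longrightarrow> x \<oplus>\<^bsub>P n\<^esub> y \<in> Sp n B"

lemma Sp_carrier: "x \<in> Sp n B \<Longrightarrow> x \<in> carrier (P n)"
  by (induction rule: Sp.induct) auto

lemma Sp_mono: "x \<in> Sp n B \<Longrightarrow> (\<And>t. t \<in> composable n \<Longrightarrow> t \<in> B \<Longrightarrow> t \<in> C) \<Longrightarrow> x \<in> Sp n C"
  by (induction rule: Sp.induct) (auto intro: Sp.intros)

lemma Sp_hom:
  assumes x: "x \<in> Sp n B" and f: "f \<in> hom (add_monoid (P n)) (add_monoid (P m))"
    and tm: "\<And>q w r c. (q, w, r) \<in> composable n \<Longrightarrow> (q, w, r) \<in> B \<Longrightarrow> f (tm n c (q, w, r)) \<in> Sp m C"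
  shows "f x \<in> Sp m C"
  using x
proof (induction rule: Sp.induct)
  case Sp_zero
  then show ?case by (simp add: P_hom_zero[OF f] Sp.Sp_zero)
next
  case (Sp_tm t c)
  then show ?case using tm by (cases t) auto
next
  case (Sp_add x y)
  then show ?case by (simp add: add_hom_add[OF f] Sp_carrier Sp.Sp_add)
qed

lemma tm_uminus:
  assumes "t \<in> composable n"
  shows "\<ominus>\<^bsub>P n\<^esub> tm n c t = tm n (- c) t"
proof -
  obtain q w r where t: "t = (q, w, r)" by (cases t)
  have "\<pi> (single q (- c)) \<oplus>\<^bsub>A\<^esub> \<pi> (single q c) = \<zero>\<^bsub>A\<^esub>"
    using assms by (subst \<pi>_add[symmetric]) (auto simp: t composable_def single_add[symmetric])
  then have "tm n (- c) t \<oplus>\<^bsub>P n\<^esub> tm n c t = \<zero>\<^bsub>P n\<^esub>"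
    using assms by (auto simp: tm_def t composable_def tensor_add_left[symmetric] tensor_zero_left)
  then show ?thesis using assms by (intro P.M.minus_equality) auto
qed

lemma Sp_uminus: "x \<in> Sp n B \<Longrightarrow> \<ominus>\<^bsub>P n\<^esub> x \<in> Sp n B"
proof (induction rule: Sp.induct)
  case Sp_zero
  have neg_zero: "\<ominus>\<^bsub>P n\<^esub> \<zero>\<^bsub>P n\<^esub> = \<zero>\<^bsub>P n\<^esub>" by (rule P.M.minus_equality) simp_all
  show ?case unfolding neg_zero by (rule Sp.Sp_zero)
next
  case (Sp_tm t c)
  then show ?case unfolding tm_uminus[OF Sp_tm(1)] by (intro Sp.Sp_tm)
next
  case (Sp_add x y)
  then show ?case by (simp add: P.M.minus_add Sp_carrier Sp.Sp_add)
qed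

lemma Sp_minus: "x \<in> Sp n B \<Longrightarrow> y \<in> Sp n B \<Longrightarrow> x \<ominus>\<^bsub>P n\<^esub> y \<in> Sp n B"
  unfolding a_minus_def by (intro Sp_add Sp_uminus)

lemma Sp_finsum: "(\<And>i. i \<in> J \<Longrightarrow> f i \<in> Sp n B) \<Longrightarrow> (\<Oplus>\<^bsub>P n\<^esub>i\<in>J. f i) \<in> Sp n B"
proof (induction J rule: infinite_finite_induct)
  case (insert i J)
  then have "f i \<in> carrier (P n)" "f \<in> J \<rightarrow> carrier (P n)" using Sp_carrier by blast+
  then show ?case using insert by (simp add: P.M.finsum_insert Sp_add)
qed (simp_all add: Sp_zero)

lemma Sp_irreducible: "x \<in> carrier (P n) \<Longrightarrow> x \<in> Sp n {(q, w, u). u \<in> Irr}"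
  by (induction rule: P_induct_tm) (auto intro: Sp.intros)

lemma tensor_single_single:
  assumes "q \<in> paths Q" "w \<in> SS n" "u \<in> paths Q"
  shows "tensor n (\<pi> (single q c)) (pe w) (\<pi> (single u d)) = tensor n (\<pi> (single q (c * d))) (pe w) (\<pi> (pe u))"
  using assms tensor_scalar_swap[of "\<pi> (single q c)" "pe w" n "\<pi> (pe u)" d]
  by (simp add: \<kappa>_left \<kappa>_right mult.commute)

lemma tm_right:
  assumes "(q, w, r) \<in> composable n" "r' \<in> paths Q" "tgt Q r = src r'"
  shows "tm n c (q, w, r) \<odot>\<^sub>r\<^bsub>P n\<^esub> \<pi> (pe r') = tm n c (q, w, pcat r r')"
  using assms by (simp add: tm_def composable_def single_mult_single)

lemma tm_left:
  assumes "(q, w, r) \<in> composable n" "q' \<in> paths Q" "tgt Q q' = src q"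
  shows "\<pi> (single q' c') \<odot>\<^bsub>P n\<^esub> tm n c (q, w, r) = tm n (c' * c) (pcat q' q, w, r)"
  using assms by (simp add: tm_def composable_def single_mult_single)

lemma composable_left: "(q, w, r) \<in> composable n \<Longrightarrow> q' \<in> paths Q \<Longrightarrow> tgt Q q' = src q \<Longrightarrow> (pcat q' q, w, r) \<in> composable n"
  by (simp add: composable_def pcat_in_paths tgt_pcat)

lemma composable_right: "(q, w, r) \<in> composable n \<Longrightarrow> r' \<in> paths Q \<Longrightarrow> tgt Q r = src r' \<Longrightarrow> (q, w, pcat r r') \<in> composable n"
  by (simp add: composable_def pcat_in_paths)

lemma Sp_left:
  assumes x: "x \<in> Sp n B" and q': "q' \<in> paths Q"
    and sub: "\<And>q w r. (q, w, r) \<in> composable n \<Longrightarrow> (q, w, r) \<in> B \<Longrightarrow> tgt Q q' = src q \<Longrightarrow> (pcat q' q, w, r) \<in> C"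
  shows "\<pi> (single q' c) \<odot>\<^bsub>P n\<^esub> x \<in> Sp n C"
proof (rule Sp_hom[OF x P.lact_hom])
  show "\<pi> (single q' c) \<in> carrier A" using q' by simp
  fix q w r d assume *: "(q, w, r) \<in> composable n" "(q, w, r) \<in> B"
  show "\<pi> (single q' c) \<odot>\<^bsub>P n\<^esub> tm n d (q, w, r) \<in> Sp n C"
  proof (cases "tgt Q q' = src q")
    case True
    then show ?thesis
      using Sp_tm[OF composable_left[OF *(1) q' True] sub[OF * True]] tm_left[OF *(1) q' True] by simp
  next
    case False
    have qp: "q \<in> paths Q" using * by (simp add: composable_def)
    have "\<pi> (single q' c) \<otimes>\<^bsub>A\<^esub> \<pi> (single q d) = \<zero>\<^bsub>A\<^esub>"
      using False q' qp by (subst \<pi>_mult[symmetric]) (simp_all add: pmult_single)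
    then have "\<pi> (single q' c) \<odot>\<^bsub>P n\<^esub> tm n d (q, w, r) = \<zero>\<^bsub>P n\<^esub>"
      using * q' qp by (simp add: tm_def composable_def tensor_zero_left)
    then show ?thesis by (simp add: Sp_zero)
  qed
qed

lemma Sp_right:
  assumes x: "x \<in> Sp n B" and r': "r' \<in> paths Q"
    and sub: "\<And>q w r c. (q, w, r) \<in> composable n \<Longrightarrow> (q, w, r) \<in> B \<Longrightarrow> tgt Q r = src r' \<Longrightarrow> tm n c (q, w, pcat r r') \<in> Sp n C"
  shows "x \<odot>\<^sub>r\<^bsub>P n\<^esub> \<pi> (pe r') \<in> Sp n C"
proof (rule Sp_hom[OF x P.ract_hom])
  show "\<pi> (pe r') \<in> carrier A" using r' by simp
  fix q w r d assume *: "(q, w, r) \<in> composable n" "(q, w, r) \<in> B"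
  show "tm n d (q, w, r) \<odot>\<^sub>r\<^bsub>P n\<^esub> \<pi> (pe r') \<in> Sp n C"
  proof (cases "tgt Q r = src r'")
    case True
    then show ?thesis using sub[OF * True] tm_right[OF *(1) r' True] by simp
  next
    case False
    have qp: "r \<in> paths Q" using * by (simp add: composable_def)
    have "\<pi> (pe r) \<otimes>\<^bsub>A\<^esub> \<pi> (pe r') = \<zero>\<^bsub>A\<^esub>"
      using False r' qp by (subst \<pi>_mult[symmetric]) (simp_all add: pmult_single)
    then have "tm n d (q, w, r) \<odot>\<^sub>r\<^bsub>P n\<^esub> \<pi> (pe r') = \<zero>\<^bsub>P n\<^esub>"
      using * r' qp by (simp add: tm_def composable_def tensor_zero_right)
    then show ?thesis by (simp add: Sp_zero)
  qed
qed

text \<open>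
  Only the right factor is brought to normal form. The left one may remain an arbitrary path, because the
  maps involved are left linear.
\<close>

lemma tm_expand:
  assumes t: "(q, w, r) \<in> composable n"
    and sub: "\<And>u. u \<in> Irr \<Longrightarrow> (u, r) \<in> below\<^sup>= \<Longrightarrow> (q, w, u) \<in> B"
  shows "tm n c (q, w, r) \<in> Sp n B"
proof -
  have *: "q \<in> paths Q" "w \<in> SS n" "r \<in> paths Q" "tgt Q q = src w" "tgt Q w = src r" using t by (auto simp: composable_def)
  have "tensor n (\<pi> (single q c)) (pe w) (\<pi> (single r 1)) \<in> Sp n B"
    using *(3)
  proof (rule \<pi>_path_induct)
    show "tensor n (\<pi> (single q c)) (pe w) \<zero>\<^bsub>A\<^esub> \<in> Sp n B" using * by (simp add: tensor_zero_right Sp_zero)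
    show "tensor n (\<pi> (single q c)) (pe w) (a \<oplus>\<^bsub>A\<^esub> b) \<in> Sp n B"
      if "a \<in> carrier A" "b \<in> carrier A" "tensor n (\<pi> (single q c)) (pe w) a \<in> Sp n B"
        "tensor n (\<pi> (single q c)) (pe w) b \<in> Sp n B" for a b
      using that * by (simp add: tensor_add_right Sp_add)
    show "tensor n (\<pi> (single q c)) (pe w) (\<pi> (single u d)) \<in> Sp n B" if u: "u \<in> Irr" "(u, r) \<in> below\<^sup>=" for u d
    proof -
      have up: "u \<in> paths Q" using u(1) by (rule irreducible_in_paths)
      have "u = r \<or> src u = src r" using u(2) below_parallel[of u r] by blast
      then have su: "src u = src r" by blast
      have "(q, w, u) \<in> composable n" using * up su by (simp add: composable_def)
      from Sp_tm[OF this sub[OF u], of "c * d"] show ?thesis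
        using tensor_single_single[OF *(1,2) up, of c d] by (simp add: tm_def)
    qed
  qed
  then show ?thesis by (simp add: tm_def)
qed

lemma Sp_idem_left:
  assumes "x \<in> Sp n B" and "v \<in> verts Q" and "\<And>q w r. (q, w, r) \<in> composable n \<Longrightarrow> (q, w, r) \<in> B \<Longrightarrow> src q = v"
  shows "idem v \<odot>\<^bsub>P n\<^esub> x = x"
  using assms(1)
proof (induction rule: Sp.induct)
  case (Sp_tm t c)
  obtain q w r where t: "t = (q, w, r)" by (cases t)
  then have B: "(q, w, r) \<in> composable n" "(q, w, r) \<in> B" using Sp_tm by simp_all
  have "src q = v" by (rule assms(3)[OF B])
  moreover have "q \<in> paths Q" "w \<in> SS n" "r \<in> paths Q" using B(1) by (simp_all add: composable_def)
  ultimately show ?case using idem_mult_single[of q v c] assms(2) by (simp add: t tm_def trivial_path)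
qed (use assms(2) in \<open>simp_all add: P.lact_zero P.lact_add_right Sp_carrier trivial_path\<close>)

lemma Sp_idem_right:
  assumes "x \<in> Sp n B" and "v \<in> verts Q" and "\<And>q w r. (q, w, r) \<in> composable n \<Longrightarrow> (q, w, r) \<in> B \<Longrightarrow> tgt Q r = v"
  shows "x \<odot>\<^sub>r\<^bsub>P n\<^esub> idem v = x"
  using assms(1)
proof (induction rule: Sp.induct)
  case (Sp_tm t c)
  obtain q w r where t: "t = (q, w, r)" by (cases t)
  then have B: "(q, w, r) \<in> composable n" "(q, w, r) \<in> B" using Sp_tm by simp_all
  have "tgt Q r = v" by (rule assms(3)[OF B])
  moreover have "q \<in> paths Q" "w \<in> SS n" "r \<in> paths Q" using B(1) by (simp_all add: composable_def)
  ultimately show ?case using single_mult_idem[of r v 1] assms(2) by (simp add: t tm_def trivial_path)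
qed (use assms(2) in \<open>simp_all add: P.ract_zero P.ract_add_left Sp_carrier trivial_path\<close>)

section \<open>The maps $\delta_n$, $\gamma_n$ and the augmentation\<close>

text \<open>
  The path that measures the size of an elementary tensor.
\<close>

definition total :: "('v, 'e) path \<times> ('v, 'e) path \<times> ('v, 'e) path \<Rightarrow> ('v, 'e) path" where
  "total t = (case t of (q, w, r) \<Rightarrow> pcat q (pcat w r))"

definition cut :: "('v, 'e) path \<Rightarrow> nat \<times> nat \<Rightarrow> ('v, 'e) path \<times> ('v, 'e) path \<times> ('v, 'e) path" where
  "cut p ij = (case ij of (i, j) \<Rightarrow> (slice p 0 i, slice p i j, slice p j (plen p)))"

lemma cut_composable:
  assumes "p \<in> paths Q" "ij \<in> occurrences p n"
  shows "cut p ij \<in> composable n" "total (cut p ij) = p"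
proof -
  obtain i j where ij: "ij = (i, j)" by (cases ij)
  then have *: "i \<le> j" "j \<le> plen p" "slice p i j \<in> SS n" using assms by (simp_all add: occurrences_def)
  show "cut p ij \<in> composable n" "total (cut p ij) = p"
    using assms(1) * by (simp_all add: ij cut_def composable_def total_def slice_in_paths tgt_slice pcat_slice)
qed

lemma total_src_tgt:
  assumes "(q, w, r) \<in> composable n"
  shows "src (total (q, w, r)) = src q" "tgt Q (total (q, w, r)) = tgt Q r" "total (q, w, r) \<in> paths Q"
proof -
  have "q \<in> paths Q" "w \<in> paths Q" "r \<in> paths Q" "tgt Q q = src w" "tgt Q w = src r"
    using assms SS_path[of w n] by (simp_all add: composable_def)
  then show "src (total (q, w, r)) = src q" "tgt Q (total (q, w, r)) = tgt Q r" "total (q, w, r) \<in> paths Q"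
    by (simp_all add: total_def tgt_pcat pcat_in_paths)
qed

lemma finite_occurrences: "p \<in> paths Q \<Longrightarrow> finite (occurrences p n)"
  by (simp add: occurrences_eq_occ interval_system.finite_occ[OF interval_system_rel])

lemma factorizations_occurrences:
  "p \<in> paths Q \<Longrightarrow> factorizations Q (SS n) p = cut p ` occurrences p n"
  by (simp add: factorizations_slice occurrences_def cut_def[abs_def])

lemma cut_inj: "inj_on (cut p) (occurrences p n)"
  using factorizations_slice_inj[of p "SS n"] by (simp add: occurrences_def cut_def[abs_def])

lemma tm_one: "(case t of (q, w, r) \<Rightarrow> tensor n (\<pi> (pe q)) (pe w) (\<pi> (pe r))) = tm n 1 t"
  by (simp add: tm_def)

lemma split_eq:
  assumes p: "p \<in> paths Q"
  shows "split n p = (\<Oplus>\<^bsub>P n\<^esub>ij\<in>occurrences p n. tm n 1 (cut p ij))"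
proof -
  have "split n p = (\<Oplus>\<^bsub>P n\<^esub>t\<in>cut p ` occurrences p n. tm n 1 t)"
    unfolding split_def factorizations_occurrences[OF p] tm_one ..
  also have "\<dots> = (\<Oplus>\<^bsub>P n\<^esub>ij\<in>occurrences p n. tm n 1 (cut p ij))"
    by (rule P.M.finsum_reindex[OF _ cut_inj]) (auto simp: cut_composable[OF p])
  finally show ?thesis .
qed

lemma split_in_Sp: "p \<in> paths Q \<Longrightarrow> (\<And>ij. ij \<in> occurrences p n \<Longrightarrow> cut p ij \<in> B) \<Longrightarrow> split n p \<in> Sp n B"
  unfolding split_eq by (rule Sp_finsum, rule Sp_tm) (auto simp: cut_composable)

text \<open>
  The two are a prefix and a suffix of \<open>w\<close>. By \<open>occ_even_inner\<close> one that does not start with \<open>w\<close> must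
  end with it, and by monotonicity there is one for each end at most.
\<close>

lemma odd_occurrences:
  assumes w: "w \<in> SS (Suc m)" and m: "even m"
  obtains j i where "occurrences w m = {(0, j), (i, plen w)}" "0 < i" "j < plen w"
proof -
  have wp: "w \<in> paths Q" using SS_path[OF w] .
  interpret interval_system "rel w" "plen w" by (rule interval_system_rel[OF wp])
  note eq = occurrences_eq_occ[OF wp]
  have full: "(0, plen w) \<in> occ (Suc m)"
    unfolding eq[symmetric] using w by (simp add: occurrences_def)
  obtain j where j: "(0, j) \<in> occ m" "j < plen w" using occ_prefix[OF full] by blast
  obtain i where i: "(i, plen w) \<in> occ m" "0 < i" using occ_last_inner[OF full] by blast
  have "(a, b) \<in> {(0, j), (i, plen w)}" if ab: "(a, b) \<in> occ m" for a b
  proof (cases "a = 0")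
    case True
    then show ?thesis using occ_unique_end[OF ab] j by simp
  next
    case False
    then have "b = plen w" using occ_even_inner[OF m full ab] occ_bounds[OF ab] by simp
    then show ?thesis using occ_less_end[OF ab i(1)] occ_less_end[OF i(1) ab] by force
  qed
  then have "occ m = {(0, j), (i, plen w)}" using i j by auto
  then show thesis using that[of j i] i j eq by simp
qed

lemma split_right_left_eq:
  assumes w: "w \<in> SS (Suc m)" and m: "even m"
    and occ: "occurrences w m = {(0, j), (i, plen w)}" "0 < i" "j < plen w"
  shows "split_right m w = tm m 1 (cut w (i, plen w))" "split_left m w = tm m 1 (cut w (0, j))"
proof -
  have wp: "w \<in> paths Q" using SS_path[OF w] .
  have i: "i \<le> plen w" using occ(1) by (auto simp: occurrences_def)
  have fact: "factorizations Q (SS m) w = {cut w (0, j), cut w (i, plen w)}"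
    by (simp add: factorizations_occurrences[OF wp] occ(1))
  have cutL: "cut w (0, j) = (slice w 0 0, slice w 0 j, slice w j (plen w))"
    and cutR: "cut w (i, plen w) = (slice w 0 i, slice w i (plen w), slice w (plen w) (plen w))"
    by (simp_all add: cut_def)
  have len: "plen (slice w 0 0) = 0" "plen (slice w j (plen w)) = plen w - j" "plen (slice w 0 i) = i"
    "plen (slice w (plen w) (plen w)) = 0"
    using i occ by (simp_all add: plen_slice)
  have L: "cut w (0, j) \<in> composable m" and R: "cut w (i, plen w) \<in> composable m"
    using cut_composable(1)[OF wp] occ(1) by auto
  have ne: "cut w (0, j) \<noteq> cut w (i, plen w)"
    using len occ(2) unfolding cutL cutR by (metis less_irrefl prod.inject)
  have "{(q, w', r) \<in> factorizations Q (SS m) w.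
       \<forall>(q', w'', r') \<in> factorizations Q (SS m) w. plen q' \<le> plen q \<and> plen r \<le> plen r'} = {cut w (i, plen w)}"
    unfolding fact cutL cutR using len occ(2,3) by auto
  then show "split_right m w = tm m 1 (cut w (i, plen w))"
    using R unfolding split_right_def tm_one by (simp add: P.M.finsum_insert)
  have "{(q, w', r) \<in> factorizations Q (SS m) w.
       \<forall>(q', w'', r') \<in> factorizations Q (SS m) w. plen q \<le> plen q' \<and> plen r' \<le> plen r} = {cut w (0, j)}"
    unfolding fact cutL cutR using len occ(2,3) by auto
  then show "split_left m w = tm m 1 (cut w (0, j))"
    using L unfolding split_left_def tm_one by (simp add: P.M.finsum_insert)
qed

text \<open>
  The value that the definition of \<open>\<delta>\<close> prescribes at the generator with middle factor \<open>w\<close>.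
\<close>

definition \<delta>_gen :: "nat \<Rightarrow> ('v, 'e) path \<Rightarrow> ('v, 'e, 'k) tens" where
  "\<delta>_gen n w = (if n = 1 then tensor 0 (\<pi> (pe w)) \<one>\<^bsub>kQ\<^esub> \<one>\<^bsub>A\<^esub> \<ominus>\<^bsub>P 0\<^esub> tensor 0 \<one>\<^bsub>A\<^esub> \<one>\<^bsub>kQ\<^esub> (\<pi> (pe w))
     else if odd n then split_right (n - 1) w \<ominus>\<^bsub>P (n - 1)\<^esub> split_left (n - 1) w
     else split (n - 1) w)"

lemma tensor_zero_one:
  assumes "p \<in> paths Q" "q \<in> paths Q" "tgt Q p = src q"
  shows "tensor 0 (\<pi> (single p c)) \<one>\<^bsub>kQ\<^esub> (\<pi> (pe q)) = tm 0 c (p, trivial (src q), q)"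
proof -
  have v: "trivial (src q) \<in> paths Q" "pe (trivial (src q)) \<in> Span 0"
    using trivial_src[OF assms(2)] by (simp_all add: trivial_in_SS src_in_verts assms)
  have "\<pi> (single p c) = \<pi> (single p c) \<otimes>\<^bsub>A\<^esub> idem (src q)"
    using single_mult_idem[of p "src q" c] assms src_in_verts by simp
  then have "tensor 0 (\<pi> (single p c)) \<one>\<^bsub>kQ\<^esub> (\<pi> (pe q)) = tensor 0 (\<pi> (single p c) \<otimes>\<^bsub>A\<^esub> idem (src q)) \<one>\<^bsub>kQ\<^esub> (\<pi> (pe q))"
    by simp
  also have "\<dots> = tensor 0 (\<pi> (single p c)) (pe (trivial (src q))) (\<pi> (pe q))"
    using v assms by (subst tensor_balance_left) (simp_all add: one_in_Span)
  finally show ?thesis by (simp add: tm_def)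
qed

lemma tensor_zero_one_right:
  assumes "p \<in> paths Q"
  shows "tensor 0 (\<pi> (single p c)) \<one>\<^bsub>kQ\<^esub> \<one>\<^bsub>A\<^esub> = tm 0 c (p, trivial (tgt Q p), trivial (tgt Q p))"
proof -
  let ?t = "trivial (tgt Q p)"
  have t: "?t \<in> paths Q" "?t \<in> SS 0" using trivial_tgt[OF assms] by (simp_all add: trivial_in_SS tgt_in_verts assms)
  have "\<pi> (single p c) = \<pi> (single p c) \<otimes>\<^bsub>A\<^esub> idem (tgt Q p)"
    using single_mult_idem[of p "tgt Q p" c] assms tgt_in_verts by simp
  then have "tensor 0 (\<pi> (single p c)) \<one>\<^bsub>kQ\<^esub> \<one>\<^bsub>A\<^esub> = tensor 0 (\<pi> (single p c) \<otimes>\<^bsub>A\<^esub> idem (tgt Q p)) \<one>\<^bsub>kQ\<^esub> \<one>\<^bsub>A\<^esub>"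
    by simp
  also have "\<dots> = tensor 0 (\<pi> (single p c)) (pe ?t) \<one>\<^bsub>A\<^esub>"
    using t assms by (subst tensor_balance_left) (simp_all add: one_in_Span)
  also have "\<dots> = tensor 0 (\<pi> (single p c)) (pe ?t) (idem (tgt Q p))"
    using tensor_idem_right[of "\<pi> (single p c)" ?t 0 "\<one>\<^bsub>A\<^esub>"] t assms by simp
  finally show ?thesis by (simp add: tm_def)
qed

lemma tensor_zero_one_left:
  assumes "p \<in> paths Q"
  shows "tensor 0 \<one>\<^bsub>A\<^esub> \<one>\<^bsub>kQ\<^esub> (\<pi> (pe p)) = tm 0 1 (trivial (src p), trivial (src p), p)"
proof -
  let ?t = "trivial (src p)"
  have t: "?t \<in> paths Q" "?t \<in> SS 0" using trivial_src[OF assms] by (simp_all add: trivial_in_SS src_in_verts assms)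
  have "\<pi> (pe p) = idem (src p) \<otimes>\<^bsub>A\<^esub> \<pi> (pe p)"
    using idem_mult_single[of p "src p" 1] assms src_in_verts by simp
  then have "tensor 0 \<one>\<^bsub>A\<^esub> \<one>\<^bsub>kQ\<^esub> (\<pi> (pe p)) = tensor 0 \<one>\<^bsub>A\<^esub> \<one>\<^bsub>kQ\<^esub> (idem (src p) \<otimes>\<^bsub>A\<^esub> \<pi> (pe p))"
    by simp
  also have "\<dots> = tensor 0 \<one>\<^bsub>A\<^esub> (pe ?t) (\<pi> (pe p))"
    using t assms by (subst tensor_balance_right[symmetric]) (simp_all add: one_in_Span)
  also have "\<dots> = tensor 0 (idem (src p)) (pe ?t) (\<pi> (pe p))"
    using tensor_idem_left[of "\<one>\<^bsub>A\<^esub>" ?t 0 "\<pi> (pe p)"] t assms by (simp add: src_def)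
  finally show ?thesis by (simp add: tm_def)
qed

text \<open>
  An arrow contains two vertices, its source and its target, so that $\delta_1$ follows the pattern of the
  other odd degrees.
\<close>

lemma \<delta>_gen_odd:
  assumes w: "w \<in> SS (Suc m)" and m: "even m"
    and occ: "occurrences w m = {(0, j), (i, plen w)}" "0 < i" "j < plen w"
  shows "\<delta>_gen (Suc m) w = tm m 1 (cut w (i, plen w)) \<ominus>\<^bsub>P m\<^esub> tm m 1 (cut w (0, j))"
proof (cases "m = 0")
  case True
  have wp: "w \<in> paths Q" and len: "plen w = 1" using w True by (auto simp: overlap_paths.simps)
  have "(0, j) \<in> occurrences w 0" "(i, plen w) \<in> occurrences w 0" using occ(1) True by auto
  then have "j = 0" "i = 1" using wp len by (auto simp: occurrences_def SS_0 slice_def vtx_def plen_def)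
  then have cuts: "cut w (0, j) = (trivial (src w), trivial (src w), w)"
     "cut w (i, plen w) = (w, trivial (tgt Q w), trivial (tgt Q w))"
    using len slice_full[of w] vtx_plen[of w] by (simp_all add: cut_def slice_empty del: slice_full vtx_plen)
  show ?thesis
    unfolding cuts using tensor_zero_one_right[OF wp, of 1] tensor_zero_one_left[OF wp]
    by (simp add: True \<delta>_gen_def)
next
  case False
  then show ?thesis using m split_right_left_eq[OF w m occ] by (simp add: \<delta>_gen_def)
qed

lemma \<delta>_gen_even: "odd m \<Longrightarrow> \<delta>_gen (Suc m) w = split m w"
  by (auto simp: \<delta>_gen_def)

lemma \<delta>_gen_in_Sp: "w \<in> SS (Suc m) \<Longrightarrow> \<delta>_gen (Suc m) w \<in> Sp m {t. total t = w}"
proof (cases "even m")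
  case True
  assume w: "w \<in> SS (Suc m)"
  obtain j i where occ: "occurrences w m = {(0, j), (i, plen w)}" "0 < i" "j < plen w"
    using odd_occurrences[OF w True] by blast
  then show ?thesis
    unfolding \<delta>_gen_odd[OF w True occ]
    using cut_composable[OF SS_path[OF w], of _ m] occ(1) by (intro Sp_minus Sp_tm) simp_all
next
  case False
  assume w: "w \<in> SS (Suc m)"
  then show ?thesis using False by (simp add: \<delta>_gen_even split_in_Sp SS_path cut_composable)
qed

lemma \<delta>_spec:
  "\<delta> (Suc m) \<in> bimod_hom A (P (Suc m)) (P m) \<and>
   (\<forall>w\<in>SS (Suc m). \<delta> (Suc m) (tensor (Suc m) \<one>\<^bsub>A\<^esub> (pe w) \<one>\<^bsub>A\<^esub>) = \<delta>_gen (Suc m) w)"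
proof -
  have y: "\<delta>_gen (Suc m) w \<in> carrier (P m)" if "w \<in> SS (Suc m)" for w
    using Sp_carrier[OF \<delta>_gen_in_Sp[OF that]] .
  obtain f where f: "f \<in> bimod_hom A (P (Suc m)) (P m)" "f \<in> extensional (carrier (P (Suc m)))"
    and f_pe: "\<And>w a b. w \<in> SS (Suc m) \<Longrightarrow> a \<in> carrier A \<Longrightarrow> b \<in> carrier A \<Longrightarrow>
      f (tensor (Suc m) a (pe w) b) = (a \<odot>\<^bsub>P m\<^esub> \<delta>_gen (Suc m) w) \<odot>\<^sub>r\<^bsub>P m\<^esub> b"
  proof (rule P_bimod_lift[OF P_bimodule y])
    fix w assume w: "w \<in> SS (Suc m)"
    note wp = SS_path[OF w]
    show "idem (src w) \<odot>\<^bsub>P m\<^esub> \<delta>_gen (Suc m) w = \<delta>_gen (Suc m) w"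
      by (rule Sp_idem_left[OF \<delta>_gen_in_Sp[OF w] src_in_verts[OF wp]]) (use total_src_tgt in auto)
    show "\<delta>_gen (Suc m) w \<odot>\<^sub>r\<^bsub>P m\<^esub> idem (tgt Q w) = \<delta>_gen (Suc m) w"
      by (rule Sp_idem_right[OF \<delta>_gen_in_Sp[OF w] tgt_in_verts[OF wp]]) (use total_src_tgt in auto)
  qed (assumption, blast)
  have f_gen: "f (tensor (Suc m) \<one>\<^bsub>A\<^esub> (pe w) \<one>\<^bsub>A\<^esub>) = \<delta>_gen (Suc m) w" if "w \<in> SS (Suc m)" for w
    using f_pe[OF that, of "\<one>\<^bsub>A\<^esub>" "\<one>\<^bsub>A\<^esub>"] y[OF that] by (simp add: P.lact_one P.ract_one)
  have "\<delta> (Suc m) = f"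
    unfolding \<delta>_def
  proof (rule the_equality)
    show "f \<in> bimod_hom A (P (Suc m)) (P (Suc m - 1)) \<and> f \<in> extensional (carrier (P (Suc m))) \<and>
     (\<forall>w\<in>SS (Suc m). f (tensor (Suc m) \<one>\<^bsub>A\<^esub> (pe w) \<one>\<^bsub>A\<^esub>) =
        (if Suc m = 1 then tensor 0 (\<pi> (pe w)) \<one>\<^bsub>kQ\<^esub> \<one>\<^bsub>A\<^esub> \<ominus>\<^bsub>P 0\<^esub> tensor 0 \<one>\<^bsub>A\<^esub> \<one>\<^bsub>kQ\<^esub> (\<pi> (pe w))
         else if odd (Suc m) then split_right (Suc m - 1) w \<ominus>\<^bsub>P (Suc m - 1)\<^esub> split_left (Suc m - 1) w
         else split (Suc m - 1) w))"
      using f f_gen by (simp add: \<delta>_gen_def)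
    fix g assume g: "g \<in> bimod_hom A (P (Suc m)) (P (Suc m - 1)) \<and> g \<in> extensional (carrier (P (Suc m))) \<and>
     (\<forall>w\<in>SS (Suc m). g (tensor (Suc m) \<one>\<^bsub>A\<^esub> (pe w) \<one>\<^bsub>A\<^esub>) =
        (if Suc m = 1 then tensor 0 (\<pi> (pe w)) \<one>\<^bsub>kQ\<^esub> \<one>\<^bsub>A\<^esub> \<ominus>\<^bsub>P 0\<^esub> tensor 0 \<one>\<^bsub>A\<^esub> \<one>\<^bsub>kQ\<^esub> (\<pi> (pe w))
         else if odd (Suc m) then split_right (Suc m - 1) w \<ominus>\<^bsub>P (Suc m - 1)\<^esub> split_left (Suc m - 1) w
         else split (Suc m - 1) w))"
    show "g = f"
    proof (rule extensionalityI)
      show "g x = f x" if "x \<in> carrier (P (Suc m))" for x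
        by (rule bimod_hom_eqI[OF P_bimodule _ f(1) _ that]) (use g f_gen in \<open>auto simp: \<delta>_gen_def\<close>)
    qed (use g f in auto)
  qed
  then show ?thesis using f f_gen by blast
qed

definition signed :: "nat \<Rightarrow> nat \<Rightarrow> ('v, 'e, 'k) tens \<Rightarrow> ('v, 'e, 'k) tens" where
  "signed m n x = (if even m then x else \<ominus>\<^bsub>P n\<^esub> x)"

lemma add_pow_sign: "x \<in> carrier (P n) \<Longrightarrow> add_pow (P n) ((- 1 :: int) ^ m) x = signed m n x"
proof (cases "even m")
  case False
  assume x: "x \<in> carrier (P n)"
  have "add_pow (P n) (- 1 :: int) x = \<ominus>\<^bsub>P n\<^esub> add_pow (P n) (1 :: int) x"
    using P.M.add.int_pow_neg[OF x, of 1] by simp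
  moreover have "add_pow (P n) (1 :: int) x = x" using P.M.add.int_pow_1[OF x] by simp
  ultimately show ?thesis using False by (simp add: signed_def)
next
  case True
  assume x: "x \<in> carrier (P n)"
  have "add_pow (P n) (1 :: int) x = x" using P.M.add.int_pow_1[OF x] by simp
  then show ?thesis using True by (simp add: signed_def)
qed

lemma signed_in_Sp: "x \<in> Sp n B \<Longrightarrow> signed m n x \<in> Sp n B"
  by (simp add: signed_def Sp_uminus)

text \<open>
  The value prescribed by the definition is compatible with the left idempotent of \<open>w\<close>, as all terms of a
  splitting are parallel to the path; so \<open>P_left_lift\<close> yields the map.
\<close>

lemma \<gamma>_spec:
  "\<gamma> m \<in> left_hom A (P m) (P (Suc m)) \<and>
   (\<forall>w\<in>SS m. \<forall>u\<in>Irr. tgt Q w = src u \<longrightarrow>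
     \<gamma> m (tensor m \<one>\<^bsub>A\<^esub> (pe w) (\<pi> (pe u))) = signed (Suc m) (Suc m) (split (Suc m) (pcat w u)))"
proof -
  define y where "y w u = (if tgt Q w = src u then signed (Suc m) (Suc m) (split (Suc m) (pcat w u)) else \<zero>\<^bsub>P (Suc m)\<^esub>)" for w u
  have wu: "pcat w u \<in> paths Q" if "w \<in> SS m" "u \<in> Irr" "tgt Q w = src u" for w u
    using that SS_path irreducible_in_paths pcat_in_paths by blast
  have y_Sp: "y w u \<in> Sp (Suc m) {t. src (total t) = src w}" if "w \<in> SS m" "u \<in> Irr" for w u
    using that wu[OF that] by (auto simp: y_def Sp_zero cut_composable intro!: signed_in_Sp split_in_Sp)
  have y: "y w u \<in> carrier (P (Suc m))" if "w \<in> SS m" "u \<in> Irr" for w u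
    using Sp_carrier[OF y_Sp[OF that]] .
  obtain f where f: "f \<in> left_hom A (P m) (P (Suc m))" "f \<in> extensional (carrier (P m))"
    and f_pe: "\<And>w u. w \<in> SS m \<Longrightarrow> u \<in> Irr \<Longrightarrow> f (tensor m \<one>\<^bsub>A\<^esub> (pe w) (\<pi> (pe u))) = y w u"
  proof (rule P_left_lift[OF P_bimodule y])
    fix w u assume w: "w \<in> SS m" and u: "u \<in> Irr"
    show "idem (src w) \<odot>\<^bsub>P (Suc m)\<^esub> y w u = y w u"
      by (rule Sp_idem_left[OF y_Sp[OF w u] src_in_verts[OF SS_path[OF w]]]) (use total_src_tgt in auto)
    show "y w u = \<zero>\<^bsub>P (Suc m)\<^esub>" if "tgt Q w \<noteq> src u" using that by (simp add: y_def)
  qed (assumption, assumption, blast)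
  have y_eq: "y w u = (if tgt Q w = src u then add_pow (P (Suc m)) ((- 1 :: int) ^ Suc m) (split (Suc m) (pcat w u))
         else \<zero>\<^bsub>P (Suc m)\<^esub>)" if "w \<in> SS m" "u \<in> Irr" for w u
  proof (cases "tgt Q w = src u")
    case True
    have "split (Suc m) (pcat w u) \<in> carrier (P (Suc m))"
      by (rule Sp_carrier[OF split_in_Sp[OF wu[OF that True]], of "Suc m" UNIV]) simp
    from add_pow_sign[OF this, of "Suc m"] show ?thesis using True by (simp only: y_def if_True)
  qed (simp add: y_def)
  have "\<gamma> m = f"
    unfolding \<gamma>_def
  proof (rule the_equality)
    show "f \<in> left_hom A (P m) (P (Suc m)) \<and> f \<in> extensional (carrier (P m)) \<and>
     (\<forall>w\<in>SS m. \<forall>u\<in>Irr. f (tensor m \<one>\<^bsub>A\<^esub> (pe w) (\<pi> (pe u))) =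
        (if tgt Q w = src u then add_pow (P (Suc m)) ((- 1 :: int) ^ Suc m) (split (Suc m) (pcat w u))
         else \<zero>\<^bsub>P (Suc m)\<^esub>))"
      using f f_pe y_eq by (simp del: power_Suc)
    fix g assume g: "g \<in> left_hom A (P m) (P (Suc m)) \<and> g \<in> extensional (carrier (P m)) \<and>
     (\<forall>w\<in>SS m. \<forall>u\<in>Irr. g (tensor m \<one>\<^bsub>A\<^esub> (pe w) (\<pi> (pe u))) =
        (if tgt Q w = src u then add_pow (P (Suc m)) ((- 1 :: int) ^ Suc m) (split (Suc m) (pcat w u))
         else \<zero>\<^bsub>P (Suc m)\<^esub>))"
    show "g = f"
    proof (rule extensionalityI)
      show "g x = f x" if "x \<in> carrier (P m)" for x
        by (rule left_hom_eqI[OF P_bimodule _ f(1) _ that]) (use g f_pe y_eq in \<open>auto simp del: power_Suc\<close>)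
    qed (use g f in auto)
  qed
  then show ?thesis using f f_pe by (simp add: y_def)
qed

lemma augmentation_spec:
  "augmentation \<in> bimod_hom A (P 0) (regular_bimod A) \<and>
   (\<forall>a\<in>carrier A. \<forall>b\<in>carrier A. augmentation (tensor 0 a \<one>\<^bsub>kQ\<^esub> b) = a \<otimes>\<^bsub>A\<^esub> b)"
proof -
  interpret A: ring A by (rule A_ring)
  have idem: "idem (src w) = \<pi> (pe w)" "idem (tgt Q w) = \<pi> (pe w)" "\<pi> (pe w) \<otimes>\<^bsub>A\<^esub> \<pi> (pe w) = \<pi> (pe w)"
    "\<pi> (pe w) \<in> carrier A" if w: "w \<in> SS 0" for w
  proof -
    obtain v where v: "w = trivial v" "v \<in> verts Q" using w by (auto simp: SS_0)
    then show "idem (src w) = \<pi> (pe w)" "idem (tgt Q w) = \<pi> (pe w)" "\<pi> (pe w) \<in> carrier A"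
      by (simp_all add: src_def trivial_path)
    show "\<pi> (pe w) \<otimes>\<^bsub>A\<^esub> \<pi> (pe w) = \<pi> (pe w)"
      using v idem_mult_single[of "trivial v" v 1] by (simp add: src_def trivial_path)
  qed
  have "\<exists>f. f \<in> hom (add_monoid (P 0)) (add_monoid A) \<and> f \<in> extensional (carrier (P 0)) \<and>
    (\<forall>w\<in>SS 0. \<forall>a\<in>carrier A. \<forall>b\<in>carrier A. f (tensor 0 a (pe w) b) = a \<otimes>\<^bsub>A\<^esub> \<pi> (pe w) \<otimes>\<^bsub>A\<^esub> b)"
  proof (rule P_lift[OF A_abelian_group])
    fix w a b assume w: "w \<in> SS 0" and a: "a \<in> carrier A" and b: "b \<in> carrier A"
    note i = idem[OF w]
    show "a \<otimes>\<^bsub>A\<^esub> idem (src w) \<otimes>\<^bsub>A\<^esub> \<pi> (pe w) \<otimes>\<^bsub>A\<^esub> b = a \<otimes>\<^bsub>A\<^esub> \<pi> (pe w) \<otimes>\<^bsub>A\<^esub> b"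
      using a b i by (simp add: A_m_assoc)
    show "a \<otimes>\<^bsub>A\<^esub> \<pi> (pe w) \<otimes>\<^bsub>A\<^esub> (idem (tgt Q w) \<otimes>\<^bsub>A\<^esub> b) = a \<otimes>\<^bsub>A\<^esub> \<pi> (pe w) \<otimes>\<^bsub>A\<^esub> b"
      using a b i by (simp add: A_m_assoc[symmetric]) (simp add: A_m_assoc)
    show "a \<otimes>\<^bsub>A\<^esub> \<kappa> c \<otimes>\<^bsub>A\<^esub> \<pi> (pe w) \<otimes>\<^bsub>A\<^esub> b = a \<otimes>\<^bsub>A\<^esub> \<pi> (pe w) \<otimes>\<^bsub>A\<^esub> (\<kappa> c \<otimes>\<^bsub>A\<^esub> b)" for c
      using a b i(4) \<kappa>_comm[OF i(4), of c] by (simp add: A_m_assoc[symmetric]) (simp add: A_m_assoc)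
  qed (simp_all add: idem A_l_distr A_r_distr)
  then obtain f where f: "f \<in> hom (add_monoid (P 0)) (add_monoid A)" "f \<in> extensional (carrier (P 0))"
    and f_pe: "\<And>w a b. w \<in> SS 0 \<Longrightarrow> a \<in> carrier A \<Longrightarrow> b \<in> carrier A \<Longrightarrow>
      f (tensor 0 a (pe w) b) = a \<otimes>\<^bsub>A\<^esub> \<pi> (pe w) \<otimes>\<^bsub>A\<^esub> b"
    by blast
  note fz = add_hom_zero[OF P_abelian_group A_abelian_group f(1)] add_hom_add[OF f(1)] add_hom_closed[OF f(1)]
  have f_x: "f (tensor 0 a x b) = a \<otimes>\<^bsub>A\<^esub> \<pi> x \<otimes>\<^bsub>A\<^esub> b" if x: "x \<in> Span 0" and a: "a \<in> carrier A" and b: "b \<in> carrier A" for a x b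
    using x
  proof (induction x rule: linear_span_induct)
    case zero
    then show ?case using a b by (simp add: tensor_zero_mid fz)
  next
    case (single w c)
    have "a \<otimes>\<^bsub>A\<^esub> \<kappa> c \<otimes>\<^bsub>A\<^esub> \<pi> (pe w) = a \<otimes>\<^bsub>A\<^esub> \<pi> (single w c)"
      using a SS_path[OF single] by (simp add: A_m_assoc \<kappa>_left)
    then show ?case unfolding tensor_single[OF a single b] using a b f_pe[OF single, of "a \<otimes>\<^bsub>A\<^esub> \<kappa> c" b] by simp
  next
    case (add x y)
    then show ?case using a b by (simp add: tensor_add_mid fz \<pi>_add Span_in_lin A_l_distr A_r_distr)
  qed
  have f_one: "f (tensor 0 a \<one>\<^bsub>kQ\<^esub> b) = a \<otimes>\<^bsub>A\<^esub> b" if "a \<in> carrier A" "b \<in> carrier A" for a b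
    using f_x[OF one_in_Span that] that by (simp add: \<pi>_one)
  have "augmentation = f"
    unfolding augmentation_def
  proof (rule the_equality)
    show "f \<in> hom (add_monoid (P 0)) (add_monoid A) \<and> f \<in> extensional (carrier (P 0)) \<and>
     (\<forall>a\<in>carrier A. \<forall>b\<in>carrier A. f (tensor 0 a \<one>\<^bsub>kQ\<^esub> b) = a \<otimes>\<^bsub>A\<^esub> b)"
      using f f_one by blast
    fix g assume g: "g \<in> hom (add_monoid (P 0)) (add_monoid A) \<and> g \<in> extensional (carrier (P 0)) \<and>
     (\<forall>a\<in>carrier A. \<forall>b\<in>carrier A. g (tensor 0 a \<one>\<^bsub>kQ\<^esub> b) = a \<otimes>\<^bsub>A\<^esub> b)"
    show "g = f"
    proof (rule extensionalityI)
      show "g x = f x" if "x \<in> carrier (P 0)" for x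
      proof (rule P_hom_eq_pe[OF _ f(1) A_abelian_group _ that])
        fix a w b assume a: "a \<in> carrier A" and w: "w \<in> SS 0" and b: "b \<in> carrier A"
        have "tensor 0 a (pe w) b = tensor 0 (a \<otimes>\<^bsub>A\<^esub> \<pi> (pe w)) \<one>\<^bsub>kQ\<^esub> b"
          using tensor_balance_left[OF a pe_in_Span[OF w] one_in_Span b] SS_path[OF w] by simp
        then show "g (tensor 0 a (pe w) b) = f (tensor 0 a (pe w) b)"
          using g f_one a b idem(4)[OF w] by simp
      qed (use g in blast)
    qed (use g f in auto)
  qed
  moreover have "f \<in> bimod_hom A (P 0) (regular_bimod A)"
  proof (rule bimod_homI)
    show "f \<in> hom (add_monoid (P 0)) (add_monoid (regular_bimod A))"
      using f(1) by (simp add: hom_def regular_bimod_def)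
    fix a x assume a: "a \<in> carrier A" and x: "x \<in> carrier (P 0)"
    have "f (a \<odot>\<^bsub>P 0\<^esub> x) = a \<otimes>\<^bsub>A\<^esub> f x"
      using x by (induction x rule: P_induct_pe)
        (simp_all add: a fz P.lact_zero P.lact_add_right P.lact_closed A_r_distr f_pe idem A_m_assoc)
    then show "f (a \<odot>\<^bsub>P 0\<^esub> x) = a \<odot>\<^bsub>regular_bimod A\<^esub> f x" by (simp add: regular_bimod_def)
    have "f (x \<odot>\<^sub>r\<^bsub>P 0\<^esub> a) = f x \<otimes>\<^bsub>A\<^esub> a"
      using x by (induction x rule: P_induct_pe)
        (simp_all add: a fz P.ract_zero P.ract_add_left P.ract_closed A_l_distr f_pe idem A_m_assoc)
    then show "f (x \<odot>\<^sub>r\<^bsub>P 0\<^esub> a) = f x \<odot>\<^sub>r\<^bsub>regular_bimod A\<^esub> a" by (simp add: regular_bimod_def)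
  qed
  ultimately show ?thesis using f_one by blast
qed

lemma regular_bimodule: "bimodule scalars A (regular_bimod A)"
proof -
  interpret A: ring A by (rule A_ring)
  have add: "abelian_group (regular_bimod A)"
  proof (rule abelian_groupI)
    fix x assume "x \<in> carrier (regular_bimod A)"
    then show "\<exists>y\<in>carrier (regular_bimod A). y \<oplus>\<^bsub>regular_bimod A\<^esub> x = \<zero>\<^bsub>regular_bimod A\<^esub>"
      using P.R.l_neg[of x] P.R.a_inv_closed[of x] by (auto simp: regular_bimod_def)
  next
    fix x y assume "x \<in> carrier (regular_bimod A)" "y \<in> carrier (regular_bimod A)"
    then show "x \<oplus>\<^bsub>regular_bimod A\<^esub> y = y \<oplus>\<^bsub>regular_bimod A\<^esub> x"
      using P.R.a_comm[of x y] by (simp add: regular_bimod_def)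
  qed (simp_all add: regular_bimod_def P.R.a_assoc)
  show ?thesis
    by (intro bimodule.intro bimodule_axioms.intro A_ring add)
      (auto simp: regular_bimod_def A_l_distr A_r_distr A_m_assoc scalars_eq \<kappa>_comm)
qed

lemma coaugmentation_hom: "coaugmentation \<in> left_hom A (regular_bimod A) (P 0)"
  unfolding left_hom_def mem_Collect_eq coaugmentation_def
  by (intro conjI ballI add_homI) (simp_all add: regular_bimod_def one_in_Span tensor_add_left)

lemma augmentation_tm:
  assumes t: "(q, w, r) \<in> composable 0"
  shows "augmentation (tm 0 c (q, w, r)) = \<pi> (single (total (q, w, r)) c)"
proof -
  obtain v where v: "w = trivial v" "v \<in> verts Q" using t SS_0 unfolding composable_def by blast
  have *: "q \<in> paths Q" "r \<in> paths Q" "tgt Q q = v" "src r = v" using t v by (auto simp: composable_def src_def)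
  have "tm 0 c (q, w, r) = tensor 0 (\<pi> (single q c)) \<one>\<^bsub>kQ\<^esub> (\<pi> (pe r))"
    using tensor_zero_one[of q r c] * v by simp
  then have "augmentation (tm 0 c (q, w, r)) = \<pi> (single q c) \<otimes>\<^bsub>A\<^esub> \<pi> (pe r)"
    using augmentation_spec * by simp
  also have "\<dots> = \<pi> (single (total (q, w, r)) c)"
    using * v by (simp add: single_mult_single total_def pcat_trivial_left)
  finally show ?thesis .
qed

lemma coaugmentation_single:
  "p \<in> paths Q \<Longrightarrow> coaugmentation (\<pi> (single p c)) = tm 0 c (p, trivial (tgt Q p), trivial (tgt Q p))"
  by (simp add: coaugmentation_def tensor_zero_one_right)

end

context diamond_system
begin

section \<open>Terminal generators\<close>

lemma slice_occurrences:
  assumes "i \<le> j" "j \<le> plen p"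
  shows "(a, b) \<in> occurrences (slice p i j) m \<longleftrightarrow> (i + a, i + b) \<in> occurrences p m \<and> i + b \<le> j"
  using assms by (auto simp: occurrences_def plen_slice slice_slice)

lemma slice_suffix: "tgt Q w = src u \<Longrightarrow> slice (pcat w u) (plen w) (plen (pcat w u)) = u"
  using slice_pcat_snd[of w u] by simp

text \<open>
  If \<open>r\<close> is irreducible, then the sum that defines $\gamma_n(1 \otimes w \otimes r)$ is empty, since by
  \<open>terminal_no_occurrences\<close> a path in $S_{n+1}$ does not occur further right either.
\<close>

definition terminal :: "nat \<Rightarrow> ('v, 'e) path \<Rightarrow> ('v, 'e) path \<Rightarrow> bool" where
  "terminal n w r \<longleftrightarrow> (\<forall>j. (0, j) \<notin> occurrences (pcat w r) (Suc n))"

definition Terminal :: "nat \<Rightarrow> (('v, 'e) path \<times> ('v, 'e) path \<times> ('v, 'e) path) set" where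
  "Terminal n = {(q, w, r). r \<in> Irr \<and> terminal n w r}"

definition upto :: "('v, 'e) path \<Rightarrow> (('v, 'e) path \<times> ('v, 'e) path \<times> ('v, 'e) path) set" where
  "upto p = {t. (total t, p) \<in> below\<^sup>=}"

lemma occurrence_start:
  assumes "w \<in> SS n" "u \<in> Irr" "tgt Q w = src u"
  shows "pcat w u \<in> paths Q" "(0, plen w) \<in> occurrences (pcat w u) n"
    "interval_system.rel_free (rel (pcat w u)) (plen w)"
proof -
  show p: "pcat w u \<in> paths Q" using assms SS_path irreducible_in_paths pcat_in_paths by blast
  show "(0, plen w) \<in> occurrences (pcat w u) n"
    using assms by (simp add: occurrences_def slice_pcat_left)
  show "interval_system.rel_free (rel (pcat w u)) (plen w)"
    using rel_free_iff[OF p, of "plen w"] slice_suffix[OF assms(3)] assms by simp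
qed

lemma occurrence_end_le:
  assumes "p \<in> paths Q" "(i, j) \<in> occurrences p n" "(i', j') \<in> occurrences p n" "i \<le> i'"
  shows "j \<le> j'"
  using assms interval_system.occ_le_end[OF interval_system_rel] by (simp add: occurrences_eq_occ)

lemma occurrence_end_less:
  assumes "p \<in> paths Q" "(i, j) \<in> occurrences p n" "(i', j') \<in> occurrences p n" "i < i'"
  shows "j < j'"
  using assms interval_system.occ_less_end[OF interval_system_rel] by (simp add: occurrences_eq_occ)

lemma occurrence_unique_end:
  assumes "p \<in> paths Q" "(i, j) \<in> occurrences p n" "(i, j') \<in> occurrences p n"
  shows "j = j'"
  using assms interval_system.occ_unique_end[OF interval_system_rel] by (simp add: occurrences_eq_occ)

lemma rel_free_mono:
  assumes "p \<in> paths Q" "interval_system.rel_free (rel p) j" "j \<le> j'"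
  shows "interval_system.rel_free (rel p) j'"
  using assms unfolding interval_system.rel_free_def[OF interval_system_rel[OF assms(1)]] by (meson le_trans)

context
  fixes n w u p
  assumes w: "w \<in> SS n" and u: "u \<in> Irr" and wu: "tgt Q w = src u" and p: "p = pcat w u"
begin

lemmas start = occurrence_start[OF w u wu, folded p]

interpretation interval_system "rel p" "plen p" by (rule interval_system_rel[OF start(1)])

lemmas occ_eq = occurrences_eq_occ[OF start(1)]

lemma suffix_irreducible:
  assumes "(i, j) \<in> occurrences p n"
  shows "slice p j (plen p) \<in> Irr"
proof -
  have "plen w \<le> j" using occurrence_end_le[OF start(1,2) assms] by simp
  then have "interval_system.rel_free (rel p) j" by (rule rel_free_mono[OF start(1,3)])
  then show ?thesis using rel_free_iff[OF start(1)] assms by (simp add: occurrences_def)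
qed

lemma cut_in_Terminal:
  assumes "(i, j) \<in> occurrences p m" and "slice p j (plen p) \<in> Irr" and none: "\<And>k. (i, k) \<notin> occurrences p (Suc m)"
  shows "cut p (i, j) \<in> Terminal m"
proof -
  have ij: "i \<le> j" "j \<le> plen p" using assms(1) by (simp_all add: occurrences_def)
  have "terminal m (slice p i j) (slice p j (plen p))"
    unfolding terminal_def pcat_slice[OF ij]
    using slice_occurrences[of i "plen p" p 0 _ "Suc m"] none ij by auto
  then show ?thesis using assms(2) by (simp add: cut_def Terminal_def)
qed

lemma suffix_irreducible_Suc:
  assumes "(i, j) \<in> occurrences p (Suc n)"
  shows "slice p j (plen p) \<in> Irr"
proof -
  obtain j' where "(i, j') \<in> occurrences p n" "j' < j" using assms occ_prefix unfolding occ_eq by metis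
  then have "plen w \<le> j" using occurrence_end_le[OF start(1,2)] by fastforce
  then have "interval_system.rel_free (rel p) j" by (rule rel_free_mono[OF start(1,3)])
  then show ?thesis using rel_free_iff[OF start(1)] assms by (simp add: occurrences_def)
qed

lemma cut_Suc_in_Terminal:
  assumes "ij \<in> occurrences p (Suc n)"
  shows "cut p ij \<in> Terminal (Suc n)"
proof -
  obtain i j where ij: "ij = (i, j)" by (cases ij)
  have "(i, k) \<notin> occurrences p (Suc (Suc n))" for k
    using occ_Suc_Suc_none[OF start(2)[unfolded occ_eq] start(3)] unfolding occ_eq by auto
  then show ?thesis using cut_in_Terminal suffix_irreducible_Suc assms ij by blast
qed

lemma terminal_no_occurrences:
  assumes "terminal n w u"
  shows "occurrences p (Suc n) = {}"
proof -
  have none: "(0, z) \<notin> occ (Suc n)" for z using assms by (simp add: terminal_def p[symmetric] occ_eq)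
  show ?thesis
    unfolding occ_eq using occ_Suc_none[OF start(2)[unfolded occ_eq] start(3) none] by auto
qed

lemma odd_cut_in_Terminal:
  assumes "odd n" "(i, j) \<in> occurrences p n" "0 < i"
  shows "cut p (i, j) \<in> Terminal n"
proof -
  have "(i, k) \<notin> occurrences p (Suc n)" for k
    using occ_odd_none[OF assms(1) start(2)[unfolded occ_eq] start(3) assms(3)] unfolding occ_eq by auto
  then show ?thesis using cut_in_Terminal suffix_irreducible assms by blast
qed

text \<open>
  Let \<open>a\<close> be the start of the last occurrence before \<open>b\<close>. By \<open>occ_even_next\<close> it extends to an occurrence of
  $S_{n+1}$ that ends at \<open>e\<close> at the latest, and by \<open>R\<close> this one ends with an occurrence of $S_n$ that starts
  after \<open>a\<close>. There is none between \<open>a\<close> and \<open>b\<close>, and those after \<open>b\<close> end too late, so it is the one at \<open>b\<close>.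
\<close>

lemma even_predecessor:
  assumes "even n" and be: "(b, e) \<in> occurrences p n" "0 < b"
    and R: "\<And>i j. (i, j) \<in> occurrences p (Suc n) \<Longrightarrow> \<exists>c. i < c \<and> (c, j) \<in> occurrences p n"
  shows "\<exists>a. (a, e) \<in> occurrences p (Suc n)"
proof -
  define a where "a = Max {a. (\<exists>j. (a, j) \<in> occurrences p n) \<and> a < b}"
  have fin: "finite {a. (\<exists>j. (a, j) \<in> occurrences p n) \<and> a < b}" by (rule finite_subset[of _ "{..<b}"]) auto
  have "0 \<in> {a. (\<exists>j. (a, j) \<in> occurrences p n) \<and> a < b}" using start(2) be(2) by auto
  then have "a \<in> {a. (\<exists>j. (a, j) \<in> occurrences p n) \<and> a < b}" unfolding a_def by (intro Max_in[OF fin]) auto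
  then obtain j where a: "(a, j) \<in> occurrences p n" "a < b" by blast
  have max: "c \<le> a" if "(c, k) \<in> occurrences p n" "c < b" for c k
    unfolding a_def by (rule Max_ge[OF fin]) (use that in blast)
  obtain z where z: "(a, z) \<in> occurrences p (Suc n)" "z \<le> e"
    using occ_even_next[OF assms(1) start(2)[unfolded occ_eq] start(3) le0 a(2) a(1)[unfolded occ_eq] be(1)[unfolded occ_eq]]
    unfolding occ_eq by blast
  obtain c where c: "a < c" "(c, z) \<in> occurrences p n" using R[OF z(1)] by blast
  have "\<not> c < b" using max[OF c(2)] c(1) by auto
  moreover have "\<not> b < c" using occurrence_end_less[OF start(1) be(1) c(2)] z(2) by auto
  ultimately have "c = b" by simp
  then have "z = e" using occurrence_unique_end[OF start(1) be(1)] c(2) by simp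
  then show ?thesis using z(1) by blast
qed

end

section \<open>Values on elementary tensors\<close>

lemma total_below:
  assumes "(q, w, r) \<in> composable n" "(r', r) \<in> below"
  shows "(total (q, w, r'), total (q, w, r)) \<in> below"
proof -
  have *: "q \<in> paths Q" "w \<in> paths Q" "r \<in> paths Q" "tgt Q q = src w" "tgt Q w = src r"
    using assms(1) SS_path[of w n] by (simp_all add: composable_def)
  have "(pcat (pcat q w) (pcat r' (trivial (tgt Q r))), pcat (pcat q w) (pcat r (trivial (tgt Q r)))) \<in> below"
    by (rule below_pcat[OF assms(2)]) (use * in \<open>simp_all add: pcat_in_paths tgt_pcat trivial_tgt src_def\<close>)
  then show ?thesis by (simp add: total_def pcat_assoc)
qed

lemma upto_irreducible:
  assumes "x \<in> Sp n (upto p)"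
  shows "x \<in> Sp n (upto p \<inter> {(q, w, u). u \<in> Irr})"
  using assms
proof (induction rule: Sp.induct)
  case (Sp_tm t c)
  obtain q w r where t: "t = (q, w, r)" by (cases t)
  show ?case
    unfolding t
  proof (rule tm_expand)
    show "(q, w, r) \<in> composable n" using Sp_tm t by simp
    fix u assume u: "u \<in> Irr" "(u, r) \<in> below\<^sup>="
    have "(total (q, w, u), total (q, w, r)) \<in> below\<^sup>="
      using u(2) total_below[of q w r n u] Sp_tm(1) t by auto
    moreover have "(total (q, w, r), p) \<in> below\<^sup>=" using Sp_tm(2) t by (simp add: upto_def)
    ultimately show "(q, w, u) \<in> upto p \<inter> {(q, w, u). u \<in> Irr}"
      using below_eq_trans[of "total (q, w, u)" "total (q, w, r)" p] u(1) unfolding upto_def by blast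
  qed
qed (auto intro: Sp.intros)

lemma tm_gen:
  assumes "(q, w, r) \<in> composable n"
  shows "tm n c (q, w, r) = (\<pi> (single q c) \<odot>\<^bsub>P n\<^esub> tensor n \<one>\<^bsub>A\<^esub> (pe w) \<one>\<^bsub>A\<^esub>) \<odot>\<^sub>r\<^bsub>P n\<^esub> \<pi> (pe r)"
    and "tm n c (q, w, r) = \<pi> (single q c) \<odot>\<^bsub>P n\<^esub> tensor n \<one>\<^bsub>A\<^esub> (pe w) (\<pi> (pe r))"
  using assms by (simp_all add: tm_def composable_def)

lemma bimod_hom_tm:
  assumes f: "f \<in> bimod_hom A (P n) M" and t: "(q, w, r) \<in> composable n"
  shows "f (tm n c (q, w, r)) = (\<pi> (single q c) \<odot>\<^bsub>M\<^esub> f (tensor n \<one>\<^bsub>A\<^esub> (pe w) \<one>\<^bsub>A\<^esub>)) \<odot>\<^sub>r\<^bsub>M\<^esub> \<pi> (pe r)"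
proof -
  have c: "\<pi> (single q c) \<in> carrier A" "\<pi> (pe r) \<in> carrier A" "tensor n \<one>\<^bsub>A\<^esub> (pe w) \<one>\<^bsub>A\<^esub> \<in> carrier (P n)"
    using t by (simp_all add: composable_def)
  show ?thesis
    unfolding tm_gen(1)[OF t] bimod_hom_rsmult[OF f c(2) P.lact_closed[OF c(1,3)]]
      left_hom_smult[OF bimod_hom_left[OF f] c(1,3)] ..
qed

lemma \<gamma>_tm:
  assumes t: "(q, w, u) \<in> composable n" and u: "u \<in> Irr"
  shows "\<gamma> n (tm n c (q, w, u)) = \<pi> (single q c) \<odot>\<^bsub>P (Suc n)\<^esub> signed (Suc n) (Suc n) (split (Suc n) (pcat w u))"
proof -
  have *: "\<pi> (single q c) \<in> carrier A" "w \<in> SS n" "u \<in> paths Q" "tgt Q w = src u"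
    using t by (simp_all add: composable_def)
  have c: "tensor n \<one>\<^bsub>A\<^esub> (pe w) (\<pi> (pe u)) \<in> carrier (P n)" using * by simp
  show ?thesis
    unfolding tm_gen(2)[OF t] left_hom_smult[OF conjunct1[OF \<gamma>_spec] *(1) c]
    using \<gamma>_spec[of n] * u by simp
qed

lemma composable_pcat: "(q, w, u) \<in> composable n \<Longrightarrow> pcat w u \<in> paths Q"
  using SS_path[of w n] by (simp add: composable_def pcat_in_paths)

lemma split_closed: "p \<in> paths Q \<Longrightarrow> split n p \<in> carrier (P n)"
  using Sp_carrier[OF split_in_Sp[of p n UNIV]] by simp

lemma signed_zero: "signed m n \<zero>\<^bsub>P n\<^esub> = \<zero>\<^bsub>P n\<^esub>"
proof -
  have neg_zero: "\<ominus>\<^bsub>P n\<^esub> \<zero>\<^bsub>P n\<^esub> = \<zero>\<^bsub>P n\<^esub>" by (rule P.M.minus_equality) simp_all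
  show ?thesis unfolding signed_def neg_zero by simp
qed

lemma \<gamma>_hom: "\<gamma> n \<in> hom (add_monoid (P n)) (add_monoid (P (Suc n)))"
  using left_hom_add conjunct1[OF \<gamma>_spec] by blast

lemma \<delta>_hom: "\<delta> (Suc n) \<in> hom (add_monoid (P (Suc n))) (add_monoid (P n))"
  using bimod_hom_add conjunct1[OF \<delta>_spec] by blast

lemma \<gamma>_Terminal:
  assumes "x \<in> Sp n (Terminal n)"
  shows "\<gamma> n x = \<zero>\<^bsub>P (Suc n)\<^esub>"
  using assms
proof (induction rule: Sp.induct)
  case Sp_zero
  then show ?case by (rule P_hom_zero[OF \<gamma>_hom])
next
  case (Sp_tm t c)
  obtain q w u where t: "t = (q, w, u)" by (cases t)
  have *: "(q, w, u) \<in> composable n" "u \<in> Irr" "terminal n w u" using Sp_tm t by (simp_all add: Terminal_def)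
  have c: "w \<in> SS n" "tgt Q w = src u" "q \<in> paths Q" using *(1) by (simp_all add: composable_def)
  have "split (Suc n) (pcat w u) = \<zero>\<^bsub>P (Suc n)\<^esub>"
    unfolding split_eq[OF composable_pcat[OF *(1)]] terminal_no_occurrences[OF c(1) *(2) c(2) refl *(3)] by simp
  then show ?case using c unfolding t \<gamma>_tm[OF *(1,2)] by (simp add: signed_zero P.lact_zero)
next
  case (Sp_add x y)
  then show ?case by (simp add: add_hom_add[OF \<gamma>_hom] Sp_carrier)
qed

lemma \<gamma>_tm_in_Sp:
  assumes t: "(q, w, u) \<in> composable n" and u: "u \<in> Irr"
  shows "\<gamma> n (tm n c (q, w, u)) \<in> Sp (Suc n) (Terminal (Suc n) \<inter> {t. total t = total (q, w, u)})"
proof -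
  have *: "w \<in> SS n" "tgt Q w = src u" "q \<in> paths Q" using t by (simp_all add: composable_def)
  have "split (Suc n) (pcat w u) \<in> Sp (Suc n) (Terminal (Suc n) \<inter> {t. total t = pcat w u})"
    by (rule split_in_Sp[OF composable_pcat[OF t]])
      (use cut_Suc_in_Terminal[OF *(1) u *(2) refl] cut_composable(2)[OF composable_pcat[OF t]] in blast)
  from signed_in_Sp[OF this, of "Suc n"] show ?thesis
    unfolding \<gamma>_tm[OF t u] by (rule Sp_left[OF _ *(3)]) (auto simp: Terminal_def total_def pcat_assoc)
qed

lemma \<gamma>_upto:
  assumes "x \<in> Sp n (upto p)"
  shows "\<gamma> n x \<in> Sp (Suc n) (Terminal (Suc n) \<inter> upto p)"
proof (rule Sp_hom[OF upto_irreducible[OF assms] \<gamma>_hom])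
  fix q w u c assume t: "(q, w, u) \<in> composable n" "(q, w, u) \<in> upto p \<inter> {(q, w, u). u \<in> Irr}"
  have u: "u \<in> Irr" using t by simp
  show "\<gamma> n (tm n c (q, w, u)) \<in> Sp (Suc n) (Terminal (Suc n) \<inter> upto p)"
    by (rule Sp_mono[OF \<gamma>_tm_in_Sp[OF t(1) u]]) (use t(2) in \<open>auto simp: upto_def\<close>)
qed

lemma Sp_total_right:
  assumes "x \<in> Sp n {t. total t = p}" "r \<in> paths Q"
  shows "x \<odot>\<^sub>r\<^bsub>P n\<^esub> \<pi> (pe r) \<in> Sp n {t. total t = pcat p r}"
proof (rule Sp_right[OF assms])
  fix q w r' c assume *: "(q, w, r') \<in> composable n" "(q, w, r') \<in> {t. total t = p}" "tgt Q r' = src r"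
  then have "total (q, w, pcat r' r) = pcat p r" by (auto simp: total_def pcat_assoc)
  then show "tm n c (q, w, pcat r' r) \<in> Sp n {t. total t = pcat p r}"
    using Sp_tm[OF composable_right[OF *(1) assms(2) *(3)]] by simp
qed

lemma \<delta>_tm:
  assumes t: "(q, w, r) \<in> composable (Suc n)"
  shows "\<delta> (Suc n) (tm (Suc n) c (q, w, r)) = (\<pi> (single q c) \<odot>\<^bsub>P n\<^esub> \<delta>_gen (Suc n) w) \<odot>\<^sub>r\<^bsub>P n\<^esub> \<pi> (pe r)"
  using bimod_hom_tm[OF conjunct1[OF \<delta>_spec] t] conjunct2[OF \<delta>_spec, of n] t by (simp add: composable_def)

lemma \<delta>_tm_in_Sp:
  assumes t: "(q, w, r) \<in> composable (Suc n)"
  shows "\<delta> (Suc n) (tm (Suc n) c (q, w, r)) \<in> Sp n {t. total t = total (q, w, r)}"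
proof -
  have *: "w \<in> SS (Suc n)" "q \<in> paths Q" "r \<in> paths Q" using t by (simp_all add: composable_def)
  have "\<pi> (single q c) \<odot>\<^bsub>P n\<^esub> \<delta>_gen (Suc n) w \<in> Sp n {t. total t = pcat q w}"
    by (rule Sp_left[OF \<delta>_gen_in_Sp[OF *(1)] *(2)]) (auto simp: total_def pcat_assoc)
  from Sp_total_right[OF this *(3)] show ?thesis unfolding \<delta>_tm[OF t] by (simp add: total_def pcat_assoc)
qed

lemma \<delta>_upto:
  assumes "x \<in> Sp (Suc n) (upto p)"
  shows "\<delta> (Suc n) x \<in> Sp n (upto p)"
proof (rule Sp_hom[OF assms \<delta>_hom])
  fix q w r c assume t: "(q, w, r) \<in> composable (Suc n)" "(q, w, r) \<in> upto p"
  show "\<delta> (Suc n) (tm (Suc n) c (q, w, r)) \<in> Sp n (upto p)"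
    by (rule Sp_mono[OF \<delta>_tm_in_Sp[OF t(1)]]) (use t(2) in \<open>auto simp: upto_def\<close>)
qed

lemma cut_slice_tm:
  assumes p: "p \<in> paths Q" and ij: "(i, j) \<in> occurrences p m" and ab: "(a, b) \<in> occurrences (slice p i j) n"
  shows "(\<pi> (pe (slice p 0 i)) \<odot>\<^bsub>P n\<^esub> tm n 1 (cut (slice p i j) (a, b))) \<odot>\<^sub>r\<^bsub>P n\<^esub> \<pi> (pe (slice p j (plen p))) =
    tm n 1 (cut p (i + a, i + b))"
proof -
  have le: "i \<le> j" "j \<le> plen p" using ij by (simp_all add: occurrences_def)
  have ab': "a \<le> b" "i + b \<le> j" using ab slice_occurrences[OF le] by (auto simp: occurrences_def)
  have c: "cut (slice p i j) (a, b) = (slice p i (i + a), slice p (i + a) (i + b), slice p (i + b) j)"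
    using le ab' slice_slice[of i a j 0 p] slice_slice[of i b j a p] slice_slice[of i "j - i" j b p]
    by (simp add: cut_def plen_slice)
  have comp: "cut (slice p i j) (a, b) \<in> composable n"
    using cut_composable(1)[OF slice_in_paths[OF p le(1)] ab] .
  have "\<pi> (single (slice p 0 i) 1) \<odot>\<^bsub>P n\<^esub> tm n 1 (cut (slice p i j) (a, b)) =
      tm n 1 (slice p 0 (i + a), slice p (i + a) (i + b), slice p (i + b) j)"
    using tm_left[OF comp[unfolded c], of "slice p 0 i" 1 1] p pcat_slice[of 0 i "i + a" p]
    by (simp add: c slice_in_paths tgt_slice)
  moreover have "(slice p 0 (i + a), slice p (i + a) (i + b), slice p (i + b) j) \<in> composable n"
    using composable_left[OF comp[unfolded c], of "slice p 0 i"] p pcat_slice[of 0 i "i + a" p]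
    by (simp add: slice_in_paths tgt_slice)
  ultimately show ?thesis
    using tm_right[of "slice p 0 (i + a)" "slice p (i + a) (i + b)" "slice p (i + b) j" n "slice p j (plen p)" 1]
      p le ab' pcat_slice[of "i + b" j "plen p" p]
    by (simp add: cut_def slice_in_paths tgt_slice)
qed

section \<open>The image of $\gamma_n$\<close>

lemma cut_start:
  assumes "w \<in> SS n" "tgt Q w = src u"
  shows "cut (pcat w u) (0, plen w) = (trivial (src w), w, u)"
  using slice_suffix[OF assms(2)] slice_empty[of "pcat w u" 0]
  by (simp add: cut_def slice_pcat_left)

text \<open>
  For a terminal $1 \otimes v \otimes r$ let $w \in S_n$ be the prefix of $v$ and $vr = wu$. Then $u$ is irreducible
  by \<open>occ_prefix_rel_free\<close>, and up to sign $\gamma_n(1 \otimes w \otimes u)$ is $1 \otimes v \otimes r$ plus terms whose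
  middle factor occurs further right. These are terminal with a shorter right factor, so that induction
  on the length of the right factor applies.
\<close>

lemma Terminal_in_\<gamma>_image:
  assumes "x \<in> Sp (Suc n) (Terminal (Suc n))"
  shows "x \<in> \<gamma> n ` carrier (P n)"
proof -
  let ?H = "\<gamma> n ` carrier (P n)"
  have H_zero: "\<zero>\<^bsub>P (Suc n)\<^esub> \<in> ?H"
    using P_hom_zero[OF \<gamma>_hom, of n] P.M.zero_closed by (metis imageI)
  have H_add: "x \<oplus>\<^bsub>P (Suc n)\<^esub> y \<in> ?H" if "x \<in> ?H" "y \<in> ?H" for x y
    using that by (auto simp: add_hom_add[OF \<gamma>_hom, symmetric])
  have H_uminus: "\<ominus>\<^bsub>P (Suc n)\<^esub> x \<in> ?H" if "x \<in> ?H" for x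
    using that by (auto simp: P_hom_uminus[OF \<gamma>_hom, symmetric])
  have H_left: "a \<odot>\<^bsub>P (Suc n)\<^esub> x \<in> ?H" if "x \<in> ?H" "a \<in> carrier A" for x a
    using that by (auto simp: left_hom_smult[OF conjunct1[OF \<gamma>_spec], symmetric] P.lact_closed)
  have H_carrier: "?H \<subseteq> carrier (P (Suc n))" using add_hom_closed[OF \<gamma>_hom] by blast
  have main: "tm (Suc n) c (q, v, r) \<in> ?H" if "(q, v, r) \<in> composable (Suc n)" "r \<in> Irr" "terminal (Suc n) v r" for q v r c
    using that
  proof (induction "plen r" arbitrary: q v r c rule: less_induct)
    case less
    have v: "v \<in> SS (Suc n)" and vr: "tgt Q v = src r" and q: "q \<in> paths Q" "tgt Q q = src v"
      using less.prems by (simp_all add: composable_def)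
    define p where "p = pcat v r"
    note st = occurrence_start[OF v less.prems(2) vr, folded p_def]
    interpret interval_system "rel p" "plen p" by (rule interval_system_rel[OF st(1)])
    note occ_eq = occurrences_eq_occ[OF st(1)]
    obtain j where j: "(0, j) \<in> occ n" "j < plen v" using occ_prefix st(2) unfolding occ_eq by blast
    have "rel_free j"
      by (rule occ_prefix_rel_free[OF st(2)[unfolded occ_eq] st(3) _ j(1)])
        (use less.prems(3) in \<open>simp add: terminal_def p_def[symmetric] occ_eq\<close>)
    then have u: "slice p j (plen p) \<in> Irr" using rel_free_iff[OF st(1)] occ_bounds[OF j(1)] by simp
    define w u where "w = slice p 0 j" and "u = slice p j (plen p)"
    have jp: "j \<le> plen p" using occ_bounds[OF j(1)] by simp
    have w: "w \<in> SS n" and wu: "tgt Q w = src u" and p_eq: "p = pcat w u" and wp: "w \<in> paths Q" and up: "u \<in> Irr"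
      using j(1) u st(1) jp unfolding occ_eq[symmetric] w_def u_def
      by (simp_all add: occurrences_def tgt_slice pcat_slice slice_in_paths)
    have src_w: "src w = src v" unfolding w_def by (simp add: p_def)
    have t: "(trivial (src v), w, u) \<in> composable n"
      using w wu up SS_path[OF v] by (simp add: composable_def trivial_src src_w irreducible_in_paths)
    define z where "z = split (Suc n) p"
    have z_eq: "z = (\<Oplus>\<^bsub>P (Suc n)\<^esub>ij\<in>occurrences p (Suc n). tm (Suc n) 1 (cut p ij))"
      unfolding z_def by (rule split_eq[OF st(1)])
    have zc: "z \<in> carrier (P (Suc n))" unfolding z_def by (rule split_closed[OF st(1)])
    have "\<gamma> n (tensor n \<one>\<^bsub>A\<^esub> (pe w) (\<pi> (pe u))) = signed (Suc n) (Suc n) z"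
      using \<gamma>_spec[of n] w up wu by (simp add: z_def p_eq)
    moreover have "tensor n \<one>\<^bsub>A\<^esub> (pe w) (\<pi> (pe u)) \<in> carrier (P n)" using w up by (simp add: irreducible_in_paths)
    ultimately have "signed (Suc n) (Suc n) z \<in> ?H" by (metis imageI)
    then have zH: "z \<in> ?H"
    proof (cases "even (Suc n)")
      case False
      then show ?thesis using H_uminus[OF \<open>signed (Suc n) (Suc n) z \<in> ?H\<close>] zc by (simp add: signed_def)
    qed (simp add: signed_def)
    let ?y = "tm (Suc n) 1 (cut p (0, plen v))"
    have cut0: "cut p (0, plen v) = (trivial (src v), v, r)" unfolding p_def by (rule cut_start[OF v vr])
    have yc: "?y \<in> carrier (P (Suc n))" using cut_composable(1)[OF st(1,2)] by simp
    have "z \<ominus>\<^bsub>P (Suc n)\<^esub> ?y \<in> ?H"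
      unfolding z_eq
    proof (rule P.M.finsum_minus_term[OF finite_occurrences[OF st(1)] st(2) _ yc H_zero H_add H_carrier])
      show "(\<lambda>ij. tm (Suc n) 1 (cut p ij)) \<in> occurrences p (Suc n) \<rightarrow> carrier (P (Suc n))"
        using cut_composable(1)[OF st(1)] by auto
      show "?y \<ominus>\<^bsub>P (Suc n)\<^esub> ?y \<in> ?H" using yc H_zero by (simp add: a_minus_def P.M.r_neg)
      fix ij assume ij: "ij \<in> occurrences p (Suc n)" "ij \<noteq> (0, plen v)"
      obtain a b where ab: "ij = (a, b)" by (cases ij)
      have "a \<noteq> 0" using ij ab occurrence_unique_end[OF st(1,2), of b] by (cases a) auto
      then have less_b: "plen v < b" using occurrence_end_less[OF st(1,2)] ij ab by simp
      have b: "b \<le> plen p" using ij ab by (simp add: occurrences_def)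
      have comp: "cut p ij \<in> composable (Suc n)" by (rule cut_composable(1)[OF st(1) ij(1)])
      have D: "cut p ij \<in> Terminal (Suc n)" by (rule cut_Suc_in_Terminal[OF w up wu p_eq ij(1)])
      have "plen (slice p b (plen p)) < plen r" using less_b b by (simp add: plen_slice p_def)
      from less.hyps[OF this, of "slice p 0 a" "slice p a b" 1] show "tm (Suc n) 1 (cut p ij) \<in> ?H"
        using comp D by (simp add: ab cut_def Terminal_def)
    qed
    then have "z \<oplus>\<^bsub>P (Suc n)\<^esub> \<ominus>\<^bsub>P (Suc n)\<^esub> (z \<ominus>\<^bsub>P (Suc n)\<^esub> ?y) \<in> ?H" by (intro H_add[OF zH] H_uminus)
    moreover have "z \<oplus>\<^bsub>P (Suc n)\<^esub> \<ominus>\<^bsub>P (Suc n)\<^esub> (z \<ominus>\<^bsub>P (Suc n)\<^esub> ?y) = ?y"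
      using zc yc P.M.add_minus_cancel_left[of z _ ?y] P.M.minus_add_cancel[of z "Suc n" ?y]
      by (simp add: a_minus_def P.M.minus_add P.M.r_neg P.M.a_assoc[symmetric])
    ultimately have "?y \<in> ?H" by simp
    then have "\<pi> (single q c) \<odot>\<^bsub>P (Suc n)\<^esub> ?y \<in> ?H" using q by (intro H_left) simp_all
    moreover have "\<pi> (single q c) \<odot>\<^bsub>P (Suc n)\<^esub> ?y = tm (Suc n) c (q, v, r)"
      using tm_left[of "trivial (src v)" v r "Suc n" q c 1] cut_composable(1)[OF st(1,2)] q
      unfolding cut0 by (simp add: src_def)
    ultimately show ?case by simp
  qed
  show ?thesis
    using assms
  proof (induction rule: Sp.induct)
    case (Sp_tm t c)
    then show ?case using main by (cases t) (auto simp: Terminal_def)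
  qed (simp_all add: H_zero H_add)
qed

section \<open>The composite $\delta_{n+1}\gamma_n$\<close>

lemma Sp_H: "\<zero>\<^bsub>P n\<^esub> \<in> Sp n B" "\<And>x y. x \<in> Sp n B \<Longrightarrow> y \<in> Sp n B \<Longrightarrow> x \<oplus>\<^bsub>P n\<^esub> y \<in> Sp n B" "Sp n B \<subseteq> carrier (P n)"
  using Sp_zero Sp_add Sp_carrier by blast+

lemma minus_self: "x \<in> carrier (P n) \<Longrightarrow> x \<ominus>\<^bsub>P n\<^esub> x = \<zero>\<^bsub>P n\<^esub>"
  by (simp add: a_minus_def P.M.r_neg)

text \<open>
  For odd \<open>n\<close> all occurrences of $S_n$ in $wu$, except the one at the beginning, give terminal terms. That one
  is contained only in the occurrence of $S_{n+1}$ at the beginning, and so appears once.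
\<close>

lemma odd_composite:
  assumes n: "odd n" and w: "w \<in> SS n" and u: "u \<in> Irr" and wu: "tgt Q w = src u" and p: "p = pcat w u"
    and j: "(0, j) \<in> occurrences p (Suc n)"
  shows "\<delta> (Suc n) (split (Suc n) p) \<ominus>\<^bsub>P n\<^esub> tm n 1 (cut p (0, plen w)) \<in> Sp n (Terminal n)"
proof -
  note st = occurrence_start[OF w u wu, folded p]
  define f where "f ij = tm n 1 (cut p ij)" for ij
  \<comment> \<open>The occurrences of $S_n$ inside \<open>(i, j)\<close>, in the coordinates of \<open>p\<close>.\<close>
  define g where "g = (\<lambda>(i, j). \<Oplus>\<^bsub>P n\<^esub>ab\<in>occurrences (slice p i j) n. case ab of (a, b) \<Rightarrow> f (i + a, i + b))"
  have f_closed: "f ij \<in> carrier (P n)" if "ij \<in> occurrences p n" for ij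
    using cut_composable(1)[OF st(1) that] by (simp add: f_def)
  have f_D: "f (i, j) \<in> Sp n (Terminal n)" if "(i, j) \<in> occurrences p n" "0 < i" for i j
    using Sp_tm[OF cut_composable(1)[OF st(1) that(1)] odd_cut_in_Terminal[OF w u wu p n that]] by (simp add: f_def)
  have sl: "(i + a, i + b) \<in> occurrences p n" if "(i, j) \<in> occurrences p (Suc n)" "(a, b) \<in> occurrences (slice p i j) n" for i j a b
    using that slice_occurrences[of i j p a b n] by (simp add: occurrences_def)
  have g: "\<delta> (Suc n) (tm (Suc n) 1 (cut p ij)) = g ij" if ij: "ij \<in> occurrences p (Suc n)" for ij
  proof -
    obtain i j where [simp]: "ij = (i, j)" by (cases ij)
    let ?w = "slice p i j" and ?q = "slice p 0 i" and ?r = "slice p j (plen p)"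
    have le: "i \<le> j" "j \<le> plen p" using ij by (simp_all add: occurrences_def)
    have cl: "\<pi> (pe ?q) \<in> carrier A" "\<pi> (pe ?r) \<in> carrier A" using le st(1) by (simp_all add: slice_in_paths)
    have wp: "?w \<in> paths Q" using le st(1) by (simp add: slice_in_paths)
    have tc: "(\<lambda>ab. tm n 1 (cut ?w ab)) \<in> occurrences ?w n \<rightarrow> carrier (P n)" using cut_composable(1)[OF wp] by simp
    then have tc': "(\<lambda>ab. \<pi> (pe ?q) \<odot>\<^bsub>P n\<^esub> tm n 1 (cut ?w ab)) \<in> occurrences ?w n \<rightarrow> carrier (P n)"
      using cl by (auto simp: P.lact_closed Pi_def)
    have "\<delta> (Suc n) (tm (Suc n) 1 (cut p ij)) = (\<pi> (pe ?q) \<odot>\<^bsub>P n\<^esub> split n ?w) \<odot>\<^sub>r\<^bsub>P n\<^esub> \<pi> (pe ?r)"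
      using \<delta>_tm[OF cut_composable(1)[OF st(1) ij, unfolded cut_def \<open>ij = (i, j)\<close> case_prod_conv], of 1] n
      by (simp add: cut_def \<delta>_gen_even)
    also have "\<dots> = (\<Oplus>\<^bsub>P n\<^esub>ab\<in>occurrences ?w n. (\<pi> (pe ?q) \<odot>\<^bsub>P n\<^esub> tm n 1 (cut ?w ab)) \<odot>\<^sub>r\<^bsub>P n\<^esub> \<pi> (pe ?r))"
      unfolding split_eq[OF wp] P.lact_finsum[OF cl(1) tc] P.ract_finsum[OF cl(2) tc'] ..
    also have "\<dots> = (\<Oplus>\<^bsub>P n\<^esub>ab\<in>occurrences ?w n. case ab of (a, b) \<Rightarrow> f (i + a, i + b))"
    proof (rule P.M.finsum_cong'[OF refl])
      show "(\<lambda>ab. case ab of (a, b) \<Rightarrow> f (i + a, i + b)) \<in> occurrences ?w n \<rightarrow> carrier (P n)"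
        using sl ij f_closed by auto
      fix ab assume ab: "ab \<in> occurrences ?w n"
      obtain a b where [simp]: "ab = (a, b)" by (cases ab)
      show "(\<pi> (pe ?q) \<odot>\<^bsub>P n\<^esub> tm n 1 (cut ?w ab)) \<odot>\<^sub>r\<^bsub>P n\<^esub> \<pi> (pe ?r) = (case ab of (a, b) \<Rightarrow> f (i + a, i + b))"
        using cut_slice_tm[OF st(1), of i j "Suc n" a b n] ij ab by (simp add: f_def)
    qed
    finally show ?thesis by (simp add: g_def)
  qed
  have g_closed: "g \<in> occurrences p (Suc n) \<rightarrow> carrier (P n)"
    using add_hom_closed[OF \<delta>_hom tm_closed[OF cut_composable(1)[OF st(1)]]] by (auto simp: g[symmetric] simp del: split_paired_All)
  have x: "f (0, plen w) \<in> carrier (P n)" by (rule f_closed[OF st(2)])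
  have "\<delta> (Suc n) (split (Suc n) p) = (\<Oplus>\<^bsub>P n\<^esub>ij\<in>occurrences p (Suc n). \<delta> (Suc n) (tm (Suc n) 1 (cut p ij)))"
    unfolding split_eq[OF st(1)]
    by (rule P_hom_finsum[OF \<delta>_hom]) (simp add: cut_composable(1)[OF st(1)])
  also have "\<dots> = (\<Oplus>\<^bsub>P n\<^esub>ij\<in>occurrences p (Suc n). g ij)"
    by (rule P.M.finsum_cong'[OF refl g_closed g])
  finally have "\<delta> (Suc n) (split (Suc n) p) = (\<Oplus>\<^bsub>P n\<^esub>ij\<in>occurrences p (Suc n). g ij)" .
  moreover have "(\<Oplus>\<^bsub>P n\<^esub>ij\<in>occurrences p (Suc n). g ij) \<ominus>\<^bsub>P n\<^esub> f (0, plen w) \<in> Sp n (Terminal n)"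
  proof (rule P.M.finsum_minus_term[OF finite_occurrences[OF st(1)] j g_closed x Sp_H])
    have jp: "j \<le> plen p" using j by (simp add: occurrences_def)
    have wp: "slice p 0 j \<in> paths Q" using jp st(1) by (simp add: slice_in_paths)
    have "(0, plen w) \<in> occurrences (slice p 0 j) n"
    proof -
      interpret interval_system "rel p" "plen p" by (rule interval_system_rel[OF st(1)])
      obtain j' where "(0, j') \<in> occurrences p n" "j' < j"
        using occ_prefix j unfolding occurrences_eq_occ[OF st(1)] by blast
      then have "plen w \<le> j" using occurrence_unique_end[OF st(1,2)] by auto
      then show ?thesis using slice_occurrences[of 0 j p 0 "plen w" n] jp st(2) by simp
    qed
    note s0 = this
    show "g (0, j) \<ominus>\<^bsub>P n\<^esub> f (0, plen w) \<in> Sp n (Terminal n)"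
      unfolding g_def case_prod_conv
    proof (rule P.M.finsum_minus_term[OF finite_occurrences[OF wp] s0 _ x Sp_H])
      show "(\<lambda>(a, b). f (0 + a, 0 + b)) \<in> occurrences (slice p 0 j) n \<rightarrow> carrier (P n)"
        using sl[OF j] f_closed by auto
      show "(case (0, plen w) of (a, b) \<Rightarrow> f (0 + a, 0 + b)) \<ominus>\<^bsub>P n\<^esub> f (0, plen w) \<in> Sp n (Terminal n)"
        using minus_self[OF x] by (simp add: Sp_zero)
      fix ab assume ab: "ab \<in> occurrences (slice p 0 j) n" "ab \<noteq> (0, plen w)"
      obtain a b where [simp]: "ab = (a, b)" by (cases ab)
      have o: "(a, b) \<in> occurrences p n" using sl[OF j, of a b] ab by simp
      have "a \<noteq> 0" using ab o occurrence_unique_end[OF st(1,2), of b] by (cases a) auto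
      then show "(case ab of (a, b) \<Rightarrow> f (0 + a, 0 + b)) \<in> Sp n (Terminal n)" using f_D[OF o] by simp
    qed
  next
    fix ij assume ij: "ij \<in> occurrences p (Suc n)" "ij \<noteq> (0, j)"
    obtain i j' where [simp]: "ij = (i, j')" by (cases ij)
    have "i \<noteq> 0" using ij occurrence_unique_end[OF st(1) j, of j'] by (cases i) auto
    then show "g ij \<in> Sp n (Terminal n)"
      unfolding g_def using ij sl f_D by (auto intro!: Sp_finsum)
  qed
  ultimately show ?thesis by (simp add: f_def)
qed

text \<open>
  For even \<open>n\<close> each occurrence of $S_{n+1}$ contributes its last occurrence of $S_n$ minus its first one. By
  \<open>even_predecessor\<close> the last ones run once through all occurrences of $S_n$ except the one at the beginning
  of $wu$; the first ones run once through those that are not terminal. The terminal ones remain.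
\<close>

lemma even_composite:
  assumes n: "even n" and w: "w \<in> SS n" and u: "u \<in> Irr" and wu: "tgt Q w = src u" and p: "p = pcat w u"
  shows "tm n 1 (cut p (0, plen w)) \<oplus>\<^bsub>P n\<^esub> \<delta> (Suc n) (split (Suc n) p) \<in> Sp n (Terminal n)"
proof -
  note st = occurrence_start[OF w u wu, folded p]
  interpret interval_system "rel p" "plen p" by (rule interval_system_rel[OF st(1)])
  note occ_eq = occurrences_eq_occ[OF st(1)]
  define f where "f ij = tm n 1 (cut p ij)" for ij
  let ?O = "occurrences p n" and ?O' = "occurrences p (Suc n)"
  have f_closed: "f ij \<in> carrier (P n)" if "ij \<in> ?O" for ij
    using cut_composable(1)[OF st(1) that] by (simp add: f_def)
  have "\<exists>l r. l \<in> ?O \<and> r \<in> ?O \<and> fst l = fst ij \<and> snd r = snd ij \<and> fst ij < fst r \<and>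
      \<delta> (Suc n) (tm (Suc n) 1 (cut p ij)) = f r \<ominus>\<^bsub>P n\<^esub> f l" if ij: "ij \<in> ?O'" for ij
  proof -
    obtain i j where [simp]: "ij = (i, j)" by (cases ij)
    let ?w = "slice p i j" and ?q = "slice p 0 i" and ?r = "slice p j (plen p)"
    have le: "i \<le> j" "j \<le> plen p" and wS: "?w \<in> SS (Suc n)" using ij by (simp_all add: occurrences_def)
    have wlen: "plen ?w = j - i" using le by (simp add: plen_slice)
    obtain b a where occ: "occurrences ?w n = {(0, b), (a, plen ?w)}" "0 < a" "b < plen ?w"
      using odd_occurrences[OF wS n] by blast
    have ol: "(0, b) \<in> occurrences ?w n" "(a, j - i) \<in> occurrences ?w n" using occ(1) wlen by simp_all
    have cl: "\<pi> (pe ?q) \<in> carrier A" "\<pi> (pe ?r) \<in> carrier A" using le st(1) by (simp_all add: slice_in_paths)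
    have wp: "?w \<in> paths Q" using le st(1) by (simp add: slice_in_paths)
    have c: "tm n 1 (cut ?w (0, b)) \<in> carrier (P n)" "tm n 1 (cut ?w (a, j - i)) \<in> carrier (P n)"
      using cut_composable(1)[OF wp] ol by simp_all
    have "\<delta> (Suc n) (tm (Suc n) 1 (cut p ij)) = (\<pi> (pe ?q) \<odot>\<^bsub>P n\<^esub> \<delta>_gen (Suc n) ?w) \<odot>\<^sub>r\<^bsub>P n\<^esub> \<pi> (pe ?r)"
      using \<delta>_tm[OF cut_composable(1)[OF st(1) ij, unfolded cut_def \<open>ij = (i, j)\<close> case_prod_conv], of 1]
      by (simp add: cut_def)
    also have "\<dots> = f (i + a, i + (j - i)) \<ominus>\<^bsub>P n\<^esub> f (i + 0, i + b)"
      using \<delta>_gen_odd[OF wS n occ] cut_slice_tm[OF st(1) _ ol(1), of "Suc n"] cut_slice_tm[OF st(1) _ ol(2), of "Suc n"] ij c cl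
      by (simp add: wlen P.lact_minus P.ract_minus P.lact_closed f_def)
    finally have "\<delta> (Suc n) (tm (Suc n) 1 (cut p ij)) = f (i + a, j) \<ominus>\<^bsub>P n\<^esub> f (i, i + b)" using le by simp
    moreover have "(i, i + b) \<in> ?O" "(i + a, j) \<in> ?O"
      using ol slice_occurrences[OF le, of 0 b n] slice_occurrences[OF le, of a "j - i" n] le by simp_all
    ultimately show ?thesis using occ(2) by (intro exI[of _ "(i, i + b)"] exI[of _ "(i + a, j)"]) simp
  qed
  note lr_ex = this
  have "\<forall>ij\<in>?O'. \<exists>lr. fst lr \<in> ?O \<and> snd lr \<in> ?O \<and> fst (fst lr) = fst ij \<and> snd (snd lr) = snd ij \<and> fst ij < fst (snd lr) \<and>
      \<delta> (Suc n) (tm (Suc n) 1 (cut p ij)) = f (snd lr) \<ominus>\<^bsub>P n\<^esub> f (fst lr)"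
  proof
    fix ij assume "ij \<in> ?O'"
    from lr_ex[OF this] obtain l r where "l \<in> ?O \<and> r \<in> ?O \<and> fst l = fst ij \<and> snd r = snd ij \<and> fst ij < fst r \<and>
      \<delta> (Suc n) (tm (Suc n) 1 (cut p ij)) = f r \<ominus>\<^bsub>P n\<^esub> f l" by blast
    then show "\<exists>lr. fst lr \<in> ?O \<and> snd lr \<in> ?O \<and> fst (fst lr) = fst ij \<and> snd (snd lr) = snd ij \<and> fst ij < fst (snd lr) \<and>
      \<delta> (Suc n) (tm (Suc n) 1 (cut p ij)) = f (snd lr) \<ominus>\<^bsub>P n\<^esub> f (fst lr)"
      by (intro exI[of _ "(l, r)"]) simp
  qed
  from bchoice[OF this] obtain lr where lr: "\<forall>ij\<in>?O'. fst (lr ij) \<in> ?O \<and> snd (lr ij) \<in> ?O \<and> fst (fst (lr ij)) = fst ij \<and> snd (snd (lr ij)) = snd ij \<and>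
      fst ij < fst (snd (lr ij)) \<and> \<delta> (Suc n) (tm (Suc n) 1 (cut p ij)) = f (snd (lr ij)) \<ominus>\<^bsub>P n\<^esub> f (fst (lr ij))"
    by blast
  \<comment> \<open>The first and the last occurrence of $S_n$ inside an occurrence of $S_{n+1}$.\<close>
  define L R where "L ij = fst (lr ij)" and "R ij = snd (lr ij)" for ij
  have L: "L ij \<in> ?O" "fst (L ij) = fst ij" and R: "R ij \<in> ?O" "snd (R ij) = snd ij" "fst ij < fst (R ij)"
    and \<delta>_eq: "\<delta> (Suc n) (tm (Suc n) 1 (cut p ij)) = f (R ij) \<ominus>\<^bsub>P n\<^esub> f (L ij)" if "ij \<in> ?O'" for ij
    using lr that by (simp_all add: L_def R_def)
  have inj_L: "inj_on L ?O'"
  proof (rule inj_onI)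
    fix s t assume st': "s \<in> ?O'" "t \<in> ?O'" "L s = L t"
    then have "fst s = fst t" using L(2) by metis
    then obtain i j j' where "s = (i, j)" "t = (i, j')" by (metis prod.collapse)
    then show "s = t" using occurrence_unique_end[OF st(1), of i j "Suc n" j'] st' by simp
  qed
  have inj_R: "inj_on R ?O'"
  proof (rule inj_onI)
    fix s t assume st': "s \<in> ?O'" "t \<in> ?O'" "R s = R t"
    then have e: "snd s = snd t" using R(2) by metis
    then obtain i i' j where s: "s = (i, j)" "t = (i', j)" by (metis prod.collapse)
    have "\<not> i < i'" "\<not> i' < i"
      using occurrence_end_less[OF st(1), of i j "Suc n" i' j] occurrence_end_less[OF st(1), of i' j "Suc n" i j] st' s
      by auto
    then show "s = t" using s by simp
  qed
  let ?U = "L ` ?O'"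
  have U: "(i, j) \<in> ?U" if "(i, j) \<in> ?O" "(i, k) \<in> ?O'" for i j k
  proof -
    have "L (i, k) \<in> ?O" "fst (L (i, k)) = i" using L[OF that(2)] by simp_all
    then have "L (i, k) = (i, j)" using occurrence_unique_end[OF st(1) that(1), of "snd (L (i, k))"] by (metis prod.collapse)
    then show ?thesis using that(2) by (metis imageI)
  qed
  have R_image: "R ` ?O' = ?O - {(0, plen w)}"
  proof (rule equalityI; rule subsetI)
    fix s assume "s \<in> R ` ?O'"
    then show "s \<in> ?O - {(0, plen w)}" using R by fastforce
  next
    fix s assume s: "s \<in> ?O - {(0, plen w)}"
    obtain b e where [simp]: "s = (b, e)" by (cases s)
    have be: "(b, e) \<in> ?O" using s by simp
    have "b \<noteq> 0" using s occurrence_unique_end[OF st(1,2), of e] by (cases b) auto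
    moreover have "\<exists>c>i. (c, j) \<in> ?O" if "(i, j) \<in> ?O'" for i j
      using R[OF that] by (metis fst_conv snd_conv prod.collapse)
    ultimately obtain a where a: "(a, e) \<in> ?O'"
      using even_predecessor[OF w u wu p n be] by blast
    have "R (a, e) \<in> ?O" "snd (R (a, e)) = e" using R[OF a] by simp_all
    then have "(fst (R (a, e)), e) \<in> ?O" by (metis prod.collapse)
    then have "fst (R (a, e)) = b"
      using occurrence_end_less[OF st(1) be, of "fst (R (a, e))" e] occurrence_end_less[OF st(1) _ be, of "fst (R (a, e))" e]
      by (meson less_irrefl linorder_neqE_nat)
    then have "R (a, e) = s" using \<open>snd (R (a, e)) = e\<close> by (simp add: prod_eq_iff)
    then show "s \<in> R ` ?O'" using a by (metis imageI)
  qed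
  have fin: "finite ?O" "finite ?O'" by (simp_all add: finite_occurrences[OF st(1)])
  have U_sub: "?U \<subseteq> ?O" using L by auto
  have c: "f \<in> B \<rightarrow> carrier (P n)" if "B \<subseteq> ?O" for B using f_closed that by auto
  have cR: "(\<lambda>ij. f (R ij)) \<in> ?O' \<rightarrow> carrier (P n)" and cL: "(\<lambda>ij. f (L ij)) \<in> ?O' \<rightarrow> carrier (P n)"
    using R L f_closed by auto
  have "\<delta> (Suc n) (split (Suc n) p) = (\<Oplus>\<^bsub>P n\<^esub>ij\<in>?O'. \<delta> (Suc n) (tm (Suc n) 1 (cut p ij)))"
    unfolding split_eq[OF st(1)]
    by (rule P_hom_finsum[OF \<delta>_hom]) (simp add: cut_composable(1)[OF st(1)])
  also have "\<dots> = (\<Oplus>\<^bsub>P n\<^esub>ij\<in>?O'. f (R ij) \<ominus>\<^bsub>P n\<^esub> f (L ij))"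
  proof (rule P.M.finsum_cong'[OF refl _ \<delta>_eq])
    show "(\<lambda>ij. f (R ij) \<ominus>\<^bsub>P n\<^esub> f (L ij)) \<in> ?O' \<rightarrow> carrier (P n)"
      using cR cL by (simp add: Pi_def)
  qed
  also have "\<dots> = (\<Oplus>\<^bsub>P n\<^esub>ij\<in>?O'. f (R ij)) \<ominus>\<^bsub>P n\<^esub> (\<Oplus>\<^bsub>P n\<^esub>ij\<in>?O'. f (L ij))"
    by (rule P.M.finsum_minus[OF cR cL])
  also have "(\<Oplus>\<^bsub>P n\<^esub>ij\<in>?O'. f (R ij)) = (\<Oplus>\<^bsub>P n\<^esub>ij\<in>?O - {(0, plen w)}. f ij)"
    unfolding R_image[symmetric] by (rule P.M.finsum_reindex[symmetric, OF c inj_R]) (use R(1) in blast)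
  also have "(\<Oplus>\<^bsub>P n\<^esub>ij\<in>?O'. f (L ij)) = (\<Oplus>\<^bsub>P n\<^esub>ij\<in>?U. f ij)"
    by (rule P.M.finsum_reindex[symmetric, OF c inj_L]) (use L(1) in blast)
  finally have \<delta>_split: "\<delta> (Suc n) (split (Suc n) p) = (\<Oplus>\<^bsub>P n\<^esub>ij\<in>?O - {(0, plen w)}. f ij) \<ominus>\<^bsub>P n\<^esub> (\<Oplus>\<^bsub>P n\<^esub>ij\<in>?U. f ij)" .
  have sum1: "(\<Oplus>\<^bsub>P n\<^esub>ij\<in>?O. f ij) = f (0, plen w) \<oplus>\<^bsub>P n\<^esub> (\<Oplus>\<^bsub>P n\<^esub>ij\<in>?O - {(0, plen w)}. f ij)"
  proof -
    have O_eq: "?O = insert (0, plen w) (?O - {(0, plen w)})" using st(2) by blast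
    show ?thesis by (subst O_eq, rule P.M.finsum_insert) (use fin f_closed st(2) in auto)
  qed
  have sum2: "(\<Oplus>\<^bsub>P n\<^esub>ij\<in>?O. f ij) = (\<Oplus>\<^bsub>P n\<^esub>ij\<in>?U. f ij) \<oplus>\<^bsub>P n\<^esub> (\<Oplus>\<^bsub>P n\<^esub>ij\<in>?O - ?U. f ij)"
  proof -
    have O_eq: "?O = ?U \<union> (?O - ?U)" using U_sub by blast
    show ?thesis by (subst O_eq, rule P.M.finsum_Un_disjoint) (use fin f_closed U_sub in auto)
  qed
  have cl: "f (0, plen w) \<in> carrier (P n)" "(\<Oplus>\<^bsub>P n\<^esub>ij\<in>?O - {(0, plen w)}. f ij) \<in> carrier (P n)"
    "(\<Oplus>\<^bsub>P n\<^esub>ij\<in>?U. f ij) \<in> carrier (P n)" "(\<Oplus>\<^bsub>P n\<^esub>ij\<in>?O - ?U. f ij) \<in> carrier (P n)"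
    using f_closed st(2) U_sub by (auto intro!: P.M.finsum_closed)
  have "f (0, plen w) \<oplus>\<^bsub>P n\<^esub> \<delta> (Suc n) (split (Suc n) p) =
      (f (0, plen w) \<oplus>\<^bsub>P n\<^esub> (\<Oplus>\<^bsub>P n\<^esub>ij\<in>?O - {(0, plen w)}. f ij)) \<ominus>\<^bsub>P n\<^esub> (\<Oplus>\<^bsub>P n\<^esub>ij\<in>?U. f ij)"
    unfolding \<delta>_split using cl by (simp add: a_minus_def P.M.a_assoc)
  also have "\<dots> = (\<Oplus>\<^bsub>P n\<^esub>ij\<in>?O - ?U. f ij)"
    unfolding sum1[symmetric] sum2 by (rule P.M.add_minus_cancel_left[OF cl(3,4)])
  also have "\<dots> \<in> Sp n (Terminal n)"
  proof (rule Sp_finsum)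
    fix ij assume ij: "ij \<in> ?O - ?U"
    obtain i j where [simp]: "ij = (i, j)" by (cases ij)
    have o: "(i, j) \<in> ?O" using ij by simp
    have "(i, k) \<notin> ?O'" for k using U[OF o, of k] ij by auto
    then have "cut p (i, j) \<in> Terminal n" using cut_in_Terminal[OF w u wu p o suffix_irreducible[OF w u wu p o]] by blast
    then show "f ij \<in> Sp n (Terminal n)" using Sp_tm[OF cut_composable(1)[OF st(1) o]] by (simp add: f_def)
  qed
  finally show ?thesis by (simp add: f_def)
qed

text \<open>
  The sign in the definition of $\gamma_n$ makes the two parities uniform.
\<close>

lemma id_minus_\<delta>\<gamma>:
  assumes "x \<in> carrier (P n)"
  shows "x \<ominus>\<^bsub>P n\<^esub> \<delta> (Suc n) (\<gamma> n x) \<in> Sp n (Terminal n)"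
  using assms
proof (induction x rule: P_induct_tm)
  case zero
  then show ?case
    by (simp add: P_hom_zero[OF \<gamma>_hom] P_hom_zero[OF \<delta>_hom]
        minus_self Sp_zero)
next
  case (tm q w u c)
  have *: "w \<in> SS n" "tgt Q w = src u" "q \<in> paths Q" "tgt Q q = src w" using tm by (simp_all add: composable_def)
  define p where "p = pcat w u"
  note st = occurrence_start[OF *(1) tm(2) *(2), folded p_def]
  let ?t = "tm n 1 (cut p (0, plen w))" and ?s = "split (Suc n) p"
  have cut0: "cut p (0, plen w) = (trivial (src w), w, u)" unfolding p_def by (rule cut_start[OF *(1,2)])
  have tc: "?t \<in> carrier (P n)" using cut_composable(1)[OF st(1,2)] by simp
  have sc: "?s \<in> carrier (P (Suc n))" by (rule split_closed[OF st(1)])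
  have tm_eq: "tm n c (q, w, u) = \<pi> (single q c) \<odot>\<^bsub>P n\<^esub> ?t"
    using tm_left[of "trivial (src w)" w u n q c 1] cut_composable(1)[OF st(1,2)] * unfolding cut0 by (simp add: src_def)
  have qc: "\<pi> (single q c) \<in> carrier A" using * by simp
  have dc: "\<delta> (Suc n) ?s \<in> carrier (P n)" by (rule add_hom_closed[OF \<delta>_hom sc])
  have main: "?t \<ominus>\<^bsub>P n\<^esub> \<delta> (Suc n) (signed (Suc n) (Suc n) ?s) \<in> Sp n (Terminal n)"
  proof (cases "terminal n w u")
    case True
    have "?s = \<zero>\<^bsub>P (Suc n)\<^esub>"
      unfolding split_eq[OF st(1)] terminal_no_occurrences[OF *(1) tm(2) *(2) p_def True] by simp
    then have "\<delta> (Suc n) (signed (Suc n) (Suc n) ?s) = \<zero>\<^bsub>P n\<^esub>"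
      by (simp add: signed_zero P_hom_zero[OF \<delta>_hom])
    moreover have "?t \<in> Sp n (Terminal n)"
      by (rule Sp_tm[OF cut_composable(1)[OF st(1,2)]]) (use True tm in \<open>simp add: cut0 Terminal_def\<close>)
    ultimately show ?thesis by (simp add: Sp_minus Sp_zero)
  next
    case False
    then obtain j where j: "(0, j) \<in> occurrences p (Suc n)" by (auto simp: terminal_def p_def)
    show ?thesis
    proof (cases "even n")
      case True
      have "\<delta> (Suc n) (signed (Suc n) (Suc n) ?s) = \<ominus>\<^bsub>P n\<^esub> \<delta> (Suc n) ?s"
        using True sc by (simp add: signed_def P_hom_uminus[OF \<delta>_hom])
      then show ?thesis using even_composite[OF True *(1) tm(2) *(2) p_def] dc by (simp add: a_minus_def)
    next
      case False
      have "\<ominus>\<^bsub>P n\<^esub> (\<delta> (Suc n) ?s \<ominus>\<^bsub>P n\<^esub> ?t) \<in> Sp n (Terminal n)"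
        by (rule Sp_uminus[OF odd_composite[OF False *(1) tm(2) *(2) p_def j]])
      moreover have "\<ominus>\<^bsub>P n\<^esub> (\<delta> (Suc n) ?s \<ominus>\<^bsub>P n\<^esub> ?t) = ?t \<ominus>\<^bsub>P n\<^esub> \<delta> (Suc n) ?s"
        using dc tc by (simp add: a_minus_def P.M.minus_add P.M.a_comm)
      ultimately show ?thesis using False by (simp add: signed_def)
    qed
  qed
  have \<gamma>_eq: "\<gamma> n (tm n c (q, w, u)) = \<pi> (single q c) \<odot>\<^bsub>P (Suc n)\<^esub> signed (Suc n) (Suc n) ?s"
    using \<gamma>_tm[OF tm(1,2)] by (simp add: p_def)
  have sgc: "signed (Suc n) (Suc n) ?s \<in> carrier (P (Suc n))" using sc by (simp add: signed_def)
  have "tm n c (q, w, u) \<ominus>\<^bsub>P n\<^esub> \<delta> (Suc n) (\<gamma> n (tm n c (q, w, u))) =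
      \<pi> (single q c) \<odot>\<^bsub>P n\<^esub> (?t \<ominus>\<^bsub>P n\<^esub> \<delta> (Suc n) (signed (Suc n) (Suc n) ?s))"
    unfolding \<gamma>_eq left_hom_smult[OF bimod_hom_left[OF conjunct1[OF \<delta>_spec]] qc sgc]
      P.lact_minus[OF qc tc add_hom_closed[OF \<delta>_hom sgc]] unfolding tm_eq by (rule refl)
  also have "\<dots> \<in> Sp n (Terminal n)" by (rule Sp_left[OF main *(3)]) (simp add: Terminal_def)
  finally show ?case .
next
  case (plus x y)
  have c: "\<delta> (Suc n) (\<gamma> n x) \<in> carrier (P n)" "\<delta> (Suc n) (\<gamma> n y) \<in> carrier (P n)"
    using plus by (simp_all add: add_hom_closed[OF \<delta>_hom] add_hom_closed[OF \<gamma>_hom])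
  have "(x \<oplus>\<^bsub>P n\<^esub> y) \<ominus>\<^bsub>P n\<^esub> \<delta> (Suc n) (\<gamma> n (x \<oplus>\<^bsub>P n\<^esub> y)) =
      (x \<ominus>\<^bsub>P n\<^esub> \<delta> (Suc n) (\<gamma> n x)) \<oplus>\<^bsub>P n\<^esub> (y \<ominus>\<^bsub>P n\<^esub> \<delta> (Suc n) (\<gamma> n y))"
    using plus(1,2) c
    by (simp add: add_hom_add[OF \<gamma>_hom] add_hom_add[OF \<delta>_hom] add_hom_closed[OF \<gamma>_hom] a_minus_def P.M.minus_add P.M.a_ac)
  then show ?case using Sp_add[OF plus(3,4)] by simp
qed

end

context diamond_system
begin

section \<open>Order of the terms\<close>

lemma upto_carrier:
  assumes "(q, w, r) \<in> composable n"
  shows "tm n c (q, w, r) \<in> Sp n (upto (total (q, w, r)))"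
  by (rule Sp_tm[OF assms]) (simp add: upto_def)

lemma upto_parallel:
  assumes "(q, w, r) \<in> composable n" "(q, w, r) \<in> upto p" "p \<in> paths Q"
  shows "src q = src p" "tgt Q r = tgt Q p"
proof -
  have "src (total (q, w, r)) = src p \<and> tgt Q (total (q, w, r)) = tgt Q p"
    using assms(2) below_parallel[of "total (q, w, r)" p] unfolding upto_def by blast
  then show "src q = src p" "tgt Q r = tgt Q p" using total_src_tgt[OF assms(1)] by simp_all
qed

lemma below_sandwich:
  assumes "(p', p) \<in> below\<^sup>=" "q \<in> paths Q" "r \<in> paths Q" "tgt Q q = src p" "tgt Q p = src r"
  shows "(pcat q (pcat p' r), pcat q (pcat p r)) \<in> below\<^sup>="
  using assms below_pcat[of p' p q r] by blast

lemma upto_left: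
  assumes x: "x \<in> Sp n (upto p)" and p: "p \<in> paths Q" and q: "q \<in> paths Q" "tgt Q q = src p"
  shows "\<pi> (single q c) \<odot>\<^bsub>P n\<^esub> x \<in> Sp n (upto (pcat q p))"
proof (rule Sp_left[OF x q(1)])
  fix q' w r assume t: "(q', w, r) \<in> composable n" "(q', w, r) \<in> upto p"
  then have "(total (q', w, r), p) \<in> below\<^sup>=" by (simp add: upto_def)
  from below_sandwich[OF this q(1) trivial_tgt[OF p] q(2)]
  have "(pcat q (total (q', w, r)), pcat q p) \<in> below\<^sup>=" by (simp add: src_def)
  then show "(pcat q q', w, r) \<in> upto (pcat q p)" by (simp add: upto_def total_def pcat_assoc)
qed

lemma upto_right:
  assumes x: "x \<in> Sp n (upto p)" and p: "p \<in> paths Q" and r: "r \<in> paths Q" "tgt Q p = src r"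
  shows "x \<odot>\<^sub>r\<^bsub>P n\<^esub> \<pi> (pe r) \<in> Sp n (upto (pcat p r))"
proof (rule Sp_right[OF x r(1)])
  fix q' w r' c assume t: "(q', w, r') \<in> composable n" "(q', w, r') \<in> upto p" "tgt Q r' = src r"
  then have "(total (q', w, r'), p) \<in> below\<^sup>=" by (simp add: upto_def)
  from below_sandwich[OF this trivial_src[OF p] r(1) _ r(2)]
  have "(pcat (total (q', w, r')) r, pcat p r) \<in> below\<^sup>="
    using upto_parallel[OF t(1,2) p] total_src_tgt(1)[OF t(1)] by (simp add: pcat_trivial_left)
  then have "(q', w, pcat r' r) \<in> upto (pcat p r)" by (simp add: upto_def total_def pcat_assoc)
  then show "tm n c (q', w, pcat r' r) \<in> Sp n (upto (pcat p r))"
    by (rule Sp_tm[OF composable_right[OF t(1) r(1) t(3)]])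
qed

text \<open>
  The lexicographic order by size and length of the right factor, which makes the operator \<open>E\<close> of the
  recursion locally nilpotent.
\<close>

definition rank_below :: "('v, 'e) path \<Rightarrow> nat \<Rightarrow> (('v, 'e) path \<times> ('v, 'e) path \<times> ('v, 'e) path) set" where
  "rank_below p l = {(q, w, u). u \<in> Irr \<and> ((total (q, w, u), p) \<in> below \<or> total (q, w, u) = p \<and> plen u < l)}"

text \<open>
  Terms of \<open>z\<close> of smaller size than the occurrence \<open>v\<close> of $S_{n+1}$ in question are of smaller size also
  after multiplication. A term of the same size has a middle factor $w_1$ which is a subpath of \<open>v\<close>. It does
  not start with \<open>v\<close>, as otherwise the term would not be terminal; hence $w_1$ starts to the right of $w$ in
  \<open>p\<close>, ends to the right of $w$, and leaves a shorter right factor.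
\<close>

lemma rank_below_step:
  assumes w: "w \<in> SS n" and u: "u \<in> Irr" and wu: "tgt Q w = src u" and p: "p = pcat w u"
    and ij: "(i, j) \<in> occurrences p (Suc n)" and z: "z \<in> Sp n (Terminal n \<inter> upto (slice p i j))"
  shows "(\<pi> (pe (slice p 0 i)) \<odot>\<^bsub>P n\<^esub> z) \<odot>\<^sub>r\<^bsub>P n\<^esub> \<pi> (pe (slice p j (plen p))) \<in> Sp n (rank_below p (plen u))"
proof -
  note st = occurrence_start[OF w u wu, folded p]
  have le: "i \<le> j" "j \<le> plen p" and v: "slice p i j \<in> SS (Suc n)" using ij by (simp_all add: occurrences_def)
  let ?q = "slice p 0 i" and ?v = "slice p i j" and ?r = "slice p j (plen p)"
  have qp: "?q \<in> paths Q" "?v \<in> paths Q" "?r \<in> paths Q" "tgt Q ?q = src ?v" "tgt Q ?v = src ?r"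
    using le st(1) by (simp_all add: slice_in_paths tgt_slice)
  have qvr: "pcat ?q (pcat ?v ?r) = p" using le by (simp add: pcat_slice)
  have 1: "\<pi> (single ?q 1) \<odot>\<^bsub>P n\<^esub> z \<in> Sp n {(pcat ?q q1, w1, r1) |q1 w1 r1. (q1, w1, r1) \<in> composable n \<and> (q1, w1, r1) \<in> Terminal n \<inter> upto ?v}"
    by (rule Sp_left[OF z qp(1)]) blast
  show ?thesis
  proof (rule Sp_right[OF 1 qp(3)])
    fix q' w1 r1 c assume "(q', w1, r1) \<in> composable n" and comp: "tgt Q r1 = src ?r"
      and "(q', w1, r1) \<in> {(pcat ?q q1, w1, r1) |q1 w1 r1. (q1, w1, r1) \<in> composable n \<and> (q1, w1, r1) \<in> Terminal n \<inter> upto ?v}"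
    then obtain q1 where q': "q' = pcat ?q q1" and t': "(q', w1, r1) \<in> composable n"
      and t1: "(q1, w1, r1) \<in> composable n" "(q1, w1, r1) \<in> Terminal n" "(q1, w1, r1) \<in> upto ?v" by blast
    have t: "(q', w1, pcat r1 ?r) \<in> composable n" by (rule composable_right[OF t' qp(3) comp])
    have total: "total (q', w1, pcat r1 ?r) = pcat ?q (pcat (total (q1, w1, r1)) ?r)"
      by (simp add: q' total_def pcat_assoc)
    have w1: "w1 \<in> SS n" "q1 \<in> paths Q" "r1 \<in> paths Q" "tgt Q q1 = src w1" "tgt Q w1 = src r1"
      using t1(1) by (simp_all add: composable_def)
    show "tm n c (q', w1, pcat r1 ?r) \<in> Sp n (rank_below p (plen u))"
    proof (rule tm_expand[OF t])
      fix u' assume u': "u' \<in> Irr" "(u', pcat r1 ?r) \<in> below\<^sup>="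
      have tu: "(total (q', w1, u'), total (q', w1, pcat r1 ?r)) \<in> below\<^sup>="
        using u'(2) total_below[OF t, of u'] by auto
      have tp: "(total (q', w1, pcat r1 ?r), p) \<in> below\<^sup>="
        using below_sandwich[OF _ qp(1,3,4,5), of "total (q1, w1, r1)"] t1(3) unfolding total qvr upto_def by blast
      have "total (q', w1, u') = p \<longrightarrow> plen u' < plen u" if neq: "(total (q', w1, u'), p) \<notin> below"
      proof -
        have eq: "total (q', w1, u') = total (q', w1, pcat r1 ?r)" "total (q', w1, pcat r1 ?r) = p"
          using tu tp neq below_trans by (metis UnE pair_in_Id_conv)+
        then have u'_eq: "u' = pcat r1 ?r"
          using u'(2) total_below[OF t, of u'] wf_below by (metis UnE pair_in_Id_conv wf_not_refl)
        have v_eq: "total (q1, w1, r1) = ?v"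
        proof (rule ccontr)
          assume "total (q1, w1, r1) \<noteq> ?v"
          then have "(total (q1, w1, r1), ?v) \<in> below" using t1(3) by (simp add: upto_def)
          from below_pcat[OF this qp(1,3,4,5)] have "(p, p) \<in> below" using total qvr eq by simp
          then show False using wf_below by (metis wf_not_refl)
        qed
        have "plen q1 \<noteq> 0"
        proof
          assume "plen q1 = 0"
          then have "q1 = trivial (src w1)" using plen_zero[of q1] w1(4) by (metis tgt_trivial)
          then have "?v = pcat w1 r1" using v_eq by (simp add: total_def pcat_trivial_left)
          moreover have "(0, plen ?v) \<in> occurrences ?v (Suc n)" using v by (simp add: occurrences_def)
          ultimately show False using t1(2) by (auto simp: Terminal_def terminal_def)
        qed
        define a b where "a = i + plen q1" and "b = i + plen q1 + plen w1"
        have vlen: "plen ?v = j - i" using le by (simp add: plen_slice)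
        have lens: "plen q1 + plen w1 + plen r1 = j - i"
          using v_eq vlen by (simp add: total_def) (metis add.assoc plen_pcat)
        have "slice ?v (plen q1) (plen q1 + plen w1) = w1"
          unfolding v_eq[symmetric] total_def
          using slice_pcat_right[of q1 "pcat w1 r1" 0 "plen w1"] w1(4) by (simp add: slice_pcat_left)
        then have "slice p a b = w1"
          using slice_slice[of i "plen q1 + plen w1" j "plen q1" p] lens le by (simp add: a_def b_def add.assoc)
        then have ab: "(a, b) \<in> occurrences p n"
          using w1(1) lens le by (simp add: occurrences_def a_def b_def)
        have "plen w < b" using occurrence_end_less[OF st(1,2) ab] \<open>plen q1 \<noteq> 0\<close> by (simp add: a_def)
        moreover have "plen u' + b = plen p"
          using lens le by (simp add: u'_eq b_def plen_slice)
        ultimately show ?thesis by (simp add: p)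
      qed
      moreover have "(total (q', w1, u'), p) \<in> below\<^sup>=" by (rule below_eq_trans[OF tu tp])
      ultimately show "(q', w1, u') \<in> rank_below p (plen u)"
        using u'(1) unfolding rank_below_def by blast
    qed
  qed
qed

lemma rank_below_left:
  assumes x: "x \<in> Sp n (rank_below p l)" and p: "p \<in> paths Q" and q: "q \<in> paths Q" "tgt Q q = src p"
  shows "\<pi> (single q c) \<odot>\<^bsub>P n\<^esub> x \<in> Sp n (rank_below (pcat q p) l)"
proof (rule Sp_left[OF x q(1)])
  fix q' w u assume t: "(q', w, u) \<in> rank_below p l"
  have "(total (q', w, u), p) \<in> below \<Longrightarrow> (pcat q (total (q', w, u)), pcat q p) \<in> below"
    using below_pcat[of "total (q', w, u)" p q "trivial (tgt Q p)"] q trivial_tgt[OF p] by (simp add: src_def)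
  then show "(pcat q q', w, u) \<in> rank_below (pcat q p) l"
    using t by (auto simp: rank_below_def total_def pcat_assoc)
qed

end

section \<open>One step of the recursion\<close>

text \<open>
  \<open>H\<close> is $\rho_{n-1}\partial_n$ and \<open>d\<close> is $\partial_n$. The target of \<open>d\<close> is kept general because it is
  $P_{n-1}$ for positive \<open>n\<close> and $A$ for \<open>n = 0\<close>. The assumptions \<open>H_upto\<close> and \<open>H_Terminal\<close> say that \<open>H\<close> is a
  projection onto the span of the terminal generators and does not increase sizes.
\<close>

locale resolution_stage = diamond_system Q S I \<phi>
  for Q :: "('v, 'e) pre_digraph" and S :: "('v, 'e) path set"
    and I :: "(('v, 'e) path \<Rightarrow>\<^sub>0 'k :: field) set" and \<phi> +
  fixes n :: nat and H :: "('v, 'e, 'k) tens \<Rightarrow> ('v, 'e, 'k) tens"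
    and M :: "(('v, 'e, 'k) quot_elem, 'b) bimod" and d
  assumes H: "H \<in> left_hom A (P n) (P n)"
    and H_upto: "\<And>x p. x \<in> Sp n (upto p) \<Longrightarrow> H x \<in> Sp n (Terminal n \<inter> upto p)"
    and H_Terminal: "\<And>x. x \<in> Sp n (Terminal n) \<Longrightarrow> H x = x"
    and M: "bimodule scalars A M" and d: "d \<in> bimod_hom A (P n) M"
    and dH: "\<And>x. x \<in> carrier (P n) \<Longrightarrow> d (H x) = d x"
    and d_zero: "\<And>x. x \<in> carrier (P n) \<Longrightarrow> d x = \<zero>\<^bsub>M\<^esub> \<Longrightarrow> H x = \<zero>\<^bsub>P n\<^esub>"
begin

interpretation M: bimodule scalars A M by (rule M)

abbreviation "D \<equiv> differential_step (Suc n) H"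
abbreviation "\<rho>' \<equiv> homotopy_step n D"

lemmas H_hom = left_hom_add[OF H]
lemmas H_closed = add_hom_closed[OF H_hom]

definition D_gen :: "('v, 'e) path \<Rightarrow> ('v, 'e, 'k) tens" where
  "D_gen w = \<delta>_gen (Suc n) w \<ominus>\<^bsub>P n\<^esub> H (\<delta>_gen (Suc n) w)"

lemma \<delta>_gen_upto: "w \<in> SS (Suc n) \<Longrightarrow> \<delta>_gen (Suc n) w \<in> Sp n (upto w)"
  by (rule Sp_mono[OF \<delta>_gen_in_Sp]) (auto simp: upto_def)

lemma \<delta>_gen_closed: "w \<in> SS (Suc n) \<Longrightarrow> \<delta>_gen (Suc n) w \<in> carrier (P n)"
  by (rule Sp_carrier[OF \<delta>_gen_in_Sp])

lemma D_gen_upto: "w \<in> SS (Suc n) \<Longrightarrow> D_gen w \<in> Sp n (upto w)"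
  unfolding D_gen_def by (rule Sp_minus[OF \<delta>_gen_upto Sp_mono[OF H_upto[OF \<delta>_gen_upto]]]) auto

lemma D_spec:
  "D \<in> bimod_hom A (P (Suc n)) (P n) \<and>
   (\<forall>w\<in>SS (Suc n). \<forall>a\<in>carrier A. \<forall>b\<in>carrier A. D (tensor (Suc n) a (pe w) b) = (a \<odot>\<^bsub>P n\<^esub> D_gen w) \<odot>\<^sub>r\<^bsub>P n\<^esub> b)"
proof -
  obtain f where f: "f \<in> bimod_hom A (P (Suc n)) (P n)" "f \<in> extensional (carrier (P (Suc n)))"
    and f_pe: "\<And>w a b. w \<in> SS (Suc n) \<Longrightarrow> a \<in> carrier A \<Longrightarrow> b \<in> carrier A \<Longrightarrow>
      f (tensor (Suc n) a (pe w) b) = (a \<odot>\<^bsub>P n\<^esub> D_gen w) \<odot>\<^sub>r\<^bsub>P n\<^esub> b"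
  proof (rule P_bimod_lift[OF P_bimodule])
    fix w assume w: "w \<in> SS (Suc n)"
    note wp = SS_path[OF w]
    show "D_gen w \<in> carrier (P n)" by (rule Sp_carrier[OF D_gen_upto[OF w]])
    show "idem (src w) \<odot>\<^bsub>P n\<^esub> D_gen w = D_gen w"
      by (rule Sp_idem_left[OF D_gen_upto[OF w] src_in_verts[OF wp]]) (rule upto_parallel(1)[OF _ _ wp])
    show "D_gen w \<odot>\<^sub>r\<^bsub>P n\<^esub> idem (tgt Q w) = D_gen w"
      by (rule Sp_idem_right[OF D_gen_upto[OF w] tgt_in_verts[OF wp]]) (rule upto_parallel(2)[OF _ _ wp])
  qed blast
  have "D = f"
    unfolding differential_step_def
  proof (rule the_equality)
    have \<delta>_val: "\<delta> (Suc n) (tensor (Suc n) \<one>\<^bsub>A\<^esub> (pe w) \<one>\<^bsub>A\<^esub>) = \<delta>_gen (Suc n) w" if "w \<in> SS (Suc n)" for w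
      using \<delta>_spec[of n] that by blast
    show "f \<in> hom (add_monoid (P (Suc n))) (add_monoid (P (Suc n - 1))) \<and> f \<in> extensional (carrier (P (Suc n))) \<and>
      (\<forall>a\<in>carrier A. \<forall>b\<in>carrier A. \<forall>w\<in>SS (Suc n). f (tensor (Suc n) a (pe w) b) =
        (let y = \<delta> (Suc n) (tensor (Suc n) \<one>\<^bsub>A\<^esub> (pe w) \<one>\<^bsub>A\<^esub>)
         in (a \<odot>\<^bsub>P (Suc n - 1)\<^esub> (y \<ominus>\<^bsub>P (Suc n - 1)\<^esub> H y)) \<odot>\<^sub>r\<^bsub>P (Suc n - 1)\<^esub> b))"
      using bimod_hom_add[OF f(1)] f(2) by (simp add: f_pe \<delta>_val D_gen_def Let_def)
    fix g assume g: "g \<in> hom (add_monoid (P (Suc n))) (add_monoid (P (Suc n - 1))) \<and> g \<in> extensional (carrier (P (Suc n))) \<and>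
      (\<forall>a\<in>carrier A. \<forall>b\<in>carrier A. \<forall>w\<in>SS (Suc n). g (tensor (Suc n) a (pe w) b) =
        (let y = \<delta> (Suc n) (tensor (Suc n) \<one>\<^bsub>A\<^esub> (pe w) \<one>\<^bsub>A\<^esub>)
         in (a \<odot>\<^bsub>P (Suc n - 1)\<^esub> (y \<ominus>\<^bsub>P (Suc n - 1)\<^esub> H y)) \<odot>\<^sub>r\<^bsub>P (Suc n - 1)\<^esub> b))"
    show "g = f"
    proof (rule extensionalityI)
      show "g x = f x" if "x \<in> carrier (P (Suc n))" for x
        by (rule P_hom_eq_pe[OF _ bimod_hom_add[OF f(1)] P_abelian_group _ that])
          (use g in \<open>auto simp: f_pe \<delta>_val D_gen_def Let_def\<close>)
    qed (use g f in auto)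
  qed
  then show ?thesis using f f_pe by blast
qed

lemmas D_bimod_hom = conjunct1[OF D_spec]
lemmas D_hom = bimod_hom_add[OF D_bimod_hom]
lemmas D_closed = add_hom_closed[OF D_hom]

lemma D_tm:
  assumes t: "(q, w, r) \<in> composable (Suc n)"
  shows "D (tm (Suc n) c (q, w, r)) = (\<pi> (single q c) \<odot>\<^bsub>P n\<^esub> D_gen w) \<odot>\<^sub>r\<^bsub>P n\<^esub> \<pi> (pe r)"
  using conjunct2[OF D_spec] t by (simp add: tm_def composable_def)

lemma D_upto:
  assumes "x \<in> Sp (Suc n) (upto p)"
  shows "D x \<in> Sp n (upto p)"
proof (rule Sp_hom[OF assms D_hom])
  fix q w r c assume t: "(q, w, r) \<in> composable (Suc n)" "(q, w, r) \<in> upto p"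
  have *: "w \<in> SS (Suc n)" "q \<in> paths Q" "r \<in> paths Q" "tgt Q q = src w" "tgt Q w = src r" "w \<in> paths Q"
    using t(1) SS_path[of w "Suc n"] unfolding composable_def by simp_all
  have "\<pi> (single q c) \<odot>\<^bsub>P n\<^esub> D_gen w \<in> Sp n (upto (pcat q w))"
    by (rule upto_left[OF D_gen_upto[OF *(1)] *(6,2,4)])
  from upto_right[OF this pcat_in_paths[OF *(2,6,4)] *(3)]
  have "D (tm (Suc n) c (q, w, r)) \<in> Sp n (upto (total (q, w, r)))"
    unfolding D_tm[OF t(1)] using * by (simp add: tgt_pcat total_def pcat_assoc)
  moreover have "(total (q, w, r), p) \<in> below\<^sup>=" using t(2) by (simp add: upto_def)
  ultimately show "D (tm (Suc n) c (q, w, r)) \<in> Sp n (upto p)"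
    by (elim Sp_mono) (use below_eq_trans in \<open>unfold upto_def, blast\<close>)
qed

lemma dD: "x \<in> carrier (P (Suc n)) \<Longrightarrow> d (D x) = \<zero>\<^bsub>M\<^esub>"
proof (induction x rule: P_induct_pe)
  case zero
  then show ?case
    by (simp add: P_hom_zero[OF D_hom]
        add_hom_zero[OF P_abelian_group M.M.abelian_group_axioms bimod_hom_add[OF d]])
next
  case (tensor a w b)
  note w = tensor(2)
  have yc: "\<delta>_gen (Suc n) w \<in> carrier (P n)" "D_gen w \<in> carrier (P n)"
    using \<delta>_gen_closed[OF w] Sp_carrier[OF D_gen_upto[OF w]] .
  have "d (D_gen w) = d (\<delta>_gen (Suc n) w) \<ominus>\<^bsub>M\<^esub> d (H (\<delta>_gen (Suc n) w))"
    unfolding D_gen_def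
    by (rule add_hom_minus[OF P_abelian_group M.M.abelian_group_axioms bimod_hom_add[OF d] yc(1) H_closed[OF yc(1)]])
  then have "d (D_gen w) = \<zero>\<^bsub>M\<^esub>"
    using dH[OF yc(1)] add_hom_closed[OF bimod_hom_add[OF d] yc(1)] by (simp add: a_minus_def M.M.r_neg)
  then show ?case
    using tensor conjunct2[OF D_spec] yc
    by (simp add: bimod_hom_rsmult[OF d] left_hom_smult[OF bimod_hom_left[OF d]] P.lact_closed M.lact_zero M.ract_zero)
next
  case (plus x y)
  then show ?case
    by (simp add: add_hom_add[OF D_hom] D_closed add_hom_add[OF bimod_hom_add[OF d]])
qed

lemma HD: "x \<in> carrier (P (Suc n)) \<Longrightarrow> H (D x) = \<zero>\<^bsub>P n\<^esub>"
  by (rule d_zero[OF D_closed dD])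

subsection \<open>Local nilpotency\<close>

text \<open>
  \<open>E\<close> is the operator whose geometric series enters the definition of the homotopy. It is \<open>E'\<close> after
  $\gamma_n$, and \<open>E'\<close>, in contrast to \<open>E\<close>, is a map of bimodules.
\<close>

abbreviation E' :: "('v, 'e, 'k) tens \<Rightarrow> ('v, 'e, 'k) tens" where
  "E' z \<equiv> \<delta> (Suc n) z \<ominus>\<^bsub>P n\<^esub> D z"

abbreviation E :: "('v, 'e, 'k) tens \<Rightarrow> ('v, 'e, 'k) tens" where
  "E y \<equiv> \<delta> (Suc n) (\<gamma> n y) \<ominus>\<^bsub>P n\<^esub> D (\<gamma> n y)"

lemma E'_hom: "(\<lambda>z. E' z) \<in> hom (add_monoid (P (Suc n))) (add_monoid (P n))"
  by (rule add_homI)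
    (simp_all add: add_hom_closed[OF \<delta>_hom] D_closed add_hom_add[OF \<delta>_hom] add_hom_add[OF D_hom] P.M.add_minus_add)

lemma E'_left: "a \<in> carrier A \<Longrightarrow> z \<in> carrier (P (Suc n)) \<Longrightarrow> E' (a \<odot>\<^bsub>P (Suc n)\<^esub> z) = a \<odot>\<^bsub>P n\<^esub> E' z"
  by (simp add: left_hom_smult[OF bimod_hom_left[OF conjunct1[OF \<delta>_spec]]] left_hom_smult[OF bimod_hom_left[OF D_bimod_hom]]
      P.lact_minus add_hom_closed[OF \<delta>_hom] D_closed)

lemma E_hom: "(\<lambda>y. E y) \<in> hom (add_monoid (P n)) (add_monoid (P n))"
  by (rule add_hom_comp[OF \<gamma>_hom E'_hom])

lemma E_left: "a \<in> carrier A \<Longrightarrow> y \<in> carrier (P n) \<Longrightarrow> E (a \<odot>\<^bsub>P n\<^esub> y) = a \<odot>\<^bsub>P n\<^esub> E y"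
  using left_hom_smult[OF conjunct1[OF \<gamma>_spec], of a y n] E'_left[of a "\<gamma> n y"] add_hom_closed[OF \<gamma>_hom, of y n] by simp

lemma E'_tm:
  assumes t: "(q, w, r) \<in> composable (Suc n)"
  shows "E' (tm (Suc n) c (q, w, r)) = (\<pi> (single q c) \<odot>\<^bsub>P n\<^esub> H (\<delta>_gen (Suc n) w)) \<odot>\<^sub>r\<^bsub>P n\<^esub> \<pi> (pe r)"
proof -
  have w: "w \<in> SS (Suc n)" and cl: "\<pi> (single q c) \<in> carrier A" "\<pi> (pe r) \<in> carrier A"
    using t by (simp_all add: composable_def)
  let ?y = "\<delta>_gen (Suc n) w"
  have y: "?y \<in> carrier (P n)" "H ?y \<in> carrier (P n)" "D_gen w \<in> carrier (P n)"
    using \<delta>_gen_closed[OF w] H_closed Sp_carrier[OF D_gen_upto[OF w]] by blast+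
  have "?y \<ominus>\<^bsub>P n\<^esub> D_gen w = H ?y"
    by (rule P.M.minus_swap(1)[OF y, symmetric]) (simp add: D_gen_def)
  then show ?thesis
    unfolding \<delta>_tm[OF t] D_tm[OF t] using cl y
    by (simp add: P.lact_minus[symmetric] P.ract_minus[symmetric] P.lact_closed)
qed

text \<open>
  By \<open>E'_tm\<close>, the summand of a splitting that belongs to $qvr = wu$ is mapped to $q\,H(\delta(1 \otimes v \otimes 1))\,r$,
  to which \<open>rank_below_step\<close> applies.
\<close>

lemma E_rank:
  assumes t: "(q, w, u) \<in> composable n" and u: "u \<in> Irr"
  shows "E (tm n c (q, w, u)) \<in> Sp n (rank_below (total (q, w, u)) (plen u))"
proof -
  have *: "w \<in> SS n" "tgt Q w = src u" "q \<in> paths Q" "tgt Q q = src w" using t by (simp_all add: composable_def)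
  define p where "p = pcat w u"
  note st = occurrence_start[OF *(1) u *(2), folded p_def]
  let ?s = "split (Suc n) p"
  have sc: "?s \<in> carrier (P (Suc n))" by (rule split_closed[OF st(1)])
  have each: "E' (tm (Suc n) 1 (cut p ij)) \<in> Sp n (rank_below p (plen u))" if ij: "ij \<in> occurrences p (Suc n)" for ij
  proof -
    obtain i j where ij': "ij = (i, j)" by (cases ij)
    have comp: "cut p (i, j) \<in> composable (Suc n)" using cut_composable(1)[OF st(1) ij] ij' by simp
    have v: "slice p i j \<in> SS (Suc n)" using ij ij' by (simp add: occurrences_def)
    show ?thesis
      unfolding ij' using E'_tm[OF comp[unfolded cut_def case_prod_conv], of 1]
        rank_below_step[OF *(1) u *(2) p_def ij[unfolded ij'] H_upto[OF \<delta>_gen_upto[OF v]]]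
      by (simp add: cut_def)
  qed
  have "E' ?s = (\<Oplus>\<^bsub>P n\<^esub>ij\<in>occurrences p (Suc n). E' (tm (Suc n) 1 (cut p ij)))"
    unfolding split_eq[OF st(1)]
    by (rule P_hom_finsum[OF E'_hom]) (simp add: cut_composable(1)[OF st(1)])
  then have s: "E' ?s \<in> Sp n (rank_below p (plen u))" using Sp_finsum[OF each] by simp
  have "E' (signed (Suc n) (Suc n) ?s) \<in> Sp n (rank_below p (plen u))"
    using s Sp_uminus[OF s] P_hom_uminus[OF E'_hom sc] by (simp add: signed_def)
  from rank_below_left[OF this st(1) *(3), of c]
  have "\<pi> (single q c) \<odot>\<^bsub>P n\<^esub> E' (signed (Suc n) (Suc n) ?s) \<in> Sp n (rank_below (total (q, w, u)) (plen u))"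
    using * by (simp add: p_def total_def)
  moreover have "signed (Suc n) (Suc n) ?s \<in> carrier (P (Suc n))" using sc by (simp add: signed_def)
  ultimately show ?thesis
    unfolding \<gamma>_tm[OF t u] p_def[symmetric] using E'_left[of "\<pi> (single q c)"] *(3) by simp
qed

lemma E_closed: "y \<in> carrier (P n) \<Longrightarrow> E y \<in> carrier (P n)"
  using add_hom_closed[OF E_hom] .

lemma E_zero: "E \<zero>\<^bsub>P n\<^esub> = \<zero>\<^bsub>P n\<^esub>"
  by (rule P_hom_zero[OF E_hom])

lemma E_pow_closed: "y \<in> carrier (P n) \<Longrightarrow> ((\<lambda>y. E y) ^^ i) y \<in> carrier (P n)"
  by (induction i) (simp_all add: E_closed)

lemma E_pow_zero: "((\<lambda>y. E y) ^^ i) \<zero>\<^bsub>P n\<^esub> = \<zero>\<^bsub>P n\<^esub>"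
  by (induction i) (simp_all add: E_zero)

lemma E_pow_add:
  "x \<in> carrier (P n) \<Longrightarrow> y \<in> carrier (P n) \<Longrightarrow>
    ((\<lambda>y. E y) ^^ i) (x \<oplus>\<^bsub>P n\<^esub> y) = ((\<lambda>y. E y) ^^ i) x \<oplus>\<^bsub>P n\<^esub> ((\<lambda>y. E y) ^^ i) y"
  by (induction i) (simp_all add: add_hom_add[OF E_hom] E_pow_closed)

lemma E_pow_vanishes:
  assumes "((\<lambda>y. E y) ^^ N) x = \<zero>\<^bsub>P n\<^esub>" "N \<le> i"
  shows "((\<lambda>y. E y) ^^ i) x = \<zero>\<^bsub>P n\<^esub>"
proof -
  obtain j where "i = j + N" using assms(2) by (metis le_add_diff_inverse2)
  then show ?thesis using assms(1) by (simp add: funpow_add E_pow_zero)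
qed

lemma E_nilpotent_tm:
  assumes "(q, w, u) \<in> composable n" "u \<in> Irr"
  shows "\<exists>N. ((\<lambda>y. E y) ^^ N) (tm n c (q, w, u)) = \<zero>\<^bsub>P n\<^esub>"
proof -
  let ?R = "inv_image (below <*lex*> less_than) (\<lambda>(q, w, u). (total (q, w, u), plen u))"
  have wf: "wf ?R" by (intro wf_inv_image wf_lex_prod wf_below wf_less_than)
  have "\<forall>q w u c. t = (q, w, u) \<longrightarrow> (q, w, u) \<in> composable n \<longrightarrow> u \<in> Irr \<longrightarrow>
      (\<exists>N. ((\<lambda>y. E y) ^^ N) (tm n c (q, w, u)) = \<zero>\<^bsub>P n\<^esub>)" for t
  proof (induction t rule: wf_induct_rule[OF wf])
    case (1 t)
    show ?case
    proof (intro allI impI)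
      fix q w u c assume t: "t = (q, w, u)" "(q, w, u) \<in> composable n" "u \<in> Irr"
      have "\<exists>N. ((\<lambda>y. E y) ^^ N) x = \<zero>\<^bsub>P n\<^esub>" if "x \<in> Sp n (rank_below (total (q, w, u)) (plen u))" for x
        using that
      proof (induction rule: Sp.induct)
        case Sp_zero
        then show ?case by (intro exI[of _ 0]) simp
      next
        case (Sp_tm t' c')
        obtain q' w' u' where t': "t' = (q', w', u')" by (cases t')
        then have "(t', t) \<in> ?R" "u' \<in> Irr" using Sp_tm(2) t(1) by (auto simp: rank_below_def)
        then show ?case using 1 t' Sp_tm(1) by blast
      next
        case (Sp_add x y)
        then obtain N N' where N: "((\<lambda>y. E y) ^^ N) x = \<zero>\<^bsub>P n\<^esub>" "((\<lambda>y. E y) ^^ N') y = \<zero>\<^bsub>P n\<^esub>" by blast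
        show ?case
          using Sp_add(1,2) E_pow_vanishes[OF N(1), of "max N N'"] E_pow_vanishes[OF N(2), of "max N N'"]
          by (intro exI[of _ "max N N'"]) (simp add: E_pow_add Sp_carrier)
      qed
      from this[OF E_rank[OF t(2,3)]] obtain N where "((\<lambda>y. E y) ^^ N) (E (tm n c (q, w, u))) = \<zero>\<^bsub>P n\<^esub>" by blast
      then show "\<exists>N. ((\<lambda>y. E y) ^^ N) (tm n c (q, w, u)) = \<zero>\<^bsub>P n\<^esub>"
        by (intro exI[of _ "Suc N"]) (simp only: funpow_Suc_right comp_apply)
    qed
  qed
  then show ?thesis using assms by blast
qed

lemma E_nilpotent:
  assumes "x \<in> carrier (P n)"
  shows "\<exists>N. ((\<lambda>y. E y) ^^ N) x = \<zero>\<^bsub>P n\<^esub>"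
  using assms
proof (induction x rule: P_induct_tm)
  case zero
  then show ?case by (intro exI[of _ 0]) simp
next
  case (tm q w u c)
  then show ?case by (rule E_nilpotent_tm)
next
  case (plus x y)
  then obtain N N' where N: "((\<lambda>y. E y) ^^ N) x = \<zero>\<^bsub>P n\<^esub>" "((\<lambda>y. E y) ^^ N') y = \<zero>\<^bsub>P n\<^esub>" by blast
  show ?case
    using plus(1,2) E_pow_vanishes[OF N(1), of "max N N'"] E_pow_vanishes[OF N(2), of "max N N'"]
    by (intro exI[of _ "max N N'"]) (simp add: E_pow_add)
qed

lemma summand_eq: "homotopy_summand n D i x = \<gamma> n (((\<lambda>y. E y) ^^ i) x)"
  by (simp add: homotopy_summand_def)

lemma finite_summands:
  assumes "x \<in> carrier (P n)"
  shows "finite {i. i \<ge> 1 \<and> homotopy_summand n D i x \<noteq> \<zero>\<^bsub>P (Suc n)\<^esub>}"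
proof -
  obtain N where N: "((\<lambda>y. E y) ^^ N) x = \<zero>\<^bsub>P n\<^esub>" using E_nilpotent[OF assms] by blast
  have "homotopy_summand n D i x = \<zero>\<^bsub>P (Suc n)\<^esub>" if "N \<le> i" for i
    unfolding summand_eq E_pow_vanishes[OF N that] by (rule P_hom_zero[OF \<gamma>_hom])
  then have "{i. i \<ge> 1 \<and> homotopy_summand n D i x \<noteq> \<zero>\<^bsub>P (Suc n)\<^esub>} \<subseteq> {..<N}" by (auto simp: not_le[symmetric])
  then show ?thesis by (rule finite_subset) simp
qed

lemma E_upto: "x \<in> Sp n (upto p) \<Longrightarrow> E x \<in> Sp n (upto p)"
proof -
  assume "x \<in> Sp n (upto p)"
  then have "\<gamma> n x \<in> Sp (Suc n) (upto p)" using Sp_mono[OF \<gamma>_upto] by blast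
  then show ?thesis by (intro Sp_minus \<delta>_upto D_upto)
qed

text \<open>
  \<open>y\<close> is the sum of the $E^i x$, which is finite by nilpotency; the sum for $\rho_n x$ is its image under
  $\gamma_n$, and $(1 - E)y$ telescopes to $x$. Working with \<open>y\<close> avoids any further manipulation of sums.
\<close>

lemma homotopy_char:
  assumes x: "x \<in> carrier (P n)"
  obtains y where "y \<in> carrier (P n)" "y \<ominus>\<^bsub>P n\<^esub> E y = x" "\<rho>' x = \<gamma> n y"
    "\<And>p. x \<in> Sp n (upto p) \<Longrightarrow> y \<in> Sp n (upto p)"
proof -
  obtain N0 where N0: "((\<lambda>y. E y) ^^ N0) x = \<zero>\<^bsub>P n\<^esub>" using E_nilpotent[OF x] by blast
  \<comment> \<open>Positive, so that the summand of index 0, which is $\gamma_n x$ itself, is included.\<close>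
  define N where "N = Suc N0"
  have N: "((\<lambda>y. E y) ^^ N) x = \<zero>\<^bsub>P n\<^esub>" unfolding N_def by (rule E_pow_vanishes[OF N0]) simp
  let ?g = "\<lambda>i. ((\<lambda>y. E y) ^^ i) x"
  have g: "?g \<in> B \<rightarrow> carrier (P n)" for B using E_pow_closed[OF x] by simp
  define y where "y = (\<Oplus>\<^bsub>P n\<^esub>i\<in>{..<N}. ?g i)"
  have yc: "y \<in> carrier (P n)" unfolding y_def by (rule P.M.finsum_closed[OF g])
  have tel: "(\<Oplus>\<^bsub>P n\<^esub>i\<in>{..<k}. ?g i) \<ominus>\<^bsub>P n\<^esub> E (\<Oplus>\<^bsub>P n\<^esub>i\<in>{..<k}. ?g i) = x \<ominus>\<^bsub>P n\<^esub> ?g k" for k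
  proof (induction k)
    case 0
    have "\<zero>\<^bsub>P n\<^esub> \<ominus>\<^bsub>P n\<^esub> E \<zero>\<^bsub>P n\<^esub> = \<zero>\<^bsub>P n\<^esub>" unfolding E_zero by (rule minus_self) simp
    then show ?case using minus_self[OF x] by simp
  next
    case (Suc k)
    let ?y = "\<Oplus>\<^bsub>P n\<^esub>i\<in>{..<k}. ?g i"
    have c: "?y \<in> carrier (P n)" "?g k \<in> carrier (P n)" "E ?y \<in> carrier (P n)" "E (?g k) \<in> carrier (P n)"
      using P.M.finsum_closed[OF g] E_pow_closed[OF x] E_closed by blast+
    have "(\<Oplus>\<^bsub>P n\<^esub>i\<in>{..<Suc k}. ?g i) = ?g k \<oplus>\<^bsub>P n\<^esub> ?y"
      unfolding lessThan_Suc by (rule P.M.finsum_insert) (use g c in auto)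
    then have "(\<Oplus>\<^bsub>P n\<^esub>i\<in>{..<Suc k}. ?g i) \<ominus>\<^bsub>P n\<^esub> E (\<Oplus>\<^bsub>P n\<^esub>i\<in>{..<Suc k}. ?g i) =
        (?g k \<ominus>\<^bsub>P n\<^esub> E (?g k)) \<oplus>\<^bsub>P n\<^esub> (?y \<ominus>\<^bsub>P n\<^esub> E ?y)"
      using add_hom_add[OF E_hom c(2,1)] P.M.add_minus_add[OF c(2,1,4,3)] by simp
    also have "\<dots> = (?g k \<ominus>\<^bsub>P n\<^esub> E (?g k)) \<oplus>\<^bsub>P n\<^esub> (x \<ominus>\<^bsub>P n\<^esub> ?g k)" unfolding Suc.IH ..
    also have "\<dots> = (x \<ominus>\<^bsub>P n\<^esub> ?g k) \<oplus>\<^bsub>P n\<^esub> ?g k \<ominus>\<^bsub>P n\<^esub> E (?g k)"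
      using x c(2,4) by (simp add: a_minus_def P.M.a_ac)
    also have "\<dots> = x \<ominus>\<^bsub>P n\<^esub> ?g (Suc k)" unfolding P.M.minus_add_cancel[OF x c(2)] by simp
    finally show ?case .
  qed
  have "y \<ominus>\<^bsub>P n\<^esub> E y = x" using tel[of N] N P.M.minus_zero_right[OF x] by (simp add: y_def)
  moreover have "\<rho>' x = \<gamma> n y"
  proof -
    let ?h = "\<lambda>i. homotopy_summand n D i x"
    have hc: "?h \<in> B \<rightarrow> carrier (P (Suc n))" for B
      unfolding summand_eq using add_hom_closed[OF \<gamma>_hom] E_pow_closed[OF x] by auto
    have h0: "?h i = \<zero>\<^bsub>P (Suc n)\<^esub>" if "N \<le> i" for i
      unfolding summand_eq E_pow_vanishes[OF N that] by (rule P_hom_zero[OF \<gamma>_hom])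
    have "(\<Oplus>\<^bsub>P (Suc n)\<^esub>i\<in>{i. i \<ge> 1 \<and> ?h i \<noteq> \<zero>\<^bsub>P (Suc n)\<^esub>}. ?h i) = (\<Oplus>\<^bsub>P (Suc n)\<^esub>i\<in>{1..<N}. ?h i)"
      by (rule P.M.finsum_mono_neutral) (use h0 hc in \<open>auto simp: not_le[symmetric]\<close>)
    then have "\<rho>' x = ?h 0 \<oplus>\<^bsub>P (Suc n)\<^esub> (\<Oplus>\<^bsub>P (Suc n)\<^esub>i\<in>{1..<N}. ?h i)"
      by (simp add: homotopy_step_def homotopy_summand_def)
    also have "\<dots> = (\<Oplus>\<^bsub>P (Suc n)\<^esub>i\<in>insert 0 {1..<N}. ?h i)"
      by (rule P.M.finsum_insert[symmetric]) (use hc in auto)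
    also have "insert 0 {1..<N} = {..<N}" by (auto simp: N_def)
    also have "(\<Oplus>\<^bsub>P (Suc n)\<^esub>i\<in>{..<N}. ?h i) = \<gamma> n y"
      unfolding y_def summand_eq by (rule P_hom_finsum[OF \<gamma>_hom g, symmetric])
    finally show ?thesis .
  qed
  moreover have "y \<in> Sp n (upto p)" if "x \<in> Sp n (upto p)" for p
  proof -
    have "?g i \<in> Sp n (upto p)" for i by (induction i) (simp_all add: that E_upto)
    then show ?thesis unfolding y_def by (intro Sp_finsum)
  qed
  ultimately show thesis using that yc by blast
qed

lemma one_minus_E_injective:
  assumes "y \<in> carrier (P n)" "y' \<in> carrier (P n)" "y \<ominus>\<^bsub>P n\<^esub> E y = y' \<ominus>\<^bsub>P n\<^esub> E y'"
  shows "y = y'"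
proof -
  let ?z = "y \<ominus>\<^bsub>P n\<^esub> y'"
  have c: "?z \<in> carrier (P n)" "E y \<in> carrier (P n)" "E y' \<in> carrier (P n)" "E ?z \<in> carrier (P n)"
    using assms E_closed by simp_all
  have "E ?z = E y \<ominus>\<^bsub>P n\<^esub> E y'"
    by (rule P_hom_minus[OF E_hom assms(1,2)])
  then have "?z \<ominus>\<^bsub>P n\<^esub> E ?z = (y \<ominus>\<^bsub>P n\<^esub> E y) \<ominus>\<^bsub>P n\<^esub> (y' \<ominus>\<^bsub>P n\<^esub> E y')"
    using assms(1,2) c(2,3) by (simp add: a_minus_def P.M.minus_add P.M.a_ac)
  also have "\<dots> = \<zero>\<^bsub>P n\<^esub>" unfolding assms(3) by (rule minus_self) (use assms c in simp)
  finally have "E ?z = ?z" using P.M.minus_eq_zero_iff[OF c(1,4)] by simp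
  then have "((\<lambda>y. E y) ^^ N) ?z = ?z" for N by (induction N) simp_all
  moreover obtain N where "((\<lambda>y. E y) ^^ N) ?z = \<zero>\<^bsub>P n\<^esub>" using E_nilpotent[OF c(1)] by blast
  ultimately have "?z = \<zero>\<^bsub>P n\<^esub>" by simp
  then show ?thesis using P.M.minus_eq_zero_iff[OF assms(1,2)] by simp
qed

lemma homotopy_eq:
  assumes "y \<in> carrier (P n)"
  shows "\<rho>' (y \<ominus>\<^bsub>P n\<^esub> E y) = \<gamma> n y"
proof -
  have "y \<ominus>\<^bsub>P n\<^esub> E y \<in> carrier (P n)" using assms E_closed by simp
  then obtain y' where "y' \<in> carrier (P n)" "y' \<ominus>\<^bsub>P n\<^esub> E y' = y \<ominus>\<^bsub>P n\<^esub> E y" "\<rho>' (y \<ominus>\<^bsub>P n\<^esub> E y) = \<gamma> n y'"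
    using homotopy_char by metis
  then show ?thesis using one_minus_E_injective[OF _ assms] by metis
qed

lemma homotopy_left_hom: "\<rho>' \<in> left_hom A (P n) (P (Suc n))"
  unfolding left_hom_def mem_Collect_eq
proof (intro conjI ballI add_homI)
  fix x assume x: "x \<in> carrier (P n)"
  obtain y where y: "y \<in> carrier (P n)" "y \<ominus>\<^bsub>P n\<^esub> E y = x" "\<rho>' x = \<gamma> n y" using homotopy_char[OF x] by metis
  show "\<rho>' x \<in> carrier (P (Suc n))" using y(1) by (simp add: y(3) add_hom_closed[OF \<gamma>_hom])
  have Ey: "E y \<in> carrier (P n)" by (rule E_closed[OF y(1)])
  show "\<rho>' (x \<oplus>\<^bsub>P n\<^esub> x') = \<rho>' x \<oplus>\<^bsub>P (Suc n)\<^esub> \<rho>' x'" if x': "x' \<in> carrier (P n)" for x'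
  proof -
    obtain y' where y': "y' \<in> carrier (P n)" "y' \<ominus>\<^bsub>P n\<^esub> E y' = x'" "\<rho>' x' = \<gamma> n y'" using homotopy_char[OF x'] by metis
    have "x \<oplus>\<^bsub>P n\<^esub> x' = (y \<oplus>\<^bsub>P n\<^esub> y') \<ominus>\<^bsub>P n\<^esub> E (y \<oplus>\<^bsub>P n\<^esub> y')"
      unfolding add_hom_add[OF E_hom y(1) y'(1)] P.M.add_minus_add[OF y(1) y'(1) Ey E_closed[OF y'(1)]] y(2) y'(2) ..
    then show ?thesis
      using homotopy_eq[of "y \<oplus>\<^bsub>P n\<^esub> y'"] y(1) y'(1) by (simp add: y(3) y'(3) add_hom_add[OF \<gamma>_hom])
  qed
  show "\<rho>' (a \<odot>\<^bsub>P n\<^esub> x) = a \<odot>\<^bsub>P (Suc n)\<^esub> \<rho>' x" if a: "a \<in> carrier A" for a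
  proof -
    have "a \<odot>\<^bsub>P n\<^esub> x = (a \<odot>\<^bsub>P n\<^esub> y) \<ominus>\<^bsub>P n\<^esub> E (a \<odot>\<^bsub>P n\<^esub> y)"
      unfolding E_left[OF a y(1)] using P.lact_minus[OF a y(1) Ey] y(2) by simp
    then show ?thesis
      using homotopy_eq[OF P.lact_closed[OF a y(1)]] left_hom_smult[OF conjunct1[OF \<gamma>_spec] a y(1)] by (simp add: y(3))
  qed
qed

lemmas homotopy_hom = left_hom_add[OF homotopy_left_hom]

lemma homotopy_Terminal:
  assumes "x \<in> Sp n (Terminal n)"
  shows "\<rho>' x = \<zero>\<^bsub>P (Suc n)\<^esub>"
proof -
  have x: "x \<in> carrier (P n)" by (rule Sp_carrier[OF assms])
  have "E x = \<zero>\<^bsub>P n\<^esub>"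
    unfolding \<gamma>_Terminal[OF assms] by (rule P_hom_zero[OF E'_hom])
  then have "x \<ominus>\<^bsub>P n\<^esub> E x = x" using P.M.minus_zero_right[OF x] by simp
  then show ?thesis using homotopy_eq[OF x] \<gamma>_Terminal[OF assms] by simp
qed

lemma homotopy_upto: "x \<in> Sp n (upto p) \<Longrightarrow> \<rho>' x \<in> Sp (Suc n) (Terminal (Suc n) \<inter> upto p)"
  using homotopy_char[OF Sp_carrier] \<gamma>_upto by metis

lemma H_in_Terminal: "x \<in> carrier (P n) \<Longrightarrow> H x \<in> Sp n (Terminal n)"
proof (rule Sp_hom[OF Sp_irreducible H_hom])
  fix q w u c assume "(q, w, u) \<in> composable n"
  from H_upto[OF upto_carrier[OF this]] show "H (tm n c (q, w, u)) \<in> Sp n (Terminal n)"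
    by (rule Sp_mono) blast
qed

text \<open>
  With $x = (1 - E)y$ and $z = y - \delta\gamma y$, which is in the span of the terminal generators, one has
  $x = z + \partial\gamma y$. As \<open>H\<close> fixes $z$ and kills the image of $\partial$, this gives $Hx = z$, and what
  remains is $\partial\gamma y = \partial\rho x$.
\<close>

lemma D_homotopy:
  assumes x: "x \<in> carrier (P n)"
  shows "D (\<rho>' x) = x \<ominus>\<^bsub>P n\<^esub> H x"
proof -
  obtain y where y: "y \<in> carrier (P n)" "y \<ominus>\<^bsub>P n\<^esub> E y = x" "\<rho>' x = \<gamma> n y" using homotopy_char[OF x] by metis
  have gy: "\<gamma> n y \<in> carrier (P (Suc n))" by (rule add_hom_closed[OF \<gamma>_hom y(1)])
  define z where "z = y \<ominus>\<^bsub>P n\<^esub> \<delta> (Suc n) (\<gamma> n y)"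
  have z: "z \<in> Sp n (Terminal n)" unfolding z_def by (rule id_minus_\<delta>\<gamma>[OF y(1)])
  have c: "z \<in> carrier (P n)" "D (\<gamma> n y) \<in> carrier (P n)" "\<delta> (Suc n) (\<gamma> n y) \<in> carrier (P n)"
    using Sp_carrier[OF z] D_closed[OF gy] add_hom_closed[OF \<delta>_hom gy] by blast+
  have x_eq: "x = z \<oplus>\<^bsub>P n\<^esub> D (\<gamma> n y)"
    unfolding y(2)[symmetric] z_def using y(1) c by (simp add: a_minus_def P.M.minus_add P.M.a_ac)
  then have "H x = H z \<oplus>\<^bsub>P n\<^esub> H (D (\<gamma> n y))" using add_hom_add[OF H_hom c(1,2)] by simp
  then have "H x = z" using H_Terminal[OF z] HD[OF gy] c by simp
  then show ?thesis using P.M.add_minus_cancel_left[OF c(1,2)] x_eq y(3) by simp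
qed

lemma next_H_left_hom: "(\<rho>' \<circ> D) \<in> left_hom A (P (Suc n)) (P (Suc n))"
  unfolding left_hom_def mem_Collect_eq
proof (intro conjI ballI)
  show "\<rho>' \<circ> D \<in> hom (add_monoid (P (Suc n))) (add_monoid (P (Suc n)))"
    using add_hom_comp[OF D_hom homotopy_hom] by (simp add: comp_def)
qed (simp add: left_hom_smult[OF bimod_hom_left[OF D_bimod_hom]] left_hom_smult[OF homotopy_left_hom] D_closed)

lemma next_H_upto: "x \<in> Sp (Suc n) (upto p) \<Longrightarrow> (\<rho>' \<circ> D) x \<in> Sp (Suc n) (Terminal (Suc n) \<inter> upto p)"
  by (simp add: homotopy_upto D_upto)

text \<open>
  Such an $x$ is $\gamma y = \rho v$ with $v = (1 - E)y$. Then $\rho\partial\rho v = \rho(v - Hv) = \rho v$, because $\rho$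
  kills the terminal element $Hv$.
\<close>

lemma next_H_Terminal:
  assumes "x \<in> Sp (Suc n) (Terminal (Suc n))"
  shows "(\<rho>' \<circ> D) x = x"
proof -
  obtain y where y: "y \<in> carrier (P n)" "x = \<gamma> n y" using Terminal_in_\<gamma>_image[OF assms] by blast
  let ?v = "y \<ominus>\<^bsub>P n\<^esub> E y"
  have v: "?v \<in> carrier (P n)" using y(1) E_closed by simp
  have x: "x = \<rho>' ?v" using homotopy_eq[OF y(1)] y(2) by simp
  have "\<rho>' (D x) = \<rho>' (?v \<ominus>\<^bsub>P n\<^esub> H ?v)" using D_homotopy[OF v] x by simp
  also have "\<dots> = \<rho>' ?v \<ominus>\<^bsub>P (Suc n)\<^esub> \<rho>' (H ?v)"
    by (rule P_hom_minus[OF homotopy_hom v H_closed[OF v]])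
  also have "\<dots> = x"
    using homotopy_Terminal[OF H_in_Terminal[OF v]] x P.M.minus_zero_right[OF add_hom_closed[OF homotopy_hom v]] by simp
  finally show ?thesis by simp
qed

lemma next_dH: "x \<in> carrier (P (Suc n)) \<Longrightarrow> D ((\<rho>' \<circ> D) x) = D x"
  using D_homotopy[OF D_closed, of x] HD[of x] P.M.minus_zero_right[OF D_closed] by simp

lemma next_d_zero: "x \<in> carrier (P (Suc n)) \<Longrightarrow> D x = \<zero>\<^bsub>P n\<^esub> \<Longrightarrow> (\<rho>' \<circ> D) x = \<zero>\<^bsub>P (Suc n)\<^esub>"
  using P_hom_zero[OF homotopy_hom] by simp

lemma exact: "D ` carrier (P (Suc n)) = {x \<in> carrier (P n). d x = \<zero>\<^bsub>M\<^esub>}"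
proof (intro equalityI subsetI)
  fix x assume "x \<in> {x \<in> carrier (P n). d x = \<zero>\<^bsub>M\<^esub>}"
  then have x: "x \<in> carrier (P n)" "d x = \<zero>\<^bsub>M\<^esub>" by simp_all
  then have "x = D (\<rho>' x)" using D_homotopy[OF x(1)] d_zero[OF x] P.M.minus_zero_right[OF x(1)] by simp
  then show "x \<in> D ` carrier (P (Suc n))" using add_hom_closed[OF homotopy_hom x(1)] by blast
qed (use dD D_closed in auto)

lemma D_homotopy_add:
  assumes x: "x \<in> carrier (P n)"
  shows "D (\<rho>' x) \<oplus>\<^bsub>P n\<^esub> H x = x"
  using P.M.minus_swap(2)[OF x H_closed[OF x] D_closed[OF add_hom_closed[OF homotopy_hom x]] D_homotopy[OF x, symmetric]] ..

end

section \<open>The resolution\<close>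

context diamond_system
begin

declare differential.simps [simp del]

lemma trivial_irreducible: "v \<in> verts Q \<Longrightarrow> trivial v \<in> Irr"
  using rel_length[of "trivial v"]
  by (auto simp: irreducible_iff trivial_path rel_def plen_def)

text \<open>
  An occurrence of $S_{n+1}$ is longer than the occurrence of $S_n$ with the same start, which here is all of
  \<open>w\<close>.
\<close>

lemma terminal_trivial:
  assumes w: "w \<in> SS n"
  shows "terminal n w (trivial v)"
  unfolding terminal_def pcat_trivial_right
proof (intro allI notI)
  fix j assume j: "(0, j) \<in> occurrences w (Suc n)"
  interpret interval_system "rel w" "plen w" by (rule interval_system_rel[OF SS_path[OF w]])
  note occ_eq = occurrences_eq_occ[OF SS_path[OF w]]
  have *: "(0, plen w) \<in> occurrences w n" using w by (simp add: occurrences_def)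
  obtain j' where j': "(0, j') \<in> occ n" "j' < j" using j occ_prefix unfolding occ_eq by metis
  have "j' = plen w" using occ_unique_end[OF j'(1)] * unfolding occ_eq by blast
  then show False using j'(2) j by (simp add: occurrences_def)
qed

lemma composable_total: "(q, w, r) \<in> composable n \<Longrightarrow> total (q, w, r) \<in> paths Q"
  using SS_path[of w n] by (simp add: composable_def total_def pcat_in_paths)

lemma tm_trivial_in_Sp:
  assumes "(q, w, trivial (tgt Q w)) \<in> composable n"
  shows "tm n c (q, w, trivial (tgt Q w)) \<in> Sp n (Terminal n)"
proof (rule Sp_tm[OF assms])
  have w: "w \<in> SS n" using assms by (simp add: composable_def)
  show "(q, w, trivial (tgt Q w)) \<in> Terminal n"
    using terminal_trivial[OF w] trivial_irreducible[OF tgt_in_verts[OF SS_path[OF w]]] by (simp add: Terminal_def)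
qed

lemma composable_trivial:
  assumes "q \<in> paths Q" "w \<in> SS n" "tgt Q q = src w"
  shows "(q, w, trivial (tgt Q w)) \<in> composable n"
  using assms trivial_tgt[OF SS_path[OF assms(2)]] by (simp add: composable_def src_def)

text \<open>
  The right factor 1 can be replaced by the idempotent at the target of \<open>w\<close>, which is the class of an
  irreducible path.
\<close>

lemma tensor_one_in_Sp:
  assumes a: "a \<in> carrier A" and w: "w \<in> SS n"
  shows "tensor n a (pe w) \<one>\<^bsub>A\<^esub> \<in> Sp n (Terminal n)"
proof -
  have pw: "pe w \<in> Span n" using w by simp
  show ?thesis using a
  proof (rule A_induct)
    show "tensor n \<zero>\<^bsub>A\<^esub> (pe w) \<one>\<^bsub>A\<^esub> \<in> Sp n (Terminal n)" by (simp add: tensor_zero_left[OF pw] Sp_zero)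
  next
    fix a b assume "a \<in> carrier A" "b \<in> carrier A" "tensor n a (pe w) \<one>\<^bsub>A\<^esub> \<in> Sp n (Terminal n)" "tensor n b (pe w) \<one>\<^bsub>A\<^esub> \<in> Sp n (Terminal n)"
    then show "tensor n (a \<oplus>\<^bsub>A\<^esub> b) (pe w) \<one>\<^bsub>A\<^esub> \<in> Sp n (Terminal n)"
      using pw by (simp add: tensor_add_left Sp_add)
  next
    fix p c assume p: "p \<in> paths Q"
    note wp = SS_path[OF w]
    have pc: "\<pi> (single p c) \<in> carrier A" using p by simp
    show "tensor n (\<pi> (single p c)) (pe w) \<one>\<^bsub>A\<^esub> \<in> Sp n (Terminal n)"
    proof (cases "tgt Q p = src w")
      case True
      have "tensor n (\<pi> (single p c)) (pe w) \<one>\<^bsub>A\<^esub> = tensor n (\<pi> (single p c)) (pe w) (idem (tgt Q w) \<otimes>\<^bsub>A\<^esub> \<one>\<^bsub>A\<^esub>)"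
        by (rule tensor_idem_right[OF pc w, symmetric]) simp
      also have "\<dots> = tm n c (p, w, trivial (tgt Q w))"
        using idem_tgt_closed[OF wp] by (simp add: tm_def)
      finally show ?thesis using tm_trivial_in_Sp[OF composable_trivial[OF p w True]] by simp
    next
      case False
      have "tensor n (\<pi> (single p c)) (pe w) \<one>\<^bsub>A\<^esub> = tensor n (\<pi> (single p c) \<otimes>\<^bsub>A\<^esub> idem (src w)) (pe w) \<one>\<^bsub>A\<^esub>"
        by (rule tensor_idem_left[OF pc w, symmetric]) simp
      also have "\<dots> = \<zero>\<^bsub>P n\<^esub>"
        using False single_mult_idem[OF p src_in_verts[OF wp]] tensor_zero_left[OF pw] by simp
      finally show ?thesis by (simp add: Sp_zero)
    qed
  qed
qed

lemma Terminal_0: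
  assumes "(q, w, r) \<in> composable 0" "(q, w, r) \<in> Terminal 0"
  obtains v where "v \<in> verts Q" "w = trivial v" "r = trivial v" "tgt Q q = v"
proof -
  obtain v where v: "w = trivial v" "v \<in> verts Q" using assms(1) SS_0 unfolding composable_def by blast
  have *: "r \<in> paths Q" "tgt Q q = v" "src r = v" using assms(1) v by (auto simp: composable_def src_def)
  have "plen r = 0"
  proof (rule ccontr)
    assume "plen r \<noteq> 0"
    then have "(0, 1) \<in> occurrences (pcat w r) (Suc 0)"
      using * v by (simp add: occurrences_def pcat_trivial_left slice_in_paths plen_slice Suc_leI overlap_paths.simps)
    then show False using assms(2) by (simp add: Terminal_def terminal_def)
  qed
  then show thesis using that v * plen_zero[of r] by simp
qed

text \<open>
  The endomorphism $\rho_{n-1}\partial_n$ of \<^term>\<open>P n\<close>.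
\<close>

definition H :: "nat \<Rightarrow> ('v, 'e, 'k) tens \<Rightarrow> ('v, 'e, 'k) tens" where
  "H n = (case n of 0 \<Rightarrow> coaugmentation \<circ> augmentation | Suc m \<Rightarrow> homotopy m \<circ> differential (Suc m))"

lemma differential_eq: "differential (Suc n) = differential_step (Suc n) (H n)"
  by (cases n) (simp_all add: H_def differential.simps homotopy_def)

lemmas augmentation_bimod_hom = conjunct1[OF augmentation_spec]
lemmas augmentation_hom = bimod_hom_add[OF augmentation_bimod_hom]

lemma augmentation_closed: "x \<in> carrier (P 0) \<Longrightarrow> augmentation x \<in> carrier A"
  using add_hom_closed[OF augmentation_hom] by (simp add: regular_bimod_def)

lemma coaugmentation_closed: "a \<in> carrier A \<Longrightarrow> coaugmentation a \<in> carrier (P 0)"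
  using add_hom_closed[OF left_hom_add[OF coaugmentation_hom]] by (simp add: regular_bimod_def)

lemma augmentation_coaugmentation: "a \<in> carrier A \<Longrightarrow> augmentation (coaugmentation a) = a"
  using conjunct2[OF augmentation_spec] by (simp add: coaugmentation_def)

lemma H_0_tm:
  assumes "(q, w, r) \<in> composable 0"
  shows "H 0 (tm 0 c (q, w, r)) =
    tm 0 c (total (q, w, r), trivial (tgt Q (total (q, w, r))), trivial (tgt Q (total (q, w, r))))"
  using assms composable_total[OF assms] by (simp add: H_def augmentation_tm coaugmentation_single)

lemma H_0_left_hom: "H 0 \<in> left_hom A (P 0) (P 0)"
  unfolding left_hom_def mem_Collect_eq
proof (intro conjI ballI)
  show "H 0 \<in> hom (add_monoid (P 0)) (add_monoid (P 0))"
    using add_hom_comp[OF augmentation_hom left_hom_add[OF coaugmentation_hom]] by (simp add: H_def comp_def)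
qed (simp add: H_def left_hom_smult[OF bimod_hom_left[OF augmentation_bimod_hom]] left_hom_smult[OF coaugmentation_hom]
    add_hom_closed[OF augmentation_hom])

text \<open>
  The terminal generators of degree 0 are those whose right factor is a vertex, since any arrow in the
  right factor would be a path in $S_1$. So \<open>H 0\<close>, which maps $a \otimes b$ to $ab \otimes 1$, is the projection onto
  their span.
\<close>

lemma stage_0: "resolution_stage Q S I \<phi> 0 (H 0) (regular_bimod A) augmentation"
proof (intro resolution_stage.intro diamond_system_axioms resolution_stage_axioms.intro, rule H_0_left_hom)
  note hom = left_hom_add[OF H_0_left_hom]
  show "H 0 x \<in> Sp 0 (Terminal 0 \<inter> upto p)" if x: "x \<in> Sp 0 (upto p)" for x p
  proof (rule Sp_hom[OF x hom])
    fix q w r c assume t: "(q, w, r) \<in> composable 0" "(q, w, r) \<in> upto p"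
    let ?p = "total (q, w, r)" and ?e = "trivial (tgt Q (total (q, w, r)))"
    have p: "?p \<in> paths Q" by (rule composable_total[OF t(1)])
    have e: "?e \<in> SS 0" by (rule trivial_in_SS[OF tgt_in_verts[OF p]])
    have comp: "(?p, ?e, ?e) \<in> composable 0" using composable_trivial[OF p e] by (simp add: src_def)
    have "(?p, ?e, ?e) \<in> Terminal 0"
      using terminal_trivial[OF e] trivial_irreducible[OF tgt_in_verts[OF p]] by (simp add: Terminal_def)
    moreover have "(?p, ?e, ?e) \<in> upto p" using t(2) by (simp add: upto_def total_def[of "(_, trivial _, _)"])
    ultimately show "H 0 (tm 0 c (q, w, r)) \<in> Sp 0 (Terminal 0 \<inter> upto p)"
      unfolding H_0_tm[OF t(1)] by (intro Sp_tm comp IntI)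
  qed
  show "H 0 x = x" if "x \<in> Sp 0 (Terminal 0)" for x
    using that
  proof (induction rule: Sp.induct)
    case Sp_zero
    show ?case by (rule P_hom_zero[OF hom])
  next
    case (Sp_tm t c)
    obtain q w r where t: "t = (q, w, r)" by (cases t)
    obtain v where "w = trivial v" "r = trivial v" "tgt Q q = v" using Terminal_0 Sp_tm unfolding t by metis
    then show ?case using H_0_tm[of q w r c] Sp_tm(1) unfolding t by (simp add: total_def)
  next
    case (Sp_add x y)
    then show ?case using add_hom_add[OF hom, of x y] by (simp add: Sp_carrier)
  qed
  show "bimodule scalars A (regular_bimod A)" by (rule regular_bimodule)
  show "augmentation \<in> bimod_hom A (P 0) (regular_bimod A)" by (rule augmentation_bimod_hom)
  show "augmentation (H 0 x) = augmentation x" if "x \<in> carrier (P 0)" for x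
    using augmentation_coaugmentation[OF augmentation_closed[OF that]] by (simp add: H_def)
  show "H 0 x = \<zero>\<^bsub>P 0\<^esub>" if "x \<in> carrier (P 0)" "augmentation x = \<zero>\<^bsub>regular_bimod A\<^esub>" for x
    using that(2) tensor_zero_left[OF one_in_Span, of "\<one>\<^bsub>A\<^esub>"]
    by (simp add: H_def coaugmentation_def regular_bimod_def)
qed

lemma stage_Suc:
  assumes "resolution_stage Q S I \<phi> n (H n) M d"
  shows "resolution_stage Q S I \<phi> (Suc n) (H (Suc n)) (P n) (differential (Suc n))"
proof -
  interpret stage: resolution_stage Q S I \<phi> n "H n" M d by (rule assms)
  have H_Suc: "H (Suc n) = homotopy_step n (differential_step (Suc n) (H n)) \<circ> differential_step (Suc n) (H n)"
    unfolding differential_eq[symmetric] homotopy_def[symmetric] by (simp add: H_def)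
  show ?thesis
    unfolding H_Suc differential_eq
    by (intro resolution_stage.intro diamond_system_axioms resolution_stage_axioms.intro; fact stage.next_H_left_hom stage.next_H_upto stage.next_H_Terminal P_bimodule stage.D_bimod_hom
        stage.next_dH stage.next_d_zero)
qed

lemma stage: "resolution_stage Q S I \<phi> (Suc n) (H (Suc n)) (P n) (differential (Suc n))"
proof (induction n)
  case 0
  show ?case by (rule stage_Suc[OF stage_0])
next
  case (Suc n)
  then show ?case by (rule stage_Suc)
qed

lemma stage_facts:
  assumes "resolution_stage Q S I \<phi> n (H n) M d"
  shows "differential (Suc n) \<in> bimod_hom A (P (Suc n)) (P n)"
    and "differential (Suc n) ` carrier (P (Suc n)) = {x \<in> carrier (P n). d x = \<zero>\<^bsub>M\<^esub>}"
    and "homotopy n \<in> left_hom A (P n) (P (Suc n))"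
    and "x \<in> carrier (P n) \<Longrightarrow>
      finite {i. i \<ge> 1 \<and> homotopy_summand n (differential (Suc n)) i x \<noteq> \<zero>\<^bsub>P (Suc n)\<^esub>}"
    and "x \<in> carrier (P n) \<Longrightarrow> differential (Suc n) (homotopy n x) \<oplus>\<^bsub>P n\<^esub> H n x = x"
    and "x \<in> Sp n (Terminal n) \<Longrightarrow> homotopy n x = \<zero>\<^bsub>P (Suc n)\<^esub>"
proof -
  interpret stage: resolution_stage Q S I \<phi> n "H n" M d by (rule assms)
  show "differential (Suc n) \<in> bimod_hom A (P (Suc n)) (P n)"
    unfolding differential_eq by (rule stage.D_bimod_hom)
  show "differential (Suc n) ` carrier (P (Suc n)) = {x \<in> carrier (P n). d x = \<zero>\<^bsub>M\<^esub>}"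
    unfolding differential_eq by (rule stage.exact)
  show "homotopy n \<in> left_hom A (P n) (P (Suc n))"
    unfolding homotopy_def differential_eq by (rule stage.homotopy_left_hom)
  show "finite {i. i \<ge> 1 \<and> homotopy_summand n (differential (Suc n)) i x \<noteq> \<zero>\<^bsub>P (Suc n)\<^esub>}"
    if "x \<in> carrier (P n)"
    unfolding differential_eq by (rule stage.finite_summands[OF that])
  show "differential (Suc n) (homotopy n x) \<oplus>\<^bsub>P n\<^esub> H n x = x" if "x \<in> carrier (P n)"
    unfolding homotopy_def differential_eq by (rule stage.D_homotopy_add[OF that])
  show "homotopy n x = \<zero>\<^bsub>P (Suc n)\<^esub>" if "x \<in> Sp n (Terminal n)"
    unfolding homotopy_def differential_eq by (rule stage.homotopy_Terminal[OF that])
qed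

lemma differential_bimod_hom: "differential (Suc n) \<in> bimod_hom A (P (Suc n)) (P n)"
  by (cases n) (simp_all add: stage_facts(1)[OF stage_0] stage_facts(1)[OF stage])

lemma homotopy_left_hom: "homotopy n \<in> left_hom A (P n) (P (Suc n))"
  by (cases n) (simp_all add: stage_facts(3)[OF stage_0] stage_facts(3)[OF stage])

lemma homotopy_summands_finite:
  "x \<in> carrier (P n) \<Longrightarrow> finite {i. i \<ge> 1 \<and> homotopy_summand n (differential (Suc n)) i x \<noteq> \<zero>\<^bsub>P (Suc n)\<^esub>}"
  using stage_facts(4)[OF stage_0] stage_facts(4)[OF stage] by (cases n) blast+

lemma homotopy_tensor_one:
  assumes "a \<in> carrier A" "w \<in> SS n"
  shows "homotopy n (tensor n a (pe w) \<one>\<^bsub>A\<^esub>) = \<zero>\<^bsub>P (Suc n)\<^esub>"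
  using tensor_one_in_Sp[OF assms] stage_facts(6)[OF stage_0] stage_facts(6)[OF stage] by (cases n) blast+

lemma augmentation_surj: "augmentation ` carrier (P 0) = carrier A"
proof (intro equalityI subsetI)
  fix a assume "a \<in> carrier A"
  then show "a \<in> augmentation ` carrier (P 0)"
    using augmentation_coaugmentation coaugmentation_closed by (metis imageI)
qed (use augmentation_closed in blast)

lemma resolution:
  "projective_bimodule_resolution TYPE('m) TYPE('n) scalars A P differential augmentation (regular_bimod A)"
  unfolding projective_bimodule_resolution_def
proof (intro conjI allI)
  show "bimodule scalars A (regular_bimod A)" by (rule regular_bimodule)
  show "projective_bimodule TYPE('m) TYPE('n) scalars A (P n)" for n by (rule P_projective)
  show "augmentation \<in> bimod_hom A (P 0) (regular_bimod A)" by (rule augmentation_bimod_hom)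
  show "differential (Suc n) \<in> bimod_hom A (P (Suc n)) (P n)" for n by (rule differential_bimod_hom)
  show "augmentation ` carrier (P 0) = carrier (regular_bimod A)"
    using augmentation_surj by (simp add: regular_bimod_def)
  show "differential 1 ` carrier (P 1) = {x \<in> carrier (P 0). augmentation x = \<zero>\<^bsub>regular_bimod A\<^esub>}"
    using stage_facts(2)[OF stage_0] by simp
  show "differential (Suc (Suc n)) ` carrier (P (Suc (Suc n))) =
      {x \<in> carrier (P (Suc n)). differential (Suc n) x = \<zero>\<^bsub>P n\<^esub>}" for n
    by (rule stage_facts(2)[OF stage])
qed

lemma homotopy_identity_0:
  "x \<in> carrier (P 0) \<Longrightarrow> differential 1 (homotopy 0 x) \<oplus>\<^bsub>P 0\<^esub> coaugmentation (augmentation x) = x"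
  using stage_facts(5)[OF stage_0, of x] by (simp add: H_def)

lemma homotopy_identity_Suc:
  "x \<in> carrier (P (Suc n)) \<Longrightarrow>
    differential (Suc (Suc n)) (homotopy (Suc n) x) \<oplus>\<^bsub>P (Suc n)\<^esub> homotopy n (differential (Suc n) x) = x"
  using stage_facts(5)[OF stage, of x n] by (simp add: H_def)

end

theorem proposition4p3:
  fixes Q :: "('v, 'e) pre_digraph"
    and S :: "('v, 'e) path set"
    and \<phi> :: "('v, 'e) path \<Rightarrow> (('v, 'e) path \<Rightarrow>\<^sub>0 'k :: field_char_0)"
    and I :: "(('v, 'e) path \<Rightarrow>\<^sub>0 'k) set"
  defines "A \<equiv> quiver_quotient.A Q I"
    and "P \<equiv> quiver_quotient.P Q S I"
    and "d \<equiv> quiver_quotient.differential Q S I"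
    and "d\<^sub>0 \<equiv> quiver_quotient.augmentation Q S I"
    and "\<rho> \<equiv> quiver_quotient.homotopy Q S I"
    and "\<rho>\<^sub>m\<^sub>1 \<equiv> quiver_quotient.coaugmentation Q S I"
  assumes "fin_digraph Q"
    and "ideal I (path_algebra Q)"
    and "reduction_system Q S \<phi>"
    and "satisfies_diamond Q S \<phi> I"
  shows
    "projective_bimodule_resolution TYPE('m) TYPE('n) (quiver_quotient.scalars Q I) A
       P d d\<^sub>0 (regular_bimod A) \<and>
     (\<forall>n. \<forall>x\<in>carrier (P n).
        finite {i. i \<ge> 1 \<and> quiver_quotient.homotopy_summand Q S I n (d (Suc n)) i x \<noteq> \<zero>\<^bsub>P (Suc n)\<^esub>}) \<and>
     \<rho>\<^sub>m\<^sub>1 \<in> left_hom A (regular_bimod A) (P 0) \<and>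
     (\<forall>n. \<rho> n \<in> left_hom A (P n) (P (Suc n))) \<and>
     (\<forall>a\<in>carrier A. d\<^sub>0 (\<rho>\<^sub>m\<^sub>1 a) = a) \<and>
     (\<forall>x\<in>carrier (P 0). d 1 (\<rho> 0 x) \<oplus>\<^bsub>P 0\<^esub> \<rho>\<^sub>m\<^sub>1 (d\<^sub>0 x) = x) \<and>
     (\<forall>n. \<forall>x\<in>carrier (P (Suc n)).
        d (Suc (Suc n)) (\<rho> (Suc n) x) \<oplus>\<^bsub>P (Suc n)\<^esub> \<rho> n (d (Suc n) x) = x) \<and>
     (\<forall>n. \<forall>a\<in>carrier A. \<forall>w\<in>overlap_paths Q S n.
        \<rho> n (quiver_quotient.tensor Q S I n a (pe w) \<one>\<^bsub>A\<^esub>) = \<zero>\<^bsub>P (Suc n)\<^esub>)"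
proof -
  interpret diamond_system Q S I \<phi> using assms(7-10) by (rule diamond_system.intro)
  show ?thesis
    unfolding assms(1-6)
    by (intro conjI allI ballI resolution homotopy_summands_finite coaugmentation_hom homotopy_left_hom
        augmentation_coaugmentation homotopy_identity_0 homotopy_identity_Suc homotopy_tensor_one)
qed

end
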